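(* Let $n\ge2$, $m\ge1$, $2\le q<p<n$, let $\Omega\subset\mathbb{R}^n$ be a bounded open set, and let $G$ satisfy hypotheses H.1 and H.2 (stated in the context) with exponent $q$. For $\varepsilon\in(0,1]$ let $u_\varepsilon\in W^{1,p}(\Omega,\mathbb{R}^m)$ be a local minimizer of the functional $\mathcal{F}_\varepsilon(\cdot,\Omega)$ defined in the context. Then $u_\varepsilon\in W^{2,2}_{loc}(\Omega,\mathbb{R}^m)$ and there exists a positive constant $C_{p,q}$ (not depending on $\varepsilon$) such that $$\int_{B_s(x_0)}\left[|\nabla u_\varepsilon(x)|^2+\varepsilon\right]^{\frac{q-2}2}|Hu_\varepsilon|^2\,dx\le\frac{C_{p,q}}{(t-s)^2}\int_{B_t(x_0)}\varepsilon|\nabla u_\varepsilon|^p+|u_\varepsilon|^q+|\nabla u_\varepsilon|^q+1\,dx$$ for every $x_0\in\Omega$ and every $0<s<t<R_0<\min\{1,\operatorname{dist}(x_0,\partial\Omega)\}$.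
   Context: Notation: $\mathbb{R}^m_{+,0}=[0,+\infty)^m$; $u=(u^1,\dots,u^m)$; $B_s(x_0)$ is the ball of radius $s$ centred at $x_0$; $Hu_\varepsilon$ denotes the collection of all second weak derivatives (Hessians of the components) of $u_\varepsilon$. For $0<\varepsilon\le1$, $$\mathcal{F}_\varepsilon(u,\Omega)=\int_\Omega\varepsilon\sum_{\alpha=1}^m|\nabla u^\alpha|^p+G\left(\sqrt{|u^1|^2+\varepsilon},\dots,\sqrt{|u^m|^2+\varepsilon},\sqrt{|\nabla u^1|^2+\varepsilon},\dots,\sqrt{|\nabla u^m|^2+\varepsilon}\right)dx.$$ H.1: $G:\mathbb{R}^m_{+,0}\times\mathbb{R}^m_{+,0}\to\mathbb{R}$ is strictly convex, and there are a constant $L_0>1$ and a measurable function $a:\Omega\to[0,\infty)$ such that for every $s,\xi\in\mathbb{R}^m_{+,0}$ (and a.e. $x\in\Omega$) $$\sum_{\alpha=1}^m(\xi^\alpha)^q+\sum_{\alpha=1}^m(s^\alpha)^q\le G(s,\xi)\le L_0\Big[\sum_{\alpha=1}^m(\xi^\alpha)^q+\sum_{\alpha=1}^m(s^\alpha)^q+a(x)\Big].$$ H.2: $G\in C^2(\mathbb{R}^m_{+,0}\times\mathbb{R}^m_{+,0})$ and there is $\vartheta>0$ such that $$\sum_{\alpha,\beta=1}^m\Big(\partial_{s^\beta s^\alpha}G(s,\xi)\lambda^\alpha\lambda^\beta+\partial_{\xi^\beta s^\alpha}G(s,\xi)\lambda^\alpha\mu^\beta+\partial_{s^\beta\xi^\alpha}G(s,\xi)\mu^\alpha\lambda^\beta+\partial_{\xi^\beta\xi^\alpha}G(s,\xi)\mu^\alpha\mu^\beta\Big)\ge\vartheta\left(|s|^{q-2}+|\xi|^{q-2}\right)\left(|\lambda|^2+|\mu|^2\right)$$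 for every $(s,\xi)\in\mathbb{R}^m_{+,0}\times\mathbb{R}^m_{+,0}$ and every $(\lambda,\mu)\in\mathbb{R}^m\times\mathbb{R}^m$. Moreover there is $L_1>1$ such that for all $\alpha,\beta=1,\dots,m$ and all $(s,\xi)\in\mathbb{R}^m_{+,0}\times\mathbb{R}^m_{+,0}$: $0\le\partial_{\xi^\alpha}G(s,\xi)\le L_1[|s|^{q-1}+|\xi|^{q-1}]$, $0\le\partial_{s^\alpha}G(s,\xi)\le L_1[|s|^{q-1}+|\xi|^{q-1}]$, and each of $|\partial_{s^\beta s^\alpha}G(s,\xi)|$, $|\partial_{s^\beta\xi^\alpha}G(s,\xi)|$, $|\partial_{\xi^\beta\xi^\alpha}G(s,\xi)|$ is $\le L_1[|s|^{q-2}+|\xi|^{q-2}]$. A function $u\in W^{1,p}(\Omega,\mathbb{R}^m)$ is a local minimizer of $\mathcal{F}_\varepsilon$ if $\mathcal{F}_\varepsilon(u,\Sigma)\le\mathcal{F}_\varepsilon(u+\varphi,\Sigma)$ for every open $\Sigma\subset\subset\Omega$ and every $\varphi\in W^{1,p}_0(\Sigma,\mathbb{R}^m)$, where $\mathcal{F}_\varepsilon(\cdot,\Sigma)$ is the same integral over $\Sigma$. *)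

theory Defs
  imports "HOL-Analysis.Analysis"
begin

section \<open>Classical derivatives and test functions\<close>

text \<open>
  The derivative of \<open>f\<close> relative to \<open>S\<close> in the direction \<open>e\<close>.  At boundary points of a closed
  orthant it is the one-sided derivative when \<open>e\<close> is a coordinate direction.
\<close>

definition partial_within ::
  "'a::real_normed_vector set \<Rightarrow> 'a \<Rightarrow> ('a \<Rightarrow> real) \<Rightarrow> 'a \<Rightarrow> real" where
  "partial_within S e f z =
     vector_derivative (\<lambda>t. f (z + t *\<^sub>R e)) (at 0 within {t. z + t *\<^sub>R e \<in> S})"

definition has_partial_within ::
  "'a::real_normed_vector set \<Rightarrow> 'a \<Rightarrow> ('a \<Rightarrow> real) \<Rightarrow> 'a \<Rightarrow> bool" where
  "has_partial_within S e f z \<longleftrightarrow>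
     (\<lambda>t. f (z + t *\<^sub>R e)) differentiable (at 0 within {t. z + t *\<^sub>R e \<in> S})"

primrec Ck_on :: "nat \<Rightarrow> 'a::euclidean_space set \<Rightarrow> ('a \<Rightarrow> real) \<Rightarrow> bool" where
  "Ck_on 0 S f \<longleftrightarrow> continuous_on S f"
| "Ck_on (Suc k) S f \<longleftrightarrow> continuous_on S f \<and>
     (\<forall>e\<in>Basis. (\<forall>z\<in>S. has_partial_within S e f z) \<and> Ck_on k S (partial_within S e f))"

definition test_function :: "'a::euclidean_space set \<Rightarrow> ('a \<Rightarrow> real) \<Rightarrow> bool" where
  "test_function \<Omega> \<phi> \<longleftrightarrow> (\<forall>k. Ck_on k UNIV \<phi>) \<and>
     compact (closure {x. \<phi> x \<noteq> 0}) \<and> closure {x. \<phi> x \<noteq> 0} \<subseteq> \<Omega>"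


section \<open>Weak derivatives and Sobolev spaces\<close>

definition Lp_on :: "real \<Rightarrow> 'a::euclidean_space set \<Rightarrow> ('a \<Rightarrow> real) \<Rightarrow> bool" where
  "Lp_on p \<Omega> v \<longleftrightarrow> v \<in> borel_measurable (lebesgue_on \<Omega>) \<and>
     integrable (lebesgue_on \<Omega>) (\<lambda>x. \<bar>v x\<bar> powr p)"

definition loc_integrable :: "'a::euclidean_space set \<Rightarrow> ('a \<Rightarrow> real) \<Rightarrow> bool" where
  "loc_integrable \<Omega> v \<longleftrightarrow> (\<forall>K. compact K \<and> K \<subseteq> \<Omega> \<longrightarrow> integrable (lebesgue_on K) v)"

definition has_weak_partial ::
  "(real^'n) set \<Rightarrow> 'n \<Rightarrow> (real^'n \<Rightarrow> real) \<Rightarrow> (real^'n \<Rightarrow> real) \<Rightarrow> bool" where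
  "has_weak_partial \<Omega> i v w \<longleftrightarrow> loc_integrable \<Omega> v \<and> loc_integrable \<Omega> w \<and>
     (\<forall>\<phi>. test_function \<Omega> \<phi> \<longrightarrow>
        (LINT x|lebesgue_on \<Omega>. v x * partial_within UNIV (axis i 1) \<phi> x) =
        - (LINT x|lebesgue_on \<Omega>. w x * \<phi> x))"

text \<open>
  Weak derivatives on an open set are unique up to null sets.  The functions below fix one
  representative; they are meaningful only where a weak derivative exists.
\<close>

definition weak_partial ::
  "(real^'n) set \<Rightarrow> 'n \<Rightarrow> (real^'n \<Rightarrow> real) \<Rightarrow> real^'n \<Rightarrow> real" where
  "weak_partial \<Omega> i v = (SOME w. has_weak_partial \<Omega> i v w)"

definition weak_grad ::
  "(real^'n) set \<Rightarrow> (real^'n \<Rightarrow> real^'m) \<Rightarrow> real^'n \<Rightarrow> real^'n^'m" where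
  "weak_grad \<Omega> u x = (\<chi> \<alpha> i. weak_partial \<Omega> i (\<lambda>y. u y $ \<alpha>) x)"

definition weak_hess ::
  "(real^'n) set \<Rightarrow> (real^'n \<Rightarrow> real^'m) \<Rightarrow> real^'n \<Rightarrow> real^'n^'n^'m" where
  "weak_hess \<Omega> u x =
     (\<chi> \<alpha> i j. weak_partial \<Omega> j (weak_partial \<Omega> i (\<lambda>y. u y $ \<alpha>)) x)"

primrec sobolev :: "nat \<Rightarrow> real \<Rightarrow> (real^'n) set \<Rightarrow> (real^'n \<Rightarrow> real) \<Rightarrow> bool" where
  "sobolev 0 p \<Omega> v \<longleftrightarrow> Lp_on p \<Omega> v"
| "sobolev (Suc k) p \<Omega> v \<longleftrightarrow> Lp_on p \<Omega> v \<and>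
     (\<forall>i. \<exists>w. has_weak_partial \<Omega> i v w \<and> sobolev k p \<Omega> w)"

definition sobolev_vec ::
  "nat \<Rightarrow> real \<Rightarrow> (real^'n) set \<Rightarrow> (real^'n \<Rightarrow> real^'m) \<Rightarrow> bool" where
  "sobolev_vec k p \<Omega> u \<longleftrightarrow> (\<forall>\<alpha>. sobolev k p \<Omega> (\<lambda>x. u x $ \<alpha>))"

definition compactly_inside :: "'a::topological_space set \<Rightarrow> 'a set \<Rightarrow> bool" where
  "compactly_inside D \<Omega> \<longleftrightarrow> compact (closure D) \<and> closure D \<subseteq> \<Omega>"

definition sobolev_vec_loc ::
  "nat \<Rightarrow> real \<Rightarrow> (real^'n) set \<Rightarrow> (real^'n \<Rightarrow> real^'m) \<Rightarrow> bool" where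
  "sobolev_vec_loc k p \<Omega> u \<longleftrightarrow>
     (\<forall>D. open D \<and> compactly_inside D \<Omega> \<longrightarrow> sobolev_vec k p D u)"

definition W1p_norm :: "real \<Rightarrow> (real^'n) set \<Rightarrow> (real^'n \<Rightarrow> real^'m) \<Rightarrow> real" where
  "W1p_norm p \<Omega> u =
     ((LINT x|lebesgue_on \<Omega>. norm (u x) powr p) +
      (LINT x|lebesgue_on \<Omega>. norm (weak_grad \<Omega> u x) powr p)) powr (1 / p)"

text \<open>The space \<open>W\<^sub>0\<close> is the closure of the vector-valued test functions in the \<open>W\<close> norm.\<close>

definition sobolev_vec_zero ::
  "real \<Rightarrow> (real^'n) set \<Rightarrow> (real^'n \<Rightarrow> real^'m) \<Rightarrow> bool" where
  "sobolev_vec_zero p \<Omega> \<phi> \<longleftrightarrow> sobolev_vec 1 p \<Omega> \<phi> \<and>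
     (\<forall>e>0. \<exists>\<psi>. (\<forall>\<alpha>. test_function \<Omega> (\<lambda>x. \<psi> x $ \<alpha>)) \<and>
        W1p_norm p \<Omega> (\<lambda>x. \<phi> x - \<psi> x) < e)"


section \<open>The hypotheses on the integrand\<close>

definition strictly_convex_on :: "'a::real_vector set \<Rightarrow> ('a \<Rightarrow> real) \<Rightarrow> bool" where
  "strictly_convex_on S f \<longleftrightarrow> convex S \<and>
     (\<forall>x\<in>S. \<forall>y\<in>S. \<forall>t. x \<noteq> y \<and> 0 < t \<and> t < 1 \<longrightarrow>
        f ((1 - t) *\<^sub>R x + t *\<^sub>R y) < (1 - t) * f x + t * f y)"

definition orthant :: "(real^'m) set" where
  "orthant = {s. \<forall>\<alpha>. 0 \<le> s $ \<alpha>}"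

text \<open>
  In the library \<open>0 powr 0 = 0\<close>, but the expressions with exponent \<open>q - 2\<close> below need the
  convention that the zeroth power of \<open>0\<close> is \<open>1\<close> when \<open>q = 2\<close>.
\<close>

definition rpow :: "real \<Rightarrow> real \<Rightarrow> real" where
  "rpow x a = (if a = 0 then 1 else x powr a)"

definition H1 :: "real \<Rightarrow> (real^'n) set \<Rightarrow> ((real^'m) \<times> (real^'m) \<Rightarrow> real) \<Rightarrow> bool" where
  "H1 q \<Omega> G \<longleftrightarrow> strictly_convex_on (orthant \<times> orthant) G \<and>
     (\<exists>L0>1. \<exists>a. a \<in> borel_measurable (lebesgue_on \<Omega>) \<and> (\<forall>x\<in>\<Omega>. 0 \<le> a x) \<and>
        (\<forall>s\<in>orthant. \<forall>\<xi>\<in>orthant. AE x in lebesgue_on \<Omega>.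
           (\<Sum>\<alpha>\<in>UNIV. (\<xi> $ \<alpha>) powr q) + (\<Sum>\<alpha>\<in>UNIV. (s $ \<alpha>) powr q) \<le> G (s, \<xi>) \<and>
           G (s, \<xi>) \<le>
             L0 * ((\<Sum>\<alpha>\<in>UNIV. (\<xi> $ \<alpha>) powr q) + (\<Sum>\<alpha>\<in>UNIV. (s $ \<alpha>) powr q) + a x)))"

definition d_s :: "'m \<Rightarrow> ((real^'m) \<times> (real^'m) \<Rightarrow> real) \<Rightarrow> (real^'m) \<times> (real^'m) \<Rightarrow> real" where
  "d_s \<alpha> = partial_within (orthant \<times> orthant) (axis \<alpha> 1, 0)"

definition d_xi :: "'m \<Rightarrow> ((real^'m) \<times> (real^'m) \<Rightarrow> real) \<Rightarrow> (real^'m) \<times> (real^'m) \<Rightarrow> real" where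
  "d_xi \<alpha> = partial_within (orthant \<times> orthant) (0, axis \<alpha> 1)"

definition H2 :: "real \<Rightarrow> ((real^'m) \<times> (real^'m) \<Rightarrow> real) \<Rightarrow> bool" where
  "H2 q G \<longleftrightarrow> Ck_on 2 (orthant \<times> orthant) G \<and>
     (\<exists>\<theta>>0. \<forall>s\<in>orthant. \<forall>\<xi>\<in>orthant. \<forall>v w :: real^'m.
        (\<Sum>\<alpha>\<in>UNIV. \<Sum>\<beta>\<in>UNIV.
            d_s \<beta> (d_s \<alpha> G) (s, \<xi>) * (v $ \<alpha>) * (v $ \<beta>)
          + d_xi \<beta> (d_s \<alpha> G) (s, \<xi>) * (v $ \<alpha>) * (w $ \<beta>)
          + d_s \<beta> (d_xi \<alpha> G) (s, \<xi>) * (w $ \<alpha>) * (v $ \<beta>)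
          + d_xi \<beta> (d_xi \<alpha> G) (s, \<xi>) * (w $ \<alpha>) * (w $ \<beta>))
        \<ge> \<theta> * (rpow (norm s) (q - 2) + rpow (norm \<xi>) (q - 2)) * ((norm v)\<^sup>2 + (norm w)\<^sup>2)) \<and>
     (\<exists>L1>1. \<forall>\<alpha> \<beta>. \<forall>s\<in>orthant. \<forall>\<xi>\<in>orthant.
        0 \<le> d_xi \<alpha> G (s, \<xi>) \<and>
        d_xi \<alpha> G (s, \<xi>) \<le> L1 * (norm s powr (q - 1) + norm \<xi> powr (q - 1)) \<and>
        0 \<le> d_s \<alpha> G (s, \<xi>) \<and>
        d_s \<alpha> G (s, \<xi>) \<le> L1 * (norm s powr (q - 1) + norm \<xi> powr (q - 1)) \<and>
        \<bar>d_s \<beta> (d_s \<alpha> G) (s, \<xi>)\<bar> \<le> L1 * (rpow (norm s) (q - 2) + rpow (norm \<xi>) (q - 2)) \<and>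
        \<bar>d_s \<beta> (d_xi \<alpha> G) (s, \<xi>)\<bar> \<le> L1 * (rpow (norm s) (q - 2) + rpow (norm \<xi>) (q - 2)) \<and>
        \<bar>d_xi \<beta> (d_xi \<alpha> G) (s, \<xi>)\<bar> \<le> L1 * (rpow (norm s) (q - 2) + rpow (norm \<xi>) (q - 2)))"


section \<open>The functional and its local minimizers\<close>

text \<open>
  For \<open>q < p\<close> and bounded \<open>D\<close>, the growth condition on \<open>G\<close> makes the integrand integrable for
  every \<open>u\<close> in the Sobolev space with exponent \<open>p\<close>, so the integral never takes its default value.
\<close>

definition energy ::
  "((real^'m) \<times> (real^'m) \<Rightarrow> real) \<Rightarrow> real \<Rightarrow> real \<Rightarrow> (real^'n \<Rightarrow> real^'m) \<Rightarrow> (real^'n) set \<Rightarrow> real" where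
  "energy G p \<epsilon> u D = (LINT x|lebesgue_on D.
     \<epsilon> * (\<Sum>\<alpha>\<in>UNIV. norm (weak_grad D u x $ \<alpha>) powr p) +
     G (\<chi> \<alpha>. sqrt (\<bar>u x $ \<alpha>\<bar>\<^sup>2 + \<epsilon>), \<chi> \<alpha>. sqrt ((norm (weak_grad D u x $ \<alpha>))\<^sup>2 + \<epsilon>)))"

definition local_minimizer ::
  "((real^'m) \<times> (real^'m) \<Rightarrow> real) \<Rightarrow> real \<Rightarrow> real \<Rightarrow> (real^'n) set \<Rightarrow> (real^'n \<Rightarrow> real^'m) \<Rightarrow> bool" where
  "local_minimizer G p \<epsilon> \<Omega> u \<longleftrightarrow> sobolev_vec 1 p \<Omega> u \<and>
     (\<forall>D \<phi>. open D \<and> compactly_inside D \<Omega> \<and> sobolev_vec_zero p D \<phi> \<longrightarrow>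
        energy G p \<epsilon> u D \<le> energy G p \<epsilon> (\<lambda>x. u x + \<phi> x) D)"

end

theory Submission
  imports Defs
begin

text \<open>
  The idea is to compare a local minimizer \<open>u\<close>, with gradient \<open>z\<close>, with the average of two copies of itself that
  are moved in opposite directions.  Fix a coordinate direction \<open>e\<close>, a cutoff \<open>\<eta>\<close> and a small \<open>h\<close>, let \<open>\<psi>\<^sub>h\<close> be the
  inverse of the shear \<open>y \<mapsto> y - h \<eta>(y) e\<close>, and take \<open>(u \<circ> \<psi>\<^sub>h + u \<circ> \<psi>\<^sub>-\<^sub>h) / 2\<close> as the competitor.  It agrees with \<open>u\<close>
  off the support of \<open>\<eta>\<close>, and where \<open>\<eta> = 1\<close> the two copies are the translates of \<open>u\<close> by \<open>\<plusminus> h e\<close>.  No Euler-Lagrange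
  equation is needed, and minimality is used once, for this competitor.

  Let \<open>f\<close> be the integrand as a function of the values and the gradient.  Two of its properties matter, with
  constants that depend on neither \<open>u\<close> nor \<open>\<epsilon>\<close>.  The gain (\<open>dens_midpoint\<close>): at the midpoint of a segment \<open>f\<close> lies below
  the average of its end values by a multiple of \<open>(\<bar>z\<bar>\<^sup>2 + \<epsilon>)\<^sup>(\<^sup>q\<^sup>-\<^sup>2\<^sup>)\<^sup>/\<^sup>2 \<bar>z' - z\<bar>\<^sup>2\<close>, up to lowering \<open>\<bar>z\<bar>\<close> in the weight by \<open>\<bar>z' - z\<bar>\<close>.
  The cost (\<open>dens_inner_variation\<close>): after a change of variables, the energies of the two moved copies have an average
  that exceeds the energy of \<open>u\<close> by \<open>O(h\<^sup>2)\<close> times the integral of \<open>\<epsilon> \<bar>z\<bar>\<^sup>p + \<bar>u\<bar>\<^sup>q + \<bar>z\<bar>\<^sup>q + 1\<close>, because the first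
  order terms cancel.  Both follow from bounds for the second derivative of \<open>f\<close> along lines
  (\<open>radial_second_derivative\<close>).  Since \<open>G\<close> is evaluated at the norms \<open>(\<bar>z\<^sup>\<alpha>\<bar>\<^sup>2 + \<epsilon>)\<^sup>1\<^sup>/\<^sup>2\<close>, that derivative consists of the
  Hessian form of \<open>G\<close>, which sees the radial part of the increment, and of first derivatives of \<open>G\<close> times the curvature
  of the norm, which see the tangential part; so the first derivatives of \<open>G\<close> have to be bounded from below
  (\<open>H2_first_derivative_lower\<close>).

  Minimality now bounds the gain by the cost (\<open>difference_estimate\<close>): the symmetric difference quotients of \<open>z\<close> are
  bounded in a weighted \<open>L\<^sup>2\<close> norm by the right hand side of the claim, with the factor \<open>1 / r\<^sup>2\<close> that comes from
  \<open>\<bar>\<nabla>\<eta>\<bar> \<le> n / r\<close>.  Iterated midpoints of these quotients converge strongly in \<open>L\<^sup>2\<close> (\<open>midpoint_hull_limit\<close>), the limit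
  is the weak derivative of \<open>z\<close> in direction \<open>e\<close>, and the weighted bound passes to the limit because the weights
  converge almost everywhere (\<open>weak_derivative_estimate\<close>).  Adding the directions gives the estimate on balls, and gluing
  the local derivatives along an exhaustion gives second weak derivatives on the whole domain.
\<close>

section \<open>Partial derivatives and smooth functions\<close>

lemma has_partial_within_interior:
 assumes "has_partial_within S e f z" "z \<in> interior S"
 shows "((%t. f (z + t *\<^sub>R e)) has_real_derivative partial_within S e f z) (at 0)"
proof -
 let ?T = "{t. z + t *\<^sub>R e \<in> S}"
 have "open ((%t. z + t *\<^sub>R e) -` interior S)"
  by (rule open_vimage) (auto intro!: continuous_intros)
 moreover have "0 \<in> (%t. z + t *\<^sub>R e) -` interior S" using assms by auto
 moreover have "(%t. z + t *\<^sub>R e) -` interior S \<subseteq> ?T" using interior_subset by auto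
 ultimately have "0 \<in> interior ?T" by (meson interiorI)
 then have *: "at 0 within ?T = at 0" by (rule at_within_interior)
 have "((%t. f (z + t *\<^sub>R e)) has_vector_derivative partial_within S e f z) (at 0)"
  using assms(1) unfolding has_partial_within_def partial_within_def * by (simp add: vector_derivative_works)
 then show ?thesis by (simp add: has_real_derivative_iff_has_vector_derivative)
qed

lemma has_partialD:
 assumes "has_partial_within UNIV e f z"
 shows "((%t. f (z + t *\<^sub>R e)) has_real_derivative partial_within UNIV e f z) (at 0)"
 using has_partial_within_interior[OF assms] by simp

lemma partialI:
 assumes "((%t. f (z + t *\<^sub>R e)) has_real_derivative d) (at 0)"
 shows "has_partial_within UNIV e f z" "partial_within UNIV e f z = d"
 using assms unfolding has_partial_within_def partial_within_def
 by (auto simp: has_real_derivative_iff_has_vector_derivative differentiableI_vector vector_derivative_at)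

lemma Ck_on_SucI:
 assumes "continuous_on UNIV f"
  and "!!e z. e \<in> Basis ==> ((%t. f (z + t *\<^sub>R e)) has_real_derivative D e z) (at 0)"
  and "!!e. e \<in> Basis ==> Ck_on k UNIV (D e)"
 shows "Ck_on (Suc k) UNIV f"
proof -
 have "partial_within UNIV e f = D e" if "e \<in> Basis" for e
  using partialI(2)[OF assms(2)[OF that]] by auto
 then show ?thesis using assms partialI(1)[OF assms(2)] by auto
qed

lemma Ck_on_continuous: "Ck_on k S f ==> continuous_on S f"
 by (cases k) auto

lemma Ck_on_SucD: "Ck_on (Suc k) S f ==> Ck_on k S f"
 by (induction k arbitrary: f) auto

lemma Ck_on_partial:
 "Ck_on (Suc k) UNIV f ==> e \<in> Basis ==>
  ((%t. f (z + t *\<^sub>R e)) has_real_derivative partial_within UNIV e f z) (at 0)"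
 by (auto intro: has_partialD)

lemma Ck_on_const: "Ck_on k UNIV (%x. c)"
 by (induction k arbitrary: c) (auto intro!: Ck_on_SucI[where D="%_ _. 0"] simp del: Ck_on.simps(2))

lemma Ck_on_add:
 assumes "Ck_on k UNIV f" "Ck_on k UNIV g" shows "Ck_on k UNIV (%x. f x + g x)"
 using assms
proof (induction k arbitrary: f g)
 case 0 then show ?case by (auto intro: continuous_intros)
next
 case (Suc k)
 show ?case
 proof (rule Ck_on_SucI[where D="%e x. partial_within UNIV e f x + partial_within UNIV e g x"])
  show "continuous_on UNIV (%x. f x + g x)" using Suc.prems by (auto intro: continuous_intros)
  show "Ck_on k UNIV (%x. partial_within UNIV e f x + partial_within UNIV e g x)" if "e \<in> Basis" for e
   using Suc that by auto
  show "((%t. f (z + t *\<^sub>R e) + g (z + t *\<^sub>R e)) has_real_derivative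
    partial_within UNIV e f z + partial_within UNIV e g z) (at 0)" if "e \<in> Basis" for e z
   using Suc.prems[THEN Ck_on_partial, OF that] by (intro DERIV_add)
 qed
qed

lemma Ck_on_mult:
 assumes "Ck_on k UNIV f" "Ck_on k UNIV g" shows "Ck_on k UNIV (%x. f x * g x)"
 using assms
proof (induction k arbitrary: f g)
 case 0 then show ?case by (auto intro: continuous_intros)
next
 case (Suc k)
 show ?case
 proof (rule Ck_on_SucI[where D="%e x. partial_within UNIV e f x * g x + partial_within UNIV e g x * f x"])
  show "continuous_on UNIV (%x. f x * g x)" using Suc.prems by (auto intro: continuous_intros)
  show "Ck_on k UNIV (%x. partial_within UNIV e f x * g x + partial_within UNIV e g x * f x)" if "e \<in> Basis" for e
   using Suc.prems[THEN Ck_on_SucD] Suc.prems that by (intro Ck_on_add Suc.IH) auto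
  show "((%t. f (z + t *\<^sub>R e) * g (z + t *\<^sub>R e)) has_real_derivative
    partial_within UNIV e f z * g z + partial_within UNIV e g z * f z) (at 0)" if "e \<in> Basis" for e z
   using DERIV_mult[OF Suc.prems(1)[THEN Ck_on_partial, OF that] Suc.prems(2)[THEN Ck_on_partial, OF that], of z z]
   by simp
 qed
qed

lemma Ck_on_cmult: "Ck_on k UNIV f ==> Ck_on k UNIV (%x. c * f x)"
 by (intro Ck_on_mult Ck_on_const)

lemma Ck_on_diff:
 assumes "Ck_on k UNIV f" "Ck_on k UNIV g" shows "Ck_on k UNIV (%x. f x - g x)"
 using Ck_on_add[OF assms(1) Ck_on_cmult[OF assms(2), of "-1"]] by simp

lemma Ck_on_affine:
 assumes "Ck_on k UNIV f" shows "Ck_on k UNIV (%x. f (a + c *\<^sub>R x))"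
 using assms
proof (induction k arbitrary: f)
 case 0 then show ?case
  by (auto intro!: continuous_intros continuous_on_compose2[of UNIV f])
next
 case (Suc k)
 show ?case
 proof (rule Ck_on_SucI[where D="%e x. c * partial_within UNIV e f (a + c *\<^sub>R x)"])
  show "continuous_on UNIV (%x. f (a + c *\<^sub>R x))" using Suc.prems
   by (auto intro!: continuous_intros continuous_on_compose2[of UNIV f])
  show "Ck_on k UNIV (%x. c * partial_within UNIV e f (a + c *\<^sub>R x))" if "e \<in> Basis" for e
   using Suc that by (auto intro!: Ck_on_cmult)
  show "((%t. f (a + c *\<^sub>R (z + t *\<^sub>R e))) has_real_derivative
    c * partial_within UNIV e f (a + c *\<^sub>R z)) (at 0)" if "e \<in> Basis" for e z
  proof -
   have "((%t. f ((a + c *\<^sub>R z) + t *\<^sub>R e)) has_real_derivative partial_within UNIV e f (a + c *\<^sub>R z)) (at (c * 0))"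
    using Suc.prems[THEN Ck_on_partial, OF that] by simp
   from DERIV_chain2[where g="%t. c * t", OF this, of c UNIV]
   have "((%t. f ((a + c *\<^sub>R z) + (c * t) *\<^sub>R e)) has_real_derivative partial_within UNIV e f (a + c *\<^sub>R z) * c) (at 0)"
    by (auto intro!: derivative_eq_intros)
   then show ?thesis by (simp add: algebra_simps)
  qed
 qed
qed

lemma partial_affine:
 assumes "Ck_on (Suc 0) UNIV f" "e \<in> Basis"
 shows "partial_within UNIV e (%x. f (a + c *\<^sub>R x)) z = c * partial_within UNIV e f (a + c *\<^sub>R z)"
proof (rule partialI(2))
 have "((%t. f ((a + c *\<^sub>R z) + t *\<^sub>R e)) has_real_derivative partial_within UNIV e f (a + c *\<^sub>R z)) (at (c * 0))"
  using assms(1)[THEN Ck_on_partial, OF assms(2)] by simp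
 from DERIV_chain2[where g="%t. c * t", OF this, of c UNIV]
 have "((%t. f ((a + c *\<^sub>R z) + (c * t) *\<^sub>R e)) has_real_derivative partial_within UNIV e f (a + c *\<^sub>R z) * c) (at 0)"
  by (auto intro!: derivative_eq_intros)
 then show "((%t. f (a + c *\<^sub>R (z + t *\<^sub>R e))) has_real_derivative
    c * partial_within UNIV e f (a + c *\<^sub>R z)) (at 0)"
  by (simp add: algebra_simps)
qed

text \<open>Moving along one coordinate at a time and applying the mean value theorem on each leg.\<close>

lemma has_derivative_of_continuous_partials:
 fixes f :: "'a::euclidean_space => real"
 assumes "open S" and xS: "x \<in> S"
  and D: "!!b z. b \<in> Basis ==> z \<in> S ==> ((%t. f (z + t *\<^sub>R b)) has_real_derivative D b z) (at 0)"
  and cont: "!!b. b \<in> Basis ==> continuous_on S (D b)"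
 shows "(f has_derivative (%v. \<Sum>b\<in>Basis. (v \<bullet> b) * D b x)) (at x)"
proof -
 obtain r where r: "r > 0" "ball x r \<subseteq> S" using assms(1) xS openE by blast
 \<comment> \<open>Induction over the coordinates in which the increment may be nonzero.\<close>
 have main: "\<forall>e>0. \<exists>d>0. d <= r & (\<forall>v. norm v < d & (\<forall>b\<in>Basis - B. v \<bullet> b = 0) \<longrightarrow>
   \<bar>f (x + v) - f x - (\<Sum>b\<in>B. (v \<bullet> b) * D b x)\<bar> <= e * norm v)" if "finite B" "B \<subseteq> Basis" for B
  using that
 proof (induction B)
  case empty
  have "v = 0" if "\<forall>b\<in>Basis. v \<bullet> b = 0" for v :: 'a using that by (simp add: euclidean_all_zero_iff)
  then have "abs (f (x + v) - f x - (\<Sum>b\<in>{}. (v \<bullet> b) * D b x)) <= e * norm v"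
   if "norm v < r & (\<forall>b\<in>Basis - {}. v \<bullet> b = 0)" for e v using that by fastforce
  then show ?case using r by (intro allI impI exI[of _ r]) auto
 next
  case (insert b B)
  show ?case
  proof (intro allI impI)
   fix e :: real assume e: "e > 0"
   from insert obtain d1 where d1: "d1 > 0" "d1 <= r" and
    IH: "!!v. norm v < d1 ==> (\<forall>b\<in>Basis - B. v \<bullet> b = 0) ==>
      abs (f (x + v) - f x - (\<Sum>b\<in>B. (v \<bullet> b) * D b x)) <= e/2 * norm v"
    using e by (auto dest!: spec[of _ "e/2"])
   have bB: "b \<in> Basis" using insert by auto
   have "isCont (D b) x" using cont[OF bB] assms(1) xS by (simp add: continuous_on_eq_continuous_at)
   then obtain d2 where d2: "d2 > 0" "!!y. dist y x < d2 ==> abs (D b y - D b x) < e/2"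
    unfolding continuous_at_eps_delta using e by (metis half_gt_zero dist_real_def)
   show "\<exists>d>0. d <= r & (\<forall>v. norm v < d & (\<forall>b\<in>Basis - insert b B. v \<bullet> b = 0) \<longrightarrow>
     \<bar>f (x + v) - f x - (\<Sum>b\<in>insert b B. (v \<bullet> b) * D b x)\<bar> <= e * norm v)"
   proof (intro exI[of _ "min d1 (d2/2)"] conjI allI impI)
    show "0 < min d1 (d2/2)" "min d1 (d2/2) <= r" using d1 d2 by auto
    fix v :: 'a assume v: "norm v < min d1 (d2/2) & (\<forall>b\<in>Basis - insert b B. v \<bullet> b = 0)"
    define w where "w = v - (v \<bullet> b) *\<^sub>R b"
    have wb: "w \<bullet> b = 0" using bB by (simp add: w_def inner_diff_left)
    have wb': "w \<bullet> c = v \<bullet> c" if "c \<in> Basis" "c \<noteq> b" for c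
     using bB that by (simp add: w_def inner_diff_left inner_not_same_Basis)
    have vb: "abs (v \<bullet> b) <= norm v" using bB by (simp add: Basis_le_norm)
    have seg: "norm (w + s *\<^sub>R b) <= norm v" if "abs s <= abs (v \<bullet> b)" for s
    proof -
     have pyth: "(norm (w + s *\<^sub>R b))^2 = (norm w)^2 + s^2" for s
      unfolding power2_norm_eq_inner using wb bB
      by (simp add: inner_add_left inner_add_right inner_commute power2_eq_square)
     note pyth[of s]
     moreover have "(norm v)^2 = (norm w)^2 + (v \<bullet> b)^2"
      using pyth[of "v \<bullet> b"] by (simp add: w_def)
     moreover have "s^2 <= (v \<bullet> b)^2" using that abs_le_square_iff by blast
     ultimately have "(norm (w + s *\<^sub>R b))^2 <= (norm v)^2" by linarith
     then show ?thesis by (rule power2_le_imp_le) simp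
    qed
    have normw: "norm w <= norm v" using seg[of 0] by simp
    have w0: "\<forall>c\<in>Basis - B. w \<bullet> c = 0"
    proof
     fix c assume c: "c \<in> Basis - B"
     show "w \<bullet> c = 0"
     proof (cases "c = b")
      case False
      then show ?thesis using c wb'[of c] v by auto
     qed (simp add: wb)
    qed
    have 1: "abs (f (x + w) - f x - (\<Sum>c\<in>B. (w \<bullet> c) * D c x)) <= e/2 * norm w"
     using IH[OF le_less_trans[OF normw] w0] v by simp
    have 2: "\<exists>s. abs s <= abs (v \<bullet> b) & f (x + w + (v \<bullet> b) *\<^sub>R b) - f (x + w) = (v \<bullet> b) * D b (x + w + s *\<^sub>R b)"
    proof -
     let ?g = "%s. f (x + w + s *\<^sub>R b)"
     have der: "(?g has_real_derivative D b (x + w + s *\<^sub>R b)) (at s)" if "abs s <= abs (v \<bullet> b)" for s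
     proof -
      have "x - (x + w + s *\<^sub>R b) = - (w + s *\<^sub>R b)" by simp
      then have "dist x (x + w + s *\<^sub>R b) = norm (w + s *\<^sub>R b)" unfolding dist_norm by (simp only: norm_minus_cancel)
      then have "dist x (x + w + s *\<^sub>R b) < r" using seg[OF that] v d1 by simp
      then have "x + w + s *\<^sub>R b \<in> S" using r by auto
      from D[OF bB this] have "((%t. f (x + w + s *\<^sub>R b + t *\<^sub>R b)) has_real_derivative D b (x + w + s *\<^sub>R b)) (at (s + - s))" by simp
      from this[unfolded DERIV_shift] show ?thesis by (simp add: algebra_simps)
     qed
     consider "v \<bullet> b = 0" | "v \<bullet> b > 0" | "v \<bullet> b < 0" by linarith
     then show ?thesis
     proof cases
      case 1 then show ?thesis by auto
     next
      case 2
      from MVT2[OF 2, of ?g "%s. D b (x + w + s *\<^sub>R b)"] der 2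
      obtain s where "0 < s" "s < v \<bullet> b" "?g (v \<bullet> b) - ?g 0 = (v \<bullet> b - 0) * D b (x + w + s *\<^sub>R b)" by auto
      then show ?thesis by (intro exI[of _ s]) auto
     next
      case 3
      from MVT2[OF 3, of ?g "%s. D b (x + w + s *\<^sub>R b)"] der 3
      obtain s where "s < 0" "s > v \<bullet> b" "?g 0 - ?g (v \<bullet> b) = (0 - v \<bullet> b) * D b (x + w + s *\<^sub>R b)" by auto
      then show ?thesis by (intro exI[of _ s]) auto
     qed
    qed
    then obtain s where s: "abs s <= abs (v \<bullet> b)" "f (x + w + (v \<bullet> b) *\<^sub>R b) - f (x + w) = (v \<bullet> b) * D b (x + w + s *\<^sub>R b)" by blast
    have "x + w + s *\<^sub>R b - x = w + s *\<^sub>R b" by simp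
    then have "dist (x + w + s *\<^sub>R b) x < d2" using seg[OF s(1)] v d2(1) unfolding dist_norm by simp
    then have "abs (D b (x + w + s *\<^sub>R b) - D b x) < e/2" by (rule d2(2))
    then have 3: "abs ((v \<bullet> b) * (D b (x + w + s *\<^sub>R b) - D b x)) <= norm v * (e/2)"
     unfolding abs_mult using vb by (intro mult_mono) auto
    have eq: "x + v = x + w + (v \<bullet> b) *\<^sub>R b" by (simp add: w_def)
    have sB: "(\<Sum>c\<in>B. (w \<bullet> c) * D c x) = (\<Sum>c\<in>B. (v \<bullet> c) * D c x)"
     using insert.hyps insert.prems wb' by (intro sum.cong) auto
    have "f (x + v) - f x - (\<Sum>c\<in>insert b B. (v \<bullet> c) * D c x)
      = (f (x + w) - f x - (\<Sum>c\<in>B. (w \<bullet> c) * D c x)) + (v \<bullet> b) * (D b (x + w + s *\<^sub>R b) - D b x)"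
     using insert.hyps s(2) unfolding eq sB by (simp add: algebra_simps)
    also have "abs (...) <= e/2 * norm w + norm v * (e/2)" using 1 3 by linarith
    also have "... <= e * norm v" using mult_left_mono[OF normw less_imp_le[OF e]] by (simp add: algebra_simps)
    finally show "abs (f (x + v) - f x - (\<Sum>c\<in>insert b B. (v \<bullet> c) * D c x)) <= e * norm v" .
   qed
  qed
 qed
 show ?thesis
  unfolding has_derivative_at_alt
 proof (intro conjI allI impI)
  show "bounded_linear (%v. \<Sum>b\<in>Basis. (v \<bullet> b) * D b x)"
   by (intro bounded_linear_sum bounded_linear_mult_left[THEN bounded_linear_compose] bounded_linear_inner_left)
  fix e :: real assume "e > 0"
  from main[OF finite_Basis subset_refl, rule_format, OF this] obtain d where d: "d > 0"
   "!!v. norm v < d ==> abs (f (x + v) - f x - (\<Sum>b\<in>Basis. (v \<bullet> b) * D b x)) <= e * norm v" by auto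
  show "\<exists>d>0. \<forall>y. norm (y - x) < d \<longrightarrow> norm (f y - f x - (\<Sum>b\<in>Basis. ((y - x) \<bullet> b) * D b x)) <= e * norm (y - x)"
   using d(1) d(2)[of "y - x" for y] by (intro exI[of _ d]) auto
 qed
qed

lemma Ck_on_has_derivative:
 assumes "Ck_on (Suc 0) UNIV f"
 shows "(f has_derivative (%v. \<Sum>b\<in>Basis. (v \<bullet> b) * partial_within UNIV b f x)) (at x)"
 using assms by (intro has_derivative_of_continuous_partials[where S=UNIV]) (auto intro: has_partialD)

lemma Ck_on_curve_derivative:
 assumes "Ck_on (Suc 0) UNIV f" "(c has_vector_derivative v) (at t)"
 shows "((%t. f (c t)) has_real_derivative (\<Sum>b\<in>Basis. (v \<bullet> b) * partial_within UNIV b f (c t))) (at t)"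
proof -
 have "((%t. f (c t)) has_derivative (%h. \<Sum>b\<in>Basis. ((h *\<^sub>R v) \<bullet> b) * partial_within UNIV b f (c t))) (at t)"
  using has_derivative_compose[OF assms(2)[unfolded has_vector_derivative_def] Ck_on_has_derivative[OF assms(1)]] by simp
 then show ?thesis
  unfolding has_field_derivative_def by (rule has_derivative_eq_rhs) (auto simp: sum_distrib_left mult_ac)
qed

text \<open>Both mixed derivatives are limits of one second difference quotient, which two applications of the mean value
  theorem evaluate in either order.\<close>

lemma partials_commute:
 assumes C2: "Ck_on (Suc (Suc 0)) UNIV f" and e: "d \<in> Basis" "e \<in> Basis"
 shows "partial_within UNIV e (partial_within UNIV d f) z = partial_within UNIV d (partial_within UNIV e f) z"
proof -
 let ?P = "partial_within UNIV"
 have line: "((%t. g (y + t *\<^sub>R b)) has_real_derivative ?P b g (y + s *\<^sub>R b)) (at s)"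
  if "Ck_on (Suc 0) UNIV g" "b \<in> Basis" for g :: "'a => real" and b y s
 proof -
  have "((%t. g (y + s *\<^sub>R b + t *\<^sub>R b)) has_real_derivative ?P b g (y + s *\<^sub>R b)) (at (s + - s))"
   using Ck_on_partial[OF that] by simp
  from this[unfolded DERIV_shift] show ?thesis by (simp add: algebra_simps)
 qed
 have C1: "Ck_on (Suc 0) UNIV f" using Ck_on_SucD[OF C2] .
 have key: "\<exists>a b. 0 < a & a < h & 0 < b & b < h \<and>
   f (z + h *\<^sub>R d + h *\<^sub>R e) - f (z + h *\<^sub>R d) - f (z + h *\<^sub>R e) + f z
   = h * h * ?P e (?P d f) (z + a *\<^sub>R d + b *\<^sub>R e)"
  if h: "h > 0" and e: "d \<in> Basis" "e \<in> Basis" for h d e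
 proof -
  have Cd: "Ck_on (Suc 0) UNIV (?P d f)" using C2 e by simp
  let ?g = "%a. f (z + h *\<^sub>R e + a *\<^sub>R d) - f (z + a *\<^sub>R d)"
  have "(?g has_real_derivative ?P d f (z + h *\<^sub>R e + a *\<^sub>R d) - ?P d f (z + a *\<^sub>R d)) (at a)" for a
   by (intro DERIV_diff line C1 e)
  from MVT2[OF h this] obtain a where a: "0 < a" "a < h"
   "?g h - ?g 0 = h * (?P d f (z + h *\<^sub>R e + a *\<^sub>R d) - ?P d f (z + a *\<^sub>R d))" by auto
  have "((%b. ?P d f (z + a *\<^sub>R d + b *\<^sub>R e)) has_real_derivative ?P e (?P d f) (z + a *\<^sub>R d + b *\<^sub>R e)) (at b)" for b
   by (intro line Cd e)
  from MVT2[OF h this] obtain b where b: "0 < b" "b < h"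
   "?P d f (z + a *\<^sub>R d + h *\<^sub>R e) - ?P d f (z + a *\<^sub>R d + 0 *\<^sub>R e) = (h - 0) * ?P e (?P d f) (z + a *\<^sub>R d + b *\<^sub>R e)" by blast
  show ?thesis using a b by (intro exI[of _ a] exI[of _ b]) (simp add: algebra_simps)
 qed
 have ex: "\<exists>x y. norm (x - z) <= 2 * h & norm (y - z) <= 2 * h & ?P e (?P d f) x = ?P d (?P e f) y" if h: "h > 0" for h
 proof -
  obtain a b where ab: "0 < a" "a < h" "0 < b" "b < h"
   "f (z + h *\<^sub>R d + h *\<^sub>R e) - f (z + h *\<^sub>R d) - f (z + h *\<^sub>R e) + f z
   = h * h * ?P e (?P d f) (z + a *\<^sub>R d + b *\<^sub>R e)" using key[OF h e] by blast
  obtain a' b' where ab': "0 < a'" "a' < h" "0 < b'" "b' < h"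
   "f (z + h *\<^sub>R e + h *\<^sub>R d) - f (z + h *\<^sub>R e) - f (z + h *\<^sub>R d) + f z
   = h * h * ?P d (?P e f) (z + a' *\<^sub>R e + b' *\<^sub>R d)" using key[OF h e(2) e(1)] by blast
  have "?P e (?P d f) (z + a *\<^sub>R d + b *\<^sub>R e) = ?P d (?P e f) (z + a' *\<^sub>R e + b' *\<^sub>R d)"
   using ab(5) ab'(5) h by (simp add: algebra_simps)
  moreover have "norm (a *\<^sub>R d + b *\<^sub>R e) <= 2 * h" "norm (a' *\<^sub>R e + b' *\<^sub>R d) <= 2 * h"
   using ab ab' e by (auto intro!: order_trans[OF norm_triangle_ineq])
  ultimately show ?thesis
   by (intro exI[of _ "z + a *\<^sub>R d + b *\<^sub>R e"] exI[of _ "z + a' *\<^sub>R e + b' *\<^sub>R d"]) (auto simp: algebra_simps)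
 qed
 define h where "h n = inverse (real (Suc n))" for n
 have hpos: "h n > 0" for n by (simp add: h_def)
 have hlim: "h \<longlonglongrightarrow> 0" unfolding h_def by (rule LIMSEQ_inverse_real_of_nat)
 from ex[OF hpos] obtain x y where xy: "!!n. norm (x n - z) <= 2 * h n" "!!n. norm (y n - z) <= 2 * h n"
  "!!n. ?P e (?P d f) (x n) = ?P d (?P e f) (y n)" by metis
 have lim2: "(%n. 2 * h n) \<longlonglongrightarrow> 0" using tendsto_mult_left[OF hlim, of 2] by simp
 have xl: "x \<longlonglongrightarrow> z" and yl: "y \<longlonglongrightarrow> z"
  using Lim_null_comparison[OF always_eventually lim2, of "%n. x n - z"]
   Lim_null_comparison[OF always_eventually lim2, of "%n. y n - z"] xy
  by (auto simp: LIM_zero_iff)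
 have c1: "isCont (?P e (?P d f)) z" and c2: "isCont (?P d (?P e f)) z" using C2 e by (auto simp: continuous_on_eq_continuous_at)
 have "(%n. ?P e (?P d f) (x n)) \<longlonglongrightarrow> ?P e (?P d f) z" using isCont_tendsto_compose[OF c1 xl] .
 moreover have "(%n. ?P e (?P d f) (x n)) \<longlonglongrightarrow> ?P d (?P e f) z" unfolding xy(3) using isCont_tendsto_compose[OF c2 yl] .
 ultimately show ?thesis by (rule LIMSEQ_unique)
qed

text \<open>The chain rule for a shear; by induction it keeps smooth functions smooth, so a shear sends test functions to
  test functions.\<close>

lemma shear_partial:
 assumes f: "Ck_on (Suc 0) UNIV f" and g: "Ck_on (Suc 0) UNIV g" and e: "e \<in> Basis" and i: "i \<in> Basis"
 shows "((%t. f ((z + t *\<^sub>R e) - (h * g (z + t *\<^sub>R e)) *\<^sub>R i)) has_real_derivative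
  partial_within UNIV e f (z - (h * g z) *\<^sub>R i) - h * partial_within UNIV e g z * partial_within UNIV i f (z - (h * g z) *\<^sub>R i)) (at 0)"
proof -
 have dg: "((%t. g (z + t *\<^sub>R e)) has_vector_derivative partial_within UNIV e g z) (at 0)"
  using Ck_on_partial[OF g e] by (simp add: has_real_derivative_iff_has_vector_derivative)
 have "((%t. (z + t *\<^sub>R e) - (h * g (z + t *\<^sub>R e)) *\<^sub>R i) has_vector_derivative (e - (h * partial_within UNIV e g z) *\<^sub>R i)) (at 0)"
  by (auto intro!: derivative_eq_intros dg simp: has_real_derivative_iff_has_vector_derivative Ck_on_partial[OF g e])
 from Ck_on_curve_derivative[OF f this]
 have "((%t. f ((z + t *\<^sub>R e) - (h * g (z + t *\<^sub>R e)) *\<^sub>R i)) has_real_derivative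
   (\<Sum>b\<in>Basis. ((e - (h * partial_within UNIV e g z) *\<^sub>R i) \<bullet> b) * partial_within UNIV b f (z - (h * g z) *\<^sub>R i))) (at 0)" by simp
 moreover have "(\<Sum>b\<in>Basis. ((e - (h * partial_within UNIV e g z) *\<^sub>R i) \<bullet> b) * partial_within UNIV b f (z - (h * g z) *\<^sub>R i))
  = (\<Sum>b\<in>Basis. (if b = e then partial_within UNIV b f (z - (h * g z) *\<^sub>R i) else 0))
   - (\<Sum>b\<in>Basis. (if b = i then h * partial_within UNIV e g z * partial_within UNIV b f (z - (h * g z) *\<^sub>R i) else 0))"
  unfolding sum_subtractf[symmetric] using e i
  by (intro sum.cong) (auto simp: inner_diff_left inner_Basis algebra_simps)
 ultimately show ?thesis using e i by (simp add: sum.delta')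
qed

lemma Ck_on_shear:
 assumes "Ck_on k UNIV f" "!!k. Ck_on k UNIV g" and i: "i \<in> Basis"
 shows "Ck_on k UNIV (%x. f (x - (h * g x) *\<^sub>R i))"
 using assms(1)
proof (induction k arbitrary: f)
 case 0
 have "continuous_on UNIV g" using assms(2)[of 0] by simp
 with 0 show ?case
  by (auto intro!: continuous_intros continuous_on_compose2[of UNIV f])
next
 case (Suc k)
 have cg: "continuous_on UNIV g" using assms(2)[of 0] by simp
 have f1: "Ck_on (Suc 0) UNIV f" using Suc.prems Ck_on_continuous by auto
 show ?case
 proof (rule Ck_on_SucI[OF _ shear_partial[OF f1 assms(2) _ i]])
  show "continuous_on UNIV (%x. f (x - (h * g x) *\<^sub>R i))" using Suc.prems cg
   by (auto intro!: continuous_intros continuous_on_compose2[of UNIV f])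
  show "Ck_on k UNIV (%z. partial_within UNIV e f (z - (h * g z) *\<^sub>R i)
   - h * partial_within UNIV e g z * partial_within UNIV i f (z - (h * g z) *\<^sub>R i))" if "e \<in> Basis" for e
   using Suc.prems assms(2)[of "Suc k"] i that
   by (intro Ck_on_diff Ck_on_mult[where g="%z. partial_within UNIV i f (z - (h * g z) *\<^sub>R i)"] Ck_on_cmult Suc.IH) auto
 qed auto
qed

section \<open>Bump functions\<close>

text \<open>The powers in the denominator make the family closed under differentiation up to linear combinations, so that
  smoothness of all members is a single induction.\<close>

definition exp_bump :: "nat => real => real" where
 "exp_bump k x = (if x > 0 then exp (- 1 / x) / x ^ k else 0)"

lemma exp_bump_tendsto_0: "(exp_bump k \<longlongrightarrow> 0) (at 0)"
proof -
 have "((%x. x ^ k / exp x) \<longlongrightarrow> (0::real)) at_top" by (rule tendsto_power_div_exp_0)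
 then have "((%x. inverse x ^ k / exp (inverse x)) \<longlongrightarrow> (0::real)) (at_right 0)"
  by (rule filterlim_compose[OF _ filterlim_inverse_at_top_right])
 moreover have "eventually (%x. inverse x ^ k / exp (inverse x) = exp_bump k x) (at_right 0)"
  by (rule eventually_at_right_less[THEN eventually_mono]) (simp add: exp_bump_def exp_minus field_simps inverse_eq_divide)
 ultimately have r: "(exp_bump k \<longlongrightarrow> 0) (at_right 0)" by (rule Lim_transform_eventually)
 have "eventually (%x. 0 = exp_bump k x) (at_left 0)"
  unfolding eventually_at_left_field by (auto simp: exp_bump_def intro!: exI[of _ "-1"])
 then have l: "(exp_bump k \<longlongrightarrow> 0) (at_left 0)" by (rule Lim_transform_eventually[OF tendsto_const])
 show ?thesis using l r by (simp add: filterlim_split_at)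
qed

lemma exp_bump_deriv: "(exp_bump k has_real_derivative exp_bump (k + 2) x - k * exp_bump (k + 1) x) (at x)"
proof -
 consider "x < 0" | "x > 0" | "x = 0" by linarith
 then show ?thesis
 proof cases
  case 1
  have "((%x. 0) has_real_derivative 0) (at x)" by simp
  then have "(exp_bump k has_real_derivative 0) (at x)"
   by (rule has_field_derivative_transform_within_open[where S="{..<0}"]) (use 1 in \<open>auto simp: exp_bump_def\<close>)
  then show ?thesis using 1 by (simp add: exp_bump_def)
 next
  case 2
  have "((%x. exp (- 1 / x) / x ^ k) has_real_derivative exp_bump (k + 2) x - k * exp_bump (k + 1) x) (at x)"
  proof (cases k)
   case 0
   then show ?thesis using 2 by (auto intro!: derivative_eq_intros simp: exp_bump_def power2_eq_square)
  next
   case (Suc j)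
   have "((%x. exp (- 1 / x) / x ^ k) has_real_derivative
     ((exp (- 1 / x) * (1 / x^2)) * x ^ k - exp (- 1 / x) * (k * x ^ (k - 1))) / (x ^ k * x ^ k)) (at x)"
    using 2 by (auto intro!: derivative_eq_intros simp: power2_eq_square)
   moreover have "((exp (- 1 / x) * (1 / x^2)) * x ^ k - exp (- 1 / x) * (k * x ^ (k - 1))) / (x ^ k * x ^ k)
     = exp_bump (k + 2) x - k * exp_bump (k + 1) x"
    using 2 Suc by (simp add: exp_bump_def divide_simps power2_eq_square) (simp add: algebra_simps)
   ultimately show ?thesis by simp
  qed
  then show ?thesis
   by (rule has_field_derivative_transform_within_open[where S="{0<..}"]) (use 2 in \<open>auto simp: exp_bump_def\<close>)
 next
  case 3
  have "((%h. (exp_bump k (0 + h) - exp_bump k 0) / h) \<longlongrightarrow> 0) (at 0)"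
  proof (rule Lim_transform_eventually[OF exp_bump_tendsto_0[of "k+1"]])
   show "eventually (%h. exp_bump (k + 1) h = (exp_bump k (0 + h) - exp_bump k 0) / h) (at 0)"
    by (rule always_eventually) (simp add: exp_bump_def)
  qed
  then show ?thesis using 3 by (simp add: DERIV_def exp_bump_def)
 qed
qed

lemma Ck_on_inner: "Ck_on k UNIV (%x. x \<bullet> e)"
proof (cases k)
 case (Suc j)
 show ?thesis unfolding Suc
 proof (rule Ck_on_SucI[where D="%b _. b \<bullet> e"])
  show "((%t. (z + t *\<^sub>R b) \<bullet> e) has_real_derivative b \<bullet> e) (at 0)" for b z
   by (auto intro!: derivative_eq_intros simp: inner_add_left)
 qed (auto intro!: continuous_intros Ck_on_const)
qed (auto intro!: continuous_intros)

lemma Ck_on_exp_bump_ball: "Ck_on m UNIV (%x::'a::euclidean_space. exp_bump k (r - x \<bullet> x))"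
proof (induction m arbitrary: k)
 case 0
 have "continuous_on UNIV (exp_bump k)"
  using exp_bump_deriv by (intro continuous_at_imp_continuous_on) (blast intro: DERIV_isCont)
 then show ?case by (auto intro!: continuous_intros continuous_on_compose2[of UNIV "exp_bump k"])
next
 case (Suc m)
 have c: "continuous_on UNIV (exp_bump k)"
  using exp_bump_deriv by (intro continuous_at_imp_continuous_on) (blast intro: DERIV_isCont)
 show ?case
 proof (rule Ck_on_SucI[where D="%e x. (exp_bump (k + 2) (r - x \<bullet> x) - k * exp_bump (k + 1) (r - x \<bullet> x)) * ((-2) * (x \<bullet> e))"])
  show "continuous_on UNIV (%x::'a. exp_bump k (r - x \<bullet> x))"
   using c by (auto intro!: continuous_intros continuous_on_compose2[of UNIV "exp_bump k"])
  show "((%t. exp_bump k (r - (z + t *\<^sub>R e) \<bullet> (z + t *\<^sub>R e))) has_real_derivative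
   (exp_bump (k + 2) (r - z \<bullet> z) - k * exp_bump (k + 1) (r - z \<bullet> z)) * ((-2) * (z \<bullet> e))) (at 0)" for e z :: 'a
  proof -
   have "((%t. r - (z + t *\<^sub>R e) \<bullet> (z + t *\<^sub>R e)) has_real_derivative ((-2) * (z \<bullet> e))) (at 0)"
    by (auto intro!: derivative_eq_intros simp: inner_add_left inner_add_right inner_commute)
   from DERIV_chain2[where f="exp_bump k" and g="%t. r - (z + t *\<^sub>R e) \<bullet> (z + t *\<^sub>R e)", OF _ this] exp_bump_deriv
   show ?thesis by auto
  qed
  show "Ck_on m UNIV (%x::'a. (exp_bump (k + 2) (r - x \<bullet> x) - k * exp_bump (k + 1) (r - x \<bullet> x)) * ((-2) * (x \<bullet> e)))" for e
   by (intro Ck_on_mult Ck_on_diff Ck_on_cmult Ck_on_inner Suc.IH)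
 qed
qed

section \<open>Test functions\<close>

lemma test_functionI:
 assumes "!!k. Ck_on k UNIV phi" "compact K" "K \<subseteq> Om" "!!x. phi x \<noteq> 0 ==> x \<in> K"
 shows "test_function Om phi"
proof -
 have "closure {x. phi x \<noteq> 0} \<subseteq> K" using assms by (intro closure_minimal) (auto intro: compact_imp_closed)
 then show ?thesis unfolding test_function_def
  using assms(1,3) compact_Int_closed[OF assms(2) closed_closure[of "{x. phi x \<noteq> 0}"]] by (auto simp: Int_absorb1)
qed

lemma test_function_support:
 assumes "test_function Om phi"
 obtains K where "compact K" "K \<subseteq> Om" "!!x. x \<notin> K ==> phi x = 0"
proof (rule that)
 show "compact (closure {x. phi x \<noteq> 0})" "closure {x. phi x \<noteq> 0} \<subseteq> Om"
  using assms by (auto simp: test_function_def)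
 show "phi x = 0" if "x \<notin> closure {x. phi x \<noteq> 0}" for x
  using that closure_subset[of "{x. phi x \<noteq> 0}"] by auto
qed

lemma test_function_Ck: "test_function Om phi ==> Ck_on k UNIV phi"
 by (simp add: test_function_def)

lemma test_function_mono: "test_function Om phi ==> Om \<subseteq> Om' ==> test_function Om' phi"
 by (auto simp: test_function_def)

lemma test_function_cont: "test_function Om phi ==> continuous_on S phi"
 using test_function_Ck[of Om phi 0] by (auto intro: continuous_on_subset)

lemma test_function_measurable[measurable_dest]: "test_function Om phi ==> phi \<in> borel_measurable borel"
 by (intro borel_measurable_continuous_onI test_function_cont)

lemma partial_eq_0_outside:
 assumes "closed K" "!!x. x \<notin> K ==> phi x = 0" "z \<notin> K"
 shows "partial_within UNIV e phi z = 0"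
proof (rule partialI(2))
 have "open ((%t. z + t *\<^sub>R e) -` (- K))" by (rule open_vimage) (auto intro!: continuous_intros assms simp: open_Compl)
 moreover have "((%t. 0) has_real_derivative 0) (at (0::real))" by simp
 ultimately show "((%t. phi (z + t *\<^sub>R e)) has_real_derivative 0) (at 0)"
  using has_field_derivative_transform_within_open[of "%t. 0" 0 0 "(%t. z + t *\<^sub>R e) -` (- K)"] assms by fastforce
qed

lemma test_function_partial:
 assumes "test_function Om phi" "e \<in> Basis" shows "test_function Om (partial_within UNIV e phi)"
proof -
 obtain K where K: "compact K" "K \<subseteq> Om" "!!x. x \<notin> K ==> phi x = 0" using test_function_support[OF assms(1)] by blast
 show ?thesis
 proof (rule test_functionI[OF _ K(1,2)])
  show "Ck_on k UNIV (partial_within UNIV e phi)" for k using test_function_Ck[OF assms(1), of "Suc k"] assms(2) by simp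
  show "x \<in> K" if "partial_within UNIV e phi x \<noteq> 0" for x
   using partial_eq_0_outside[of K phi x e] compact_imp_closed[OF K(1)] K(3) that by blast
 qed
qed

lemma test_function_bounded:
 assumes "test_function Om phi" obtains B where "B > 0" "!!x. abs (phi x) <= B"
proof -
 obtain K where K: "compact K" "K \<subseteq> Om" "!!x. x \<notin> K ==> phi x = 0" using test_function_support[OF assms] by blast
 have "compact (phi ` K)" using K test_function_cont[OF assms] by (intro compact_continuous_image)
 then obtain B where "B > 0" "!!x. x \<in> K ==> abs (phi x) <= B"
  using compact_imp_bounded bounded_pos[of "phi ` K"] by auto
 then have "abs (phi x) <= B" for x using K(3)[of x] by (cases "x \<in> K") auto
 then show ?thesis using \<open>B > 0\<close> that by blast
qed

lemma test_function_mult: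
 assumes "test_function Om phi" "!!k. Ck_on k UNIV g" shows "test_function Om (%x. g x * phi x)"
proof -
 obtain K where K: "compact K" "K \<subseteq> Om" "!!x. x \<notin> K ==> phi x = 0" using test_function_support[OF assms(1)] by blast
 show ?thesis
 proof (rule test_functionI[OF _ K(1,2)])
  show "Ck_on k UNIV (%x. g x * phi x)" for k by (rule Ck_on_mult[OF assms(2) test_function_Ck[OF assms(1)]])
  show "x \<in> K" if "g x * phi x \<noteq> 0" for x using K(3)[of x] that by (cases "x \<in> K") auto
 qed
qed

lemma test_function_line:
 assumes "test_function Om phi" "e \<in> Basis"
 shows "((%t. phi (z + t *\<^sub>R e)) has_real_derivative partial_within UNIV e phi (z + s *\<^sub>R e)) (at s)"
proof -
 have "((%t. phi (z + s *\<^sub>R e + t *\<^sub>R e)) has_real_derivative partial_within UNIV e phi (z + s *\<^sub>R e)) (at (s + - s))"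
  using Ck_on_partial[OF test_function_Ck[OF assms(1)] assms(2)] by simp
 from this[unfolded DERIV_shift] show ?thesis by (simp add: algebra_simps)
qed

section \<open>Convolution with a test function\<close>

lemma convolution_integrable:
 fixes phi :: "'a::euclidean_space => real"
 assumes f: "integrable lborel f" and phi: "test_function Om phi"
 shows "integrable lborel (%y. f y * phi (x - y))"
proof -
 obtain B where B: "B > 0" "!!x. abs (phi x) <= B" using test_function_bounded[OF phi] by blast
 have [measurable]: "phi \<in> borel_measurable borel" by (rule test_function_measurable[OF phi])
 have [measurable]: "f \<in> borel_measurable borel" using f by auto
 show ?thesis
  by (rule Bochner_Integration.integrable_bound[OF integrable_mult_left[OF integrable_norm[OF f], of B]])
   (use B in \<open>auto simp: abs_mult intro!: mult_left_mono\<close>)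
qed

lemma convolution_cont:
 fixes phi :: "'a::euclidean_space => real"
 assumes f: "integrable lborel f" and phi: "test_function Om phi"
 shows "continuous_on UNIV (%x. LINT y|lborel. f y * phi (x - y))"
proof -
 obtain B where B: "B > 0" "!!x. abs (phi x) <= B" using test_function_bounded[OF phi] by blast
 have [measurable]: "phi \<in> borel_measurable borel" by (rule test_function_measurable[OF phi])
 have [measurable]: "f \<in> borel_measurable borel" using f by auto
 have c: "isCont phi z" for z using test_function_cont[OF phi, of UNIV] by (simp add: continuous_on_eq_continuous_at)
 show ?thesis
  unfolding continuous_on_sequentially comp_def
 proof (intro ballI allI impI)
  fix X x assume X: "(\<forall>n. X n \<in> (UNIV::'a set)) & X \<longlonglongrightarrow> x"
  show "(%n. LINT y|lborel. f y * phi (X n - y)) \<longlonglongrightarrow> (LINT y|lborel. f y * phi (x - y))"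
  proof (rule integral_dominated_convergence[where w="%y. B * abs (f y)"])
   show "integrable lborel (%y. B * abs (f y))" using f by auto
   show "AE y in lborel. (%n. f y * phi (X n - y)) \<longlonglongrightarrow> f y * phi (x - y)"
    using X by (auto intro!: tendsto_intros isCont_tendsto_compose[OF c])
   show "AE y in lborel. norm (f y * phi (X n - y)) <= B * abs (f y)" for n
    by (intro AE_I2) (simp add: abs_mult mult.commute[of B] mult_left_mono B)
  qed auto
 qed
qed

text \<open>Difference quotients of a test function are bounded by the supremum of its derivative, so dominated convergence
  moves the derivative onto the test function.\<close>

lemma convolution_partial:
 fixes phi :: "'a::euclidean_space => real"
 assumes f: "integrable lborel f" and phi: "test_function Om phi" and e: "e \<in> Basis"
 shows "((%t. LINT y|lborel. f y * phi (z + t *\<^sub>R e - y)) has_real_derivative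
  (LINT y|lborel. f y * partial_within UNIV e phi (z - y))) (at 0)"
proof -
 have phi': "test_function Om (partial_within UNIV e phi)" by (rule test_function_partial[OF phi e])
 obtain B where B: "B > 0" "!!x. abs (partial_within UNIV e phi x) <= B" using test_function_bounded[OF phi'] by blast
 have [measurable]: "phi \<in> borel_measurable borel" "partial_within UNIV e phi \<in> borel_measurable borel"
  by (rule test_function_measurable[OF phi] test_function_measurable[OF phi'])+
 have [measurable]: "f \<in> borel_measurable borel" using f by auto
 note int = convolution_integrable[OF f phi]
 have lip: "abs (phi (z + t *\<^sub>R e) - phi z) <= B * abs t" for z t
  using field_differentiable_bound[of UNIV "%t. phi (z + t *\<^sub>R e)" "%s. partial_within UNIV e phi (z + s *\<^sub>R e)" B t 0]
   test_function_line[OF phi e] B by auto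
 show ?thesis
  unfolding DERIV_def
 proof (rule LIMSEQ_SEQ_conv[THEN iffD1], intro allI impI, elim conjE)
  fix S :: "nat => real" assume S: "\<forall>n. S n \<noteq> 0" "S \<longlonglongrightarrow> 0"
  have "(%n. LINT y|lborel. f y * ((phi (z - y + S n *\<^sub>R e) - phi (z - y)) / S n)) \<longlonglongrightarrow>
    (LINT y|lborel. f y * partial_within UNIV e phi (z - y))"
  proof (rule integral_dominated_convergence[where w="%y. B * abs (f y)"])
   show "integrable lborel (%y. B * abs (f y))" using f by auto
   show "AE y in lborel. (%n. f y * ((phi (z - y + S n *\<^sub>R e) - phi (z - y)) / S n)) \<longlonglongrightarrow> f y * partial_within UNIV e phi (z - y)"
   proof (rule AE_I2)
    fix y
    have "((%h. (phi (z - y + h *\<^sub>R e) - phi (z - y)) / h) \<longlongrightarrow> partial_within UNIV e phi (z - y)) (at 0)"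
     using test_function_line[OF phi e, of "z - y" 0] by (simp add: DERIV_def)
    then have "(%n. (phi (z - y + S n *\<^sub>R e) - phi (z - y)) / S n) \<longlonglongrightarrow> partial_within UNIV e phi (z - y)"
     using LIMSEQ_SEQ_conv[THEN iffD2] S by blast
    then show "(%n. f y * ((phi (z - y + S n *\<^sub>R e) - phi (z - y)) / S n)) \<longlonglongrightarrow> f y * partial_within UNIV e phi (z - y)"
     by (rule tendsto_mult_left)
   qed
   show "AE y in lborel. norm (f y * ((phi (z - y + S n *\<^sub>R e) - phi (z - y)) / S n)) <= B * abs (f y)" for n
   proof (rule AE_I2)
    fix y
    have "abs ((phi (z - y + S n *\<^sub>R e) - phi (z - y)) / S n) <= B"
     using lip[of "z - y" "S n"] S(1) by (simp add: abs_divide pos_divide_le_eq)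
    from mult_left_mono[OF this, of "abs (f y)"]
    show "norm (f y * ((phi (z - y + S n *\<^sub>R e) - phi (z - y)) / S n)) <= B * abs (f y)" by (simp add: abs_mult mult.commute)
   qed
  qed auto
  moreover have "(LINT y|lborel. f y * ((phi (z - y + s *\<^sub>R e) - phi (z - y)) / s)) =
   ((LINT y|lborel. f y * phi (z + (0 + s) *\<^sub>R e - y)) - (LINT y|lborel. f y * phi (z + 0 *\<^sub>R e - y))) / s" for s
  proof -
   have "f y * ((phi (z - y + s *\<^sub>R e) - phi (z - y)) / s) = (f y * phi (z + s *\<^sub>R e - y) - f y * phi (z - y)) / s" for y
   proof -
    have "z - y + s *\<^sub>R e = z + s *\<^sub>R e - y" by simp
    show ?thesis unfolding \<open>z - y + s *\<^sub>R e = z + s *\<^sub>R e - y\<close> by (simp add: right_diff_distrib)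
   qed
   then have "(LINT y|lborel. f y * ((phi (z - y + s *\<^sub>R e) - phi (z - y)) / s)) =
     (LINT y|lborel. (f y * phi (z + s *\<^sub>R e - y) - f y * phi (z - y)) / s)" by (simp only:)
   then show ?thesis using Bochner_Integration.integral_diff[OF int[of "z + s *\<^sub>R e"] int[of z]] by simp
  qed
  ultimately show "(%n. ((LINT y|lborel. f y * phi (z + (0 + S n) *\<^sub>R e - y)) - (LINT y|lborel. f y * phi (z + 0 *\<^sub>R e - y))) / S n)
    \<longlonglongrightarrow> (LINT y|lborel. f y * partial_within UNIV e phi (z - y))" by (simp only:)
 qed
qed

lemma Ck_on_convolution:
 fixes phi :: "'a::euclidean_space => real"
 assumes f: "integrable lborel f" and "test_function Om phi"
 shows "Ck_on k UNIV (%x. LINT y|lborel. f y * phi (x - y))"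
 using assms(2)
proof (induction k arbitrary: phi)
 case 0 then show ?case using convolution_cont[OF f] by simp
next
 case (Suc k)
 show ?case
  by (rule Ck_on_SucI[OF convolution_cont[OF f Suc.prems] convolution_partial[OF f Suc.prems]])
   (auto intro: Suc.IH test_function_partial[OF Suc.prems])
qed

section \<open>Continuity of translations and mollification\<close>

lemma ball_measurable[measurable]: "ball (x::'a::euclidean_space) r \<in> sets borel" "cball x r \<in> sets borel"
 by simp_all

lemma lborel_distr_reflect: "distr lborel borel (%y. x - y) = (lborel :: 'a::euclidean_space measure)"
 using lborel_affine[of "-1" x] by (simp add: density_1)

lemma nn_integral_translate:
 fixes f :: "'a::euclidean_space => ennreal"
 assumes [measurable]: "f \<in> borel_measurable borel"
 shows "(\<integral>\<^sup>+x. f (x + h) \<partial>lborel) = (\<integral>\<^sup>+x. f x \<partial>lborel)"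
proof -
 have "(\<integral>\<^sup>+x. f x \<partial>lborel) = (\<integral>\<^sup>+x. f x \<partial>distr lborel borel ((+) h))" by (simp add: lborel_distr_plus)
 also have "... = (\<integral>\<^sup>+x. f (h + x) \<partial>lborel)" by (rule nn_integral_distr) measurable
 finally show ?thesis by (simp add: add.commute)
qed

lemma integral_translate:
 fixes f :: "'a::euclidean_space => real"
 assumes [measurable]: "f \<in> borel_measurable borel"
 shows "(LINT x|lborel. f (x + h)) = (LINT x|lborel. f x)"
proof -
 have "(LINT x|lborel. f x) = (LINT x|distr lborel borel ((+) h). f x)" by (simp add: lborel_distr_plus)
 also have "... = (LINT x|lborel. f (h + x))" by (rule integral_distr) measurable
 finally show ?thesis by (simp add: add.commute)
qed

lemma integral_reflect:
 fixes f :: "'a::euclidean_space => real"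
 assumes [measurable]: "f \<in> borel_measurable borel"
 shows "(LINT y|lborel. f (x - y)) = (LINT y|lborel. f y)"
proof -
 have "(LINT x|lborel. f x) = (LINT y|distr lborel borel (%y. x - y). f y)" by (simp add: lborel_distr_reflect)
 also have "... = (LINT y|lborel. f (x - y))" by (rule integral_distr) measurable
 finally show ?thesis by simp
qed

lemma powr_add_le:
 fixes a b :: real assumes "p > 0"
 shows "abs (a + b) powr p <= 2 powr p * (abs a powr p + abs b powr p)"
proof -
 have "abs (a + b) powr p <= (2 * max \<bar>a\<bar> \<bar>b\<bar>) powr p" using assms by (intro powr_mono2) auto
 also have "... = 2 powr p * max \<bar>a\<bar> \<bar>b\<bar> powr p" by (simp add: powr_mult)
 also have "... <= 2 powr p * (abs a powr p + abs b powr p)" by (intro mult_left_mono) (auto simp: max_def)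
 finally show ?thesis .
qed

definition Lp_dist :: "real => ('a::euclidean_space => real) => ('a => real) => ennreal" where
 "Lp_dist p f g = (\<integral>\<^sup>+x. ennreal (abs (f x - g x) powr p) \<partial>lborel)"

lemma Lp_dist_triangle:
 assumes [measurable]: "f \<in> borel_measurable borel" "g \<in> borel_measurable borel" "k \<in> borel_measurable borel" and p: "p > 0"
 shows "Lp_dist p f g <= ennreal (2 powr p) * (Lp_dist p f k + Lp_dist p k g)"
proof -
 have "Lp_dist p f g <= (\<integral>\<^sup>+x. ennreal (2 powr p) * (ennreal (abs (f x - k x) powr p) + ennreal (abs (k x - g x) powr p)) \<partial>lborel)"
  unfolding Lp_dist_def
 proof (rule nn_integral_mono)
  fix x
  have "abs (f x - g x) powr p <= 2 powr p * (abs (f x - k x) powr p + abs (k x - g x) powr p)"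
   using powr_add_le[OF p, of "f x - k x" "k x - g x"] by simp
  then show "ennreal (abs (f x - g x) powr p) <= ennreal (2 powr p) * (ennreal (abs (f x - k x) powr p) + ennreal (abs (k x - g x) powr p))"
   by (simp add: ennreal_mult[symmetric] ennreal_plus[symmetric] ennreal_leI del: ennreal_plus)
 qed
 also have "... = ennreal (2 powr p) * (Lp_dist p f k + Lp_dist p k g)"
  unfolding Lp_dist_def by (simp add: nn_integral_cmult nn_integral_add)
 finally show ?thesis .
qed

lemma Lp_dist_translate:
 assumes [measurable]: "f \<in> borel_measurable borel" "g \<in> borel_measurable borel"
 shows "Lp_dist p (%x. f (x + h)) (%x. g (x + h)) = Lp_dist p f g"
 unfolding Lp_dist_def using nn_integral_translate[of "%x. ennreal (abs (f x - g x) powr p)" h] by measurable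

text \<open>Measurable functions are limits of continuous ones almost everywhere, so dominated convergence
  gives density once values and support have been truncated.\<close>

lemma Lp_approx_continuous:
 fixes f :: "'a::euclidean_space => real"
 assumes f[measurable]: "f \<in> borel_measurable borel" and p: "p > 0"
  and fin: "(\<integral>\<^sup>+x. ennreal (abs (f x) powr p) \<partial>lborel) < \<infinity>" and e: "e > (0::real)"
 obtains g R where "continuous_on UNIV g" "R > 0" "!!x. norm x > R ==> g x = 0" "Lp_dist p f g <= ennreal e"
proof -
 define c where "c = e / (2 * 2 powr p)"
 have c: "c > 0" using e by (simp add: c_def)
 define F where "F N x = (if \<bar>f x\<bar> <= real N & norm x <= real N then f x else 0)" for N x
 have [measurable]: "F N \<in> borel_measurable borel" for N unfolding F_def by measurable
 have "(%N. Lp_dist p f (F N)) \<longlonglongrightarrow> (\<integral>\<^sup>+x. 0 \<partial>(lborel :: 'a measure))"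
  unfolding Lp_dist_def
 proof (rule nn_integral_dominated_convergence[where w="%x. ennreal (abs (f x) powr p)"])
  show "AE x in lborel. ennreal (abs (f x - F N x) powr p) <= ennreal (abs (f x) powr p)" for N
   by (rule AE_I2) (auto simp: F_def)
  show "AE x in lborel. (%N. ennreal (abs (f x - F N x) powr p)) \<longlonglongrightarrow> 0"
  proof (rule AE_I2)
   fix x
   obtain N0 where N0: "real N0 \<ge> max \<bar>f x\<bar> (norm x)" using real_arch_simple by blast
   have "eventually (%N. ennreal (abs (f x - F N x) powr p) = 0) sequentially"
    using eventually_ge_at_top[of N0]
   proof eventually_elim
    case (elim N)
    then have "real N \<ge> real N0" by simp
    then have "F N x = f x" using N0 unfolding F_def by auto
    then show ?case by simp
   qed
   then show "(%N. ennreal (abs (f x - F N x) powr p)) \<longlonglongrightarrow> 0" by (rule tendsto_eventually)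
  qed
 qed (use fin in auto)
 then have "eventually (%N. Lp_dist p f (F N) < ennreal c) sequentially"
  using c by (intro order_tendstoD(2)[where y=0]) auto
 then obtain N where N: "Lp_dist p f (F N) < ennreal c" by (auto simp: eventually_sequentially)
 have "(F N) measurable_on UNIV"
  by (rule lebesgue_measurable_imp_measurable_on_real) (auto intro: measurable_completion)
 then obtain Z g where Z: "negligible Z" and g: "!!k. continuous_on UNIV (g k)"
  and lim: "!!x. x \<notin> Z ==> (%k. g k x) \<longlonglongrightarrow> F N x" unfolding measurable_on_def by auto
 define cut where "cut x = max 0 (min 1 (real N + 1 - norm x))" for x :: 'a
 define h where "h k x = max (- real N) (min (real N) (g k x)) * cut x" for k x
 have hc: "continuous_on UNIV (h k)" for k unfolding h_def cut_def by (intro continuous_intros g)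
 then have [measurable]: "h k \<in> borel_measurable borel" for k by (rule borel_measurable_continuous_onI)
 have h0: "h k x = 0" if "norm x > real N + 1" for k x using that by (simp add: h_def cut_def)
 have "(%k. Lp_dist p (F N) (h k)) \<longlonglongrightarrow> (\<integral>\<^sup>+x. 0 \<partial>(lborel :: 'a measure))"
  unfolding Lp_dist_def
 proof (rule nn_integral_dominated_convergence[where w="%x. ennreal ((2 * real N) powr p) * indicator (cball 0 (real N + 1)) x"])
  show "AE x in lborel. ennreal (abs (F N x - h k x) powr p) <= ennreal ((2 * real N) powr p) * indicator (cball 0 (real N + 1)) x" for k
  proof (rule AE_I2)
   fix x
   show "ennreal (abs (F N x - h k x) powr p) <= ennreal ((2 * real N) powr p) * indicator (cball 0 (real N + 1)) x"
   proof (cases "norm x > real N + 1")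
    case True then show ?thesis using h0 by (simp add: F_def)
   next
    case False
    have "abs (h k x) <= real N * 1" unfolding h_def abs_mult by (intro mult_mono) (auto simp: cut_def)
    moreover have "abs (F N x) <= real N" by (simp add: F_def)
    ultimately have "abs (F N x - h k x) <= 2 * real N" by linarith
    then have "abs (F N x - h k x) powr p <= (2 * real N) powr p" using p by (intro powr_mono2) auto
    then show ?thesis using False by (auto simp: indicator_def intro: ennreal_leI)
   qed
  qed
  have "emeasure lborel (cball (0::'a) (real N + 1)) < \<infinity>" by (intro emeasure_compact_finite compact_cball)
  then show "(\<integral>\<^sup>+x. ennreal ((2 * real N) powr p) * indicator (cball (0::'a) (real N + 1)) x \<partial>lborel) < \<infinity>"
   by (subst nn_integral_cmult_indicator) (auto simp: ennreal_mult_less_top)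
  have "AE x in lebesgue. x \<notin> Z" using Z by (intro AE_not_in) (simp add: negligible_iff_null_sets)
  then have "AE x in lborel. x \<notin> Z" by (simp add: AE_completion_iff)
  then show "AE x in lborel. (%k. ennreal (abs (F N x - h k x) powr p)) \<longlonglongrightarrow> 0"
  proof eventually_elim
   case (elim x)
   have "(%k. h k x) \<longlonglongrightarrow> max (- real N) (min (real N) (F N x)) * cut x"
    unfolding h_def by (intro tendsto_intros lim elim)
   also have "max (- real N) (min (real N) (F N x)) * cut x = F N x" by (auto simp: F_def cut_def)
   finally have "(%k. abs (F N x - h k x)) \<longlonglongrightarrow> \<bar>F N x - F N x\<bar>" by (intro tendsto_intros)
   then have "(%k. abs (F N x - h k x) powr p) \<longlonglongrightarrow> 0 powr p" using p by (intro tendsto_powr') auto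
   then have "(%k. ennreal (abs (F N x - h k x) powr p)) \<longlonglongrightarrow> ennreal (0 powr p)" by (rule tendsto_ennrealI)
   then show ?case by simp
  qed
 qed simp_all
 then have "eventually (%k. Lp_dist p (F N) (h k) < ennreal c) sequentially"
  using c by (intro order_tendstoD(2)[where y=0]) auto
 then obtain k where k: "Lp_dist p (F N) (h k) < ennreal c" by (auto simp: eventually_sequentially)
 have "Lp_dist p f (h k) <= ennreal (2 powr p) * (Lp_dist p f (F N) + Lp_dist p (F N) (h k))"
  by (rule Lp_dist_triangle[OF _ _ _ p]) auto
 also have "... <= ennreal (2 powr p) * (ennreal c + ennreal c)" using N k by (intro mult_left_mono add_mono) auto
 also have "... = ennreal e" using c by (simp add: ennreal_mult[symmetric] ennreal_plus[symmetric] c_def del: ennreal_plus)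
 finally show ?thesis using that[of "h k" "real N + 1"] hc h0 by auto
qed

text \<open>For a continuous function of compact support this is uniform continuity on a slightly larger ball; density gives
  the general case.\<close>

lemma Lp_translation_continuous:
 fixes f :: "'a::euclidean_space => real"
 assumes f[measurable]: "f \<in> borel_measurable borel" and p: "p > 0"
  and fin: "(\<integral>\<^sup>+x. ennreal (abs (f x) powr p) \<partial>lborel) < \<infinity>" and e: "e > (0::real)"
 obtains d where "d > 0" "!!h. norm h < d ==> Lp_dist p (%x. f (x + h)) f <= ennreal e"
proof -
 define c where "c = e / (3 * (2 powr p * 2 powr p))"
 have c: "c > 0" using e by (simp add: c_def)
 obtain g R where g: "continuous_on UNIV g" "R > 0" "!!x. norm x > R ==> g x = 0" "Lp_dist p f g <= ennreal c"
  using Lp_approx_continuous[OF f p fin c] by blast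
 have [measurable]: "g \<in> borel_measurable borel" by (rule borel_measurable_continuous_onI[OF g(1)])
 let ?B = "cball (0::'a) (R + 1)"
 define v where "v = measure lborel ?B"
 have v: "v \<ge> 0" "emeasure lborel ?B = ennreal v"
  using emeasure_compact_finite[OF compact_cball, of "0::'a" "R + 1"] by (simp_all add: v_def emeasure_eq_ennreal_measure)
 define w where "w = (c / (v + 1)) powr (1 / p)"
 have w: "w > 0" "w powr p * v <= c"
 proof -
  show "w > 0" using c v by (simp add: w_def)
  have "w powr p = c / (v + 1)" using c v p by (simp add: w_def powr_powr)
  then have "w powr p * (v + 1) = c" using v by simp
  then show "w powr p * v <= c" using powr_ge_zero[of w p] unfolding distrib_left by linarith
 qed
 have "uniformly_continuous_on (cball 0 (R + 2)) g"
  by (rule compact_uniformly_continuous[OF continuous_on_subset[OF g(1)]]) auto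
 then obtain d where d: "d > 0" "!!x y. x \<in> cball 0 (R + 2) ==> y \<in> cball 0 (R + 2) ==> dist y x < d ==> dist (g y) (g x) < w"
  using w(1) unfolding uniformly_continuous_on_def by meson
 show ?thesis
 proof (rule that[of "min d 1"])
  show "min d 1 > 0" using d by simp
  fix h :: 'a assume h: "norm h < min d 1"
  have "Lp_dist p (%x. g (x + h)) g <= (\<integral>\<^sup>+x. ennreal (w powr p) * indicator ?B x \<partial>lborel)"
   unfolding Lp_dist_def
  proof (rule nn_integral_mono)
   fix x :: 'a
   show "ennreal (abs (g (x + h) - g x) powr p) <= ennreal (w powr p) * indicator ?B x"
   proof (cases "norm x > R + 1")
    case True
    have "norm x <= norm (x + h) + norm h" using norm_triangle_ineq[of "x + h" "- h"] by simp
    then have "norm (x + h) > R" using True h by linarith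
    then show ?thesis using True g by simp
   next
    case False
    have "norm (x + h) <= R + 2" using norm_triangle_ineq[of x h] False h by linarith
    then have "x + h \<in> cball 0 (R + 2)" "x \<in> cball 0 (R + 2)" using False by (simp_all only: mem_cball_0)
    then have "abs (g (x + h) - g x) <= w" using d(2)[of x "x + h"] h by (simp add: dist_norm)
    then have "abs (g (x + h) - g x) powr p <= w powr p" using p by (intro powr_mono2) auto
    then show ?thesis using False by (auto simp: indicator_def intro: ennreal_leI)
   qed
  qed
  also have "... = ennreal (w powr p * v)" using v by (subst nn_integral_cmult_indicator) (simp_all add: ennreal_mult)
  also have "... <= ennreal c" using w by (intro ennreal_leI)
  finally have gg: "Lp_dist p (%x. g (x + h)) g <= ennreal c" .
  have gf: "Lp_dist p g f <= ennreal c" using g(4) by (simp add: Lp_dist_def abs_minus_commute)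
  have "Lp_dist p (%x. f (x + h)) f <= ennreal (2 powr p) * (Lp_dist p (%x. f (x + h)) (%x. g (x + h)) + Lp_dist p (%x. g (x + h)) f)"
   by (rule Lp_dist_triangle[OF _ _ _ p]) measurable
  also have "... <= ennreal (2 powr p) * (Lp_dist p f g + ennreal (2 powr p) * (Lp_dist p (%x. g (x + h)) g + Lp_dist p g f))"
   using Lp_dist_translate[of f g p h]
   by (intro mult_left_mono add_mono Lp_dist_triangle[OF _ _ _ p]) auto
  also have "... <= ennreal (2 powr p) * (ennreal c + ennreal (2 powr p) * (ennreal c + ennreal c))"
   using g(4) gg gf by (intro mult_left_mono add_mono) auto
  also have "... = ennreal (2 powr p * (c + 2 powr p * (c + c)))"
   using c by (simp add: ennreal_mult[symmetric] ennreal_plus[symmetric] del: ennreal_plus)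
  also have "... <= ennreal (2 powr p * (2 powr p * c + 2 powr p * (c + c)))"
  proof (intro ennreal_leI mult_left_mono add_mono)
   have "1 <= 2 powr p" using p by (simp add: ge_one_powr_ge_zero)
   then show "c <= 2 powr p * c" using c by simp
  qed auto
  also have "2 powr p * (2 powr p * c + 2 powr p * (c + c)) = e"
   by (simp add: c_def field_simps)
  finally show "Lp_dist p (%x. f (x + h)) f <= ennreal e" .
 qed
qed

definition mollifier :: "real => 'a::euclidean_space => real" where
 "mollifier d x = exp_bump 0 (d^2 - x \<bullet> x) / (LINT y|lborel. exp_bump 0 (d^2 - (y::'a) \<bullet> y))"

definition mollify :: "real => ('a::euclidean_space => real) => 'a => real" where
 "mollify d f x = (LINT y|lborel. f y * mollifier d (x - y))"

lemma exp_bump_ball_eq_0: "d > 0 ==> norm x \<ge> d ==> exp_bump 0 (d^2 - x \<bullet> x) = 0"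
 by (simp add: exp_bump_def power2_norm_eq_inner[symmetric] not_less power_mono)

lemma test_function_bump: "d > 0 ==> test_function UNIV (%x::'a::euclidean_space. exp_bump 0 (d^2 - x \<bullet> x))"
proof (rule test_functionI[of _ "cball 0 d"])
 show "x \<in> cball 0 d" if "d > 0" "exp_bump 0 (d^2 - x \<bullet> x) \<noteq> 0" for x :: 'a
  using exp_bump_ball_eq_0[of d x] that by (cases "norm x \<ge> d") auto
qed (auto simp: Ck_on_exp_bump_ball)

lemma test_function_integrable:
 fixes phi :: "'a::euclidean_space => real"
 assumes "test_function Om phi" shows "integrable lborel phi"
proof -
 obtain K where K: "compact K" "K \<subseteq> Om" "!!x. x \<notin> K ==> phi x = 0"
  using test_function_support[OF assms] by blast
 have "integrable lborel (%x. indicator K x *\<^sub>R phi x)" by (rule borel_integrable_compact[OF K(1) test_function_cont[OF assms]])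
 moreover have "(%x. indicator K x *\<^sub>R phi x) = phi" using K(3) by (auto simp: indicator_def fun_eq_iff)
 ultimately show ?thesis by simp
qed

lemma integral_bump_pos:
 assumes d: "d > 0" shows "(LINT y|lborel. exp_bump 0 (d^2 - (y::'a::euclidean_space) \<bullet> y)) > 0"
proof (rule ccontr)
 let ?f = "%y::'a. exp_bump 0 (d^2 - y \<bullet> y)"
 assume a: "\<not> ?thesis"
 have int: "integrable lborel ?f" by (rule test_function_integrable[OF test_function_bump[OF d]])
 have nn: "?f y \<ge> 0" for y by (simp add: exp_bump_def)
 have "(LINT y|lborel. ?f y) = 0" using a integral_nonneg_AE[of ?f lborel, OF AE_I2[OF nn]] by linarith
 then have ae: "AE y in lborel. ?f y = 0" using integral_nonneg_eq_0_iff_AE[OF int] nn by auto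
 have nz: "?f y \<noteq> 0" if "norm y < d" for y
 proof -
  have "y \<bullet> y < d^2" using that by (simp add: power2_norm_eq_inner[symmetric] power_strict_mono)
  then show ?thesis by (simp add: exp_bump_def)
 qed
 have "AE y in lborel. y \<notin> ball (0::'a) d" using ae
 proof eventually_elim
  case (elim y) then show ?case using nz[of y] by auto
 qed
 then have "ball (0::'a) d \<in> null_sets lborel" using AE_iff_null_sets[of "ball (0::'a) d" lborel] by simp
 then have "negligible (ball (0::'a) d)" unfolding negligible_iff_null_sets by (rule null_sets_completionI)
 then show False using open_not_negligible[of "ball (0::'a) d"] d by simp
qed

lemma mollifier_nonneg: "d > 0 ==> mollifier d x \<ge> 0"
 using integral_bump_pos[of d, where 'a='a] by (simp add: mollifier_def exp_bump_def)

lemma mollifier_eq_0: "d > 0 ==> norm x \<ge> d ==> mollifier d x = 0"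
 by (simp add: mollifier_def exp_bump_ball_eq_0)

lemma mollifier_test:
 assumes d: "d > 0" shows "test_function UNIV (mollifier d :: 'a::euclidean_space => real)"
proof (rule test_functionI[of _ "cball 0 d"])
 show "Ck_on k UNIV (mollifier d :: 'a => real)" for k
  using Ck_on_cmult[OF Ck_on_exp_bump_ball[where 'a='a], of k "1 / (LINT y|lborel. exp_bump 0 (d^2 - (y::'a) \<bullet> y))" 0 "d^2"]
  by (simp add: mollifier_def[abs_def])
 show "x \<in> cball 0 d" if "mollifier d x \<noteq> 0" for x :: 'a
  using mollifier_eq_0[OF d, of x] that by (cases "norm x \<ge> d") auto
qed auto

lemma mollifier_integral: "d > 0 ==> (LINT y|lborel. mollifier d (y::'a::euclidean_space)) = 1"
 using integral_bump_pos[of d, where 'a='a] by (simp add: mollifier_def)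

lemma mollifier_measurable[measurable]: "d > 0 ==> mollifier d \<in> borel_measurable borel"
 by (rule test_function_measurable[OF mollifier_test])

lemma mollify_alt:
 fixes f :: "'a::euclidean_space => real"
 assumes d: "d > 0" and [measurable]: "f \<in> borel_measurable borel"
 shows "mollify d f x = (LINT y|lborel. f (x - y) * mollifier d y)"
proof -
 have [measurable]: "mollifier d \<in> borel_measurable (borel :: 'a measure)" by (rule mollifier_measurable[OF d])
 show ?thesis using integral_reflect[of "%y. f y * mollifier d (x - y)" x] by (simp add: mollify_def)
qed

lemma Ck_on_mollify: "d > 0 ==> integrable lborel f ==> Ck_on k UNIV (mollify d f)"
 unfolding mollify_def[abs_def] by (rule Ck_on_convolution[OF _ mollifier_test])

lemma mollify_eq_0: "d > 0 ==> (!!y. norm (x - y) < d ==> f y = 0) ==> mollify d f x = 0"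
proof -
 assume d: "d > 0" and f: "!!y. norm (x - y) < d ==> f y = 0"
 have "f y * mollifier d (x - y) = 0" for y using f[of y] mollifier_eq_0[OF d, of "x - y"] by (cases "norm (x - y) < d") auto
 then have "(%y. f y * mollifier d (x - y)) = (%y. 0)" by blast
 then show ?thesis by (simp add: mollify_def)
qed

text \<open>The tangent to \<open>t powr p\<close> at the mean value, integrated against the weight.\<close>

lemma jensen_powr:
 fixes g \<rho> :: "'a => real"
 assumes p: "p \<ge> 1" and \<rho>: "!!x. \<rho> x \<ge> 0" "integrable M \<rho>" "(\<integral>x. \<rho> x \<partial>M) = 1"
  and g: "integrable M (%x. g x * \<rho> x)" and [measurable]: "g \<in> borel_measurable M"
 shows "ennreal (abs (\<integral>x. g x * \<rho> x \<partial>M) powr p) <= (\<integral>\<^sup>+x. ennreal (abs (g x) powr p * \<rho> x) \<partial>M)"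
proof (cases "(\<integral>\<^sup>+x. ennreal (abs (g x) powr p * \<rho> x) \<partial>M) = \<infinity> \<or> (\<integral>x. g x * \<rho> x \<partial>M) = 0")
 case True then show ?thesis using p by auto
next
 case False
 have [measurable]: "\<rho> \<in> borel_measurable M" using \<rho> by auto
 have int: "integrable M (%x. abs (g x) powr p * \<rho> x)"
  using False \<rho>(1) by (intro integrableI_bounded) (auto simp: abs_mult less_top)
 define m where "m = abs (\<integral>x. g x * \<rho> x \<partial>M)"
 have m: "m > 0" using False by (simp add: m_def)
 have ga: "integrable M (%x. abs (g x) * \<rho> x)" using integrable_norm[OF g] \<rho>(1) by (simp add: abs_mult)
 have mle: "m <= (\<integral>x. abs (g x) * \<rho> x \<partial>M)"
  unfolding m_def using integral_norm_bound[of M "%x. g x * \<rho> x"] \<rho>(1) by (simp add: abs_mult)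
 have young: "p * m powr (p - 1) * t <= t powr p + (p - 1) * m powr p" if t: "t \<ge> 0" for t
 proof (cases "t = 0")
  case True then show ?thesis using p by simp
 next
  case False
  have "(t powr p) powr (1/p) * (m powr p) powr (1 - 1/p) <= 1/p * t powr p + (1 - 1/p) * m powr p"
   using p t False m by (intro Youngs_inequality_0) auto
  moreover have "(t powr p) powr (1/p) = t" using p t by (simp add: powr_powr)
  moreover have "(m powr p) powr (1 - 1/p) = m powr (p - 1)" using p by (simp add: powr_powr right_diff_distrib)
  ultimately have "t * m powr (p - 1) <= 1/p * t powr p + (1 - 1/p) * m powr p" by simp
  then have "p * (t * m powr (p - 1)) <= p * (1/p * t powr p + (1 - 1/p) * m powr p)" using p by (intro mult_left_mono) auto
  also have "... = t powr p + (p - 1) * m powr p" using p by (simp add: field_simps)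
  finally show ?thesis by (simp add: mult_ac)
 qed
 have "p * m powr (p - 1) * m <= p * m powr (p - 1) * (\<integral>x. abs (g x) * \<rho> x \<partial>M)"
  using mle p by (intro mult_left_mono) auto
 also have "... = (\<integral>x. p * m powr (p - 1) * (abs (g x) * \<rho> x) \<partial>M)" by simp
 also have "... <= (\<integral>x. abs (g x) powr p * \<rho> x + (p - 1) * m powr p * \<rho> x \<partial>M)"
 proof (rule integral_mono_AE)
  have "p * m powr (p - 1) * (abs (g x) * \<rho> x) <= abs (g x) powr p * \<rho> x + (p - 1) * m powr p * \<rho> x" for x
   using mult_right_mono[OF young[of "abs (g x)"] \<rho>(1)[of x]] by (simp add: algebra_simps)
  then show "AE x in M. p * m powr (p - 1) * (abs (g x) * \<rho> x) <= abs (g x) powr p * \<rho> x + (p - 1) * m powr p * \<rho> x" by simp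
 qed (use ga int \<rho> in auto)
 also have "... = (\<integral>x. abs (g x) powr p * \<rho> x \<partial>M) + (p - 1) * m powr p" using int \<rho> by simp
 finally have "p * m powr p <= (\<integral>x. abs (g x) powr p * \<rho> x \<partial>M) + (p - 1) * m powr p"
  using m powr_add[of m "p - 1" 1] by simp
 then have "m powr p <= (\<integral>x. abs (g x) powr p * \<rho> x \<partial>M)" by (simp add: algebra_simps)
 then show ?thesis using nn_integral_eq_integral[OF int] \<rho>(1) by (simp add: m_def ennreal_leI)
qed

text \<open>By Jensen's inequality the error of a mollification is an average of the errors of small translations.\<close>

lemma Lp_dist_mollify:
 fixes f :: "'a::euclidean_space => real"
 assumes d: "d > 0" and p: "p \<ge> 1" and f: "integrable lborel f"
  and c: "!!h. norm h < d ==> Lp_dist p (%x. f (x + h)) f <= c"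
 shows "Lp_dist p (mollify d f) f <= c"
proof -
 have fm[measurable]: "f \<in> borel_measurable borel" using f by auto
 have [measurable]: "mollifier d \<in> borel_measurable (borel :: 'a measure)" by (rule mollifier_measurable[OF d])
 note nn = mollifier_nonneg[OF d, where 'a='a]
 have int1: "integrable lborel (mollifier d :: 'a => real)" by (rule test_function_integrable[OF mollifier_test[OF d]])
 have int2: "integrable lborel (%y. f (x - y) * mollifier d y)" for x
 proof -
  have "integrable (distr lborel borel (%y. x - y)) (%y. f y * mollifier d (x - y))"
   unfolding lborel_distr_reflect by (rule convolution_integrable[OF f mollifier_test[OF d]])
  then show ?thesis by (subst (asm) integrable_distr_eq) auto
 qed
 have "Lp_dist p (mollify d f) f <= (\<integral>\<^sup>+x. (\<integral>\<^sup>+y. ennreal (abs (f (x - y) - f x) powr p * mollifier d y) \<partial>lborel) \<partial>lborel)"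
  unfolding Lp_dist_def
 proof (rule nn_integral_mono)
  fix x
  have "mollify d f x - f x = (LINT y|lborel. (f (x - y) - f x) * mollifier d y)"
   using int1 int2[of x] mollifier_integral[OF d, where 'a='a] by (simp add: mollify_alt[OF d fm] left_diff_distrib)
  then show "ennreal (abs (mollify d f x - f x) powr p) <= (\<integral>\<^sup>+y. ennreal (abs (f (x - y) - f x) powr p * mollifier d y) \<partial>lborel)"
   using jensen_powr[OF p nn int1 mollifier_integral[OF d], of "%y. f (x - y) - f x"] int1 int2[of x]
   by (simp add: left_diff_distrib)
 qed
 also have "... = (\<integral>\<^sup>+y. (\<integral>\<^sup>+x. ennreal (abs (f (x - y) - f x) powr p * mollifier d y) \<partial>lborel) \<partial>lborel)"
  by (rule lborel_pair.Fubini') measurable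
 also have "... <= (\<integral>\<^sup>+y. ennreal (mollifier d y) * c \<partial>(lborel :: 'a measure))"
 proof (rule nn_integral_mono)
  fix y :: 'a
  have "(\<integral>\<^sup>+x. ennreal (abs (f (x - y) - f x) powr p * mollifier d y) \<partial>lborel) =
    (\<integral>\<^sup>+x. ennreal (mollifier d y) * ennreal (abs (f (x + (- y)) - f x) powr p) \<partial>lborel)"
   using nn by (intro nn_integral_cong) (simp add: ennreal_mult mult.commute)
  also have "... = ennreal (mollifier d y) * Lp_dist p (%x. f (x + (- y))) f"
   unfolding Lp_dist_def by (rule nn_integral_cmult) measurable
  also have "... <= ennreal (mollifier d y) * c"
   using c[of "- y"] mollifier_eq_0[OF d, of y] by (cases "norm y < d") (auto intro!: mult_left_mono)
  finally show "(\<integral>\<^sup>+x. ennreal (abs (f (x - y) - f x) powr p * mollifier d y) \<partial>lborel) <= ennreal (mollifier d y) * c" .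
 qed
 also have "... = (\<integral>\<^sup>+y. ennreal (mollifier d y) \<partial>(lborel :: 'a measure)) * c" by (rule nn_integral_multc) measurable
 also have "(\<integral>\<^sup>+y. ennreal (mollifier d y) \<partial>(lborel :: 'a measure)) = 1"
  using nn_integral_eq_integral[OF int1] nn mollifier_integral[OF d, where 'a='a] by simp
 finally show ?thesis by simp
qed

lemma mollify_Lp_converges:
 fixes f :: "'a::euclidean_space => real"
 assumes f: "integrable lborel f" and p: "p \<ge> 1"
  and fin: "(\<integral>\<^sup>+x. ennreal (abs (f x) powr p) \<partial>lborel) < \<infinity>" and e: "e > (0::real)"
 obtains d0 where "d0 > 0" "!!d. 0 < d ==> d < d0 ==> Lp_dist p (mollify d f) f <= ennreal e"
proof -
 have "f \<in> borel_measurable borel" "p > 0" using f p by auto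
 from Lp_translation_continuous[OF this fin e] obtain d0 where
  "d0 > 0" "!!h. norm h < d0 ==> Lp_dist p (%x. f (x + h)) f <= ennreal e" by blast
 then show ?thesis using Lp_dist_mollify[OF _ p f] by (intro that[of d0]) auto
qed

text \<open>Mollifying the Lipschitz function that is \<open>1\<close> up to distance \<open>r\<close> and \<open>0\<close> beyond distance \<open>2 r\<close>: convolution with
  a probability density does not increase the Lipschitz constant.\<close>

lemma smooth_cutoff:
 fixes K :: "'a::euclidean_space set"
 assumes K: "compact K" "K \<noteq> {}" and r: "r > 0" and U: "{x. infdist x K <= 3 * r} \<subseteq> U"
 obtains eta where "test_function U eta" "!!x. 0 <= eta x" "!!x. eta x <= 1"
  "!!x. infdist x K <= r / 2 ==> eta x = 1"
  "!!e x. e \<in> Basis ==> abs (partial_within UNIV e eta x) <= 1 / r"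
  "!!x y. abs (eta x - eta y) <= norm (x - y) / r"
proof -
 define L where "L x = max 0 (min 1 (2 - infdist x K / r))" for x
 \<comment> \<open>The mollification radius \<open>r / 2\<close> leaves \<open>L = 1\<close> intact up to distance \<open>r / 2\<close>.\<close>
 define d where "d = r / 2"
 have d: "d > 0" using r by (simp add: d_def)
 have Lc: "continuous_on UNIV L" unfolding L_def using r by (intro continuous_intros) auto
 have [measurable]: "L \<in> borel_measurable borel" by (rule borel_measurable_continuous_onI[OF Lc])
 have L01: "0 <= L x" "L x <= 1" for x by (auto simp: L_def)
 have cmp: "compact {x. infdist x K <= 2 * r}" "compact {x. infdist x K <= 3 * r}" using K r by (auto intro!: compact_infdist_le)
 have L0: "L x = 0" if "infdist x K > 2 * r" for x using that r by (simp add: L_def field_simps)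
 have L1: "L x = 1" if "infdist x K <= r" for x using that r by (simp add: L_def field_simps)
 have Llip: "abs (L x - L y) <= norm (x - y) / r" for x y
 proof -
  have "abs (L x - L y) <= abs (infdist x K / r - infdist y K / r)" by (auto simp: L_def)
  also have "... = abs (infdist x K - infdist y K) / r" using r by (simp add: diff_divide_distrib[symmetric])
  also have "... <= dist x y / r" using infdist_triangle_abs[of x K y] r by (intro divide_right_mono) auto
  finally show ?thesis by (simp add: dist_norm)
 qed
 have Lint: "integrable lborel L"
 proof -
  have "integrable lborel (%x. indicator {x. infdist x K <= 2 * r} x *\<^sub>R L x)"
   by (rule borel_integrable_compact[OF cmp(1) continuous_on_subset[OF Lc]]) auto
  moreover have "(%x. indicator {x. infdist x K <= 2 * r} x *\<^sub>R L x) = L" using L0 by (auto simp: indicator_def fun_eq_iff)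
  ultimately show ?thesis by simp
 qed
 have [measurable]: "mollifier d \<in> borel_measurable (borel :: 'a measure)" by (rule mollifier_measurable[OF d])
 note nn = mollifier_nonneg[OF d, where 'a='a]
 have int1: "integrable lborel (mollifier d :: 'a => real)" by (rule test_function_integrable[OF mollifier_test[OF d]])
 have int2: "integrable lborel (%y. L (x - y) * mollifier d y)" for x
  by (rule Bochner_Integration.integrable_bound[OF int1]) (use L01 nn in \<open>auto simp: abs_mult intro!: AE_I2 mult_left_le_one_le\<close>)
 define eta where "eta = mollify d L"
 have alt: "eta x = (LINT y|lborel. L (x - y) * mollifier d y)" for x unfolding eta_def by (rule mollify_alt[OF d]) measurable
 have Ck: "Ck_on k UNIV eta" for k unfolding eta_def by (rule Ck_on_mollify[OF d Lint])
 have lip: "abs (eta x - eta y) <= norm (x - y) / r" for x y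
 proof -
  have "eta x - eta y = (LINT z|lborel. (L (x - z) - L (y - z)) * mollifier d z)"
   unfolding alt using int2 by (simp add: left_diff_distrib)
  also have "abs (...) <= (LINT z|lborel. abs ((L (x - z) - L (y - z)) * mollifier d z))"
   using integral_norm_bound[of lborel "%z. (L (x - z) - L (y - z)) * mollifier d z"] by simp
  also have "... <= (LINT z|lborel. norm (x - y) / r * mollifier d (z::'a))"
  proof (rule integral_mono_AE)
   have "abs ((L (x - z) - L (y - z)) * mollifier d z) <= norm (x - y) / r * mollifier d z" for z
    using mult_right_mono[OF Llip[of "x - z" "y - z"] nn[of z]] nn[of z] by (simp add: abs_mult)
   then show "AE z in lborel. abs ((L (x - z) - L (y - z)) * mollifier d z) <= norm (x - y) / r * mollifier d z" by simp
  qed (use int2 int1 in \<open>auto simp: left_diff_distrib\<close>)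
  also have "... = norm (x - y) / r" using mollifier_integral[OF d, where 'a='a] by simp
  finally show ?thesis .
 qed
 show ?thesis
 proof (rule that[of eta])
  show "abs (eta x - eta y) <= norm (x - y) / r" for x y by (rule lip)
  show "test_function U eta"
  proof (rule test_functionI[OF Ck cmp(2) U])
   fix x assume a: "eta x \<noteq> 0"
   show "x \<in> {x. infdist x K <= 3 * r}"
   proof (rule ccontr)
    assume "x \<notin> {x. infdist x K <= 3 * r}"
    then have x: "infdist x K > 3 * r" by simp
    have "eta x = 0" unfolding eta_def
    proof (rule mollify_eq_0[OF d])
     fix y assume "norm (x - y) < d"
     then have "infdist y K > 2 * r" using infdist_triangle_abs[of x K y] x r by (simp add: dist_norm d_def)
     then show "L y = 0" by (rule L0)
    qed
    with a show False by simp
   qed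
  qed
  show "0 <= eta x" for x unfolding alt using L01 nn by (intro integral_nonneg_AE AE_I2) auto
  show "eta x <= 1" for x
  proof -
   have "eta x <= (LINT y|lborel. mollifier d (y::'a))"
    unfolding alt using int1 int2 L01 nn by (intro integral_mono_AE AE_I2) (auto intro: mult_left_le_one_le)
   then show ?thesis using mollifier_integral[OF d, where 'a='a] by simp
  qed
  show "eta x = 1" if "infdist x K <= r / 2" for x
  proof -
   have "L (x - y) * mollifier d y = mollifier d y" for y
   proof (cases "norm y < d")
    case True
    then have "infdist (x - y) K <= r" using infdist_triangle_abs[of "x - y" K x] that by (simp add: dist_norm d_def)
    then show ?thesis by (simp add: L1)
   next
    case False then show ?thesis using mollifier_eq_0[OF d, of y] by simp
   qed
   then show ?thesis unfolding alt using mollifier_integral[OF d, where 'a='a] by (simp only:)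
  qed
  show "abs (partial_within UNIV e eta x) <= 1 / r" if e: "e \<in> Basis" for e x
  proof -
   have "((%h. (eta (x + h *\<^sub>R e) - eta x) / h) \<longlongrightarrow> partial_within UNIV e eta x) (at 0)"
    using Ck_on_partial[OF Ck[of "Suc 0"] e, of x] by (simp add: DERIV_def)
   then have "((%h. abs ((eta (x + h *\<^sub>R e) - eta x) / h)) \<longlongrightarrow> \<bar>partial_within UNIV e eta x\<bar>) (at 0)" by (rule tendsto_rabs)
   moreover have "eventually (%h. abs ((eta (x + h *\<^sub>R e) - eta x) / h) <= 1 / r) (at 0)"
   proof (rule eventually_at_topological[THEN iffD2], intro exI[of _ UNIV] conjI ballI impI)
    fix h :: real assume h: "h \<noteq> 0"
    have "abs (eta (x + h *\<^sub>R e) - eta x) <= abs h / r" using lip[of "x + h *\<^sub>R e" x] e by simp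
    then have "abs (eta (x + h *\<^sub>R e) - eta x) / \<bar>h\<bar> <= (abs h / r) / \<bar>h\<bar>" by (rule divide_right_mono) simp
    then show "abs ((eta (x + h *\<^sub>R e) - eta x) / h) <= 1 / r" using h by (simp add: abs_divide)
   qed auto
   ultimately show ?thesis by (rule tendsto_upperbound) simp
  qed
 qed
qed

section \<open>Weak derivatives\<close>

lemma lebesgue_on_vanish:
 fixes f :: "'a::euclidean_space => real"
 assumes "S \<in> sets lebesgue" "!!x. x \<notin> S ==> f x = 0"
 shows "integral\<^sup>L (lebesgue_on S) f = integral\<^sup>L lebesgue f"
  and "integrable (lebesgue_on S) f \<longleftrightarrow> integrable lebesgue f"
proof -
 have "(%x. indicator S x *\<^sub>R f x) = f" using assms(2) by (auto simp: indicator_def fun_eq_iff)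
 then show "integral\<^sup>L (lebesgue_on S) f = integral\<^sup>L lebesgue f"
  "integrable (lebesgue_on S) f \<longleftrightarrow> integrable lebesgue f"
  using assms(1) by (simp_all add: integral_restrict_space integrable_restrict_space)
qed

lemma integrable_lebesgue_on_subset:
 fixes f :: "'a::euclidean_space => real"
 assumes "integrable (lebesgue_on T) f" "S \<in> sets lebesgue" "T \<in> sets lebesgue" "S \<subseteq> T"
 shows "integrable (lebesgue_on S) f"
proof -
 have "integrable lebesgue (%x. indicator T x *\<^sub>R f x)" using assms by (simp add: integrable_restrict_space)
 then have "integrable lebesgue (%x. indicator S x *\<^sub>R (indicator T x *\<^sub>R f x))" using assms(2) by (rule integrable_mult_indicator[rotated])
 moreover have "(%x. indicator S x *\<^sub>R (indicator T x *\<^sub>R f x)) = (%x. indicator S x *\<^sub>R f x)"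
  using assms(4) by (auto simp: indicator_def fun_eq_iff)
 ultimately have "integrable lebesgue (%x. indicator S x *\<^sub>R f x)" by (simp only:)
 then show ?thesis using assms(2) by (simp add: integrable_restrict_space)
qed

lemma integrable_bounded_finite:
 fixes f :: "'a => real"
 assumes "integrable M f" "g \<in> borel_measurable M" "!!x. abs (g x) <= B"
 shows "integrable M (%x. f x * g x)"
proof (rule Bochner_Integration.integrable_bound)
 show "integrable M (%x. f x * B)" using assms by simp
 show "AE x in M. norm (f x * g x) <= norm (f x * B)"
 proof (rule AE_I2)
  fix x
  have "abs (g x) <= abs B" using assms(3)[of x] by linarith
  then show "norm (f x * g x) <= norm (f x * B)" by (simp add: abs_mult mult_left_mono)
 qed
qed (use assms in auto)

lemma loc_integrable_test_function:
 fixes Om :: "'a::euclidean_space set"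
 assumes v: "loc_integrable Om v" and phi: "test_function Om phi" and O: "Om \<in> sets lebesgue"
 shows "integrable (lebesgue_on Om) (%x. v x * phi x)" "integrable lebesgue (%x. v x * phi x)"
  "(LINT x|lebesgue_on Om. v x * phi x) = (LINT x|lebesgue. v x * phi x)"
proof -
 obtain K where K: "compact K" "K \<subseteq> Om" "!!x. x \<notin> K ==> phi x = 0" using test_function_support[OF phi] by blast
 obtain B where B: "B > 0" "!!x. abs (phi x) <= B" using test_function_bounded[OF phi] by blast
 have Ks: "K \<in> sets lebesgue" using K(1) by (simp add: borel_compact)
 have "phi \<in> borel_measurable (lebesgue_on K)"
  by (intro continuous_imp_measurable_on_sets_lebesgue test_function_cont[OF phi] Ks)
 then have "integrable (lebesgue_on K) (%x. v x * phi x)"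
  using v K B unfolding loc_integrable_def by (intro integrable_bounded_finite[where B=B]) auto
 then show i: "integrable lebesgue (%x. v x * phi x)"
  using lebesgue_on_vanish(2)[OF Ks, of "%x. v x * phi x"] K(3) by simp
 have z: "x \<notin> Om ==> v x * phi x = 0" for x using K by auto
 show "integrable (lebesgue_on Om) (%x. v x * phi x)" using lebesgue_on_vanish(2)[OF O z] i by simp
 show "(LINT x|lebesgue_on Om. v x * phi x) = (LINT x|lebesgue. v x * phi x)" by (rule lebesgue_on_vanish(1)[OF O z])
qed

lemma loc_integrable_mono: "loc_integrable Om v ==> D \<subseteq> Om ==> loc_integrable D v"
 by (auto simp: loc_integrable_def)

lemma has_weak_partial_alt:
 fixes Om :: "(real^'n) set"
 assumes O: "Om \<in> sets lebesgue"
 shows "has_weak_partial Om i v w \<longleftrightarrow> loc_integrable Om v & loc_integrable Om w \<and>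
  (\<forall>phi. test_function Om phi \<longrightarrow> (LINT x|lebesgue. v x * partial_within UNIV (axis i 1) phi x) = - (LINT x|lebesgue. w x * phi x))"
proof -
 have e: "axis i 1 \<in> (Basis :: (real^'n) set)" by (simp add: axis_in_Basis_iff)
 show ?thesis
 proof (cases "loc_integrable Om v & loc_integrable Om w")
  case True
  then have v: "loc_integrable Om v" and w: "loc_integrable Om w" by auto
  show ?thesis
   using True by (simp add: has_weak_partial_def loc_integrable_test_function(3)[OF w _ O]
     loc_integrable_test_function(3)[OF v test_function_partial[OF _ e] O])
 qed (auto simp: has_weak_partial_def)
qed

lemma has_weak_partial_mono:
 fixes Om :: "(real^'n) set"
 assumes "has_weak_partial Om i v w" "D \<subseteq> Om" "Om \<in> sets lebesgue" "D \<in> sets lebesgue"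
 shows "has_weak_partial D i v w"
 using assms(1) loc_integrable_mono[OF _ assms(2)] test_function_mono[OF _ assms(2)]
 by (simp add: has_weak_partial_alt[OF assms(3)] has_weak_partial_alt[OF assms(4)])

lemma has_weak_partial_lincomb:
 fixes Om :: "(real^'n) set"
 assumes O: "Om \<in> sets lebesgue" and 1: "has_weak_partial Om i v w" and 2: "has_weak_partial Om i v' w'"
 shows "has_weak_partial Om i (%x. a * v x + b * v' x) (%x. a * w x + b * w' x)"
proof -
 have e: "axis i 1 \<in> (Basis :: (real^'n) set)" by (simp add: axis_in_Basis_iff)
 note L = loc_integrable_test_function(2)[OF _ _ O]
 have l: "loc_integrable Om v" "loc_integrable Om w" "loc_integrable Om v'" "loc_integrable Om w'"
  using 1 2 by (auto simp: has_weak_partial_def)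
 have "(LINT x|lebesgue. (a * v x + b * v' x) * partial_within UNIV (axis i 1) phi x) = - (LINT x|lebesgue. (a * w x + b * w' x) * phi x)"
  if phi: "test_function Om phi" for phi
 proof -
  note phi' = test_function_partial[OF phi e]
  have "(LINT x|lebesgue. v x * partial_within UNIV (axis i 1) phi x) = - (LINT x|lebesgue. w x * phi x)"
   "(LINT x|lebesgue. v' x * partial_within UNIV (axis i 1) phi x) = - (LINT x|lebesgue. w' x * phi x)"
   using 1 2 phi unfolding has_weak_partial_alt[OF O] by auto
  then show ?thesis using L[OF l(1) phi'] L[OF l(2) phi] L[OF l(3) phi'] L[OF l(4) phi]
   by (simp add: distrib_right mult.assoc)
 qed
 moreover have "loc_integrable Om (%x. a * v x + b * v' x)" "loc_integrable Om (%x. a * w x + b * w' x)"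
  using l unfolding loc_integrable_def by auto
 ultimately show ?thesis unfolding has_weak_partial_alt[OF O] by blast
qed

lemma borel_representative:
 fixes v :: "'a::euclidean_space => real"
 assumes S: "S \<in> sets borel" and v: "v \<in> borel_measurable (lebesgue_on S)"
 obtains v' where "v' \<in> borel_measurable borel" "!!x. x \<notin> S ==> v' x = 0" "AE x in lebesgue_on S. v x = v' x"
proof -
 have Sl: "S \<in> sets lebesgue" using S by simp
 have "(%x. indicator S x *\<^sub>R v x) \<in> borel_measurable lebesgue"
  using v Sl by (simp add: borel_measurable_restrict_space_iff)
 then obtain g where g: "g \<in> borel_measurable lborel" "AE x in lborel. indicator S x *\<^sub>R v x = g x"
  using completion_ex_borel_measurable_real by blast
 have [measurable]: "g \<in> borel_measurable borel" "S \<in> sets borel" using g S by auto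
 show ?thesis
 proof (rule that[of "%x. indicator S x * g x"])
  show "(%x. indicator S x * g x) \<in> borel_measurable borel" by measurable
  have "AE x in lebesgue. indicator S x *\<^sub>R v x = g x" using g(2) by (simp add: AE_completion_iff)
  then show "AE x in lebesgue_on S. v x = indicator S x * g x"
   using Sl by (auto simp: AE_restrict_space_iff elim!: eventually_mono)
 qed auto
qed

lemma measurable_lebesgue_on_cong_AE:
 fixes f g :: "'a::euclidean_space => real"
 assumes g: "g \<in> borel_measurable (lebesgue_on S)" and S: "S \<in> sets lebesgue" and ae: "AE x in lebesgue_on S. f x = g x"
 shows "f \<in> borel_measurable (lebesgue_on S)"
proof -
 have "AE x in lebesgue. x \<in> S \<longrightarrow> f x = g x" using ae S by (simp add: AE_restrict_space_iff)
 then obtain N where N: "N \<in> null_sets lebesgue" "{x. \<not> (x \<in> S \<longrightarrow> f x = g x)} \<subseteq> N" by (auto simp: eventually_ae_filter)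
 have "g measurable_on S" using g S by (simp add: measurable_on_iff_borel_measurable)
 then have "f measurable_on S"
  by (rule measurable_on_spike[where S=N]) (use N in \<open>auto simp: negligible_iff_null_sets\<close>)
 then show ?thesis using S by (simp add: measurable_on_iff_borel_measurable)
qed

lemma integrable_lebesgue_on_cong_AE:
 fixes f g :: "'a::euclidean_space => real"
 assumes g: "integrable (lebesgue_on S) g" and S: "S \<in> sets lebesgue" and ae: "AE x in lebesgue_on S. f x = g x"
 shows "integrable (lebesgue_on S) f"
 using integrable_cong_AE[OF measurable_lebesgue_on_cong_AE[OF _ S ae] _ ae] g by auto

lemma AE_lebesgue_on_subset:
 assumes "AE x in lebesgue_on T. P x" "S \<subseteq> T" "S \<in> sets lebesgue" "T \<in> sets lebesgue"
 shows "AE x in lebesgue_on S. P x"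
 using assms by (auto simp: AE_restrict_space_iff elim!: eventually_mono)

lemma loc_integrable_cong_AE:
 fixes v v' :: "'a::euclidean_space => real"
 assumes "loc_integrable Om v" "AE x in lebesgue_on Om. v' x = v x" "Om \<in> sets lebesgue"
 shows "loc_integrable Om v'"
 unfolding loc_integrable_def
proof (intro allI impI)
 fix K assume K: "compact K & K \<subseteq> Om"
 then have Ks: "K \<in> sets lebesgue" by (simp add: borel_compact)
 show "integrable (lebesgue_on K) v'"
  by (rule integrable_lebesgue_on_cong_AE[OF _ Ks AE_lebesgue_on_subset[OF assms(2) _ Ks assms(3)]])
   (use assms(1) K in \<open>auto simp: loc_integrable_def\<close>)
qed

lemma has_weak_partial_cong_AE:
 fixes Om :: "(real^'n) set"
 assumes "has_weak_partial Om i v w" "AE x in lebesgue_on Om. v' x = v x" "AE x in lebesgue_on Om. w' x = w x"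
  and O: "Om \<in> sets lebesgue"
 shows "has_weak_partial Om i v' w'"
proof -
 have e: "axis i 1 \<in> (Basis :: (real^'n) set)" by (simp add: axis_in_Basis_iff)
 have l: "loc_integrable Om v" "loc_integrable Om w" using assms by (auto simp: has_weak_partial_def)
 have l': "loc_integrable Om v'" "loc_integrable Om w'"
  using loc_integrable_cong_AE[OF l(1) assms(2) O] loc_integrable_cong_AE[OF l(2) assms(3) O] by auto
 have c: "(LINT x|lebesgue_on Om. g' x * phi x) = (LINT x|lebesgue_on Om. g x * phi x)"
  if "test_function Om phi" "loc_integrable Om g" "loc_integrable Om g'" "AE x in lebesgue_on Om. g' x = g x" for g g' phi
  using loc_integrable_test_function(1)[OF that(2,1) O] loc_integrable_test_function(1)[OF that(3,1) O] that(4)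
  by (intro integral_cong_AE) auto
 show ?thesis unfolding has_weak_partial_def
 proof (intro conjI allI impI l')
  fix phi assume phi: "test_function Om phi"
  then show "(LINT x|lebesgue_on Om. v' x * partial_within UNIV (axis i 1) phi x) = - (LINT x|lebesgue_on Om. w' x * phi x)"
   using assms(1) c[OF test_function_partial[OF phi e] l(1) l'(1) assms(2)] c[OF phi l(2) l'(2) assms(3)]
   by (simp add: has_weak_partial_def)
 qed
qed

lemma has_weak_partial_borel:
 fixes Om :: "(real^'n) set"
 assumes O: "open Om" and [measurable]: "v \<in> borel_measurable borel" "w \<in> borel_measurable borel"
 shows "has_weak_partial Om i v w \<longleftrightarrow> loc_integrable Om v & loc_integrable Om w \<and>
  (\<forall>phi. test_function Om phi \<longrightarrow> (LINT x|lborel. v x * partial_within UNIV (axis i 1) phi x) = - (LINT x|lborel. w x * phi x))"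
proof -
 have e: "axis i 1 \<in> (Basis :: (real^'n) set)" by (simp add: axis_in_Basis_iff)
 have O': "Om \<in> sets lebesgue" using O by auto
 have c: "(LINT x|lebesgue. g x * phi x) = (LINT x|lborel. g x * phi x)"
  if "test_function Om phi" "g \<in> borel_measurable borel" for g phi
 proof -
  have [measurable]: "phi \<in> borel_measurable borel" "g \<in> borel_measurable borel" using that test_function_measurable by auto
  show ?thesis by (rule integral_completion) measurable
 qed
 show ?thesis
  by (simp add: has_weak_partial_alt[OF O'] c[OF test_function_partial[OF _ e] assms(2)] c[OF _ assms(3)])
qed

lemma test_function_reflected_mollifier:
 assumes "d > 0" "cball x d \<subseteq> Om"
 shows "test_function Om (%y::'a::euclidean_space. mollifier d (x - y))"
proof (rule test_functionI[OF _ compact_cball assms(2)])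
 show "Ck_on k UNIV (%y. mollifier d (x - y))" for k
  using Ck_on_affine[OF test_function_Ck[OF mollifier_test[OF assms(1)]], of k x "-1"] by simp
 show "y \<in> cball x d" if "mollifier d (x - y) \<noteq> 0" for y
  using mollifier_eq_0[OF assms(1), of "x - y"] that by (cases "norm (x - y) \<ge> d") (auto simp: dist_norm)
qed

lemma compact_exhaustion:
 fixes S :: "'a::euclidean_space set"
 assumes "open S"
 shows "\<exists>C::nat => 'a set. (\<forall>n. compact (C n)) & (\<forall>n. C n \<subseteq> S) & (\<forall>n. C n \<subseteq> interior (C (Suc n))) & \<Union> (range C) = S \<and>
  (\<forall>K. compact K & K \<subseteq> S \<longrightarrow> (\<exists>N. \<forall>n\<ge>N. K \<subseteq> C n))"
 apply (rule open_Union_compact_subsets[OF assms])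
 subgoal for C by (rule exI[of _ C]) simp
 done

text \<open>Testing with reflected mollifiers shows that all small mollifications vanish on a compact set, and they converge
  in the mean.\<close>

lemma fundamental_lemma:
 fixes Om :: "'a::euclidean_space set"
 assumes O: "open Om" and w: "loc_integrable Om w"
  and 0: "!!phi. test_function Om phi ==> (LINT x|lebesgue_on Om. w x * phi x) = 0"
 shows "AE x in lebesgue_on Om. w x = 0"
proof -
 have O': "Om \<in> sets lebesgue" using O by auto
 obtain C where C: "!!n. compact (C n)" "!!n. C n \<subseteq> Om" "!!n. C n \<subseteq> interior (C (Suc n))" "\<Union> (range C) = Om"
  using compact_exhaustion[OF O] by auto
 have "AE x in lebesgue. x \<in> C n \<longrightarrow> w x = 0" for n
 proof -
  define K where "K = C (Suc n)"
  have K: "compact K" "K \<subseteq> Om" "C n \<subseteq> interior K" using C by (auto simp: K_def)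
  have Ks: "K \<in> sets borel" "C n \<in> sets borel" using K C by (auto simp: borel_compact)
  have Kl: "K \<in> sets lebesgue" using Ks by simp
  have wi: "integrable (lebesgue_on K) w" using w K by (auto simp: loc_integrable_def)
  then have wi': "integrable lebesgue (%x. indicator K x *\<^sub>R w x)" using Kl by (simp add: integrable_restrict_space)
  obtain g where g: "g \<in> borel_measurable borel" "!!x. x \<notin> K ==> g x = 0" "AE x in lebesgue_on K. w x = g x"
   using borel_representative[OF Ks(1), of w] wi by blast
  have [measurable]: "g \<in> borel_measurable borel" "C n \<in> sets borel" by (use g Ks in auto)
  have ae: "AE x in lebesgue. indicator K x *\<^sub>R w x = g x"
   using g(2,3) Kl by (auto simp: AE_restrict_space_iff indicator_def elim!: eventually_mono)
  have "integrable lebesgue g"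
   by (rule integrable_cong_AE[THEN iffD1, OF _ _ ae wi']) (use wi' in \<open>auto intro: measurable_completion\<close>)
  then have gi: "integrable lborel g" by (simp add: integrable_completion)
  have gfin: "(\<integral>\<^sup>+x. ennreal (abs (g x) powr 1) \<partial>lborel) < \<infinity>"
   using gi unfolding integrable_iff_bounded by simp
  obtain eps where eps: "eps > 0" "(\<Union>x\<in>C n. ball x eps) \<subseteq> interior K"
   using compact_subset_open_imp_ball_epsilon_subset[OF C(1) open_interior K(3)] by blast
  have bound: "(\<integral>\<^sup>+x. ennreal \<bar>g x\<bar> * indicator (C n) x \<partial>lborel) <= 0 + ennreal e" if e: "e > 0" for e :: real
  proof -
   obtain d0 where d0: "d0 > 0" "!!d. 0 < d ==> d < d0 ==> Lp_dist 1 (mollify d g) g <= ennreal e"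
    using mollify_Lp_converges[OF gi order_refl gfin e] by blast
   \<comment> \<open>The mollifiers centred in \<open>C n\<close> are supported in \<open>interior K\<close>.\<close>
   define d where "d = min d0 eps / 2"
   have d: "d > 0" "d < d0" "d < eps" using d0 eps by (auto simp: d_def)
   have z: "mollify d g x = 0" if x: "x \<in> C n" for x
   proof -
    have cb: "cball x d \<subseteq> K" using eps(2) x d interior_subset[of K] by (force simp: subset_eq)
    have mz: "mollifier d (x - y) = 0" if "y \<notin> K" for y
     using mollifier_eq_0[OF d(1), of "x - y"] cb that by (force simp: subset_eq dist_norm)
    have tf: "test_function Om (%y. mollifier d (x - y))" using cb K by (intro test_function_reflected_mollifier d) auto
    have [measurable]: "mollifier d \<in> borel_measurable (borel::'a measure)" using mollifier_measurable[OF d(1)] .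
    have "mollify d g x = (LINT y|lebesgue. g y * mollifier d (x - y))"
     unfolding mollify_def by (rule integral_completion[symmetric]) measurable
    also have "... = (LINT y|lebesgue. w y * mollifier d (x - y))"
    proof (rule integral_cong_AE)
     show "(%y. g y * mollifier d (x - y)) \<in> borel_measurable lebesgue" by (intro measurable_completion) measurable
     show "(%y. w y * mollifier d (x - y)) \<in> borel_measurable lebesgue"
      using loc_integrable_test_function(2)[OF w tf O'] by auto
     show "AE y in lebesgue. g y * mollifier d (x - y) = w y * mollifier d (x - y)"
      using ae
     proof eventually_elim
      case (elim y) then show ?case using mz[of y] by (cases "y \<in> K") auto
     qed
    qed
    also have "... = 0" using 0[OF tf] loc_integrable_test_function(3)[OF w tf O'] by simp
    finally show ?thesis .
   qed
   have "(\<integral>\<^sup>+x. ennreal \<bar>g x\<bar> * indicator (C n) x \<partial>lborel) <= Lp_dist 1 (mollify d g) g"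
    unfolding Lp_dist_def by (rule nn_integral_mono) (auto simp: indicator_def z)
   then show ?thesis using d0(2)[OF d(1,2)] by simp
  qed
  then have "(\<integral>\<^sup>+x. ennreal \<bar>g x\<bar> * indicator (C n) x \<partial>lborel) <= 0" by (rule ennreal_le_epsilon) auto
  then have "AE x in lborel. ennreal \<bar>g x\<bar> * indicator (C n) x = 0" by (simp add: nn_integral_0_iff_AE)
  then have "AE x in lebesgue. ennreal \<bar>g x\<bar> * indicator (C n) x = 0" by (simp add: AE_completion_iff)
  then show ?thesis using ae
  proof eventually_elim
   case (elim x)
   have "x \<in> K" if "x \<in> C n" using that K(3) interior_subset by blast
   with elim show ?case by (auto simp: indicator_def)
  qed
 qed
 then have "AE x in lebesgue. \<forall>n. x \<in> C n \<longrightarrow> w x = 0" by (subst AE_all_countable) blast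
 then show ?thesis using O' C(4) by (auto simp: AE_restrict_space_iff elim!: eventually_mono)
qed

lemma has_weak_partial_unique:
 fixes Om :: "(real^'n) set"
 assumes O: "open Om" and 1: "has_weak_partial Om i v w" and 2: "has_weak_partial Om i v w'"
 shows "AE x in lebesgue_on Om. w x = w' x"
proof -
 have O': "Om \<in> sets lebesgue" using O by auto
 have l: "loc_integrable Om w" "loc_integrable Om w'" using 1 2 by (auto simp: has_weak_partial_def)
 have "AE x in lebesgue_on Om. w x - w' x = 0"
 proof (rule fundamental_lemma[OF O])
  show "loc_integrable Om (%x. w x - w' x)" using l by (auto simp: loc_integrable_def)
  show "(LINT x|lebesgue_on Om. (w x - w' x) * phi x) = 0" if phi: "test_function Om phi" for phi
   using 1 2 phi loc_integrable_test_function(1)[OF l(1) phi O'] loc_integrable_test_function(1)[OF l(2) phi O']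
   by (auto simp: left_diff_distrib has_weak_partial_def)
 qed
 then show ?thesis by simp
qed

lemma weak_partial_works: "has_weak_partial Om i v w ==> has_weak_partial Om i v (weak_partial Om i v)"
 unfolding weak_partial_def by (rule someI[of "has_weak_partial Om i v"])

lemma weak_partial_AE:
 fixes Om :: "(real^'n) set"
 assumes "open Om" "has_weak_partial Om i v w"
 shows "AE x in lebesgue_on Om. weak_partial Om i v x = w x"
 by (rule has_weak_partial_unique[OF assms(1) weak_partial_works[OF assms(2)] assms(2)])

text \<open>The derivative of a test function integrates to zero: its convolution with the indicator of a large ball
  is locally constant.\<close>

lemma integral_partial_test_function:
 assumes phi: "test_function UNIV phi" and e: "e \<in> Basis"
 shows "(LINT x|lborel. partial_within UNIV e phi (x::'a::euclidean_space)) = 0"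
proof -
 obtain K where "compact K" "K \<subseteq> UNIV" and K0: "!!x. x \<notin> K ==> phi x = 0" using test_function_support[OF phi] by blast
 then have K: "compact K" "!!x. x \<notin> K ==> phi x = 0" by auto
 obtain R where R: "!!x. x \<in> K ==> norm x <= R" using compact_imp_bounded[OF K(1)] by (auto simp: bounded_iff)
 let ?B = "cball (0::'a) (R + 1)"
 have f: "integrable lborel (%y. indicator ?B y :: real)" using emeasure_compact_finite[OF compact_cball, of "0::'a" "R+1"] by auto
 have [measurable]: "phi \<in> borel_measurable borel" "partial_within UNIV e phi \<in> borel_measurable borel"
  using test_function_measurable[OF phi] test_function_measurable[OF test_function_partial[OF phi e]] by auto
 have const: "(LINT y|lborel. indicator ?B y * phi (0 + t *\<^sub>R e - y)) = (LINT y|lborel. phi y)" if t: "abs t < 1" for t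
 proof -
  have "indicator ?B y * phi (0 + t *\<^sub>R e - y) = phi (t *\<^sub>R e - y)" for y
  proof (cases "t *\<^sub>R e - y \<in> K")
   case True
   have "norm y <= norm (t *\<^sub>R e) + norm (t *\<^sub>R e - y)" using norm_triangle_ineq4[of "t *\<^sub>R e" "t *\<^sub>R e - y"] by simp
   then have "norm y <= R + 1" using R[OF True] t e by simp
   then show ?thesis by simp
  next
   case False then show ?thesis using K(2)[of "t *\<^sub>R e - y"] by simp
  qed
  then have "(LINT y|lborel. indicator ?B y * phi (0 + t *\<^sub>R e - y)) = (LINT y|lborel. phi (t *\<^sub>R e - y))" by (simp only:)
  then show ?thesis using integral_reflect[of phi "t *\<^sub>R e"] by simp
 qed
 have "((%t. LINT y|lborel. phi y) has_real_derivative 0) (at (0::real))" by simp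
 then have "((%t. LINT y|lborel. indicator ?B y * phi (0 + t *\<^sub>R e - y)) has_real_derivative 0) (at 0)"
  by (rule has_field_derivative_transform_within_open[where S="{-1<..<1}"]) (use const in auto)
 moreover note convolution_partial[OF f phi e, of 0]
 ultimately have "(LINT y|lborel. indicator ?B y * partial_within UNIV e phi (0 - y)) = 0" by (rule DERIV_unique[symmetric])
 moreover have "indicator ?B y * partial_within UNIV e phi (0 - y) = partial_within UNIV e phi (0 - y)" for y
 proof (cases "- y \<in> K")
  case True then show ?thesis using R[OF True] by simp
 next
  case False
  then have "partial_within UNIV e phi (0 - y) = 0"
   using partial_eq_0_outside[of K phi "0 - y" e] K compact_imp_closed[OF K(1)] by simp
  then show ?thesis by simp
 qed
 ultimately have "(LINT y|lborel. partial_within UNIV e phi (0 - y)) = 0" by (simp only:)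
 then show ?thesis using integral_reflect[of "partial_within UNIV e phi" 0] by simp
qed

lemma loc_integrable_borel_integrable:
 fixes f :: "'a::euclidean_space => real"
 assumes "integrable lborel f" shows "loc_integrable Om f"
proof -
 have "f \<in> borel_measurable lborel" using assms by auto
 then have "integrable lebesgue f" using assms integrable_completion by blast
 then show ?thesis
  unfolding loc_integrable_def using integrable_lebesgue_on_subset[of UNIV f]
  by (simp add: lebesgue_on_UNIV_eq borel_compact)
qed

lemma partial_mult:
 assumes "Ck_on (Suc 0) UNIV f" "Ck_on (Suc 0) UNIV g" "e \<in> Basis"
 shows "partial_within UNIV e (%x. f x * g x) z = partial_within UNIV e f z * g z + partial_within UNIV e g z * f z"
 using DERIV_mult[OF assms(1)[THEN Ck_on_partial, OF assms(3)] assms(2)[THEN Ck_on_partial, OF assms(3)], of z z]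
 by (intro partialI(2)) simp

lemma has_weak_partial_test_function:
 fixes Om :: "(real^'n) set" and phi :: "real^'n => real"
 assumes phi: "test_function UNIV phi" and O: "open Om"
 shows "has_weak_partial Om i phi (partial_within UNIV (axis i 1) phi)"
proof -
 have e: "axis i 1 \<in> (Basis :: (real^'n) set)" by (simp add: axis_in_Basis_iff)
 note phi' = test_function_partial[OF phi e]
 have m: "phi \<in> borel_measurable borel" "partial_within UNIV (axis i 1) phi \<in> borel_measurable borel"
  using test_function_measurable phi phi' by auto
 have "(LINT x|lborel. phi x * partial_within UNIV (axis i 1) \<psi> x) = - (LINT x|lborel. partial_within UNIV (axis i 1) phi x * \<psi> x)"
  if \<psi>: "test_function Om \<psi>" for \<psi>
 proof -
  note Cphi = test_function_Ck[OF phi] and C\<psi> = test_function_Ck[OF \<psi>]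
  have \<psi>': "test_function UNIV \<psi>" using test_function_mono[OF \<psi>] by simp
  have "test_function UNIV (%x. phi x * \<psi> x)" by (rule test_function_mult[OF \<psi>' Cphi])
  from integral_partial_test_function[OF this e]
  have "(LINT x|lborel. partial_within UNIV (axis i 1) phi x * \<psi> x + partial_within UNIV (axis i 1) \<psi> x * phi x) = 0"
   by (simp add: partial_mult[OF Cphi C\<psi> e])
  moreover have "integrable lborel (%x. partial_within UNIV (axis i 1) phi x * \<psi> x)"
   by (rule test_function_integrable[OF test_function_mult[OF \<psi>' test_function_Ck[OF phi']]])
  moreover have "integrable lborel (%x. partial_within UNIV (axis i 1) \<psi> x * phi x)"
   by (rule test_function_integrable[OF test_function_mult[OF phi test_function_Ck[OF test_function_partial[OF \<psi> e]]]])
  ultimately show ?thesis by (simp add: mult.commute)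
 qed
 then show ?thesis unfolding has_weak_partial_borel[OF O m]
  using test_function_integrable[OF phi] test_function_integrable[OF phi'] loc_integrable_borel_integrable by blast
qed

lemma compact_infdist_nbhd:
 fixes K :: "'a::euclidean_space set"
 assumes "compact K" "K \<noteq> {}" "open U" "K \<subseteq> U"
 obtains r where "r > 0" "{x. infdist x K <= 3 * r} \<subseteq> U"
proof -
 obtain e where e: "e > 0" "(\<Union>x\<in>K. ball x e) \<subseteq> U"
  using compact_subset_open_imp_ball_epsilon_subset[OF assms(1,3,4)] by blast
 show ?thesis
 proof (rule that[of "e / 6"])
  show "{x. infdist x K <= 3 * (e / 6)} \<subseteq> U"
  proof
   fix x assume x: "x \<in> {x. infdist x K <= 3 * (e / 6)}"
   obtain a where a: "a \<in> K" "infdist x K = dist x a"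
    using infdist_attains_inf[OF compact_imp_closed[OF assms(1)] assms(2)] by metis
   then have "x \<in> ball a e" using x e by (auto simp: dist_commute)
   then show "x \<in> U" using a e by blast
  qed
 qed (use e in simp)
qed

text \<open>A function vanishing near the boundary keeps its weak derivative when extended by zero: a test function may be
  multiplied by a cutoff.\<close>

lemma has_weak_partial_extend:
 fixes D :: "(real^'n) set"
 assumes D: "open D" and wp: "has_weak_partial D i v w" and K: "compact K" "K \<subseteq> D"
  and v: "integrable lborel v" "!!x. x \<notin> K ==> v x = 0" and w: "integrable lborel w" "!!x. x \<notin> K ==> w x = 0"
 shows "has_weak_partial UNIV i v w"
proof -
 have e: "axis i 1 \<in> (Basis :: (real^'n) set)" by (simp add: axis_in_Basis_iff)
 have m: "v \<in> borel_measurable borel" "w \<in> borel_measurable borel" using v w by auto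
 have "(LINT x|lborel. v x * partial_within UNIV (axis i 1) phi x) = - (LINT x|lborel. w x * phi x)"
  if phi: "test_function UNIV phi" for phi
 proof (cases "K = {}")
  case True then show ?thesis using v w by simp
 next
  case False
  obtain r where r: "r > 0" "{x. infdist x K <= 3 * r} \<subseteq> D" using compact_infdist_nbhd[OF K(1) False D K(2)] by blast
  obtain eta where eta: "test_function D eta" "!!x. infdist x K <= r / 2 ==> eta x = 1"
   by (rule smooth_cutoff[OF K(1) False r]) (rule that)
  note Cphi = test_function_Ck[OF phi] and Ceta = test_function_Ck[OF eta(1)]
  have t: "test_function D (%x. phi x * eta x)" by (rule test_function_mult[OF eta(1) Cphi])
  have p: "partial_within UNIV (axis i 1) (%x. phi x * eta x) x = partial_within UNIV (axis i 1) phi x" if x: "x \<in> K" for x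
  proof -
   have "partial_within UNIV (axis i 1) eta x = 0"
   proof (rule partialI(2))
    have op: "open ((%t. x + t *\<^sub>R axis i 1) -` {y. infdist y K < r / 2})"
     by (rule open_vimage) (auto intro!: continuous_intros open_Collect_less)
    have d0: "((%t. 1) has_real_derivative 0) (at (0::real))" by simp
    show "((%t. eta (x + t *\<^sub>R axis i 1)) has_real_derivative 0) (at 0)"
     by (rule has_field_derivative_transform_within_open[OF d0 op]) (use x r eta(2) in auto)
   qed
   then show ?thesis using eta(2)[of x] x r by (simp add: partial_mult[OF Cphi Ceta e])
  qed
  have "v x * partial_within UNIV (axis i 1) (%x. phi x * eta x) x = v x * partial_within UNIV (axis i 1) phi x" for x
   using p v by (cases "x \<in> K") auto
  moreover have "w x * (phi x * eta x) = w x * phi x" for x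
   using eta(2)[of x] r w by (cases "x \<in> K") auto
  moreover have "(LINT x|lborel. v x * partial_within UNIV (axis i 1) (%x. phi x * eta x) x) = - (LINT x|lborel. w x * (phi x * eta x))"
   using wp t unfolding has_weak_partial_borel[OF D m] by blast
  ultimately show ?thesis by (simp only:)
 qed
 then show ?thesis unfolding has_weak_partial_borel[OF open_UNIV m]
  using loc_integrable_borel_integrable v w by blast
qed

lemma partial_mollify:
 fixes v w :: "real^'n => real"
 assumes d: "d > 0" and wp: "has_weak_partial UNIV i v w" and v: "integrable lborel v" and w: "integrable lborel w"
 shows "partial_within UNIV (axis i 1) (mollify d v) x = mollify d w x"
proof -
 have e: "axis i 1 \<in> (Basis :: (real^'n) set)" by (simp add: axis_in_Basis_iff)
 have m: "v \<in> borel_measurable borel" "w \<in> borel_measurable borel" using v w by auto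
 let ?P = "partial_within UNIV (axis i 1)"
 have "?P (mollify d v) x = (LINT y|lborel. v y * ?P (mollifier d) (x - y))"
  unfolding mollify_def[abs_def] by (rule partialI(2)[OF convolution_partial[OF v mollifier_test[OF d] e]])
 also have "... = - (LINT y|lborel. v y * ?P (%y. mollifier d (x - y)) y)"
 proof -
  have "?P (%y. mollifier d (x - y)) y = - ?P (mollifier d) (x - y)" for y
   using partial_affine[OF test_function_Ck[OF mollifier_test[OF d]] e, of x "-1" y] by simp
  then show ?thesis by simp
 qed
 also have "... = (LINT y|lborel. w y * mollifier d (x - y))"
  using wp test_function_reflected_mollifier[OF d, of x UNIV] unfolding has_weak_partial_borel[OF open_UNIV m] by simp
 finally show ?thesis by (simp add: mollify_def)
qed

lemma test_function_mollify:
 fixes v :: "'a::euclidean_space => real"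
 assumes d: "0 < d" "d <= 3 * r" and v: "integrable lborel v" and K: "compact K" "K \<noteq> {}" "!!x. x \<notin> K ==> v x = 0"
  and U: "{x. infdist x K <= 3 * r} \<subseteq> U"
 shows "test_function U (mollify d v)"
proof (rule test_functionI[OF Ck_on_mollify[OF d(1) v] _ U])
 show "compact {x. infdist x K <= 3 * r}" using d K by (intro compact_infdist_le) auto
 show "x \<in> {x. infdist x K <= 3 * r}" if nz: "mollify d v x \<noteq> 0" for x
 proof (rule ccontr)
  assume far: "x \<notin> {x. infdist x K <= 3 * r}"
  have "mollify d v x = 0"
  proof (rule mollify_eq_0[OF d(1)])
   fix y assume y: "norm (x - y) < d"
   have "y \<notin> K"
   proof
    assume "y \<in> K"
    then have "infdist x K <= dist x y" by (rule infdist_le)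
    then show False using far y d by (simp add: dist_norm)
   qed
   then show "v y = 0" by (rule K(3))
  qed
  with nz show False by simp
 qed
qed

section \<open>Compactly supported Sobolev functions\<close>

lemma norm_vec_powr_le:
 fixes x :: "'a::real_normed_vector ^ 'n"
 assumes p: "p > 0"
 shows "norm x powr p <= real CARD('n) powr p * (\<Sum>i\<in>UNIV. norm (x $ i) powr p)"
proof -
 define M where "M = Max (range (%i. norm (x $ i)))"
 have M: "norm (x $ i) <= M" for i unfolding M_def by (intro Max_ge) auto
 have "M \<in> range (%i. norm (x $ i))" unfolding M_def by (intro Max_in) auto
 then obtain j where j: "M = norm (x $ j)" by auto
 have "norm x <= (\<Sum>i\<in>UNIV. norm (x $ i))" unfolding norm_vec_def by (rule L2_set_le_sum) auto
 also have "... <= (\<Sum>i\<in>(UNIV::'n set). M)" by (intro sum_mono M)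
 finally have "norm x <= real CARD('n) * M" by simp
 then have "norm x powr p <= (real CARD('n) * M) powr p" using p by (intro powr_mono2) auto
 also have "... = real CARD('n) powr p * norm (x $ j) powr p" by (simp add: powr_mult j)
 also have "... <= real CARD('n) powr p * (\<Sum>i\<in>UNIV. norm (x $ i) powr p)"
  by (intro mult_left_mono member_le_sum) auto
 finally show ?thesis .
qed

lemma borel_measurable_vecI:
 fixes f :: "'a => 'b::euclidean_space ^ 'n"
 assumes "!!i. (%x. f x $ i) \<in> borel_measurable M"
 shows "f \<in> borel_measurable M"
proof (rule borel_measurable_euclidean_space[THEN iffD2], intro ballI)
 fix b :: "'b^'n" assume "b \<in> Basis"
 then obtain i u where "b = axis i u" by (auto simp: Basis_vec_def)
 then show "(%x. f x \<bullet> b) \<in> borel_measurable M" using assms by (simp add: inner_axis)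
qed

lemma integral_le_nn_integral:
 fixes f :: "'a => real"
 assumes "!!x. 0 <= f x" "(\<integral>\<^sup>+x. ennreal (f x) \<partial>M) <= ennreal c" "0 <= c"
 shows "(\<integral>x. f x \<partial>M) <= c"
proof (cases "integrable M f")
 case True
 then have "ennreal (\<integral>x. f x \<partial>M) <= ennreal c" using assms nn_integral_eq_integral[OF True] by simp
 then show ?thesis using assms by simp
next
 case False then show ?thesis using assms by (simp add: not_integrable_integral_eq)
qed

lemma nn_integral_lebesgue_on_le:
 assumes "S \<in> sets lebesgue"
 shows "(\<integral>\<^sup>+x. f x \<partial>lebesgue_on S) <= (\<integral>\<^sup>+x. f x \<partial>lborel)"
proof -
 have "(\<integral>\<^sup>+x. f x \<partial>lebesgue_on S) = (\<integral>\<^sup>+x. f x * indicator S x \<partial>lebesgue)"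
  using assms by (simp add: nn_integral_restrict_space)
 also have "... <= (\<integral>\<^sup>+x. f x \<partial>lebesgue)" by (intro nn_integral_mono) (auto simp: indicator_def)
 finally show ?thesis by (simp add: nn_integral_completion)
qed

lemma Lp_on_borel:
 fixes f :: "'a::euclidean_space => real"
 assumes [measurable]: "f \<in> borel_measurable borel" and "(\<integral>\<^sup>+x. ennreal (abs (f x) powr p) \<partial>lborel) < \<infinity>" and S: "S \<in> sets lebesgue"
 shows "Lp_on p S f"
proof -
 have m: "f \<in> borel_measurable (lebesgue_on S)" by (intro measurable_restrict_space1 measurable_completion) measurable
 have "(\<integral>\<^sup>+x. ennreal (abs (f x) powr p) \<partial>lebesgue_on S) < \<infinity>"
  using nn_integral_lebesgue_on_le[OF S] assms(2) by (rule le_less_trans)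
 then have "integrable (lebesgue_on S) (%x. abs (f x) powr p)"
  using m by (intro integrableI_bounded) auto
 then show ?thesis using m by (simp add: Lp_on_def)
qed

lemma powr_ge_id_minus: fixes t :: real assumes "t \<ge> 0" "p \<ge> 1" shows "t <= 1 + t powr p"
proof (cases "t <= 1")
 case False
 then have "t powr 1 <= t powr p" using assms by (intro powr_mono) auto
 then show ?thesis using False by simp
qed (simp add: add_increasing2)

lemma integrable_of_Lp_compact:
 fixes f :: "'a::euclidean_space => real"
 assumes [measurable]: "f \<in> borel_measurable borel" and fin: "(\<integral>\<^sup>+x. ennreal (abs (f x) powr p) \<partial>lborel) < \<infinity>" and p: "p \<ge> 1"
  and K: "bounded K" "!!x. x \<notin> K ==> f x = 0"
 shows "integrable lborel f"
proof (rule integrableI_bounded)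
 obtain R where "!!x. x \<in> K ==> norm x <= R" using K(1) by (auto simp: bounded_iff)
 then have R: "K \<subseteq> cball 0 R" by auto
 have "(\<integral>\<^sup>+x. ennreal (norm (f x)) \<partial>lborel) <= (\<integral>\<^sup>+x. indicator (cball 0 R) x + ennreal (abs (f x) powr p) \<partial>lborel)"
 proof (rule nn_integral_mono)
  fix x
  show "ennreal (norm (f x)) <= indicator (cball 0 R) x + ennreal (abs (f x) powr p)"
  proof (cases "x \<in> K")
   case True
   then have "x \<in> cball 0 R" using R by auto
   moreover have "ennreal \<bar>f x\<bar> <= ennreal (1 + abs (f x) powr p)" using powr_ge_id_minus[OF _ p, of "abs (f x)"] by (intro ennreal_leI) auto
   ultimately show ?thesis by simp
  qed (simp add: K)
 qed
 also have "... = emeasure lborel (cball (0::'a) R) + (\<integral>\<^sup>+x. ennreal (abs (f x) powr p) \<partial>lborel)"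
  by (subst nn_integral_add) auto
 also have "... < \<infinity>" using fin emeasure_compact_finite[OF compact_cball, of "0::'a" R] by simp
 finally show "(\<integral>\<^sup>+x. ennreal (norm (f x)) \<partial>lborel) < \<infinity>" .
qed simp

lemma eventually_mollify_Lp:
 fixes f :: "'a::euclidean_space => real"
 assumes "integrable lborel f" "p \<ge> 1" "(\<integral>\<^sup>+x. ennreal (abs (f x) powr p) \<partial>lborel) < \<infinity>" "e > (0::real)"
 shows "eventually (%d. Lp_dist p (mollify d f) f <= ennreal e) (at_right 0)"
proof -
 obtain d0 where "d0 > 0" "!!d. 0 < d ==> d < d0 ==> Lp_dist p (mollify d f) f <= ennreal e"
  by (rule mollify_Lp_converges[OF assms]) (rule that)
 then show ?thesis unfolding eventually_at_right_field by blast
qed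

lemma nn_integral_norm_vec_le:
 fixes f :: "'a::euclidean_space => real^'m"
 assumes p: "p > 0" and m: "!!al. (%x. f x $ al) \<in> borel_measurable borel"
  and b: "!!al. (\<integral>\<^sup>+x. ennreal (abs (f x $ al) powr p) \<partial>lborel) <= ennreal c" and c: "c \<ge> 0"
 shows "(\<integral>\<^sup>+x. ennreal (norm (f x) powr p) \<partial>lborel) <= ennreal (real CARD('m) powr p * (real CARD('m) * c))"
proof -
 have [measurable]: "(%x. f x $ al) \<in> borel_measurable borel" for al by (rule m)
 have "(\<integral>\<^sup>+x. ennreal (norm (f x) powr p) \<partial>lborel) \<le>
   (\<integral>\<^sup>+x. ennreal (real CARD('m) powr p) * (\<Sum>al\<in>UNIV. ennreal (abs (f x $ al) powr p)) \<partial>lborel)"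
 proof (rule nn_integral_mono)
  fix x
  show "ennreal (norm (f x) powr p) <= ennreal (real CARD('m) powr p) * (\<Sum>al\<in>UNIV. ennreal (abs (f x $ al) powr p))"
   using ennreal_leI[OF norm_vec_powr_le[OF p, of "f x"]] by (simp add: ennreal_mult sum_nonneg)
 qed
 also have "... = ennreal (real CARD('m) powr p) * (\<Sum>al\<in>UNIV. (\<integral>\<^sup>+x. ennreal (abs (f x $ al) powr p) \<partial>lborel))"
  by (subst nn_integral_cmult, measurable) (subst nn_integral_sum, auto)
 also have "... <= ennreal (real CARD('m) powr p) * (\<Sum>al\<in>(UNIV::'m set). ennreal c)"
  by (intro mult_left_mono sum_mono b) auto
 also have "... = ennreal (real CARD('m) powr p * (real CARD('m) * c))"
  using c by (simp add: ennreal_mult ennreal_of_nat_eq_real_of_nat)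
 finally show ?thesis .
qed

lemma nn_integral_norm_mat_le:
 fixes f :: "'a::euclidean_space => real^'n^'m"
 assumes p: "p > 0" and m: "!!al i. (%x. f x $ al $ i) \<in> borel_measurable borel"
  and b: "!!al i. (\<integral>\<^sup>+x. ennreal (abs (f x $ al $ i) powr p) \<partial>lborel) <= ennreal c" and c: "c \<ge> 0"
 shows "(\<integral>\<^sup>+x. ennreal (norm (f x) powr p) \<partial>lborel) \<le>
  ennreal (real CARD('m) powr p * (real CARD('m) * (real CARD('n) powr p * (real CARD('n) * c))))"
proof -
 have [measurable]: "(%x. f x $ al $ i) \<in> borel_measurable borel" for al i by (rule m)
 have [measurable]: "(%x. f x $ al) \<in> borel_measurable borel" for al
  by (rule borel_measurable_vecI) measurable
 have *: "(\<integral>\<^sup>+x. ennreal (abs (norm (f x $ al)) powr p) \<partial>lborel) <= ennreal (real CARD('n) powr p * (real CARD('n) * c))" for al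
  using nn_integral_norm_vec_le[OF p m b c, of al] by simp
 have "(\<integral>\<^sup>+x. ennreal (norm ((\<chi> al. norm (f x $ al)) :: real^'m) powr p) \<partial>lborel) \<le>
  ennreal (real CARD('m) powr p * (real CARD('m) * (real CARD('n) powr p * (real CARD('n) * c))))"
  using * c by (intro nn_integral_norm_vec_le p) auto
 moreover have "norm ((\<chi> al. norm (f x $ al)) :: real^'m) = norm (f x)" for x by (simp add: norm_vec_def)
 ultimately show ?thesis by simp
qed

text \<open>The extension by zero has weak derivatives on the whole space, mollification commutes with them, and a
  sufficiently small mollification keeps the support inside \<open>D\<close>.\<close>

lemma compactly_supported_sobolev_zero:
 fixes D :: "(real^'n) set" and v :: "real^'n => real^'m" and w :: "real^'n => real^'n^'m"
 assumes D: "open D" and p: "p \<ge> 1" and K: "compact K" "K \<subseteq> D"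
  and vm: "!!al. (%x. v x $ al) \<in> borel_measurable borel" and wm: "!!al i. (%x. w x $ al $ i) \<in> borel_measurable borel"
  and vfin: "!!al. (\<integral>\<^sup>+x. ennreal (abs (v x $ al) powr p) \<partial>lborel) < \<infinity>"
  and wfin: "!!al i. (\<integral>\<^sup>+x. ennreal (abs (w x $ al $ i) powr p) \<partial>lborel) < \<infinity>"
  and v0: "!!x. x \<notin> K ==> v x = 0" and w0: "!!x. x \<notin> K ==> w x = 0"
  and wp: "!!al i. has_weak_partial D i (%x. v x $ al) (%x. w x $ al $ i)"
 shows "sobolev_vec_zero p D v"
proof -
 have Dl: "D \<in> sets lebesgue" using D by auto
 have vi: "integrable lborel (%x. v x $ al)" for al
  by (rule integrable_of_Lp_compact[OF vm vfin p compact_imp_bounded[OF K(1)]]) (simp add: v0)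
 have wi: "integrable lborel (%x. w x $ al $ i)" for al i
  by (rule integrable_of_Lp_compact[OF wm wfin p compact_imp_bounded[OF K(1)]]) (simp add: w0)
 have wpU: "has_weak_partial UNIV i (%x. v x $ al) (%x. w x $ al $ i)" for al i
  by (rule has_weak_partial_extend[OF D wp K vi _ wi]) (simp_all add: v0 w0)
 have S1: "sobolev_vec 1 p D v"
  unfolding sobolev_vec_def One_nat_def sobolev.simps
  using Lp_on_borel[OF vm vfin Dl] Lp_on_borel[OF wm wfin Dl] wp by blast
 have "\<exists>\<psi>. (\<forall>al. test_function D (%x. \<psi> x $ al)) & W1p_norm p D (%x. v x - \<psi> x) < e" if e: "e > 0" for e
 proof (cases "K = {}")
  case True
  then have v: "v = (%x. 0)" and w: "w = (%x. 0)" using v0 w0 by auto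
  have t: "test_function D (%x. (0::real^'m) $ al)" for al
   by (rule test_functionI[of _ "{}"]) (auto intro: Ck_on_const)
  have ae: "AE x in lebesgue_on D. weak_partial D i (%x. 0) x = 0" for i
   using weak_partial_AE[OF D wp] by (simp add: v w)
  have "AE x in lebesgue_on D. \<forall>i. weak_partial D i (%x. 0) x = 0" using ae by (intro eventually_all_finite)
  then have "AE x in lebesgue_on D. norm (weak_grad D (%x. v x - 0) x) powr p = 0"
   by (rule eventually_mono) (simp add: weak_grad_def v vec_eq_iff)
  then have "(LINT x|lebesgue_on D. norm (weak_grad D (%x. v x - 0) x) powr p) = 0" by (rule integral_eq_zero_AE)
  then have "W1p_norm p D (%x. v x - 0) = 0" by (simp add: W1p_norm_def v)
  then show ?thesis using t e by (intro exI[of _ "%x. 0"]) simp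
 next
  case False
  obtain r where r: "r > 0" "{x. infdist x K <= 3 * r} \<subseteq> D" by (rule compact_infdist_nbhd[OF K(1) False D K(2)]) (rule that)
  define N where "N = real CARD('m) powr p * (real CARD('m) * 1) + real CARD('m) powr p * (real CARD('m) * (real CARD('n) powr p * (real CARD('n) * 1)))"
  have N: "N > 0" unfolding N_def by (intro add_pos_nonneg mult_pos_pos) auto
  define c where "c = (e / 2) powr p / N"
  have c: "c > 0" using e N by (simp add: c_def)
  have "eventually (%d. (\<forall>al. Lp_dist p (mollify d (%x. v x $ al)) (%x. v x $ al) <= ennreal c) \<and>
    (\<forall>al i. Lp_dist p (mollify d (%x. w x $ al $ i)) (%x. w x $ al $ i) <= ennreal c) & d < 3 * r & 0 < d) (at_right 0)"
   using r c
   by (intro eventually_conj eventually_all_finite eventually_mollify_Lp vi wi p vfin wfin eventually_at_right_less)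
    (auto simp: eventually_at_right_field intro: exI[of _ "3 * r"])
  from eventually_happens'[OF _ this] obtain d where d: "!!al. Lp_dist p (mollify d (%x. v x $ al)) (%x. v x $ al) <= ennreal c"
   "!!al i. Lp_dist p (mollify d (%x. w x $ al $ i)) (%x. w x $ al $ i) <= ennreal c" "d < 3 * r" "0 < d"
   by auto
  define \<psi> where "\<psi> x = (\<chi> al. mollify d (%x. v x $ al) x)" for x
  define \<omega> where "\<omega> x = (\<chi> al i. mollify d (%x. w x $ al $ i) x)" for x
  have t: "test_function D (%x. \<psi> x $ al)" for al
   unfolding \<psi>_def using d K False v0 r by (auto intro!: test_function_mollify[OF _ _ vi, where K=K and r=r])
  have t': "test_function UNIV (%x. \<psi> x $ al)" for al using test_function_mono[OF t] by simp
  have P: "partial_within UNIV (axis i 1) (%x. \<psi> x $ al) = (%x. \<omega> x $ al $ i)" for al i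
   using partial_mollify[OF d(4) wpU vi wi] by (auto simp: \<psi>_def \<omega>_def)
  have e': "axis i 1 \<in> (Basis :: (real^'n) set)" for i by (simp add: axis_in_Basis_iff)
  have m1[measurable]: "(%x. \<psi> x $ al) \<in> borel_measurable borel" for al by (rule test_function_measurable[OF t])
  have m2[measurable]: "(%x. \<omega> x $ al $ i) \<in> borel_measurable borel" for al i
   using test_function_measurable[OF test_function_partial[OF t e']] unfolding P .
  have wpd: "has_weak_partial D i (%x. (v x - \<psi> x) $ al) (%x. (w x - \<omega> x) $ al $ i)" for al i
   using has_weak_partial_lincomb[OF Dl wp has_weak_partial_test_function[OF t' D], where a=1 and b="-1"]
   by (simp add: P)
  have "AE x in lebesgue_on D. \<forall>al i. weak_partial D i (%x. (v x - \<psi> x) $ al) x = (w x - \<omega> x) $ al $ i"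
   by (intro eventually_all_finite weak_partial_AE[OF D wpd])
  then have ae: "AE x in lebesgue_on D. ennreal (norm (weak_grad D (%x. v x - \<psi> x) x) powr p) = ennreal (norm (w x - \<omega> x) powr p)"
  proof eventually_elim
   case (elim x)
   then have "weak_grad D (%x. v x - \<psi> x) x = w x - \<omega> x" unfolding weak_grad_def by (simp add: vec_eq_iff)
   then show ?case by simp
  qed
  have p0: "p > 0" using p by simp
  have "(LINT x|lebesgue_on D. norm (v x - \<psi> x) powr p) <= real CARD('m) powr p * (real CARD('m) * c)"
  proof (rule integral_le_nn_integral)
   have "(\<integral>\<^sup>+x. ennreal (norm (v x - \<psi> x) powr p) \<partial>lborel) <= ennreal (real CARD('m) powr p * (real CARD('m) * c))"
    using d(1) c vm by (intro nn_integral_norm_vec_le p0) (auto simp: Lp_dist_def \<psi>_def abs_minus_commute intro!: borel_measurable_diff m1[unfolded \<psi>_def, simplified])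
   then show "(\<integral>\<^sup>+x. ennreal (norm (v x - \<psi> x) powr p) \<partial>lebesgue_on D) <= ennreal (real CARD('m) powr p * (real CARD('m) * c))"
    by (rule order_trans[OF nn_integral_lebesgue_on_le[OF Dl]])
  qed (use c in auto)
  moreover have "(LINT x|lebesgue_on D. norm (weak_grad D (%x. v x - \<psi> x) x) powr p) \<le>
    real CARD('m) powr p * (real CARD('m) * (real CARD('n) powr p * (real CARD('n) * c)))"
  proof (rule integral_le_nn_integral)
   have "(\<integral>\<^sup>+x. ennreal (norm (weak_grad D (%x. v x - \<psi> x) x) powr p) \<partial>lebesgue_on D) = (\<integral>\<^sup>+x. ennreal (norm (w x - \<omega> x) powr p) \<partial>lebesgue_on D)"
    by (rule nn_integral_cong_AE[OF ae])
   also have "... <= (\<integral>\<^sup>+x. ennreal (norm (w x - \<omega> x) powr p) \<partial>lborel)" by (rule nn_integral_lebesgue_on_le[OF Dl])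
   also have "... <= ennreal (real CARD('m) powr p * (real CARD('m) * (real CARD('n) powr p * (real CARD('n) * c))))"
    using d(2) c wm by (intro nn_integral_norm_mat_le p0) (auto simp: Lp_dist_def \<omega>_def abs_minus_commute intro!: borel_measurable_diff m2[unfolded \<omega>_def, simplified])
   finally show "(\<integral>\<^sup>+x. ennreal (norm (weak_grad D (%x. v x - \<psi> x) x) powr p) \<partial>lebesgue_on D) <= ..." .
  qed (use c in auto)
  ultimately have "(LINT x|lebesgue_on D. norm (v x - \<psi> x) powr p) + (LINT x|lebesgue_on D. norm (weak_grad D (%x. v x - \<psi> x) x) powr p) <= N * c"
   by (simp add: N_def algebra_simps)
  also have "N * c = (e / 2) powr p" using N by (simp add: c_def)
  finally have "W1p_norm p D (%x. v x - \<psi> x) <= ((e / 2) powr p) powr (1 / p)"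
   unfolding W1p_norm_def using p by (intro powr_mono2 add_nonneg_nonneg integral_nonneg_AE) auto
  also have "... = e / 2" using e p by (simp add: powr_powr)
  finally show ?thesis using e t by (intro exI[of _ \<psi>]) auto
 qed
 then show ?thesis using S1 by (simp add: sobolev_vec_zero_def)
qed

section \<open>Shears along a coordinate direction\<close>

text \<open>Substitution on compact intervals and monotone convergence: since \<open>g\<close> stays within a bounded distance of the
  identity, the images of the intervals exhaust the line.\<close>

lemma nn_integral_substitution_line:
 fixes f :: "real => ennreal"
 assumes [measurable]: "f \<in> borel_measurable borel"
  and der: "!!x. (g has_real_derivative g' x) (at x)" and cont: "continuous_on UNIV g'" and nn: "!!x. g' x \<ge> 0"
  and B: "!!x. abs (g x - x) <= B"
 shows "(\<integral>\<^sup>+x. f (g x) * ennreal (g' x) \<partial>lborel) = (\<integral>\<^sup>+x. f x \<partial>lborel)"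
proof -
 have mono: "g x <= g y" if "x <= y" for x y
  by (rule DERIV_nonneg_imp_nondecreasing[OF that]) (use der nn in blast)
 have [measurable]: "g \<in> borel_measurable borel" "g' \<in> borel_measurable borel"
  using der cont by (auto intro!: borel_measurable_continuous_onI continuous_at_imp_continuous_on intro: DERIV_isCont)
 have step: "(\<integral>\<^sup>+x. f x * indicator {g (- real (Suc N))..g (real (Suc N))} x \<partial>lborel) =
   (\<integral>\<^sup>+x. f (g x) * ennreal (g' x) * indicator {- real (Suc N)..real (Suc N)} x \<partial>lborel)" for N
  by (rule nn_integral_substitution_aux) (use der nn in \<open>auto intro: continuous_on_subset[OF cont]\<close>)
 have SUP1: "(SUP N. h x * indicator {a N..b N} x) = h x"
  if inc: "incseq (%N. h x * indicator {a N..b N} x)" and ex: "\<exists>N. a N <= x & x <= b N"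
  for h :: "real => ennreal" and a b :: "nat => real" and x
 proof (rule antisym)
  show "(SUP N. h x * indicator {a N..b N} x) <= h x" by (rule SUP_least) (auto simp: indicator_def)
  obtain N where "a N <= x & x <= b N" using ex by blast
  then have "h x = h x * indicator {a N..b N} x" by simp
  also have "... <= (SUP N. h x * indicator {a N..b N} x)" by (rule SUP_upper) simp
  finally show "h x <= (SUP N. h x * indicator {a N..b N} x)" .
 qed
 have lim: "(\<integral>\<^sup>+x. h x \<partial>lborel) = (SUP N. \<integral>\<^sup>+x. h x * indicator {a N..b N} x \<partial>lborel)"
  if [measurable]: "h \<in> borel_measurable borel" and a: "decseq a" and b: "incseq b" and ex: "!!x. \<exists>N. a N <= x & x <= b N"
  for h :: "real => ennreal" and a b :: "nat => real"
 proof -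
  have inc: "incseq (%N. h x * indicator {a N..b N} x)" for x
  proof (rule incseq_SucI)
   fix N
   have "a (Suc N) <= a N" "b N <= b (Suc N)" using a b by (auto simp: decseq_Suc_iff incseq_Suc_iff)
   then show "h x * indicator {a N..b N} x <= h x * indicator {a (Suc N)..b (Suc N)} x" by (auto simp: indicator_def)
  qed
  have "(\<integral>\<^sup>+x. (SUP N. h x * indicator {a N..b N} x) \<partial>lborel) = (SUP N. \<integral>\<^sup>+x. h x * indicator {a N..b N} x \<partial>lborel)"
   by (rule nn_integral_monotone_convergence_SUP) (use inc in \<open>auto simp: incseq_def le_fun_def\<close>)
  moreover have "(SUP N. h x * indicator {a N..b N} x) = h x" for x by (rule SUP1[OF inc ex])
  ultimately show ?thesis by simp
 qed
 have ex1: "\<exists>N. - real (Suc N) <= x & x <= real (Suc N)" for x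
 proof -
  obtain N where "real N \<ge> \<bar>x\<bar>" using real_arch_simple by blast
  then show ?thesis by (intro exI[of _ N]) auto
 qed
 have ex2: "\<exists>N. g (- real (Suc N)) <= x & x <= g (real (Suc N))" for x
 proof -
  obtain N where N: "real N \<ge> \<bar>x\<bar> + B" using real_arch_simple by blast
  show ?thesis using N B[of "- real (Suc N)"] B[of "real (Suc N)"] by (intro exI[of _ N]) auto
 qed
 have "(\<integral>\<^sup>+x. f x \<partial>lborel) = (SUP N. \<integral>\<^sup>+x. f x * indicator {g (- real (Suc N))..g (real (Suc N))} x \<partial>lborel)"
  by (rule lim) (use ex2 in \<open>auto simp: decseq_Suc_iff incseq_Suc_iff intro!: mono\<close>)
 also have "... = (SUP N. \<integral>\<^sup>+x. f (g x) * ennreal (g' x) * indicator {- real (Suc N)..real (Suc N)} x \<partial>lborel)"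
  unfolding step ..
 also have "... = (\<integral>\<^sup>+x. f (g x) * ennreal (g' x) \<partial>lborel)"
  by (rule lim[symmetric]) (use ex1 in \<open>auto simp: decseq_Suc_iff incseq_Suc_iff\<close>)
 finally show ?thesis ..
qed

text \<open>Integration over space reduces to integration along lines in one direction: average the line integrals over a
  slab of unit width.\<close>

lemma nn_integral_along_lines:
 fixes H :: "'a::euclidean_space => ennreal"
 assumes [measurable]: "H \<in> borel_measurable borel" and i: "i \<in> Basis"
 shows "(\<integral>\<^sup>+y. H y \<partial>lborel) = (\<integral>\<^sup>+y. indicator {0..1} (y \<bullet> i) * (\<integral>\<^sup>+t. H (y + t *\<^sub>R i) \<partial>(lborel :: real measure)) \<partial>lborel)"
proof -
 have slab: "(\<integral>\<^sup>+t. indicator {0..1} (c - t) \<partial>(lborel :: real measure)) = (1::ennreal)" for c :: real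
 proof -
  have "(\<integral>\<^sup>+t. indicator {0..1} (c - t) \<partial>(lborel :: real measure)) = (\<integral>\<^sup>+t. indicator {c-1..c} t \<partial>(lborel :: real measure) :: ennreal)"
   by (rule nn_integral_cong) (auto simp: indicator_def)
  then show ?thesis by simp
 qed
 have "(\<integral>\<^sup>+y. indicator {0..1} (y \<bullet> i) * (\<integral>\<^sup>+t. H (y + t *\<^sub>R i) \<partial>(lborel :: real measure)) \<partial>lborel)
   = (\<integral>\<^sup>+y. (\<integral>\<^sup>+t. indicator {0..1} (y \<bullet> i) * H (y + t *\<^sub>R i) \<partial>(lborel :: real measure)) \<partial>lborel)"
  by (simp add: nn_integral_cmult)
 also have "... = (\<integral>\<^sup>+t. (\<integral>\<^sup>+y. indicator {0..1} (y \<bullet> i) * H (y + t *\<^sub>R i) \<partial>lborel) \<partial>(lborel :: real measure))"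
  by (rule lborel_pair.Fubini') measurable
 also have "... = (\<integral>\<^sup>+t. (\<integral>\<^sup>+y. indicator {0..1} (y \<bullet> i - t) * H y \<partial>lborel) \<partial>(lborel :: real measure))"
 proof (rule nn_integral_cong)
  fix t :: real
  have "(\<integral>\<^sup>+y. indicator {0..1} (y \<bullet> i - t) * H y \<partial>lborel) = (\<integral>\<^sup>+y. indicator {0..1} ((y + t *\<^sub>R i) \<bullet> i - t) * H (y + t *\<^sub>R i) \<partial>lborel)"
   by (rule nn_integral_translate[symmetric]) measurable
  also have "... = (\<integral>\<^sup>+y. indicator {0..1} (y \<bullet> i) * H (y + t *\<^sub>R i) \<partial>lborel)"
   using i by (simp add: inner_add_left)
  finally show "(\<integral>\<^sup>+y. indicator {0..1} (y \<bullet> i) * H (y + t *\<^sub>R i) \<partial>lborel) = (\<integral>\<^sup>+y. indicator {0..1} (y \<bullet> i - t) * H y \<partial>lborel)" ..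
 qed
 also have "... = (\<integral>\<^sup>+y. (\<integral>\<^sup>+t. indicator {0..1} (y \<bullet> i - t) * H y \<partial>(lborel :: real measure)) \<partial>lborel)"
  by (rule lborel_pair.Fubini') measurable
 also have "... = (\<integral>\<^sup>+y. H y \<partial>lborel)"
  by (simp add: nn_integral_multc slab)
 finally show ?thesis ..
qed

definition shear :: "'a::euclidean_space => ('a => real) => 'a => 'a" where
 "shear i g y = y - g y *\<^sub>R i"

definition unshear :: "'a::euclidean_space => ('a => real) => 'a => 'a" where
 "unshear i g = inv (shear i g)"

lemma shear_expands:
 assumes i: "i \<in> Basis" and lip: "!!x y. abs (g x - g y) <= norm (x - y) / 2"
 shows "norm (x - y) <= 2 * norm (shear i g x - shear i g y)"
proof -
 have "x - y = (shear i g x - shear i g y) + (g x - g y) *\<^sub>R i" by (simp add: shear_def algebra_simps)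
 then have "norm (x - y) <= norm (shear i g x - shear i g y) + norm ((g x - g y) *\<^sub>R i)" by (metis norm_triangle_ineq)
 also have "norm ((g x - g y) *\<^sub>R i) <= norm (x - y) / 2" using lip[of x y] i by simp
 finally show ?thesis by simp
qed

text \<open>On every line in direction \<open>i\<close> the shear is continuous and within bounded distance of the identity, hence onto by
  the intermediate value theorem.\<close>

lemma bij_shear:
 fixes g :: "'a::euclidean_space => real"
 assumes i: "i \<in> Basis" and lip: "!!x y. abs (g x - g y) <= norm (x - y) / 2" and B: "!!x. abs (g x) <= B"
 shows "bij (shear i g)"
proof (rule bijI)
 show "inj (shear i g)"
 proof (rule injI)
  fix x y assume "shear i g x = shear i g y"
  then show "x = y" using shear_expands[OF i lip, of x y] by simp
 qed
 have gc: "continuous_on UNIV g"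
  unfolding continuous_on_iff dist_norm real_norm_def
 proof (intro ballI allI impI)
  fix x :: 'a and e :: real assume "e > 0"
  moreover have "abs (g x' - g x) < e" if "norm (x' - x) < e" for x'
   using lip[of x' x] that norm_ge_zero[of "x' - x"] by linarith
  ultimately show "\<exists>d>0. \<forall>x'\<in>UNIV. norm (x' - x) < d \<longrightarrow> \<bar>g x' - g x\<bar> < e" by blast
 qed
 show "surj (shear i g)"
  unfolding surj_def
 proof
  fix x
  let ?f = "%t. t - g (x + t *\<^sub>R i)"
  have B0: "B \<ge> 0" using B[of x] by linarith
  have "\<exists>t. - B <= t & t <= B & ?f t = 0"
  proof (rule IVT')
   show "?f (- B) <= 0" using B[of "x + (- B) *\<^sub>R i"] by linarith
   show "0 <= ?f B" using B[of "x + B *\<^sub>R i"] by linarith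
   show "- B <= B" using B0 by simp
   show "continuous_on {- B..B} ?f" by (intro continuous_intros continuous_on_compose2[OF gc]) auto
  qed
  then obtain t where "t = g (x + t *\<^sub>R i)" by auto
  then have "shear i g (x + t *\<^sub>R i) = x" by (simp add: shear_def)
  then show "\<exists>y. x = shear i g y" by metis
 qed
qed

locale shear_map =
 fixes i :: "'a::euclidean_space" and g :: "'a => real"
 assumes i: "i \<in> Basis" and lip: "!!x y. abs (g x - g y) <= norm (x - y) / 2" and bounded_g: "\<exists>B. \<forall>x. abs (g x) <= B"
  and smooth: "!!k. Ck_on k UNIV g" and partial_le: "!!x. abs (partial_within UNIV i g x) <= 1 / 2"
begin

abbreviation "chi \<equiv> shear i g"
abbreviation "psi \<equiv> unshear i g"
abbreviation "J \<equiv> %y. 1 - partial_within UNIV i g y"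

lemma bij_chi: "bij chi"
 using bij_shear[OF i lip] bounded_g by blast

lemma psi_chi[simp]: "psi (chi y) = y"
 unfolding unshear_def using bij_chi by (simp add: bij_is_inj inv_f_f)

lemma chi_psi[simp]: "chi (psi x) = x"
 unfolding unshear_def using bij_chi by (simp add: bij_is_surj surj_f_inv_f)

lemma J_bounds: "1 / 2 <= J y" "J y <= 3 / 2"
 using partial_le[of y] by (auto simp: abs_le_iff)

lemma cont_g: "continuous_on S g"
 using smooth[of 0] by (auto intro: continuous_on_subset)

lemma cont_partial: "e \<in> Basis ==> continuous_on S (partial_within UNIV e g)"
 using smooth[of "Suc 0"] by (auto intro: continuous_on_subset)

lemma cont_chi: "continuous_on S chi"
 unfolding shear_def[abs_def] by (intro continuous_intros cont_g)

lemma cont_psi: "continuous_on S psi"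
 unfolding continuous_on_iff
proof (intro ballI allI impI)
 fix x and e :: real assume "e > 0"
 moreover have "dist (psi x') (psi x) < e" if "dist x' x < e / 2" for x'
  using shear_expands[OF i lip, of "psi x'" "psi x"] that by (simp add: dist_norm)
 ultimately show "\<exists>d>0. \<forall>x'\<in>S. dist x' x < d \<longrightarrow> dist (psi x') (psi x) < e"
  by (intro exI[of _ "e / 2"]) simp
qed

lemma measurable_shear[measurable]: "chi \<in> borel_measurable borel" "psi \<in> borel_measurable borel" "J \<in> borel_measurable borel"
 "g \<in> borel_measurable borel"
 using cont_chi cont_psi cont_partial[OF i] cont_g by (auto intro!: borel_measurable_continuous_onI continuous_intros)

lemma psi_fixed: "g x = 0 ==> psi x = x"
 using psi_chi[of x] by (simp add: shear_def)

lemma psi_mem: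
 assumes "!!x. x \<notin> D ==> g x = 0" shows "psi x \<in> D \<longleftrightarrow> x \<in> D"
proof
 show "x \<in> D" if "psi x \<in> D"
 proof (rule ccontr)
  assume "x \<notin> D"
  then have "psi x = x" using assms psi_fixed by blast
  then show False using that \<open>x \<notin> D\<close> by simp
 qed
 show "psi x \<in> D" if "x \<in> D"
 proof (rule ccontr)
  assume n: "psi x \<notin> D"
  then have "chi (psi x) = psi x" using assms by (simp add: shear_def)
  then show False using n that by simp
 qed
qed

text \<open>On every line in direction \<open>i\<close> the shear is a one-dimensional change of variables with derivative \<open>J\<close>.\<close>

lemma nn_integral_shear:
 assumes [measurable]: "F \<in> borel_measurable borel"
 shows "(\<integral>\<^sup>+y. F (chi y) * ennreal (J y) \<partial>lborel) = (\<integral>\<^sup>+x. F x \<partial>lborel)"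
proof -
 obtain B where B: "!!x. abs (g x) <= B" using bounded_g by blast
 have line: "(\<integral>\<^sup>+t. F (chi (y + t *\<^sub>R i)) * ennreal (J (y + t *\<^sub>R i)) \<partial>(lborel::real measure)) = (\<integral>\<^sup>+t. F (y + t *\<^sub>R i) \<partial>(lborel::real measure))" for y
 proof -
  have "(\<integral>\<^sup>+t. (%t. F (y + t *\<^sub>R i)) (t - g (y + t *\<^sub>R i)) * ennreal (J (y + t *\<^sub>R i)) \<partial>(lborel::real measure)) = (\<integral>\<^sup>+t. F (y + t *\<^sub>R i) \<partial>(lborel::real measure))"
  proof (rule nn_integral_substitution_line[where B=B])
   fix t :: real
   have "((%s. g (y + t *\<^sub>R i + s *\<^sub>R i)) has_real_derivative partial_within UNIV i g (y + t *\<^sub>R i)) (at (t + - t))"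
    using Ck_on_partial[OF smooth[of "Suc 0"] i, of "y + t *\<^sub>R i"] by simp
   from this[unfolded DERIV_shift]
   have "((%s. g (y + s *\<^sub>R i)) has_real_derivative partial_within UNIV i g (y + t *\<^sub>R i)) (at t)" by (simp add: algebra_simps)
   then show "((%t. t - g (y + t *\<^sub>R i)) has_real_derivative J (y + t *\<^sub>R i)) (at t)" by (intro DERIV_diff DERIV_ident)
   show "0 <= J (y + t *\<^sub>R i)" using J_bounds(1)[of "y + t *\<^sub>R i"] by linarith
   show "abs (t - g (y + t *\<^sub>R i) - t) <= B" using B by simp
  next
   show "continuous_on UNIV (%t. J (y + t *\<^sub>R i))"
    by (intro continuous_intros continuous_on_compose2[OF cont_partial[OF i, of UNIV]]) auto
  qed measurable
  then show ?thesis by (simp add: shear_def algebra_simps)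
 qed
 have "(\<integral>\<^sup>+y. F (chi y) * ennreal (J y) \<partial>lborel) = (\<integral>\<^sup>+y. indicator {0..1} (y \<bullet> i) * (\<integral>\<^sup>+t. F (chi (y + t *\<^sub>R i)) * ennreal (J (y + t *\<^sub>R i)) \<partial>(lborel::real measure)) \<partial>lborel)"
  by (rule nn_integral_along_lines[OF _ i]) measurable
 also have "... = (\<integral>\<^sup>+x. F x \<partial>lborel)"
  unfolding line by (rule nn_integral_along_lines[OF _ i, symmetric]) measurable
 finally show ?thesis .
qed

lemma distr_shear: "distr (density lborel (%y. ennreal (J y))) borel chi = lborel"
proof (rule measure_eqI)
 fix A assume "A \<in> sets (distr (density lborel (%y. ennreal (J y))) borel chi)"
 then have [measurable]: "A \<in> sets borel" by simp
 have "emeasure (distr (density lborel (%y. ennreal (J y))) borel chi) A = (\<integral>\<^sup>+y. ennreal (J y) * indicator (chi -` A) y \<partial>lborel)"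
  using measurable_sets_borel[OF measurable_shear(1)] by (simp add: emeasure_distr emeasure_density)
 also have "... = (\<integral>\<^sup>+y. indicator A (chi y) * ennreal (J y) \<partial>lborel)"
  by (intro nn_integral_cong) (auto simp: indicator_def)
 also have "... = emeasure lborel A" by (subst nn_integral_shear) auto
 finally show "emeasure (distr (density lborel (%y. ennreal (J y))) borel chi) A = emeasure lborel A" .
qed simp

lemma integral_shear:
 fixes F :: "'a => real"
 assumes [measurable]: "F \<in> borel_measurable borel"
 shows "(LINT x|lborel. F x) = (LINT y|lborel. J y * F (chi y))"
  and "integrable lborel F \<longleftrightarrow> integrable lborel (%y. J y * F (chi y))"
proof -
 have Jn: "0 <= J y" for y using J_bounds(1)[of y] by linarith
 have "(LINT x|lborel. F x) = (LINT x|distr (density lborel (%y. ennreal (J y))) borel chi. F x)" by (simp only: distr_shear)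
 also have "... = (LINT y|density lborel (%y. ennreal (J y)). F (chi y))" by (rule integral_distr) measurable
 also have "... = (LINT y|lborel. J y * F (chi y))" using Jn by (subst integral_density) auto
 finally show "(LINT x|lborel. F x) = (LINT y|lborel. J y * F (chi y))" .
 have "integrable lborel F \<longleftrightarrow> integrable (distr (density lborel (%y. ennreal (J y))) borel chi) F" by (simp only: distr_shear)
 also have "... \<longleftrightarrow> integrable (density lborel (%y. ennreal (J y))) (%y. F (chi y))" by (rule integrable_distr_eq) measurable
 also have "... \<longleftrightarrow> integrable lborel (%y. J y * F (chi y))" using Jn by (subst integrable_density) auto
 finally show "integrable lborel F \<longleftrightarrow> integrable lborel (%y. J y * F (chi y))" .
qed

lemma nn_integral_psi:
 assumes [measurable]: "F \<in> borel_measurable borel"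
 shows "(\<integral>\<^sup>+x. F (psi x) \<partial>lborel) = (\<integral>\<^sup>+y. F y * ennreal (J y) \<partial>lborel)"
 using nn_integral_shear[of "%x. F (psi x)"] by simp

lemma nn_integral_psi_le:
 assumes [measurable]: "F \<in> borel_measurable borel"
 shows "(\<integral>\<^sup>+x. F (psi x) \<partial>lborel) <= 2 * (\<integral>\<^sup>+y. F y \<partial>lborel)"
proof -
 have "(\<integral>\<^sup>+y. F y * ennreal (J y) \<partial>lborel) <= (\<integral>\<^sup>+y. 2 * F y \<partial>lborel)"
 proof (rule nn_integral_mono)
  fix y
  have "ennreal (J y) <= ennreal 2" using J_bounds(2)[of y] by (intro ennreal_leI) linarith
  then show "F y * ennreal (J y) <= 2 * F y" by (subst mult.commute) (simp add: mult_right_mono)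
 qed
 then show ?thesis by (simp add: nn_integral_psi nn_integral_cmult)
qed

lemma integrable_psi:
 fixes F :: "'a => real"
 assumes F: "integrable lborel F" shows "integrable lborel (%x. F (psi x))"
proof -
 have [measurable]: "F \<in> borel_measurable borel" using F by auto
 have "integrable lborel (%y. F y * J y)"
 proof (rule integrable_bounded_finite[OF F, of _ 2])
  show "abs (J y) <= 2" for y using partial_le[of y] by linarith
 qed measurable
 then show ?thesis by (subst integral_shear(2)) (auto simp: mult.commute)
qed

lemma test_function_chi:
 assumes phi: "test_function Om phi" and g0: "!!x. x \<notin> Om ==> g x = 0"
 shows "test_function Om (%y. phi (chi y))"
proof -
 obtain K where K: "compact K" "K \<subseteq> Om" "!!x. x \<notin> K ==> phi x = 0" using test_function_support[OF phi] by blast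
 show ?thesis
 proof (rule test_functionI[of _ "psi ` K"])
  show "Ck_on k UNIV (%y. phi (chi y))" for k
   using Ck_on_shear[OF test_function_Ck[OF phi] smooth i, of k 1] by (simp add: shear_def)
  show "compact (psi ` K)" by (rule compact_continuous_image[OF cont_psi K(1)])
  show "psi ` K \<subseteq> Om" using K(2) psi_mem[OF g0] by auto
  show "y \<in> psi ` K" if "phi (chi y) \<noteq> 0" for y
   using K(3)[of "chi y"] that by (metis imageI psi_chi)
 qed
qed

end

text \<open>Composition with the inverse shear: all derivatives can be moved to the test function, because the cofactors of
  the shear are divergence free.\<close>

lemma has_weak_partial_unshear:
 fixes Om :: "(real^'n) set"
 assumes sm: "shear_map (axis k 1) g" and O: "open Om" and g0: "!!x. x \<notin> Om ==> g x = 0"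
  and U: "integrable lborel U" and W: "!!j. integrable lborel (W j)" and wp: "!!j. has_weak_partial Om j U (W j)"
 shows "has_weak_partial Om j (%x. U (unshear (axis k 1) g x))
  (%x. W j (unshear (axis k 1) g x) + partial_within UNIV (axis j 1) g (unshear (axis k 1) g x)
    / (1 - partial_within UNIV (axis k 1) g (unshear (axis k 1) g x)) * W k (unshear (axis k 1) g x))"
proof -
 interpret shear_map "axis k 1" g by (rule sm)
 let ?e = "axis j 1 :: real^'n" and ?i = "axis k 1 :: real^'n"
 let ?P = "partial_within UNIV"
 have e: "?e \<in> Basis" by (simp add: axis_in_Basis_iff)
 have [measurable]: "U \<in> borel_measurable borel" "W l \<in> borel_measurable borel" for l using U W[of l] by auto
 have [measurable]: "?P ?e g \<in> borel_measurable borel" by (rule borel_measurable_continuous_onI[OF cont_partial[OF e]])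
 define V where "V y = W j y + ?P ?e g y / J y * W k y" for y
 have [measurable]: "V \<in> borel_measurable borel" unfolding V_def by measurable
 have Pb: "abs (?P ?e g y) <= 1 / 2" for y
 proof -
  have "((%h. (g (y + h *\<^sub>R ?e) - g y) / h) \<longlongrightarrow> ?P ?e g y) (at 0)"
   using Ck_on_partial[OF smooth[of "Suc 0"] e, of y] by (simp add: DERIV_def)
  then have "((%h. abs ((g (y + h *\<^sub>R ?e) - g y) / h)) \<longlongrightarrow> \<bar>?P ?e g y\<bar>) (at 0)" by (rule tendsto_rabs)
  moreover have "eventually (%h. abs ((g (y + h *\<^sub>R ?e) - g y) / h) <= 1 / 2) (at 0)"
  proof (rule eventually_at_topological[THEN iffD2], intro exI[of _ UNIV] conjI ballI impI)
   fix h :: real assume h: "h \<noteq> 0"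
   have "abs (g (y + h *\<^sub>R ?e) - g y) <= abs h / 2" using lip[of "y + h *\<^sub>R ?e" y] by simp
   then show "abs ((g (y + h *\<^sub>R ?e) - g y) / h) <= 1 / 2" using h by (simp add: abs_divide pos_divide_le_eq)
  qed auto
  ultimately show ?thesis by (rule tendsto_upperbound) simp
 qed
 have Jp: "J y > 0" for y using J_bounds(1)[of y] by linarith
 have "integrable lborel (%y. W k y * (?P ?e g y / J y))"
 proof (rule integrable_bounded_finite[OF W, of _ 1])
  show "abs (?P ?e g y / J y) <= 1" for y using Pb[of y] J_bounds(1)[of y] by (simp add: abs_divide divide_le_eq)
 qed measurable
 then have Vi: "integrable lborel V" unfolding V_def using W[of j] by (simp add: mult.commute)
 have Upsi: "integrable lborel (%x. U (psi x))" and Vpsi: "integrable lborel (%x. V (psi x))"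
  by (rule integrable_psi[OF U] integrable_psi[OF Vi])+
 have "(LINT x|lborel. U (psi x) * ?P ?e phi x) = - (LINT x|lborel. V (psi x) * phi x)" if phi: "test_function Om phi" for phi
 proof -
  note phie = test_function_partial[OF phi e]
  have [measurable]: "phi \<in> borel_measurable borel" "?P ?e phi \<in> borel_measurable borel"
   using test_function_measurable[OF phi] test_function_measurable[OF phie] by auto
  \<comment> \<open>After the change of variables, \<open>phi \<circ> chi\<close> and its products with derivatives of \<open>g\<close> serve as test functions.\<close>
  define f where "f y = phi (chi y)" for y
  have f: "test_function Om f" unfolding f_def by (rule test_function_chi[OF phi g0])
  have fC: "Ck_on (Suc 0) UNIV f" by (rule test_function_Ck[OF f])
  have Pf: "?P b f y = ?P b phi (chi y) - ?P b g y * ?P ?i phi (chi y)" if b: "b \<in> Basis" for b y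
   using partialI(2)[OF shear_partial[OF test_function_Ck[OF phi] smooth b i, where z=y and h=1]] by (simp add: f_def[abs_def] shear_def)
  have Pe: "Ck_on m UNIV (?P ?e g)" and Pi: "Ck_on m UNIV (?P ?i g)" for m using smooth[of "Suc m"] e i by auto
  have JC: "Ck_on m UNIV J" for m by (intro Ck_on_diff Ck_on_const Pi)
  define T1 where "T1 y = J y * f y" for y
  define T2 where "T2 y = ?P ?e g y * f y" for y
  have T1: "test_function Om T1" unfolding T1_def[abs_def] by (rule test_function_mult[OF f JC])
  have T2: "test_function Om T2" unfolding T2_def[abs_def] by (rule test_function_mult[OF f Pe])
  have PJ: "?P ?e J y = - ?P ?e (?P ?i g) y" for y
  proof (rule partialI(2))
   show "((%t. 1 - ?P ?i g (y + t *\<^sub>R ?e)) has_real_derivative - ?P ?e (?P ?i g) y) (at 0)"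
    using DERIV_diff[OF DERIV_const[of 1] Ck_on_partial[OF Pi[of "Suc 0"] e, of y]] by simp
  qed
  have comm: "?P ?e (?P ?i g) y = ?P ?i (?P ?e g) y" for y by (rule partials_commute[OF smooth i e])
  have PT1: "?P ?e T1 y = - ?P ?e (?P ?i g) y * f y + ?P ?e f y * J y" for y
   unfolding T1_def[abs_def] using partial_mult[OF JC fC e, of y] by (simp add: PJ)
  have PT2: "?P ?i T2 y = ?P ?i (?P ?e g) y * f y + ?P ?i f y * ?P ?e g y" for y
   unfolding T2_def[abs_def] by (rule partial_mult[OF Pe fC i])
  have key: "J y * ?P ?e phi (chi y) = ?P ?e T1 y + ?P ?i T2 y" for y
   unfolding PT1 PT2 comm Pf[OF e] Pf[OF i] by (simp add: algebra_simps)
  have I: "integrable lborel (%y. h y * T y)" if h: "integrable lborel h" and T: "test_function Om T" for h T :: "real^'n => real"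
  proof -
   obtain B where B: "B > 0" "!!x. abs (T x) <= B" using test_function_bounded[OF T] by blast
   show ?thesis by (rule integrable_bounded_finite[OF h _ B(2)]) (use test_function_measurable[OF T] in simp)
  qed
  have wpE: "(LINT y|lborel. U y * ?P (axis l 1) T y) = - (LINT y|lborel. W l y * T y)" if "test_function Om T" for l T
   using wp[of l] that by (subst (asm) has_weak_partial_borel[OF O]) auto
  have "(LINT x|lborel. U (psi x) * ?P ?e phi x) = (LINT y|lborel. U y * ?P ?e T1 y + U y * ?P ?i T2 y)"
   by (subst integral_shear(1)) (auto simp: distrib_left[symmetric] key[symmetric] mult_ac)
  also have "... = - (LINT y|lborel. W j y * T1 y) - (LINT y|lborel. W k y * T2 y)"
   using I[OF U test_function_partial[OF T1 e]] I[OF U test_function_partial[OF T2 i]] wpE[OF T1] wpE[OF T2] by simp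
  also have "... = - (LINT y|lborel. W j y * T1 y + W k y * T2 y)"
   using I[OF W T1] I[OF W T2] by simp
  also have "(LINT y|lborel. W j y * T1 y + W k y * T2 y) = (LINT x|lborel. V (psi x) * phi x)"
  proof -
   have "J y * (V (psi (chi y)) * phi (chi y)) = W j y * T1 y + W k y * T2 y" for y
    using Jp[of y] by (simp add: V_def T1_def T2_def f_def field_simps)
   then show ?thesis by (subst integral_shear(1)) auto
  qed
  finally show ?thesis .
 qed
 then have "has_weak_partial Om j (%x. U (psi x)) (%x. V (psi x))"
  using Upsi Vpsi by (subst has_weak_partial_borel[OF O]) (auto intro: loc_integrable_borel_integrable)
 then show ?thesis by (simp add: V_def)
qed

section \<open>The integrand along lines\<close>

lemma sum_Basis_pair_vec:
 fixes f :: "(real^'m) \<times> (real^'m) => real"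
 shows
 "(\<Sum>b\<in>Basis. f (b :: (real^'m) \<times> (real^'m))) = (\<Sum>al\<in>UNIV. f (axis al 1, 0)) + (\<Sum>al\<in>UNIV. f (0, axis al 1))"
proof -
 have B: "(Basis :: (real^'m) set) = range (%al. axis al 1)" by (auto simp: Basis_vec_def)
 have inj: "inj (%al. axis al (1::real) :: real^'m)" by (auto simp: inj_def axis_eq_axis)
 have s: "(\<Sum>u\<in>(Basis :: (real^'m) set). h u) = (\<Sum>al\<in>UNIV. h (axis al 1))" for h :: "real^'m => real"
  unfolding B by (simp add: sum.reindex[OF inj])
 have "(\<Sum>b\<in>Basis. f b) = (\<Sum>u\<in>Basis. f (u, 0)) + (\<Sum>u\<in>Basis. f (0, u))"
  unfolding Basis_prod_def by (subst sum.union_disjoint) (auto simp: sum.reindex inj_on_def)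
 then show ?thesis by (simp add: s)
qed

lemma pair_axis_in_Basis: "(axis al 1, 0) \<in> (Basis :: ((real^'m) \<times> (real^'m)) set)" "(0, axis al 1) \<in> (Basis :: ((real^'m) \<times> (real^'m)) set)"
 by (auto simp: Basis_prod_def axis_in_Basis_iff)

lemma interior_orthant:
 fixes s x :: "real^'m"
 assumes "!!al. 0 < s $ al" "!!al. 0 < x $ al"
 shows "(s, x) \<in> interior (orthant \<times> orthant)"
proof -
 have "v \<in> interior orthant" if "!!al. 0 < v $ al" for v :: "real^'m"
 proof (rule interiorI)
  show "open (\<Inter>al. {v :: real^'m. 0 < v $ al})" by (intro open_INT) (auto intro!: open_Collect_less continuous_intros)
 qed (use that in \<open>auto simp: orthant_def intro: less_imp_le\<close>)
 then show ?thesis using assms by (simp add: interior_Times)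
qed

text \<open>At interior points the one-sided derivatives are ordinary ones, so the usual chain rule applies.\<close>

lemma orthant_chain:
 fixes F :: "(real^'m) \<times> (real^'m) => real"
 assumes F: "Ck_on (Suc 0) (orthant \<times> orthant) F"
  and a: "!!al. (a al has_real_derivative a' al) (at sg)" and b: "!!al. (b al has_real_derivative b' al) (at sg)"
  and pos: "!!al. 0 < a al sg" "!!al. 0 < b al sg"
 shows "((%sg. F (\<chi> al. a al sg, \<chi> al. b al sg)) has_real_derivative
  (\<Sum>al\<in>UNIV. a' al * d_s al F (\<chi> al. a al sg, \<chi> al. b al sg)) + (\<Sum>al\<in>UNIV. b' al * d_xi al F (\<chi> al. a al sg, \<chi> al. b al sg))) (at sg)"
proof -
 let ?O = "orthant \<times> orthant :: ((real^'m) \<times> (real^'m)) set"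
 let ?R = "%sg. (\<chi> al. a al sg, \<chi> al. b al sg)" and ?R' = "(\<chi> al. a' al, \<chi> al. b' al)"
 have in1: "?R sg \<in> interior ?O" using pos by (intro interior_orthant) auto
 have dF: "(F has_derivative (%v. \<Sum>e\<in>Basis. (v \<bullet> e) * partial_within ?O e F (?R sg))) (at (?R sg))"
 proof (rule has_derivative_of_continuous_partials[OF open_interior in1])
  show "((%t. F (z + t *\<^sub>R e)) has_real_derivative partial_within ?O e F z) (at 0)"
   if "e \<in> Basis" "z \<in> interior ?O" for e z
   using F that interior_subset[of ?O] by (intro has_partial_within_interior) auto
  show "continuous_on (interior ?O) (partial_within ?O e F)" if "e \<in> Basis" for e
   using F that interior_subset[of ?O] by (auto intro: continuous_on_subset)
 qed
 have "(?R has_derivative (%h. h *\<^sub>R ?R')) (at sg)"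
 proof (subst has_derivative_componentwise_within, intro ballI)
  fix e :: "(real^'m) \<times> (real^'m)" assume "e \<in> Basis"
  then consider al where "e = (axis al 1, 0)" | al where "e = (0, axis al 1)" by (auto simp: Basis_prod_def Basis_vec_def)
  then show "((%sg. ?R sg \<bullet> e) has_derivative (%h. h *\<^sub>R ?R' \<bullet> e)) (at sg)"
  proof cases
   case (1 al) then show ?thesis using has_derivative_eq_rhs[OF a[of al, unfolded has_field_derivative_def], of "%h. h * a' al"]
    by (simp add: inner_axis fun_eq_iff mult.commute)
  next
   case (2 al) then show ?thesis using has_derivative_eq_rhs[OF b[of al, unfolded has_field_derivative_def], of "%h. h * b' al"]
    by (simp add: inner_axis fun_eq_iff mult.commute)
  qed
 qed
 from has_derivative_compose[OF this dF]
 have "((%sg. F (?R sg)) has_derivative (%h. \<Sum>e\<in>Basis. (h *\<^sub>R ?R' \<bullet> e) * partial_within ?O e F (?R sg))) (at sg)" .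
 then show ?thesis
  unfolding has_field_derivative_def sum_Basis_pair_vec
  by (rule has_derivative_eq_rhs) (auto simp: inner_axis d_s_def d_xi_def sum_distrib_left sum_distrib_right distrib_left mult_ac)
qed

definition hess_form :: "((real^'m) \<times> (real^'m) => real) => real^'m => real^'m => real^'m => real^'m => real" where
 "hess_form G s xi v w = (\<Sum>al\<in>UNIV. \<Sum>\<beta>\<in>UNIV.
      d_s \<beta> (d_s al G) (s, xi) * (v $ al) * (v $ \<beta>)
     + d_xi \<beta> (d_s al G) (s, xi) * (v $ al) * (w $ \<beta>)
     + d_s \<beta> (d_xi al G) (s, xi) * (w $ al) * (v $ \<beta>)
     + d_xi \<beta> (d_xi al G) (s, xi) * (w $ al) * (w $ \<beta>))"

lemma rpow_pos: "x > 0 ==> rpow x a = x powr a"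
 by (simp add: rpow_def)

lemma norm_vec_pos: "(!!al. 0 < s $ al) ==> norm (s :: real^'m) > 0"
 by (metis less_irrefl zero_less_norm_iff zero_index)

text \<open>The quantitative content of the hypothesis at points with positive coordinates, where \<open>rpow\<close> and \<open>powr\<close> agree.\<close>

definition H2_bounds :: "real => ((real^'m) \<times> (real^'m) => real) => real => real => bool" where
 "H2_bounds q G \<theta> L \<longleftrightarrow> \<theta> > 0 & L > 1 & (\<forall>s xi. (\<forall>al. 0 < s $ al) & (\<forall>al. 0 < xi $ al) \<longrightarrow>
  (\<forall>v w. \<theta> * (norm s powr (q - 2) + norm xi powr (q - 2)) * ((norm v)^2 + (norm w)^2) <= hess_form G s xi v w) \<and>
  (\<forall>al \<beta>. 0 <= d_xi al G (s, xi) & d_xi al G (s, xi) <= L * (norm s powr (q - 1) + norm xi powr (q - 1)) \<and>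
   0 <= d_s al G (s, xi) & d_s al G (s, xi) <= L * (norm s powr (q - 1) + norm xi powr (q - 1)) \<and>
   \<bar>d_s \<beta> (d_s al G) (s, xi)\<bar> <= L * (norm s powr (q - 2) + norm xi powr (q - 2)) \<and>
   \<bar>d_xi \<beta> (d_xi al G) (s, xi)\<bar> <= L * (norm s powr (q - 2) + norm xi powr (q - 2))))"

lemma H2_boundsD:
 assumes "H2_bounds q G \<theta> L" "!!al. 0 < s $ al" "!!al. 0 < xi $ al"
 shows "\<theta> * (norm s powr (q - 2) + norm xi powr (q - 2)) * ((norm v)^2 + (norm w)^2) <= hess_form G s xi v w"
  and "0 <= d_xi al G (s, xi) & d_xi al G (s, xi) <= L * (norm s powr (q - 1) + norm xi powr (q - 1)) \<and>
   0 <= d_s al G (s, xi) & d_s al G (s, xi) <= L * (norm s powr (q - 1) + norm xi powr (q - 1)) \<and>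
   \<bar>d_s \<beta> (d_s al G) (s, xi)\<bar> <= L * (norm s powr (q - 2) + norm xi powr (q - 2)) \<and>
   \<bar>d_xi \<beta> (d_xi al G) (s, xi)\<bar> <= L * (norm s powr (q - 2) + norm xi powr (q - 2))"
 using assms unfolding H2_bounds_def by auto

lemma H2D:
 fixes G :: "(real^'m) \<times> (real^'m) => real"
 assumes "H2 q G"
 shows "\<exists>\<theta> L. H2_bounds q G \<theta> L"
proof -
 from assms obtain \<theta> where \<theta>: "\<theta> > 0" "!!s xi v w. s \<in> orthant ==> xi \<in> orthant ==>
   \<theta> * (rpow (norm s) (q - 2) + rpow (norm xi) (q - 2)) * ((norm v)^2 + (norm w)^2) <= hess_form G s xi v w"
  unfolding H2_def hess_form_def by blast
 from assms obtain L where L: "L > 1" "!!s xi al \<beta>. s \<in> orthant ==> xi \<in> orthant ==>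
   0 <= d_xi al G (s, xi) & d_xi al G (s, xi) <= L * (norm s powr (q - 1) + norm xi powr (q - 1)) \<and>
   0 <= d_s al G (s, xi) & d_s al G (s, xi) <= L * (norm s powr (q - 1) + norm xi powr (q - 1)) \<and>
   \<bar>d_s \<beta> (d_s al G) (s, xi)\<bar> <= L * (rpow (norm s) (q - 2) + rpow (norm xi) (q - 2)) \<and>
   \<bar>d_xi \<beta> (d_xi al G) (s, xi)\<bar> <= L * (rpow (norm s) (q - 2) + rpow (norm xi) (q - 2))"
  unfolding H2_def by blast
 have o: "s \<in> orthant" "rpow (norm s) (q - 2) = norm s powr (q - 2)" if "!!al. 0 < s $ al" for s :: "real^'m"
  using that norm_vec_pos[OF that] by (auto simp: orthant_def rpow_pos less_imp_le)
 have "H2_bounds q G \<theta> L"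
  unfolding H2_bounds_def
 proof (intro conjI \<theta>(1) L(1) allI impI, elim conjE)
  fix s xi v w :: "real^'m" assume "\<forall>al. 0 < s $ al" "\<forall>al. 0 < xi $ al"
  then have p: "!!al. 0 < s $ al" "!!al. 0 < xi $ al" by auto
  show "\<theta> * (norm s powr (q - 2) + norm xi powr (q - 2)) * ((norm v)^2 + (norm w)^2) <= hess_form G s xi v w"
   using \<theta>(2)[OF o(1)[OF p(1)] o(1)[OF p(2)], of v w] o(2)[OF p(1)] o(2)[OF p(2)] by simp
 next
  fix s xi :: "real^'m" and al \<beta> assume a: "(\<forall>al. 0 < s $ al) & (\<forall>al. 0 < xi $ al)"
  have p: "!!al. 0 < s $ al" "!!al. 0 < xi $ al" using a by auto
  note l = L(2)[OF o(1)[OF p(1)] o(1)[OF p(2)], of al \<beta>, unfolded o(2)[OF p(1)] o(2)[OF p(2)]]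
  show "0 <= d_xi al G (s, xi)" "d_xi al G (s, xi) <= L * (norm s powr (q - 1) + norm xi powr (q - 1))"
   "0 <= d_s al G (s, xi)" "d_s al G (s, xi) <= L * (norm s powr (q - 1) + norm xi powr (q - 1))"
   "abs (d_s \<beta> (d_s al G) (s, xi)) <= L * (norm s powr (q - 2) + norm xi powr (q - 2))"
   "abs (d_xi \<beta> (d_xi al G) (s, xi)) <= L * (norm s powr (q - 2) + norm xi powr (q - 2))"
   using l by blast+
 qed
 then show ?thesis by blast
qed

lemma H2_Ck:
 fixes G :: "(real^'m) \<times> (real^'m) => real"
 assumes "H2 q G"
 shows "Ck_on (Suc 0) (orthant \<times> orthant) G" "Ck_on (Suc 0) (orthant \<times> orthant) (d_s al G)" "Ck_on (Suc 0) (orthant \<times> orthant) (d_xi al G)"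
proof -
 have C2: "Ck_on (Suc (Suc 0)) (orthant \<times> orthant) G" using assms unfolding H2_def numeral_2_eq_2 by blast
 then show "Ck_on (Suc 0) (orthant \<times> orthant) G" by (rule Ck_on_SucD)
 have "\<forall>e\<in>Basis. Ck_on (Suc 0) (orthant \<times> orthant) (partial_within (orthant \<times> orthant) e G)"
  using C2 unfolding Ck_on.simps(2)[of "Suc 0"] by blast
 then show "Ck_on (Suc 0) (orthant \<times> orthant) (d_s al G)" "Ck_on (Suc 0) (orthant \<times> orthant) (d_xi al G)"
  unfolding d_s_def d_xi_def using pair_axis_in_Basis by blast+
qed

lemma hess_form_axis:
 "hess_form G s xi (axis al 1) 0 = d_s al (d_s al G) (s, xi)" "hess_form G s xi 0 (axis al 1) = d_xi al (d_xi al G) (s, xi)"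
proof -
 have "(\<Sum>a\<in>UNIV. \<Sum>b\<in>UNIV. h a b * (axis al 1 $ a) * (axis al 1 $ b)) = h al al" for h :: "'a => 'a => real"
 proof -
  have "(\<Sum>a\<in>UNIV. \<Sum>b\<in>UNIV. h a b * (axis al 1 $ a) * (axis al 1 $ b)) =
   (\<Sum>a\<in>UNIV. if a = al then (\<Sum>b\<in>UNIV. if b = al then h a b else 0) else 0)"
   by (intro sum.cong refl) (auto simp: axis_def if_distrib[of "%x. _ * x"] sum.delta cong: if_cong)
  then show ?thesis by (simp add: sum.delta if_distrib[of "%x. _ * x"] cong: if_cong)
 qed
 then show "hess_form G s xi (axis al 1) 0 = d_s al (d_s al G) (s, xi)" "hess_form G s xi 0 (axis al 1) = d_xi al (d_xi al G) (s, xi)"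
  by (simp_all add: hess_form_def)
qed

lemma norm_le_twice_componentwise:
 fixes s s' :: "real^'m"
 assumes "!!\<beta>. abs (s $ \<beta>) <= 2 * abs (s' $ \<beta>)" shows "norm s <= 2 * norm s'"
proof -
 have "norm s <= norm (2 *\<^sub>R s')" by (rule norm_le_componentwise_cart) (use assms in \<open>auto simp: abs_mult\<close>)
 then show ?thesis by simp
qed

lemma powr_half_bound:
 fixes x y :: real
 assumes "0 < x" "x <= 2 * y" "2 <= q"
 shows "2 powr (2 - q) * x powr (q - 2) <= y powr (q - 2)"
proof -
 have "x powr (q - 2) <= (2 * y) powr (q - 2)" using assms by (intro powr_mono2) auto
 also have "... = 2 powr (q - 2) * y powr (q - 2)" using assms by (simp add: powr_mult)
 finally have "2 powr (2 - q) * x powr (q - 2) <= 2 powr (2 - q) * (2 powr (q - 2) * y powr (q - 2))" by (intro mult_left_mono) auto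
 also have "... = y powr (q - 2)" by (simp add: mult.assoc[symmetric] powr_add[symmetric])
 finally show ?thesis .
qed

text \<open>The first derivative in a coordinate is nonnegative where that coordinate is halved, and from there ellipticity makes it
  grow.  This makes the composition with \<open>sqrt ((norm z)\<^sup>2 + eps)\<close> elliptic also orthogonally to \<open>z\<close>, where the norm
  itself does not change to first order.\<close>

lemma H2_first_derivative_lower:
 fixes G :: "(real^'m) \<times> (real^'m) => real"
 assumes H: "H2 q G" and q: "2 <= q"
 shows "\<exists>\<kappa>>0. \<forall>s xi al. (\<forall>al. 0 < s $ al) & (\<forall>al. 0 < xi $ al) \<longrightarrow>
   \<kappa> * (norm s powr (q - 2) + norm xi powr (q - 2)) * s $ al <= d_s al G (s, xi) \<and>
   \<kappa> * (norm s powr (q - 2) + norm xi powr (q - 2)) * xi $ al <= d_xi al G (s, xi)"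
proof -
 obtain \<theta> L where E: "H2_bounds q G \<theta> L" using H2D[OF H] by blast
 then have \<theta>: "\<theta> > 0" and L: "L > 1" by (auto simp: H2_bounds_def)
 note ell = H2_boundsD(1)[OF E] and bd = H2_boundsD(2)[OF E]
 \<comment> \<open>Half of the coordinate is used for integration; there the weight has lost at most the factor \<open>2 powr (2 - q)\<close>.\<close>
 define \<kappa> where "\<kappa> = \<theta> * 2 powr (2 - q) / 2"
 have \<kappa>: "\<kappa> > 0" using \<theta> by (simp add: \<kappa>_def)
 have step: "\<kappa> * W * r <= f r"
  if r: "r > 0" and der: "!!t. t > 0 ==> (f has_real_derivative f' t) (at t)"
   and f': "!!t. r / 2 <= t ==> t <= r ==> \<theta> * (2 powr (2 - q) * W) <= f' t" and f0: "f (r / 2) \<ge> 0" for f f' :: "real => real" and W r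
 proof -
  have "\<exists>t. r / 2 < t & t < r & f r - f (r / 2) = (r - r / 2) * f' t"
   by (rule MVT2) (use r der in auto)
  then obtain t where t: "r / 2 < t" "t < r" "f r - f (r / 2) = (r - r / 2) * f' t" by blast
  have "(r - r / 2) * (\<theta> * (2 powr (2 - q) * W)) <= (r - r / 2) * f' t" using f'[of t] t r by (intro mult_left_mono) auto
  then show ?thesis using t(3) f0 by (simp add: \<kappa>_def algebra_simps)
 qed
 show ?thesis
 proof (intro exI[of _ \<kappa>] conjI \<kappa> allI impI; elim conjE)
  fix s xi :: "real^'m" and al assume "\<forall>al. 0 < s $ al" "\<forall>al. 0 < xi $ al"
  then have p: "!!al. 0 < s $ al" "!!al. 0 < xi $ al" by auto
  let ?S = "%t. \<chi> \<beta>. if \<beta> = al then t else s $ \<beta>"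
  have eq: "?S (s $ al) = s" "(\<chi> \<beta>. xi $ \<beta>) = xi" by (simp_all add: vec_eq_iff)
  have pS: "0 < ?S t $ \<beta>" if "t > 0" for t \<beta> using that p by simp
  have "\<kappa> * (norm s powr (q - 2) + norm xi powr (q - 2)) * s $ al <= (%t. d_s al G (?S t, xi)) (s $ al)"
  proof (rule step)
   show "((%t. d_s al G (?S t, xi)) has_real_derivative d_s al (d_s al G) (?S t, xi)) (at t)" if "t > 0" for t
   proof -
    have "((%t. d_s al G (\<chi> \<beta>. if \<beta> = al then t else s $ \<beta>, \<chi> \<beta>. xi $ \<beta>)) has_real_derivative
     (\<Sum>\<beta>\<in>UNIV. (if \<beta> = al then 1 else 0) * d_s \<beta> (d_s al G) (?S t, \<chi> \<beta>. xi $ \<beta>)) + (\<Sum>\<beta>\<in>UNIV. 0 * d_xi \<beta> (d_s al G) (?S t, \<chi> \<beta>. xi $ \<beta>))) (at t)"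
     by (rule orthant_chain[OF H2_Ck(2)[OF H]]) (use that p in auto)
    then show ?thesis by (simp add: if_distrib[of "%x. x * _"] sum.delta cong: if_cong)
   qed
   show "\<theta> * (2 powr (2 - q) * (norm s powr (q - 2) + norm xi powr (q - 2))) <= d_s al (d_s al G) (?S t, xi)" if t: "s $ al / 2 <= t" "t <= s $ al" for t
   proof -
    have tp: "t > 0" using t p(1)[of al] by linarith
    have "norm s <= 2 * norm (?S t)" by (rule norm_le_twice_componentwise) (use t tp p less_imp_le[OF p(1)] in \<open>auto simp: abs_le_iff\<close>)
    then have "2 powr (2 - q) * norm s powr (q - 2) <= norm (?S t) powr (q - 2)"
     by (rule powr_half_bound[OF norm_vec_pos[OF p(1)] _ q])
    moreover have "2 powr (2 - q) * norm xi powr (q - 2) <= norm xi powr (q - 2)"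
     by (rule powr_half_bound[OF norm_vec_pos[OF p(2)] _ q]) simp
    ultimately have "\<theta> * (2 powr (2 - q) * (norm s powr (q - 2) + norm xi powr (q - 2))) <= \<theta> * (norm (?S t) powr (q - 2) + norm xi powr (q - 2))"
     using \<theta> by (intro mult_left_mono) (auto simp: distrib_left)
    also have "... <= d_s al (d_s al G) (?S t, xi)"
     using ell[OF pS[OF tp] p(2), of "axis al 1" 0] by (simp add: hess_form_axis)
    finally show ?thesis .
   qed
   show "0 <= d_s al G (?S (s $ al / 2), xi)" using bd[OF pS p(2), of "s $ al / 2" al al] p(1)[of al] by simp
  qed (rule p)
  then show "\<kappa> * (norm s powr (q - 2) + norm xi powr (q - 2)) * s $ al <= d_s al G (s, xi)" by (simp only: eq)
 next
  fix s xi :: "real^'m" and al assume "\<forall>al. 0 < s $ al" "\<forall>al. 0 < xi $ al"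
  then have p: "!!al. 0 < s $ al" "!!al. 0 < xi $ al" by auto
  let ?S = "%t. \<chi> \<beta>. if \<beta> = al then t else xi $ \<beta>"
  have eq: "?S (xi $ al) = xi" "(\<chi> \<beta>. s $ \<beta>) = s" by (simp_all add: vec_eq_iff)
  have pS: "0 < ?S t $ \<beta>" if "t > 0" for t \<beta> using that p by simp
  have "\<kappa> * (norm s powr (q - 2) + norm xi powr (q - 2)) * xi $ al <= (%t. d_xi al G (s, ?S t)) (xi $ al)"
  proof (rule step)
   show "((%t. d_xi al G (s, ?S t)) has_real_derivative d_xi al (d_xi al G) (s, ?S t)) (at t)" if "t > 0" for t
   proof -
    have "((%t. d_xi al G (\<chi> \<beta>. s $ \<beta>, \<chi> \<beta>. if \<beta> = al then t else xi $ \<beta>)) has_real_derivative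
     (\<Sum>\<beta>\<in>UNIV. 0 * d_s \<beta> (d_xi al G) (\<chi> \<beta>. s $ \<beta>, ?S t)) + (\<Sum>\<beta>\<in>UNIV. (if \<beta> = al then 1 else 0) * d_xi \<beta> (d_xi al G) (\<chi> \<beta>. s $ \<beta>, ?S t))) (at t)"
     by (rule orthant_chain[OF H2_Ck(3)[OF H]]) (use that p in auto)
    then show ?thesis by (simp add: if_distrib[of "%x. x * _"] sum.delta cong: if_cong)
   qed
   show "\<theta> * (2 powr (2 - q) * (norm s powr (q - 2) + norm xi powr (q - 2))) <= d_xi al (d_xi al G) (s, ?S t)" if t: "xi $ al / 2 <= t" "t <= xi $ al" for t
   proof -
    have tp: "t > 0" using t p(2)[of al] by linarith
    have "norm xi <= 2 * norm (?S t)" by (rule norm_le_twice_componentwise) (use t tp p less_imp_le[OF p(2)] in \<open>auto simp: abs_le_iff\<close>)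
    then have "2 powr (2 - q) * norm xi powr (q - 2) <= norm (?S t) powr (q - 2)"
     by (rule powr_half_bound[OF norm_vec_pos[OF p(2)] _ q])
    moreover have "2 powr (2 - q) * norm s powr (q - 2) <= norm s powr (q - 2)"
     by (rule powr_half_bound[OF norm_vec_pos[OF p(1)] _ q]) simp
    ultimately have "\<theta> * (2 powr (2 - q) * (norm s powr (q - 2) + norm xi powr (q - 2))) <= \<theta> * (norm s powr (q - 2) + norm (?S t) powr (q - 2))"
     using \<theta> by (intro mult_left_mono) (auto simp: distrib_left)
    also have "... <= d_xi al (d_xi al G) (s, ?S t)"
     using ell[OF p(1) pS[OF tp], of 0 "axis al 1"] by (simp add: hess_form_axis)
    finally show ?thesis .
   qed
   show "0 <= d_xi al G (s, ?S (xi $ al / 2))" using bd[OF p(1) pS, of "xi $ al / 2" al al] p(2)[of al] by simp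
  qed (rule p)
  then show "\<kappa> * (norm s powr (q - 2) + norm xi powr (q - 2)) * xi $ al <= d_xi al G (s, xi)" by (simp only: eq)
 qed
qed

text \<open>The regularized norm of a point that moves on a line: \<open>A + 2 B t + C t\<^sup>2\<close> is its squared norm, \<open>C\<close> that of the direction,
  and \<open>B\<^sup>2 \<le> A C\<close> is the Cauchy-Schwarz inequality.\<close>

definition quad :: "real => real => real => real => real => real" where
 "quad eps A B C t = sqrt (A + 2 * B * t + C * t^2 + eps)"

lemma quad_nonneg:
 fixes t :: real
 assumes "0 <= A" "0 <= C" "B^2 <= A * C" shows "0 <= A + 2 * B * t + C * t^2"
proof (cases "C = 0")
 case True then show ?thesis using assms by simp
next
 case False
 then have C: "C > 0" using assms by simp
 have "C * (A + 2 * B * t + C * t^2) = (B + C * t)^2 + (A * C - B^2)" by (simp add: power2_eq_square algebra_simps)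
 also have "... \<ge> 0" using assms by simp
 finally show ?thesis using C by (simp add: zero_le_mult_iff)
qed

text \<open>The second derivative of the regularized norm is the part of the squared speed \<open>C\<close> that its first derivative does not
  see, divided by the norm; in particular it is nonnegative.\<close>

lemma quad_facts:
 assumes A: "0 <= A" "0 <= C" "B^2 <= A * C" and e: "eps > 0"
 shows "quad eps A B C t > 0"
  and "(quad eps A B C has_real_derivative (B + C * t) / quad eps A B C t) (at t)"
  and "((%t. (B + C * t) / quad eps A B C t) has_real_derivative (C - ((B + C * t) / quad eps A B C t)^2) / quad eps A B C t) (at t)"
  and "((B + C * t) / quad eps A B C t)^2 <= C"
proof -
 have pos: "0 < A + 2 * B * t + C * t^2 + eps" for t using quad_nonneg[OF A, of t] e by linarith
 show p: "quad eps A B C t > 0" using pos[of t] by (simp add: quad_def)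
 have sq: "(quad eps A B C t)^2 = A + 2 * B * t + C * t^2 + eps" using pos[of t] by (simp add: quad_def)
 show d: "(quad eps A B C has_real_derivative (B + C * t) / quad eps A B C t) (at t)"
  unfolding quad_def[abs_def] using pos[of t]
  by (auto intro!: derivative_eq_intros simp: field_simps)
 have "((%t. (B + C * t) / quad eps A B C t) has_real_derivative
   (C * quad eps A B C t - (B + C * t) * ((B + C * t) / quad eps A B C t)) / (quad eps A B C t * quad eps A B C t)) (at t)"
  by (rule DERIV_divide[OF _ d]) (use p in \<open>auto intro!: derivative_eq_intros\<close>)
 then show "((%t. (B + C * t) / quad eps A B C t) has_real_derivative (C - ((B + C * t) / quad eps A B C t)^2) / quad eps A B C t) (at t)"
  by (rule DERIV_cong) (use p in \<open>simp add: divide_simps power2_eq_square\<close>)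
 have "(B + C * t)^2 = C * (A + 2 * B * t + C * t^2) - (A * C - B^2)" by (simp add: power2_eq_square algebra_simps)
 also have "... <= C * (quad eps A B C t)^2" unfolding sq distrib_left using A mult_nonneg_nonneg[OF A(2) less_imp_le[OF e]] by linarith
 finally show "((B + C * t) / quad eps A B C t)^2 <= C" using p by (simp add: power_divide divide_le_eq)
qed

lemma hess_form_le:
 fixes G :: "(real^'m) \<times> (real^'m) => real"
 assumes pos: "!!v w. 0 <= hess_form G s xi v w" and W: "W \<ge> 0"
  and b: "!!al \<beta>. abs (d_s \<beta> (d_s al G) (s, xi)) <= W" "!!al \<beta>. abs (d_xi \<beta> (d_xi al G) (s, xi)) <= W"
 shows "hess_form G s xi v w <= 2 * (real CARD('m))^2 * W * ((norm v)^2 + (norm w)^2)"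
proof -
 have dbl: "(\<Sum>al\<in>(UNIV::'m set). \<Sum>\<beta>\<in>(UNIV::'m set). h al \<beta> * (v $ al) * (v $ \<beta>)) <= (real CARD('m))^2 * W * (norm v)^2"
  if "!!al \<beta>. abs (h al \<beta>) <= W" for h and v :: "real^'m"
 proof -
  have "h al \<beta> * (v $ al) * (v $ \<beta>) <= W * (norm v)^2" for al \<beta>
  proof -
   have "h al \<beta> * (v $ al) * (v $ \<beta>) <= abs (h al \<beta>) * (abs (v $ al) * abs (v $ \<beta>))" by (metis abs_ge_self abs_mult mult.assoc)
   also have "... <= W * (norm v * norm v)" using that W by (intro mult_mono component_le_norm_cart) auto
   finally show ?thesis by (simp add: power2_eq_square)
  qed
  then have "(\<Sum>al\<in>(UNIV::'m set). \<Sum>\<beta>\<in>(UNIV::'m set). h al \<beta> * (v $ al) * (v $ \<beta>)) <= (\<Sum>al\<in>(UNIV::'m set). \<Sum>\<beta>\<in>(UNIV::'m set). W * (norm v)^2)"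
   by (intro sum_mono)
  then show ?thesis by (simp add: power2_eq_square mult_ac)
 qed
 have 1: "hess_form G s xi v 0 <= (real CARD('m))^2 * W * (norm v)^2"
  using dbl[of "%al \<beta>. d_s \<beta> (d_s al G) (s, xi)" v] b by (simp add: hess_form_def)
 have 2: "hess_form G s xi 0 w <= (real CARD('m))^2 * W * (norm w)^2"
  using dbl[of "%al \<beta>. d_xi \<beta> (d_xi al G) (s, xi)" w] b by (simp add: hess_form_def)
 have "hess_form G s xi v w + hess_form G s xi v (- w) = 2 * hess_form G s xi v 0 + 2 * hess_form G s xi 0 w"
  by (simp add: hess_form_def sum.distrib[symmetric] sum_distrib_left algebra_simps)
 then have "hess_form G s xi v w <= 2 * hess_form G s xi v 0 + 2 * hess_form G s xi 0 w" using pos[of v "- w"] by linarith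
 then show ?thesis using 1 2 by (simp add: algebra_simps)
qed

text \<open>Ellipticity and boundedness of \<open>G\<close> composed with regularized norms along a line.  The blocks are given by the
  coefficients of their squared norms, so that the statement does not depend on the dimension of the blocks.\<close>

definition radial_bounds :: "real => ((real^'m) \<times> (real^'m) => real) => real => real => bool" where
 "radial_bounds q G c M \<longleftrightarrow> c > 0 & M > 0 & (\<forall>eps A B C A' B' C'. eps > 0 & (\<forall>al. 0 <= A al & 0 <= C al & (B al)^2 <= A al * C al) \<and>
   (\<forall>al. 0 <= A' al & 0 <= C' al & (B' al)^2 <= A' al * C' al) \<longrightarrow>
   (\<exists>gm1 gm2. \<forall>t.
    ((%t. G (\<chi> al. quad eps (A al) (B al) (C al) t, \<chi> al. quad eps (A' al) (B' al) (C' al) t)) has_real_derivative gm1 t) (at t) \<and>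
    (gm1 has_real_derivative gm2 t) (at t) \<and>
    c * (norm (\<chi> al. quad eps (A al) (B al) (C al) t) powr (q - 2) + norm (\<chi> al. quad eps (A' al) (B' al) (C' al) t) powr (q - 2))
     * ((\<Sum>al\<in>UNIV. C al) + (\<Sum>al\<in>UNIV. C' al)) <= gm2 t \<and>
    gm2 t <= M * ((norm (\<chi> al. quad eps (A al) (B al) (C al) t) powr (q - 2) + norm (\<chi> al. quad eps (A' al) (B' al) (C' al) t) powr (q - 2))
     * ((\<Sum>al\<in>UNIV. C al) + (\<Sum>al\<in>UNIV. C' al))
    + (norm (\<chi> al. quad eps (A al) (B al) (C al) t) powr (q - 1) + norm (\<chi> al. quad eps (A' al) (B' al) (C' al) t) powr (q - 1))
     * ((\<Sum>al\<in>UNIV. C al / quad eps (A al) (B al) (C al) t) + (\<Sum>al\<in>UNIV. C' al / quad eps (A' al) (B' al) (C' al) t)))))"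

lemma radial_boundsD:
 assumes "radial_bounds q G c M" "eps > 0" "!!al. 0 <= A al & 0 <= C al & (B al)^2 <= A al * C al"
  "!!al. 0 <= A' al & 0 <= C' al & (B' al)^2 <= A' al * C' al"
 shows "\<exists>gm1 gm2. \<forall>t.
    ((%t. G (\<chi> al. quad eps (A al) (B al) (C al) t, \<chi> al. quad eps (A' al) (B' al) (C' al) t)) has_real_derivative gm1 t) (at t) \<and>
    (gm1 has_real_derivative gm2 t) (at t) \<and>
    c * (norm (\<chi> al. quad eps (A al) (B al) (C al) t) powr (q - 2) + norm (\<chi> al. quad eps (A' al) (B' al) (C' al) t) powr (q - 2))
     * ((\<Sum>al\<in>UNIV. C al) + (\<Sum>al\<in>UNIV. C' al)) <= gm2 t \<and>
    gm2 t <= M * ((norm (\<chi> al. quad eps (A al) (B al) (C al) t) powr (q - 2) + norm (\<chi> al. quad eps (A' al) (B' al) (C' al) t) powr (q - 2))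
     * ((\<Sum>al\<in>UNIV. C al) + (\<Sum>al\<in>UNIV. C' al))
    + (norm (\<chi> al. quad eps (A al) (B al) (C al) t) powr (q - 1) + norm (\<chi> al. quad eps (A' al) (B' al) (C' al) t) powr (q - 1))
     * ((\<Sum>al\<in>UNIV. C al / quad eps (A al) (B al) (C al) t) + (\<Sum>al\<in>UNIV. C' al / quad eps (A' al) (B' al) (C' al) t)))"
proof -
 have "eps > 0 & (\<forall>al. 0 <= A al & 0 <= C al & (B al)^2 <= A al * C al) \<and>
   (\<forall>al. 0 <= A' al & 0 <= C' al & (B' al)^2 <= A' al * C' al)"
  using assms(2-4) by blast
 then show ?thesis using assms(1)[unfolded radial_bounds_def, THEN conjunct2, THEN conjunct2,
   THEN spec[of _ eps], THEN spec[of _ A], THEN spec[of _ B], THEN spec[of _ C], THEN spec[of _ A'], THEN spec[of _ B'], THEN spec[of _ C']]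
  by (rule rev_mp)
qed

text \<open>The second derivative is the Hessian form of \<open>G\<close> on the derivatives \<open>\<rho>\<close> of the norms, plus the first derivatives of \<open>G\<close>
  times \<open>(C - \<rho>\<^sup>2) / r\<close>.  Ellipticity accounts for \<open>\<rho>\<^sup>2\<close> and the lower bound for the first derivatives, which carries the factor
  \<open>r\<close>, for \<open>C - \<rho>\<^sup>2\<close>; together they give \<open>C\<close>.\<close>

lemma radial_second_derivative:
 fixes G :: "(real^'m) \<times> (real^'m) => real"
 assumes H: "H2 q G" and q: "2 <= q"
 shows "\<exists>c M. radial_bounds q G c M"
proof -
 obtain \<theta> L where E: "H2_bounds q G \<theta> L" using H2D[OF H] by blast
 then have \<theta>: "\<theta> > 0" and L: "L > 1" by (auto simp: H2_bounds_def)
 note ell = H2_boundsD(1)[OF E] and bd = H2_boundsD(2)[OF E]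
 obtain \<kappa> where \<kappa>: "\<kappa> > 0" and lo: "\<forall>s xi al. (\<forall>al. 0 < s $ al) & (\<forall>al. 0 < xi $ al) \<longrightarrow>
   \<kappa> * (norm s powr (q - 2) + norm xi powr (q - 2)) * s $ al <= d_s al G (s, xi) \<and>
   \<kappa> * (norm s powr (q - 2) + norm xi powr (q - 2)) * xi $ al <= d_xi al G (s, xi)"
  using H2_first_derivative_lower[OF H q] by blast
 define c where "c = min \<theta> \<kappa>"
 define M where "M = 2 * (real CARD('m))^2 * L"
 have c: "c > 0" "c <= \<theta>" "c <= \<kappa>" using \<theta> \<kappa> by (auto simp: c_def)
 have card1: "1 <= (real CARD('m))^2" by (simp add: Suc_leI)
 have "1 <= 2 * (real CARD('m))^2" using card1 by linarith
 from mult_right_mono[OF this, of L] have "1 * L <= 2 * (real CARD('m))^2 * L" using L by simp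
 then have M: "M > 0" "L <= M" using L by (auto simp: M_def)
 show ?thesis
  unfolding radial_bounds_def
 proof (rule exI[of _ c], rule exI[of _ M], intro conjI c(1) M(1) allI impI, elim conjE)
  fix eps :: real and A B C A' B' C' :: "'m => real"
  assume e: "eps > 0" and P: "\<forall>al. 0 <= A al & 0 <= C al & (B al)^2 <= A al * C al" "\<forall>al. 0 <= A' al & 0 <= C' al & (B' al)^2 <= A' al * C' al"
  define r where "r al t = quad eps (A al) (B al) (C al) t" for al t
  define r' where "r' al t = quad eps (A' al) (B' al) (C' al) t" for al t
  define \<rho> where "\<rho> al t = (B al + C al * t) / r al t" for al t
  define \<rho>' where "\<rho>' al t = (B' al + C' al * t) / r' al t" for al t
  have P1: "0 <= A al" "0 <= C al" "(B al)^2 <= A al * C al" "0 <= A' al" "0 <= C' al" "(B' al)^2 <= A' al * C' al" for al using P by auto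
  note Q = quad_facts[OF P1(1-3) e, folded r_def, folded \<rho>_def] and Q' = quad_facts[OF P1(4-6) e, folded r'_def, folded \<rho>'_def]
  have dr: "(r al has_real_derivative \<rho> al t) (at t)" "(r' al has_real_derivative \<rho>' al t) (at t)" for al t
   using quad_facts(2)[OF P1(1-3) e] quad_facts(2)[OF P1(4-6) e] by (simp_all add: r_def[abs_def] \<rho>_def r'_def[abs_def] \<rho>'_def)
  have d\<rho>: "(\<rho> al has_real_derivative (C al - (\<rho> al t)^2) / r al t) (at t)" "(\<rho>' al has_real_derivative (C' al - (\<rho>' al t)^2) / r' al t) (at t)" for al t
   using quad_facts(3)[OF P1(1-3) e] quad_facts(3)[OF P1(4-6) e] by (simp_all add: r_def[abs_def] \<rho>_def[abs_def] r'_def[abs_def] \<rho>'_def[abs_def])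
  have rp: "0 < r al t" "0 < r' al t" and \<rho>le: "(\<rho> al t)^2 <= C al" "(\<rho>' al t)^2 <= C' al" for al t
   by (rule Q(1) Q'(1) Q(4) Q'(4))+
  let ?s = "%t. \<chi> al. r al t" and ?x = "%t. \<chi> al. r' al t"
  let ?v = "%t. \<chi> al. \<rho> al t" and ?w = "%t. \<chi> al. \<rho>' al t"
  define gm1 where "gm1 t = (\<Sum>al\<in>UNIV. \<rho> al t * d_s al G (?s t, ?x t)) + (\<Sum>al\<in>UNIV. \<rho>' al t * d_xi al G (?s t, ?x t))" for t
  define R where "R t = (\<Sum>al\<in>UNIV. (C al - (\<rho> al t)^2) / r al t * d_s al G (?s t, ?x t)) + (\<Sum>al\<in>UNIV. (C' al - (\<rho>' al t)^2) / r' al t * d_xi al G (?s t, ?x t))" for t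
  define gm2 where "gm2 t = hess_form G (?s t) (?x t) (?v t) (?w t) + R t" for t
  have 1: "((%t. G (?s t, ?x t)) has_real_derivative gm1 t) (at t)" for t
   unfolding gm1_def by (rule orthant_chain[OF H2_Ck(1)[OF H] dr rp])
  have 2: "(gm1 has_real_derivative gm2 t) (at t)" for t
  proof -
   let ?Ds = "%F. (\<Sum>\<beta>\<in>UNIV. \<rho> \<beta> t * d_s \<beta> F (?s t, ?x t)) + (\<Sum>\<beta>\<in>UNIV. \<rho>' \<beta> t * d_xi \<beta> F (?s t, ?x t))"
   have "(gm1 has_real_derivative
    (\<Sum>al\<in>UNIV. (C al - (\<rho> al t)^2) / r al t * d_s al G (?s t, ?x t) + ?Ds (d_s al G) * \<rho> al t)
    + (\<Sum>al\<in>UNIV. (C' al - (\<rho>' al t)^2) / r' al t * d_xi al G (?s t, ?x t) + ?Ds (d_xi al G) * \<rho>' al t)) (at t)"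
    unfolding gm1_def[abs_def]
    by (intro DERIV_add DERIV_sum DERIV_mult d\<rho> orthant_chain[OF H2_Ck(2)[OF H] dr rp] orthant_chain[OF H2_Ck(3)[OF H] dr rp])
   then show ?thesis
    by (rule DERIV_cong)
     (simp add: gm2_def R_def hess_form_def sum.distrib sum_distrib_left sum_distrib_right algebra_simps)
  qed
  have nv: "(norm (?v t))^2 = (\<Sum>al\<in>UNIV. (\<rho> al t)^2)" "(norm (?w t))^2 = (\<Sum>al\<in>UNIV. (\<rho>' al t)^2)" for t
   by (simp_all add: norm_vec_def L2_set_def sum_nonneg)
  have bounds: "c * (norm (?s t) powr (q - 2) + norm (?x t) powr (q - 2)) * ((\<Sum>al\<in>UNIV. C al) + (\<Sum>al\<in>UNIV. C' al)) <= gm2 t \<and>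
    gm2 t <= M * ((norm (?s t) powr (q - 2) + norm (?x t) powr (q - 2)) * ((\<Sum>al\<in>UNIV. C al) + (\<Sum>al\<in>UNIV. C' al))
    + (norm (?s t) powr (q - 1) + norm (?x t) powr (q - 1)) * ((\<Sum>al\<in>UNIV. C al / r al t) + (\<Sum>al\<in>UNIV. C' al / r' al t)))" for t
  proof -
   define W where "W = norm (?s t) powr (q - 2) + norm (?x t) powr (q - 2)"
   define V where "V = norm (?s t) powr (q - 1) + norm (?x t) powr (q - 1)"
   have W: "W \<ge> 0" and V: "V \<ge> 0" by (simp_all add: W_def V_def)
   have ps: "0 < ?s t $ al" "0 < ?x t $ al" for al using rp by auto
   have h1: "\<theta> * W * ((norm v)^2 + (norm w)^2) <= hess_form G (?s t) (?x t) v w" for v w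
    using ell[OF ps] by (simp add: W_def)
   have lo12: "\<kappa> * W * r al t <= d_s al G (?s t, ?x t)" "\<kappa> * W * r' al t <= d_xi al G (?s t, ?x t)" for al
    using lo[THEN spec, THEN spec, THEN spec, of "?s t" "?x t" al] rp by (simp_all add: W_def)
   have low: "c * W * (C al - (\<rho> al t)^2) <= (C al - (\<rho> al t)^2) / r al t * d_s al G (?s t, ?x t)" for al
   proof -
    have "c * W * r al t <= \<kappa> * W * r al t" using c W rp less_imp_le[OF rp(1)] by (intro mult_right_mono) auto
    also have "... <= d_s al G (?s t, ?x t)" by (rule lo12)
    finally have "(C al - (\<rho> al t)^2) / r al t * (c * W * r al t) <= (C al - (\<rho> al t)^2) / r al t * d_s al G (?s t, ?x t)"
     using \<rho>le(1)[of al t] less_imp_le[OF rp(1)] by (intro mult_left_mono) auto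
    moreover have "(C al - (\<rho> al t)^2) / r al t * (c * W * r al t) = c * W * (C al - (\<rho> al t)^2)"
     using rp(1)[of al t] by simp
    ultimately show ?thesis by (simp only:)
   qed
   have low': "c * W * (C' al - (\<rho>' al t)^2) <= (C' al - (\<rho>' al t)^2) / r' al t * d_xi al G (?s t, ?x t)" for al
   proof -
    have "c * W * r' al t <= \<kappa> * W * r' al t" using c W rp less_imp_le[OF rp(2)] by (intro mult_right_mono) auto
    also have "... <= d_xi al G (?s t, ?x t)" by (rule lo12)
    finally have "(C' al - (\<rho>' al t)^2) / r' al t * (c * W * r' al t) <= (C' al - (\<rho>' al t)^2) / r' al t * d_xi al G (?s t, ?x t)"
     using \<rho>le(2)[of al t] less_imp_le[OF rp(2)] by (intro mult_left_mono) auto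
    moreover have "(C' al - (\<rho>' al t)^2) / r' al t * (c * W * r' al t) = c * W * (C' al - (\<rho>' al t)^2)"
     using rp(2)[of al t] by simp
    ultimately show ?thesis by (simp only:)
   qed
   have "c * W * ((\<Sum>al\<in>UNIV. C al) + (\<Sum>al\<in>UNIV. C' al)) =
     c * W * ((norm (?v t))^2 + (norm (?w t))^2) + ((\<Sum>al\<in>UNIV. c * W * (C al - (\<rho> al t)^2)) + (\<Sum>al\<in>UNIV. c * W * (C' al - (\<rho>' al t)^2)))"
    by (simp add: nv sum_distrib_left[symmetric] sum_subtractf algebra_simps)
   also have "... <= \<theta> * W * ((norm (?v t))^2 + (norm (?w t))^2) + R t"
    unfolding R_def using c W by (intro add_mono mult_right_mono sum_mono low low') auto
   also have "... <= gm2 t" unfolding gm2_def using h1 by simp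
   finally have lower: "c * W * ((\<Sum>al\<in>UNIV. C al) + (\<Sum>al\<in>UNIV. C' al)) <= gm2 t" .
   have "0 <= hess_form G (?s t) (?x t) v w" for v w
   proof -
    have "0 <= \<theta> * W * ((norm v)^2 + (norm w)^2)" using \<theta> W by simp
    then show ?thesis using h1[of v w] by linarith
   qed
   then have "hess_form G (?s t) (?x t) (?v t) (?w t) <= 2 * (real CARD('m))^2 * (L * W) * ((norm (?v t))^2 + (norm (?w t))^2)"
    using bd[OF ps] L W by (intro hess_form_le) (auto simp: W_def)
   also have "... = M * W * ((\<Sum>al\<in>UNIV. (\<rho> al t)^2) + (\<Sum>al\<in>UNIV. (\<rho>' al t)^2))" by (simp add: M_def nv mult_ac)
   also have "... <= M * W * ((\<Sum>al\<in>UNIV. C al) + (\<Sum>al\<in>UNIV. C' al))"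
    using M W by (intro mult_left_mono add_mono sum_mono \<rho>le) auto
   finally have u1: "hess_form G (?s t) (?x t) (?v t) (?w t) <= M * W * ((\<Sum>al\<in>UNIV. C al) + (\<Sum>al\<in>UNIV. C' al))" .
   have up: "(C al - (\<rho> al t)^2) / r al t * d_s al G (?s t, ?x t) <= M * V * (C al / r al t)" for al
   proof -
    have "d_s al G (?s t, ?x t) <= L * V" "0 <= d_s al G (?s t, ?x t)" using bd[OF ps, of al al] by (auto simp: V_def)
    moreover have "L * V <= M * V" using M V by (intro mult_right_mono) auto
    moreover have "(C al - (\<rho> al t)^2) / r al t <= C al / r al t" using less_imp_le[OF rp(1)] by (intro divide_right_mono) auto
    ultimately have "(C al - (\<rho> al t)^2) / r al t * d_s al G (?s t, ?x t) <= C al / r al t * (M * V)"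
     using P1 less_imp_le[OF rp(1)] by (intro mult_mono) auto
    then show ?thesis by (simp add: mult_ac)
   qed
   have up': "(C' al - (\<rho>' al t)^2) / r' al t * d_xi al G (?s t, ?x t) <= M * V * (C' al / r' al t)" for al
   proof -
    have "d_xi al G (?s t, ?x t) <= L * V" "0 <= d_xi al G (?s t, ?x t)" using bd[OF ps, of al al] by (auto simp: V_def)
    moreover have "L * V <= M * V" using M V by (intro mult_right_mono) auto
    moreover have "(C' al - (\<rho>' al t)^2) / r' al t <= C' al / r' al t" using less_imp_le[OF rp(2)] by (intro divide_right_mono) auto
    ultimately have "(C' al - (\<rho>' al t)^2) / r' al t * d_xi al G (?s t, ?x t) <= C' al / r' al t * (M * V)"
     using P1 less_imp_le[OF rp(2)] by (intro mult_mono) auto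
    then show ?thesis by (simp add: mult_ac)
   qed
   have "R t <= (\<Sum>al\<in>UNIV. M * V * (C al / r al t)) + (\<Sum>al\<in>UNIV. M * V * (C' al / r' al t))"
    unfolding R_def by (intro add_mono sum_mono up up')
   also have "... = M * (V * ((\<Sum>al\<in>UNIV. C al / r al t) + (\<Sum>al\<in>UNIV. C' al / r' al t)))"
    unfolding sum_distrib_left[symmetric] by (simp only: distrib_left mult.assoc)
   finally have "gm2 t <= M * (W * ((\<Sum>al\<in>UNIV. C al) + (\<Sum>al\<in>UNIV. C' al)) + V * ((\<Sum>al\<in>UNIV. C al / r al t) + (\<Sum>al\<in>UNIV. C' al / r' al t)))"
    unfolding gm2_def using u1 by (simp add: distrib_left mult.assoc)
   then show ?thesis using lower unfolding W_def V_def by blast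
  qed
  show "\<exists>gm1 gm2. \<forall>t.
    ((%t. G (\<chi> al. quad eps (A al) (B al) (C al) t, \<chi> al. quad eps (A' al) (B' al) (C' al) t)) has_real_derivative gm1 t) (at t) \<and>
    (gm1 has_real_derivative gm2 t) (at t) \<and>
    c * (norm (\<chi> al. quad eps (A al) (B al) (C al) t) powr (q - 2) + norm (\<chi> al. quad eps (A' al) (B' al) (C' al) t) powr (q - 2))
     * ((\<Sum>al\<in>UNIV. C al) + (\<Sum>al\<in>UNIV. C' al)) <= gm2 t \<and>
    gm2 t <= M * ((norm (\<chi> al. quad eps (A al) (B al) (C al) t) powr (q - 2) + norm (\<chi> al. quad eps (A' al) (B' al) (C' al) t) powr (q - 2))
     * ((\<Sum>al\<in>UNIV. C al) + (\<Sum>al\<in>UNIV. C' al))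
    + (norm (\<chi> al. quad eps (A al) (B al) (C al) t) powr (q - 1) + norm (\<chi> al. quad eps (A' al) (B' al) (C' al) t) powr (q - 1))
     * ((\<Sum>al\<in>UNIV. C al / quad eps (A al) (B al) (C al) t) + (\<Sum>al\<in>UNIV. C' al / quad eps (A' al) (B' al) (C' al) t)))"
   using 1 2 bounds unfolding r_def r'_def by (intro exI[of _ gm1] exI[of _ gm2]) blast
 qed
qed

section \<open>Convexity and inner variations of the integrand\<close>

definition dens :: "((real^'m) \<times> (real^'m) => real) => real => real => real^'m => real^'n^'m => real" where
 "dens G p eps u z = eps * (\<Sum>al\<in>UNIV. norm (z $ al) powr p) +
  G (\<chi> al. sqrt (abs (u $ al)^2 + eps), \<chi> al. sqrt ((norm (z $ al))^2 + eps))"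

lemma taylor2:
 fixes f :: "real => real"
 assumes f: "!!t. a <= t ==> t <= b ==> (f has_real_derivative f1 t) (at t)"
  and f1: "!!t. a <= t ==> t <= b ==> (f1 has_real_derivative f2 t) (at t)"
  and c: "a <= c" "c <= b" and x: "a <= x" "x <= b"
 shows "\<exists>t. a <= t & t <= b & f x = f c + f1 c * (x - c) + f2 t / 2 * (x - c)^2"
proof (cases "x = c")
 case True then show ?thesis using c by auto
next
 case False
 define d where "d n = (if n = 0 then f else if n = 1 then f1 else f2)" for n :: nat
 have "\<exists>t. (if x < c then x < t & t < c else c < t & t < x) \<and>
   f x = (\<Sum>m<2. (d m c / fact m) * (x - c)^m) + (d 2 t / fact 2) * (x - c)^2"
  by (rule Taylor[where a=a and b=b]) (use f f1 c x False in \<open>auto simp: d_def less_2_cases_iff\<close>)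
 then obtain t where t: "if x < c then x < t & t < c else c < t & t < x"
  "f x = (\<Sum>m<2. (d m c / fact m) * (x - c)^m) + (d 2 t / fact 2) * (x - c)^2" by blast
 have "a <= t & t <= b" using t(1) c x by (auto split: if_splits)
 moreover have "f x = f c + f1 c * (x - c) + f2 t / 2 * (x - c)^2"
  using t(2) by (simp add: d_def numeral_2_eq_2)
 ultimately show ?thesis by blast
qed

text \<open>The function \<open>t \<mapsto> (1 - t a) gm (t / (1 - t a))\<close> is the perspective of \<open>gm\<close>: its derivative at \<open>0\<close> is
  \<open>gm'(0) - a gm(0)\<close>, so that the first order terms at \<open>t\<close> and \<open>-t\<close> cancel.\<close>

lemma perspective_bound:
 fixes gm :: "real => real"
 assumes d1: "!!sg. abs sg <= 4/3 * abs t ==> (gm has_real_derivative gm1 sg) (at sg)"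
  and d2: "!!sg. abs sg <= 4/3 * abs t ==> (gm1 has_real_derivative gm2 sg) (at sg)"
  and M: "!!sg. abs sg <= 4/3 * abs t ==> gm2 sg <= M" "0 <= M" and a: "abs (t * a) <= 1/4"
 shows "(1 - t * a) * gm (t / (1 - t * a)) + (1 + t * a) * gm (- (t / (1 + t * a))) <= 2 * gm 0 + 4/3 * M * t^2"
proof -
 have one: "lm * gm (s / lm) <= lm * gm 0 + s * gm1 0 + 2/3 * M * t^2" if lm: "3/4 <= lm" and s: "abs s = abs t" for lm s
 proof -
  have "abs (s / lm) = abs t / lm" using lm s by simp
  also have "... <= abs t / (3/4)" using lm by (intro divide_left_mono) auto
  finally have sl: "abs (s / lm) <= 4/3 * abs t" by simp
  have "\<exists>\<tau>. - (4/3 * abs t) <= \<tau> & \<tau> <= 4/3 * abs t & gm (s / lm) = gm 0 + gm1 0 * (s / lm - 0) + gm2 \<tau> / 2 * (s / lm - 0)^2"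
  proof (rule taylor2)
   fix \<tau> assume "- (4/3 * abs t) <= \<tau>" "\<tau> <= 4/3 * abs t"
   then have "abs \<tau> <= 4/3 * abs t" by linarith
   then show "(gm has_real_derivative gm1 \<tau>) (at \<tau>)" "(gm1 has_real_derivative gm2 \<tau>) (at \<tau>)" by (rule d1 d2)+
  next
   show "- (4/3 * abs t) <= s / lm" "s / lm <= 4/3 * abs t" using sl by linarith+
  qed simp_all
  then obtain \<tau> where "- (4/3 * abs t) <= \<tau>" "\<tau> <= 4/3 * abs t" "gm (s / lm) = gm 0 + gm1 0 * (s / lm - 0) + gm2 \<tau> / 2 * (s / lm - 0)^2" by blast
  then have \<tau>: "abs \<tau> <= 4/3 * abs t" "gm (s / lm) = gm 0 + gm1 0 * (s / lm) + gm2 \<tau> / 2 * (s / lm)^2" by (simp_all add: abs_le_iff)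
  have "gm2 \<tau> / 2 * (s / lm)^2 <= M / 2 * (s / lm)^2" using M(1)[OF \<tau>(1)] by (intro mult_right_mono) auto
  then have "lm * gm (s / lm) <= lm * (gm 0 + gm1 0 * (s / lm) + M / 2 * (s / lm)^2)" unfolding \<tau>(2) using lm by (intro mult_left_mono) auto
  also have "... = lm * gm 0 + s * gm1 0 + (M / 2 * t^2) / lm"
  proof -
   have "s^2 = t^2" using s by (metis power2_abs)
   then show ?thesis using lm by (simp add: field_simps power2_eq_square)
  qed
  also have "(M / 2 * t^2) / lm <= (M / 2 * t^2) / (3/4)" using lm M by (intro divide_left_mono) auto
  finally show ?thesis by simp
 qed
 have l: "3/4 <= 1 - t * a" "3/4 <= 1 + t * a" using a by (auto simp: abs_le_iff)
 have "(1 + t * a) * gm (- (t / (1 + t * a))) = (1 + t * a) * gm ((- t) / (1 + t * a))" by simp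
 then show ?thesis using one[OF l(1), of t] one[OF l(2), of "- t"] by (simp add: algebra_simps)
qed

lemma powr_tangent:
 fixes m t p :: real assumes p: "p \<ge> 1" and m: "m > 0" and t: "t \<ge> 0"
 shows "p * m powr (p - 1) * t <= t powr p + (p - 1) * m powr p"
proof (cases "t = 0")
 case True then show ?thesis using p by simp
next
 case False
 have "(t powr p) powr (1/p) * (m powr p) powr (1 - 1/p) <= 1/p * t powr p + (1 - 1/p) * m powr p"
  using p t False m by (intro Youngs_inequality_0) auto
 moreover have "(t powr p) powr (1/p) = t" using p t by (simp add: powr_powr)
 moreover have "(m powr p) powr (1 - 1/p) = m powr (p - 1)" using p by (simp add: powr_powr right_diff_distrib)
 ultimately have "t * m powr (p - 1) <= 1/p * t powr p + (1 - 1/p) * m powr p" by simp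
 then have "p * (t * m powr (p - 1)) <= p * (1/p * t powr p + (1 - 1/p) * m powr p)" using p by (intro mult_left_mono) auto
 also have "... = t powr p + (p - 1) * m powr p" using p by (simp add: field_simps)
 finally show ?thesis by (simp add: mult_ac)
qed

lemma norm_midpoint_powr:
 fixes x y :: "'a::real_normed_vector"
 assumes p: "p \<ge> 1"
 shows "norm ((1/2) *\<^sub>R (x + y)) powr p <= (norm x powr p + norm y powr p) / 2"
proof (cases "norm x + norm y = 0")
 case True then show ?thesis using p by (simp add: add_nonneg_eq_0_iff)
next
 case False
 define m where "m = (norm x + norm y) / 2"
 have m: "m > 0" using False add_nonneg_nonneg[OF norm_ge_zero norm_ge_zero, of x y] by (simp add: m_def less_le)
 have "norm ((1/2) *\<^sub>R (x + y)) <= m" using norm_triangle_ineq[of x y] by (simp add: m_def)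
 then have "norm ((1/2) *\<^sub>R (x + y)) powr p <= m powr p" using p by (intro powr_mono2) auto
 moreover have "p * m powr (p - 1) * norm x + p * m powr (p - 1) * norm y = 2 * (p * m powr p)"
 proof -
  have "p * m powr (p - 1) * norm x + p * m powr (p - 1) * norm y = p * (m powr (p - 1) * m) * 2"
   by (simp add: m_def algebra_simps)
  also have "m powr (p - 1) * m = m powr p" using m powr_add[of m "p - 1" 1] by simp
  finally show ?thesis by simp
 qed
 ultimately show ?thesis using powr_tangent[OF p m norm_ge_zero, of x] powr_tangent[OF p m norm_ge_zero, of y] by (simp add: algebra_simps)
qed

lemma sqrt_line_quad:
 fixes x y :: "'a::real_inner"
 shows "sqrt ((norm (x + t *\<^sub>R y))^2 + eps) = quad eps ((norm x)^2) (x \<bullet> y) ((norm y)^2) t"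
 unfolding quad_def power2_norm_eq_inner by (simp add: inner_add_left inner_add_right inner_commute power2_eq_square algebra_simps)

lemma inner_square_le: "(x \<bullet> y)^2 <= (norm x)^2 * (norm (y::'a::real_inner))^2"
 using Cauchy_Schwarz_ineq[of x y] by (simp add: power2_norm_eq_inner)

lemma block_condition:
 fixes x y :: "'b => 'a::real_inner"
 shows "0 <= (norm (x al))^2 & 0 <= (norm (y al))^2 & (x al \<bullet> y al)^2 <= (norm (x al))^2 * (norm (y al))^2"
 using inner_square_le[of "x al" "y al"] by simp

lemma half_add_half: "(1/2) *\<^sub>R x + (1/2) *\<^sub>R x = (x :: 'a::real_vector)"
 by (simp flip: scaleR_add_left)

lemma norm_vec_sqrt_sq:
 fixes z :: "('a::real_normed_vector)^'m"
 assumes e: "eps > 0"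
 shows "(norm (\<chi> al. sqrt ((norm (z $ al))^2 + eps)))^2 = (norm z)^2 + real CARD('m) * eps"
proof -
 have n: "0 <= (norm (z $ al))^2 + eps" for al using e by simp
 have "(norm (\<chi> al. sqrt ((norm (z $ al))^2 + eps)))^2 = (\<Sum>al\<in>(UNIV::'m set). (norm (z $ al))^2 + eps)"
  by (simp add: norm_vec_def[of "\<chi> al. sqrt ((norm (z $ al))^2 + eps)"] L2_set_def sum_nonneg n)
 also have "... = (norm z)^2 + real CARD('m) * eps" by (simp add: sum.distrib norm_vec_def L2_set_def sum_nonneg)
 finally show ?thesis .
qed

lemma square_powr_half: "x > 0 ==> (x^2) powr (a / 2) = x powr (a::real)"
 using powr_powr[of x 2 "a/2"] by simp

text \<open>The weight of the final estimate, as a function of the norm of the gradient.  The truncation allows arguments that are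
  only lower bounds for a norm.\<close>

definition ell_weight :: "real => real => real => real" where
 "ell_weight q eps r = ((max 0 r)^2 + eps) powr ((q - 2) / 2)"

text \<open>Uniform convexity from the lower bound for the second derivative along the segment.  On the whole segment the norm of
  the gradient is at least \<open>norm z - norm (z' - z)\<close>, which is where the weight is evaluated.\<close>

lemma dens_midpoint:
 fixes G :: "(real^'m) \<times> (real^'m) => real"
 assumes H: "H2 q G" and q: "2 <= q" and p: "1 <= p"
 shows "\<exists>c>0. \<forall>eps (u::real^'m) (z::real^'n^'m) u' z'. 0 < eps \<longrightarrow>
  dens G p eps ((1/2) *\<^sub>R (u + u')) ((1/2) *\<^sub>R (z + z')) + c * (ell_weight q eps (norm z - norm (z' - z)) * (norm (z' - z))^2)
   <= (dens G p eps u z + dens G p eps u' z') / 2"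
proof -
 obtain c M where cM: "radial_bounds q G c M" using radial_second_derivative[OF H q] by blast
 then have c: "c > 0" by (simp add: radial_bounds_def)
 show ?thesis
 proof (intro exI[of _ "c / 8"] conjI allI impI)
  show "c / 8 > 0" using c by simp
  fix eps :: real and u u' :: "real^'m" and z z' :: "real^'n^'m" assume e: "0 < eps"
  define U where "U t = u + t *\<^sub>R (u' - u)" for t
  define Z where "Z t = z + t *\<^sub>R (z' - z)" for t
  define gm where "gm t = G (\<chi> al. sqrt (abs (U t $ al)^2 + eps), \<chi> al. sqrt ((norm (Z t $ al))^2 + eps))" for t
  have sU: "sqrt (abs (U t $ al)^2 + eps) = quad eps ((norm (u $ al))^2) ((u $ al) \<bullet> ((u' - u) $ al)) ((norm ((u' - u) $ al))^2) t" for al t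
   using sqrt_line_quad[of "u $ al" t "(u' - u) $ al" eps] by (simp add: U_def)
  have sZ: "sqrt ((norm (Z t $ al))^2 + eps) = quad eps ((norm (z $ al))^2) ((z $ al) \<bullet> ((z' - z) $ al)) ((norm ((z' - z) $ al))^2) t" for al t
   using sqrt_line_quad[of "z $ al" t "(z' - z) $ al" eps] by (simp add: Z_def)
  have "\<exists>gm1 gm2. \<forall>t. (gm has_real_derivative gm1 t) (at t) & (gm1 has_real_derivative gm2 t) (at t) \<and>
    c * (norm (\<chi> al. sqrt (abs (U t $ al)^2 + eps)) powr (q - 2) + norm (\<chi> al. sqrt ((norm (Z t $ al))^2 + eps)) powr (q - 2))
     * ((\<Sum>al\<in>UNIV. (norm ((u' - u) $ al))^2) + (\<Sum>al\<in>UNIV. (norm ((z' - z) $ al))^2)) <= gm2 t"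
  proof -
   have c1: "0 <= (norm (u $ al))^2 & 0 <= (norm ((u' - u) $ al))^2 & (u $ al \<bullet> (u' - u) $ al)^2 <= (norm (u $ al))^2 * (norm ((u' - u) $ al))^2" for al
    by (rule block_condition[where x="%al. u $ al" and y="%al. (u' - u) $ al"])
   have c2: "0 <= (norm (z $ al))^2 & 0 <= (norm ((z' - z) $ al))^2 & (z $ al \<bullet> (z' - z) $ al)^2 <= (norm (z $ al))^2 * (norm ((z' - z) $ al))^2" for al
    by (rule block_condition[where x="%al. z $ al" and y="%al. (z' - z) $ al"])
   from radial_boundsD[OF cM e, where A="%al. (norm (u $ al))^2" and B="%al. u $ al \<bullet> (u' - u) $ al" and C="%al. (norm ((u' - u) $ al))^2"
     and A'="%al. (norm (z $ al))^2" and B'="%al. z $ al \<bullet> (z' - z) $ al" and C'="%al. (norm ((z' - z) $ al))^2", OF c1 c2]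
   show ?thesis unfolding gm_def[abs_def] sU sZ by blast
  qed
  then obtain gm1 gm2 where g1: "!!t. (gm has_real_derivative gm1 t) (at t)" and g2: "!!t. (gm1 has_real_derivative gm2 t) (at t)"
   and g2l: "!!t. c * (norm (\<chi> al. sqrt (abs (U t $ al)^2 + eps)) powr (q - 2) + norm (\<chi> al. sqrt ((norm (Z t $ al))^2 + eps)) powr (q - 2))
     * ((\<Sum>al\<in>UNIV. (norm ((u' - u) $ al))^2) + (\<Sum>al\<in>UNIV. (norm ((z' - z) $ al))^2)) <= gm2 t"
   by blast
  define W where "W = ell_weight q eps (norm z - norm (z' - z))"
  have W: "W \<ge> 0" by (simp add: W_def ell_weight_def)
  have low: "c * (W * (norm (z' - z))^2) <= gm2 t" if t: "0 <= t" "t <= 1" for t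
  proof -
   let ?n = "norm (\<chi> al. sqrt ((norm (Z t $ al))^2 + eps))"
   have n2: "?n^2 = (norm (Z t))^2 + real CARD('m) * eps" by (rule norm_vec_sqrt_sq[OF e])
   have "0 < (norm (Z t))^2 + real CARD('m) * eps" using e by (intro add_nonneg_pos) auto
   then have np: "?n > 0" using n2 by (metis norm_ge_zero less_eq_real_def zero_less_power2)
   have "norm z <= norm (Z t) + norm (t *\<^sub>R (z' - z))" unfolding Z_def using norm_triangle_ineq4[of "z + t *\<^sub>R (z' - z)" "t *\<^sub>R (z' - z)"] by simp
   also have "norm (t *\<^sub>R (z' - z)) <= norm (z' - z)" using t by (simp add: mult_left_le_one_le)
   finally have "(max 0 (norm z - norm (z' - z)))^2 <= (norm (Z t))^2" by (intro power_mono) auto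
   moreover have "1 * eps <= real CARD('m) * eps" using e by (intro mult_right_mono) (auto simp: Suc_leI)
   ultimately have "(max 0 (norm z - norm (z' - z)))^2 + eps <= ?n^2" unfolding n2 by linarith
   then have "W <= (?n^2) powr ((q - 2) / 2)" unfolding W_def ell_weight_def using q e by (intro powr_mono2) auto
   also have "... = ?n powr (q - 2)" by (rule square_powr_half[OF np])
   finally have W1: "W <= norm (\<chi> al. sqrt (abs (U t $ al)^2 + eps)) powr (q - 2) + ?n powr (q - 2)" by (simp add: add_increasing)
   have "(norm (z' - z))^2 = (\<Sum>al\<in>UNIV. (norm ((z' - z) $ al))^2)" by (simp add: norm_vec_def L2_set_def sum_nonneg)
   also have "... <= (\<Sum>al\<in>UNIV. (norm ((u' - u) $ al))^2) + (\<Sum>al\<in>UNIV. (norm ((z' - z) $ al))^2)" by (simp add: sum_nonneg)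
   finally have "c * W * (norm (z' - z))^2 <= c * (norm (\<chi> al. sqrt (abs (U t $ al)^2 + eps)) powr (q - 2) + ?n powr (q - 2)) * ((\<Sum>al\<in>UNIV. (norm ((u' - u) $ al))^2) + (\<Sum>al\<in>UNIV. (norm ((z' - z) $ al))^2))"
    using c W W1 by (intro mult_mono) (auto intro!: mult_nonneg_nonneg)
   then show ?thesis using g2l[of t] by (simp add: mult.assoc)
  qed
  have T: "\<exists>t. 0 <= t & t <= 1 & gm x = gm (1/2) + gm1 (1/2) * (x - 1/2) + gm2 t / 2 * (x - 1/2)^2" if "0 <= x" "x <= 1" for x
   by (rule taylor2) (use g1 g2 that in auto)
  obtain t0 where t0: "0 <= t0" "t0 <= 1" "gm 0 = gm (1/2) + gm1 (1/2) * (0 - 1/2) + gm2 t0 / 2 * (0 - 1/2)^2" using T[of 0] by auto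
  obtain t1 where t1: "0 <= t1" "t1 <= 1" "gm 1 = gm (1/2) + gm1 (1/2) * (1 - 1/2) + gm2 t1 / 2 * (1 - 1/2)^2" using T[of 1] by auto
  have G: "gm (1/2) + c / 8 * (W * (norm (z' - z))^2) <= (gm 0 + gm 1) / 2"
  proof -
   have q4: "(0 - 1/2 :: real)^2 = 1/4" "(1 - 1/2 :: real)^2 = 1/4" by (simp_all add: power2_eq_square)
   define V where "V = c * (W * (norm (z' - z))^2)"
   have "c / 8 * (W * (norm (z' - z))^2) = V / 8" by (simp add: V_def)
   moreover have "V <= gm2 t0" "V <= gm2 t1" using low[OF t0(1,2)] low[OF t1(1,2)] by (simp_all add: V_def)
   ultimately show ?thesis using t0(3)[unfolded q4] t1(3)[unfolded q4] by simp
  qed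
  have half: "U (1/2) = (1/2) *\<^sub>R (u + u')" "Z (1/2) = (1/2) *\<^sub>R (z + z')"
  proof -
   show "U (1/2) = (1/2) *\<^sub>R (u + u')" unfolding U_def using half_add_half[of u] by (simp add: scaleR_diff_right scaleR_add_right algebra_simps)
   show "Z (1/2) = (1/2) *\<^sub>R (z + z')" unfolding Z_def using half_add_half[of z] by (simp add: scaleR_diff_right scaleR_add_right algebra_simps)
  qed
  have P: "eps * (\<Sum>al\<in>UNIV. norm (((1/2) *\<^sub>R (z + z')) $ al) powr p) <= (eps * (\<Sum>al\<in>UNIV. norm (z $ al) powr p) + eps * (\<Sum>al\<in>UNIV. norm (z' $ al) powr p)) / 2"
  proof -
   have "(\<Sum>al\<in>UNIV. norm (((1/2) *\<^sub>R (z + z')) $ al) powr p) <= (\<Sum>al\<in>UNIV. (norm (z $ al) powr p + norm (z' $ al) powr p) / 2)"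
    using norm_midpoint_powr[OF p] by (intro sum_mono) simp
   also have "... = ((\<Sum>al\<in>UNIV. norm (z $ al) powr p) + (\<Sum>al\<in>UNIV. norm (z' $ al) powr p)) / 2" by (simp add: sum.distrib sum_divide_distrib[symmetric])
   finally have "eps * (\<Sum>al\<in>UNIV. norm (((1/2) *\<^sub>R (z + z')) $ al) powr p) <= eps * (((\<Sum>al\<in>UNIV. norm (z $ al) powr p) + (\<Sum>al\<in>UNIV. norm (z' $ al) powr p)) / 2)"
    using e by (intro mult_left_mono) auto
   then show ?thesis by (simp add: distrib_left)
  qed
  have "gm 0 = G (\<chi> al. sqrt (abs (u $ al)^2 + eps), \<chi> al. sqrt ((norm (z $ al))^2 + eps))"
   "gm 1 = G (\<chi> al. sqrt (abs (u' $ al)^2 + eps), \<chi> al. sqrt ((norm (z' $ al))^2 + eps))"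
   by (simp_all add: gm_def U_def Z_def)
  then show "dens G p eps ((1/2) *\<^sub>R (u + u')) ((1/2) *\<^sub>R (z + z')) + c / 8 * (ell_weight q eps (norm z - norm (z' - z)) * (norm (z' - z))^2)
   <= (dens G p eps u z + dens G p eps u' z') / 2"
   using G P unfolding dens_def gm_def[of "1/2"] half W_def by (simp add: field_simps)
 qed
qed

lemma norm_line_bounds:
 fixes z b :: "'a::real_normed_vector"
 assumes b: "norm b <= K * norm z" and s: "abs sg * K <= 1/3"
 shows "2/3 * norm z <= norm (z + sg *\<^sub>R b)" "norm (z + sg *\<^sub>R b) <= 4/3 * norm z"
proof -
 have "norm (sg *\<^sub>R b) <= abs sg * (K * norm z)" using b by (simp add: mult_left_mono)
 also have "... <= 1/3 * norm z" using mult_right_mono[OF s norm_ge_zero[of z]] by (simp add: mult.assoc)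
 finally have h: "norm (sg *\<^sub>R b) <= 1/3 * norm z" .
 show "norm (z + sg *\<^sub>R b) <= 4/3 * norm z" using norm_triangle_ineq[of z "sg *\<^sub>R b"] h by linarith
 show "2/3 * norm z <= norm (z + sg *\<^sub>R b)" using norm_triangle_ineq4[of "z + sg *\<^sub>R b" "sg *\<^sub>R b"] h by simp
qed

text \<open>The restriction on \<open>t\<close> keeps the perspective's argument so small that the norm stays comparable to \<open>norm z\<close>, and the
  second derivative of the power is then bounded by \<open>K\<^sup>2\<close> times the power itself.\<close>

lemma power_term_inner_variation:
 fixes z b :: "'a::real_inner"
 assumes p: "2 <= p" and b: "norm b <= K * norm z" and t: "abs t * K <= 1/4" and a: "abs a <= K"
 shows "(1 - t * a) * norm (z + (t / (1 - t * a)) *\<^sub>R b) powr p + (1 + t * a) * norm (z + (- (t / (1 + t * a))) *\<^sub>R b) powr p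
  <= 2 * norm z powr p + 4/3 * (p * (p - 1) * (4/3) powr (p - 2) * K^2 * norm z powr p) * t^2"
proof (cases "z = 0")
 case True
 then show ?thesis using b p by simp
next
 case False
 have K: "K \<ge> 0" using a by linarith
 define A B C where "A = (norm z)^2" and "B = z \<bullet> b" and "C = (norm b)^2"
 define Q where "Q s = A + 2 * B * s + C * s^2" for s
 have Qn: "Q s = (norm (z + s *\<^sub>R b))^2" for s
  unfolding Q_def A_def B_def C_def power2_norm_eq_inner by (simp add: inner_add_left inner_add_right inner_commute power2_eq_square algebra_simps)
 have eq: "norm (z + s *\<^sub>R b) powr p = Q s powr (p / 2)" for s
  unfolding Qn using p by (cases "norm (z + s *\<^sub>R b) = 0") (auto simp: square_powr_half)
 define g1 where "g1 s = (p / 2) * Q s powr (p / 2 - 1) * (2 * B + 2 * C * s)" for s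
 define g2 where "g2 s = (p / 2) * ((p / 2 - 1) * Q s powr (p / 2 - 2) * (2 * B + 2 * C * s) * (2 * B + 2 * C * s) + Q s powr (p / 2 - 1) * (2 * C))" for s
 have r: "2/3 * norm z <= norm (z + s *\<^sub>R b)" "norm (z + s *\<^sub>R b) <= 4/3 * norm z" if "abs s <= 4/3 * abs t" for s
 proof -
  have "abs s * K <= 4/3 * abs t * K" using that K by (intro mult_right_mono) auto
  then have "abs s * K <= 1/3" using t by simp
  then show "2/3 * norm z <= norm (z + s *\<^sub>R b)" "norm (z + s *\<^sub>R b) <= 4/3 * norm z" using norm_line_bounds[OF b] by auto
 qed
 have Qp: "Q s > 0" if "abs s <= 4/3 * abs t" for s
 proof -
  have "0 < 2/3 * norm z" using False by simp
  then have "0 < norm (z + s *\<^sub>R b)" using r(1)[OF that] by linarith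
  then show ?thesis unfolding Qn by simp
 qed
 have dQ: "(Q has_real_derivative (2 * B + 2 * C * s)) (at s)" for s
  unfolding Q_def[abs_def] by (auto intro!: derivative_eq_intros)
 have d1: "((%s. Q s powr (p / 2)) has_real_derivative g1 s) (at s)" if "abs s <= 4/3 * abs t" for s
  unfolding g1_def using DERIV_fun_powr[OF dQ Qp[OF that], of "p / 2"] by simp
 have d2: "(g1 has_real_derivative g2 s) (at s)" if "abs s <= 4/3 * abs t" for s
 proof -
  have dp: "((%s. Q s powr (p / 2 - 1)) has_real_derivative ((p / 2 - 1) * Q s powr (p / 2 - 2) * (2 * B + 2 * C * s))) (at s)"
  proof -
   have "p / 2 - 1 - 1 = p / 2 - 2" by simp
   then show ?thesis using DERIV_fun_powr[OF dQ Qp[OF that], of "p / 2 - 1"] by (simp only: of_nat_1)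
  qed
  have "((%s. (p / 2) * (Q s powr (p / 2 - 1) * (2 * B + 2 * C * s))) has_real_derivative g2 s) (at s)"
   unfolding g2_def
   by (rule DERIV_cong[OF DERIV_cmult[OF DERIV_mult[OF dp, of "%s. 2 * B + 2 * C * s" "2 * C"]]])
    (auto intro!: derivative_eq_intros simp: algebra_simps)
  then show ?thesis unfolding g1_def[abs_def] by (simp add: mult.assoc)
 qed
 define N where "N = p * (p - 1) * (4/3) powr (p - 2) * K^2 * norm z powr p"
 have up: "g2 s <= N" if s: "abs s <= 4/3 * abs t" for s
 proof -
  have CS: "(B + C * s)^2 <= C * Q s"
  proof -
   have "C * Q s - (B + C * s)^2 = A * C - B^2" unfolding Q_def by (simp add: power2_eq_square algebra_simps)
   also have "... \<ge> 0" using inner_square_le[of z b] by (simp add: A_def B_def C_def)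
   finally show ?thesis by simp
  qed
  have "Q s powr (p / 2 - 2) * (2 * B + 2 * C * s) * (2 * B + 2 * C * s) = Q s powr (p / 2 - 2) * (4 * (B + C * s)^2)"
   by (simp add: power2_eq_square algebra_simps)
  also have "... <= Q s powr (p / 2 - 2) * (4 * (C * Q s))" using CS by (intro mult_left_mono) auto
  also have "... = 4 * C * (Q s powr (p / 2 - 2) * Q s powr 1)" using Qp[OF s] by simp
  also have "Q s powr (p / 2 - 2) * Q s powr 1 = Q s powr (p / 2 - 1)" unfolding powr_add[symmetric] by simp
  finally have 1: "Q s powr (p / 2 - 2) * (2 * B + 2 * C * s) * (2 * B + 2 * C * s) <= 4 * C * Q s powr (p / 2 - 1)" .
  have "g2 s <= (p / 2) * ((p / 2 - 1) * (4 * C * Q s powr (p / 2 - 1)) + Q s powr (p / 2 - 1) * (2 * C))"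
   unfolding g2_def using mult_left_mono[OF 1, of "p / 2 - 1"] p by (intro mult_left_mono add_mono) (auto simp: mult.assoc)
  also have "... = p * (p - 1) * (C * Q s powr (p / 2 - 1))" by (simp add: field_simps)
  also have "... <= p * (p - 1) * ((K^2 * (norm z)^2) * ((4/3) powr (p - 2) * norm z powr (p - 2)))"
  proof (intro mult_left_mono mult_mono)
   have "norm b ^ 2 <= (K * norm z) ^ 2" using b by (intro power_mono) auto
   then show "C <= K^2 * (norm z)^2" by (simp add: C_def power_mult_distrib)
   have n0: "norm (z + s *\<^sub>R b) > 0" using Qp[OF s] by (simp add: Qn)
   have "p / 2 - 1 = (p - 2) / 2" by simp
   then have "Q s powr (p / 2 - 1) = (norm (z + s *\<^sub>R b))\<^sup>2 powr ((p - 2) / 2)" unfolding Qn by (simp only:)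
   also have "... = norm (z + s *\<^sub>R b) powr (p - 2)" by (rule square_powr_half[OF n0])
   also have "... <= (4/3 * norm z) powr (p - 2)" using r(2)[OF s] p by (intro powr_mono2) auto
   also have "... = (4/3) powr (p - 2) * norm z powr (p - 2)" by (rule powr_mult; simp)
   finally show "Q s powr (p / 2 - 1) <= (4/3) powr (p - 2) * norm z powr (p - 2)" .
  qed (use p in auto)
  also have "... = N"
  proof -
   have "(norm z)^2 * norm z powr (p - 2) = norm z powr p" using False powr_add[of "norm z" 2 "p - 2"] by simp
   then show ?thesis by (simp add: N_def mult_ac)
  qed
  finally show ?thesis .
 qed
 have N0: "0 <= N" using p by (simp add: N_def)
 have "abs (t * a) <= abs t * K" unfolding abs_mult using a by (intro mult_left_mono) auto
 then have ta: "abs (t * a) <= 1/4" using t by linarith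
 have "Q 0 powr (p / 2) = norm z powr p" using eq[of 0] by simp
 then show ?thesis using perspective_bound[OF d1 d2 up N0 ta] unfolding eq by (simp add: N_def)
qed

lemma norm_vec_mono:
 fixes x y :: "('a::real_normed_vector)^'m"
 assumes "!!al. norm (x $ al) <= norm (y $ al)" shows "norm x <= norm y"
 unfolding norm_vec_def using assms by (intro L2_set_mono) auto

lemma powr_sum3_le:
 fixes a b c r :: real
 assumes "0 <= a" "0 <= b" "0 <= c" "0 < r"
 shows "(a + b + c) powr r <= 3 powr r * (a powr r + b powr r + c powr r)"
proof -
 define m where "m = max a (max b c)"
 have "a + b + c <= 3 * m" unfolding m_def by linarith
 then have "(a + b + c) powr r <= (3 * m) powr r" using assms by (intro powr_mono2) auto
 also have "... = 3 powr r * m powr r" using assms by (simp add: powr_mult m_def)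
 also have "m powr r <= a powr r + b powr r + c powr r" by (auto simp: m_def max_def)
 finally show ?thesis by simp
qed

text \<open>The increment \<open>b\<close> is controlled by \<open>z\<close> block by block.  Hence the quotients \<open>C / r\<close> in the upper bound for the second
  derivative, which would blow up with vanishing blocks and \<open>eps\<close>, are controlled by the norms \<open>r\<close> themselves.\<close>

lemma G_term_inner_variation:
 fixes G :: "(real^'m) \<times> (real^'m) => real"
 assumes H: "H2 q G" and q: "2 <= q"
 shows "\<exists>C>0. \<forall>eps (u::real^'m) (z::real^'n^'m) b K t a. 0 < eps & eps <= 1 & (\<forall>al. norm (b $ al) <= K * norm (z $ al)) & abs t * K <= 1/4 & abs a <= K \<longrightarrow>
  (1 - t * a) * G (\<chi> al. sqrt (abs (u $ al)^2 + eps), \<chi> al. sqrt ((norm ((z + (t / (1 - t * a)) *\<^sub>R b) $ al))^2 + eps))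
  + (1 + t * a) * G (\<chi> al. sqrt (abs (u $ al)^2 + eps), \<chi> al. sqrt ((norm ((z + (- (t / (1 + t * a))) *\<^sub>R b) $ al))^2 + eps))
  <= 2 * G (\<chi> al. sqrt (abs (u $ al)^2 + eps), \<chi> al. sqrt ((norm (z $ al))^2 + eps))
   + C * K^2 * t^2 * (norm u powr q + norm z powr q + 1)"
proof -
 obtain c M where cM: "radial_bounds q G c M" using radial_second_derivative[OF H q] by blast
 then have M: "M > 0" by (simp add: radial_bounds_def)
 define m where "m = real CARD('m)"
 have m: "m \<ge> 1" by (simp add: m_def Suc_leI)
 define M1 where "M1 = M * (2 * 2 powr (q - 2) + 2 * 2 powr (q - 1) * (3/2 * m))"
 define M2 where "M2 = 3 powr q * (2 * m) powr q"
 have M1: "M1 > 0" unfolding M1_def using M m by (intro mult_pos_pos add_pos_pos) auto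
 have M2: "M2 > 0" unfolding M2_def using m by simp
 show ?thesis
 proof (intro exI[of _ "4/3 * M1 * M2"] conjI allI impI; (elim conjE)?)
  show "0 < 4/3 * M1 * M2" using M1 M2 by simp
  fix eps :: real and u :: "real^'m" and z b :: "real^'n^'m" and K t a :: real
  assume e: "0 < eps" "eps <= 1" and b: "\<forall>al. norm (b $ al) <= K * norm (z $ al)" and tK: "abs t * K <= 1/4" and a: "abs a <= K"
  have K: "K \<ge> 0" using a by linarith
  define S where "S = (\<chi> al. sqrt (abs (u $ al)^2 + eps))"
  define X where "X sg = (\<chi> al. sqrt ((norm ((z + sg *\<^sub>R b) $ al))^2 + eps))" for sg
  define gm where "gm sg = G (S, X sg)" for sg
  have sS: "sqrt (abs (u $ al)^2 + eps) = quad eps ((norm (u $ al))^2) 0 0 sg" for al sg by (simp add: quad_def)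
  have sX: "sqrt ((norm ((z + sg *\<^sub>R b) $ al))^2 + eps) = quad eps ((norm (z $ al))^2) (z $ al \<bullet> b $ al) ((norm (b $ al))^2) sg" for al sg
   using sqrt_line_quad[of "z $ al" sg "b $ al" eps] by simp
  have c1: "0 <= (norm (u $ al))^2 & 0 <= (0::real) & (0::real)^2 <= (norm (u $ al))^2 * 0" for al by simp
  have c2: "0 <= (norm (z $ al))^2 & 0 <= (norm (b $ al))^2 & (z $ al \<bullet> b $ al)^2 <= (norm (z $ al))^2 * (norm (b $ al))^2" for al
   using inner_square_le[of "z $ al" "b $ al"] by simp
  have "\<exists>gm1 gm2. \<forall>sg. (gm has_real_derivative gm1 sg) (at sg) & (gm1 has_real_derivative gm2 sg) (at sg) \<and>
   gm2 sg <= M * ((norm S powr (q - 2) + norm (X sg) powr (q - 2)) * ((\<Sum>al\<in>(UNIV::'m set). 0) + (\<Sum>al\<in>UNIV. (norm (b $ al))^2))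
    + (norm S powr (q - 1) + norm (X sg) powr (q - 1))
     * ((\<Sum>al\<in>(UNIV::'m set). 0 / S $ al) + (\<Sum>al\<in>UNIV. (norm (b $ al))^2 / X sg $ al)))"
   using radial_boundsD[OF cM e(1), where A="%al. (norm (u $ al))^2" and B="%al. 0" and C="%al. 0"
     and A'="%al. (norm (z $ al))^2" and B'="%al. z $ al \<bullet> b $ al" and C'="%al. (norm (b $ al))^2", OF c1 c2, folded sS sX]
   unfolding gm_def[abs_def] X_def S_def vec_lambda_beta by blast
  then obtain gm1 gm2 where g1: "!!sg. (gm has_real_derivative gm1 sg) (at sg)" and g2: "!!sg. (gm1 has_real_derivative gm2 sg) (at sg)"
   and g2u: "!!sg. gm2 sg <= M * ((norm S powr (q - 2) + norm (X sg) powr (q - 2)) * ((\<Sum>al\<in>(UNIV::'m set). 0) + (\<Sum>al\<in>UNIV. (norm (b $ al))^2))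
    + (norm S powr (q - 1) + norm (X sg) powr (q - 1))
     * ((\<Sum>al\<in>(UNIV::'m set). 0 / S $ al) + (\<Sum>al\<in>UNIV. (norm (b $ al))^2 / X sg $ al)))"
   by blast
  define N where "N = norm S + norm (X 0)"
  have X0: "X 0 $ al > 0" "norm (z $ al) <= X 0 $ al" "X 0 $ al <= norm (X 0)" for al
  proof -
   show "X 0 $ al > 0" using e by (simp add: X_def add_nonneg_pos)
   then show "X 0 $ al <= norm (X 0)" using component_le_norm_cart[of "X 0" al] by simp
   show "norm (z $ al) <= X 0 $ al" using e by (simp add: X_def real_le_rsqrt)
  qed
  have N: "N > 0" using norm_vec_pos[OF X0(1)] norm_ge_zero[of S] by (simp add: N_def add_nonneg_pos)
  have up: "gm2 sg <= M1 * K^2 * N powr q" if s: "abs sg <= 4/3 * abs t" for sg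
  proof -
   have "abs sg * K <= 4/3 * abs t * K" using s K by (intro mult_right_mono) auto
   then have sK: "abs sg * K <= 1/3" using tK by simp
   have lo: "2/3 * norm (z $ al) <= norm ((z + sg *\<^sub>R b) $ al)" and hi: "norm ((z + sg *\<^sub>R b) $ al) <= 4/3 * norm (z $ al)" for al
    using norm_line_bounds[OF b[rule_format, of al] sK] by auto
   have Xlo: "2/3 * X 0 $ al <= X sg $ al" for al
   proof -
    have "2/3 * X 0 $ al = sqrt ((2/3)^2 * ((norm (z $ al))^2 + eps))" by (simp add: X_def real_sqrt_mult)
    also have "... <= X sg $ al"
    proof -
     have "(2/3 * norm (z $ al))^2 <= (norm ((z + sg *\<^sub>R b) $ al))^2" using lo by (intro power_mono) auto
     then have "(2/3)^2 * ((norm (z $ al))^2 + eps) <= (norm ((z + sg *\<^sub>R b) $ al))^2 + eps"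
      using e by (simp add: power_mult_distrib distrib_left power2_eq_square)
     then show ?thesis by (simp add: X_def)
    qed
    finally show ?thesis .
   qed
   have Xhi: "X sg $ al <= 2 * X 0 $ al" for al
   proof -
    have "(norm ((z + sg *\<^sub>R b) $ al))^2 <= (2 * norm (z $ al))^2" using hi[of al] norm_ge_zero[of "z $ al"] by (intro power_mono) (linarith, simp)
    then have "X sg $ al <= sqrt (2^2 * ((norm (z $ al))^2 + eps))"
     using e by (simp add: X_def power_mult_distrib)
    also have "... = sqrt (2^2) * sqrt ((norm (z $ al))^2 + eps)" by (rule real_sqrt_mult)
    also have "... = 2 * X 0 $ al" by (simp add: X_def)
    finally show ?thesis .
   qed
   have Xp: "0 < X sg $ al" for al using Xlo[of al] X0(1)[of al] by linarith
   have nX: "norm (X sg) <= 2 * N"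
   proof -
    have "norm (X sg) <= norm (2 *\<^sub>R X 0)" by (rule norm_vec_mono) (use Xhi Xp X0 less_imp_le[OF Xp] less_imp_le[OF X0(1)] in simp)
    then show ?thesis using norm_ge_zero[of S] by (simp add: N_def add_increasing)
   qed
   have nS: "norm S <= 2 * N" by (simp add: N_def)
   have w: "norm S powr r + norm (X sg) powr r <= 2 * 2 powr r * N powr r" if "r \<ge> 0" for r
   proof -
    have "norm S powr r <= (2 * N) powr r" "norm (X sg) powr r <= (2 * N) powr r" using nS nX that by (auto intro: powr_mono2)
    then show ?thesis using N by (simp add: powr_mult)
   qed
   have C1: "(\<Sum>al\<in>UNIV. (norm (b $ al))^2) <= K^2 * N^2"
   proof -
    have "(\<Sum>al\<in>UNIV. (norm (b $ al))^2) <= (\<Sum>al\<in>UNIV. K^2 * (X 0 $ al)^2)"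
    proof (rule sum_mono)
     fix al
     have "norm (b $ al) <= K * X 0 $ al" using b X0(2)[of al] K by (meson mult_left_mono order_trans)
     then have "(norm (b $ al))^2 <= (K * X 0 $ al)^2" by (intro power_mono) auto
     then show "(norm (b $ al))^2 <= K^2 * (X 0 $ al)^2" by (simp add: power_mult_distrib)
    qed
    also have "... = K^2 * (norm (X 0))^2" by (simp add: sum_distrib_left[symmetric] norm_vec_def L2_set_def sum_nonneg)
    also have "... <= K^2 * N^2" using N by (intro mult_left_mono power_mono) (auto simp: N_def)
    finally show ?thesis .
   qed
   have C2: "(\<Sum>al\<in>UNIV. (norm (b $ al))^2 / X sg $ al) <= K^2 * (3/2 * m * N)"
   proof -
    have "(norm (b $ al))^2 / X sg $ al <= K^2 * (3/2 * N)" for al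
    proof -
     have "norm (b $ al) <= K * X 0 $ al" using b X0(2)[of al] K by (meson mult_left_mono order_trans)
     then have "(norm (b $ al))^2 <= (K * X 0 $ al)^2" by (intro power_mono) auto
     then have "(norm (b $ al))^2 / X sg $ al <= (K * X 0 $ al)^2 / (2/3 * X 0 $ al)"
      using Xlo[of al] X0(1)[of al] by (intro frac_le) auto
     also have "... = K^2 * (3/2 * X 0 $ al)" using X0(1)[of al] by (simp add: power2_eq_square)
     also have "... <= K^2 * (3/2 * N)"
     proof -
      have "X 0 $ al <= N" using X0(3)[of al] norm_ge_zero[of S] unfolding N_def by linarith
      then show ?thesis by (intro mult_left_mono) auto
     qed
     finally show ?thesis .
    qed
    then have "(\<Sum>al\<in>UNIV. (norm (b $ al))^2 / X sg $ al) <= (\<Sum>al\<in>(UNIV::'m set). K^2 * (3/2 * N))" by (intro sum_mono)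
    then show ?thesis by (simp add: m_def mult_ac)
   qed
   have p1: "N powr (q - 2) * N^2 = N powr q" using N powr_add[of N "q - 2" 2] by simp
   have p2: "N powr (q - 1) * N = N powr q" using N powr_add[of N "q - 1" 1] by simp
   have "gm2 sg <= M * ((norm S powr (q - 2) + norm (X sg) powr (q - 2)) * (\<Sum>al\<in>UNIV. (norm (b $ al))^2)
    + (norm S powr (q - 1) + norm (X sg) powr (q - 1)) * (\<Sum>al\<in>UNIV. (norm (b $ al))^2 / X sg $ al))"
    using g2u[of sg] by simp
   also have "... <= M * ((2 * 2 powr (q - 2) * N powr (q - 2)) * (K^2 * N^2) + (2 * 2 powr (q - 1) * N powr (q - 1)) * (K^2 * (3/2 * m * N)))"
    using M q w[of "q - 2"] w[of "q - 1"] C1 C2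
    by (intro mult_left_mono add_mono mult_mono) (auto intro!: sum_nonneg divide_nonneg_nonneg less_imp_le[OF Xp])
   also have "... = M * K^2 * (2 * 2 powr (q - 2) * (N powr (q - 2) * N^2) + 2 * 2 powr (q - 1) * (3/2 * m) * (N powr (q - 1) * N))"
    by (simp add: algebra_simps)
   also have "... = M1 * K^2 * N powr q" unfolding p1 p2 M1_def by (simp add: algebra_simps)
   finally show ?thesis .
  qed
  have "abs (t * a) <= abs t * K" unfolding abs_mult using a by (intro mult_left_mono) auto
  then have ta: "abs (t * a) <= 1/4" using tK by linarith
  have "0 <= M1 * K^2 * N powr q" using M1 by simp
  from perspective_bound[where gm=gm, OF g1 g2 up this ta]
  have pb: "(1 - t * a) * gm (t / (1 - t * a)) + (1 + t * a) * gm (- (t / (1 + t * a))) <= 2 * gm 0 + 4/3 * (M1 * K^2 * N powr q) * t^2" by simp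
  have Nq: "N powr q <= M2 * (norm u powr q + norm z powr q + 1)"
  proof -
   have rt: "sqrt (x^2 + eps) <= x + 1" if "x \<ge> 0" for x
   proof -
    have "x^2 + eps <= (x + 1)^2" using that e by (simp add: power2_eq_square algebra_simps)
    then have "sqrt (x^2 + eps) <= sqrt ((x + 1)^2)" by (rule real_sqrt_le_mono)
    then show ?thesis using that by simp
   qed
   have m1: "(norm (1::real^'m)) <= m"
    using norm_le_l1_cart[of "1::real^'m"] by (simp add: m_def)
   have "norm S <= norm (\<chi> al. abs (u $ al) + 1)"
    by (rule norm_vec_mono) (use rt[OF abs_ge_zero] e in \<open>simp add: S_def\<close>)
   also have "(\<chi> al. abs (u $ al) + 1) = (\<chi> al. abs (u $ al)) + 1" by (simp add: vec_eq_iff)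
   also have "norm ((\<chi> al. abs (u $ al)) + 1) <= norm (\<chi> al. abs (u $ al)) + norm (1::real^'m)" by (rule norm_triangle_ineq)
   also have "norm (\<chi> al. abs (u $ al)) = norm u" by (simp add: norm_vec_def)
   finally have 1: "norm S <= norm u + m" using m1 by simp
   have "norm (X 0) <= norm (\<chi> al. norm (z $ al) + 1)"
    by (rule norm_vec_mono) (use rt[OF norm_ge_zero] e in \<open>simp add: X_def\<close>)
   also have "(\<chi> al. norm (z $ al) + 1) = (\<chi> al. norm (z $ al)) + 1" by (simp add: vec_eq_iff)
   also have "norm ((\<chi> al. norm (z $ al)) + 1) <= norm (\<chi> al. norm (z $ al)) + norm (1::real^'m)" by (rule norm_triangle_ineq)
   also have "norm (\<chi> al. norm (z $ al)) = norm z" by (simp add: norm_vec_def)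
   finally have 2: "norm (X 0) <= norm z + m" using m1 by simp
   have "N <= norm u + norm z + 2 * m" using 1 2 by (simp add: N_def)
   then have "N powr q <= (norm u + norm z + 2 * m) powr q" using N q by (intro powr_mono2) auto
   also have "... <= 3 powr q * (norm u powr q + norm z powr q + (2 * m) powr q)" using m q by (intro powr_sum3_le) auto
   also have "... <= 3 powr q * ((2 * m) powr q * (norm u powr q + norm z powr q + 1))"
   proof -
    have g: "1 <= (2 * m) powr q" using m q by (intro ge_one_powr_ge_zero) auto
    have "norm u powr q <= (2 * m) powr q * norm u powr q" "norm z powr q <= (2 * m) powr q * norm z powr q"
     using mult_right_mono[OF g, of "norm u powr q"] mult_right_mono[OF g, of "norm z powr q"] by auto
    then show ?thesis by (intro mult_left_mono) (auto simp: distrib_left)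
   qed
   finally show ?thesis by (simp add: M2_def mult.assoc)
  qed
  have "4/3 * (M1 * K^2 * N powr q) * t^2 <= 4/3 * (M1 * K^2 * (M2 * (norm u powr q + norm z powr q + 1))) * t^2"
   using M1 Nq by (intro mult_right_mono mult_left_mono) auto
  also have "... = 4/3 * M1 * M2 * K^2 * t^2 * (norm u powr q + norm z powr q + 1)" by (simp only: mult_ac)
  finally have "(1 - t * a) * gm (t / (1 - t * a)) + (1 + t * a) * gm (- (t / (1 + t * a))) <= 2 * gm 0 + 4/3 * M1 * M2 * K^2 * t^2 * (norm u powr q + norm z powr q + 1)"
   using pb by linarith
  then show "(1 - t * a) * G (\<chi> al. sqrt (abs (u $ al)^2 + eps), \<chi> al. sqrt ((norm ((z + (t / (1 - t * a)) *\<^sub>R b) $ al))^2 + eps))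
  + (1 + t * a) * G (\<chi> al. sqrt (abs (u $ al)^2 + eps), \<chi> al. sqrt ((norm ((z + (- (t / (1 + t * a))) *\<^sub>R b) $ al))^2 + eps))
  <= 2 * G (\<chi> al. sqrt (abs (u $ al)^2 + eps), \<chi> al. sqrt ((norm (z $ al))^2 + eps))
   + 4/3 * M1 * M2 * K^2 * t^2 * (norm u powr q + norm z powr q + 1)"
   unfolding gm_def X_def S_def by simp
 qed
qed

lemma norm_vec_nth_le: "norm (x $ i) <= norm (x :: ('a::real_normed_vector)^'n)"
 unfolding norm_vec_def by (rule member_le_L2_set) auto

text \<open>Moving a function by an inner variation of size \<open>t\<close> changes its gradient into \<open>z + (t / (1 - t a)) b\<close> and the volume by
  the factor \<open>1 - t a\<close>.  The power term keeps its factor \<open>eps\<close>, which makes the bound uniform in it.\<close>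

lemma dens_inner_variation:
 fixes G :: "(real^'m) \<times> (real^'m) => real"
 assumes H: "H2 q G" and q: "2 <= q" and p: "2 <= p"
 shows "\<exists>C>0. \<forall>eps (u::real^'m) (z::real^'n^'m) b K t a. 0 < eps & eps <= 1 & (\<forall>al. norm (b $ al) <= K * norm (z $ al)) & abs t * K <= 1/4 & abs a <= K \<longrightarrow>
  (1 - t * a) * dens G p eps u (z + (t / (1 - t * a)) *\<^sub>R b) + (1 + t * a) * dens G p eps u (z + (- (t / (1 + t * a))) *\<^sub>R b)
  <= 2 * dens G p eps u z + C * K^2 * t^2 * (eps * norm z powr p + norm u powr q + norm z powr q + 1)"
proof -
 obtain C1 where C1: "C1 > 0" "\<forall>eps (u::real^'m) (z::real^'n^'m) b K t a. 0 < eps & eps <= 1 & (\<forall>al. norm (b $ al) <= K * norm (z $ al)) & abs t * K <= 1/4 & abs a <= K \<longrightarrow>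
  (1 - t * a) * G (\<chi> al. sqrt (abs (u $ al)^2 + eps), \<chi> al. sqrt ((norm ((z + (t / (1 - t * a)) *\<^sub>R b) $ al))^2 + eps))
  + (1 + t * a) * G (\<chi> al. sqrt (abs (u $ al)^2 + eps), \<chi> al. sqrt ((norm ((z + (- (t / (1 + t * a))) *\<^sub>R b) $ al))^2 + eps))
  <= 2 * G (\<chi> al. sqrt (abs (u $ al)^2 + eps), \<chi> al. sqrt ((norm (z $ al))^2 + eps))
   + C1 * K^2 * t^2 * (norm u powr q + norm z powr q + 1)"
  using G_term_inner_variation[OF H q] by blast
 define c where "c = 4/3 * (p * (p - 1) * (4/3) powr (p - 2))"
 have c: "c \<ge> 0" using p by (simp add: c_def)
 define m where "m = real CARD('m)"
 have m: "m \<ge> 1" by (simp add: m_def Suc_leI)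
 show ?thesis
 proof (intro exI[of _ "C1 + c * m"] conjI allI impI)
  show "0 < C1 + c * m" using C1(1) c m by (simp add: add_pos_nonneg)
  fix eps :: real and u :: "real^'m" and z b :: "real^'n^'m" and K t a :: real
  assume A: "0 < eps & eps <= 1 & (\<forall>al. norm (b $ al) <= K * norm (z $ al)) & abs t * K <= 1/4 & abs a <= K"
  then have e: "0 < eps" and b: "!!al. norm (b $ al) <= K * norm (z $ al)" and tK: "abs t * K <= 1/4" and a: "abs a <= K" by auto
  define P where "P y = (\<Sum>al\<in>UNIV. norm (y $ al) powr p)" for y :: "real^'n^'m"
  define g where "g y = G (\<chi> al. sqrt (abs (u $ al)^2 + eps), \<chi> al. sqrt ((norm (y $ al))^2 + eps))" for y :: "real^'n^'m"
  have dP: "dens G p eps u y = eps * P y + g y" for y by (simp add: dens_def P_def g_def)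
  define X where "X = norm u powr q + norm z powr q + 1"
  have X: "X \<ge> 0" by (simp add: X_def)
  let ?zp = "z + (t / (1 - t * a)) *\<^sub>R b" and ?zm = "z + (- (t / (1 + t * a))) *\<^sub>R b"
  have 1: "(1 - t * a) * g ?zp + (1 + t * a) * g ?zm <= 2 * g z + C1 * K^2 * t^2 * X"
   using C1(2)[rule_format, OF A, of u] by (simp only: g_def X_def)
  have "(1 - t * a) * P ?zp + (1 + t * a) * P ?zm = (\<Sum>al\<in>UNIV. (1 - t * a) * norm (z $ al + (t / (1 - t * a)) *\<^sub>R b $ al) powr p + (1 + t * a) * norm (z $ al + (- (t / (1 + t * a))) *\<^sub>R b $ al) powr p)"
   unfolding P_def by (simp only: sum.distrib sum_distrib_left vector_add_component vector_scaleR_component)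
  also have "... <= (\<Sum>al\<in>UNIV. 2 * norm (z $ al) powr p + 4/3 * (p * (p - 1) * (4/3) powr (p - 2) * K^2 * norm (z $ al) powr p) * t^2)"
   by (intro sum_mono power_term_inner_variation[OF p b tK a])
  also have "... = 2 * P z + c * K^2 * t^2 * P z"
  proof -
   have "4/3 * (p * (p - 1) * (4/3) powr (p - 2) * K^2 * r) * t^2 = c * K^2 * t^2 * r" for r by (simp add: c_def)
   then show ?thesis unfolding P_def by (simp only: sum.distrib sum_distrib_left)
  qed
  also have "... <= 2 * P z + c * K^2 * t^2 * (m * norm z powr p)"
  proof -
   have "norm (z $ al) powr p <= norm z powr p" for al using p by (intro powr_mono2 norm_vec_nth_le) auto
   then have "P z <= (\<Sum>al\<in>(UNIV::'m set). norm z powr p)" unfolding P_def by (intro sum_mono)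
   then have "P z <= m * norm z powr p" by (simp add: m_def)
   then show ?thesis using c by (intro add_left_mono mult_left_mono) auto
  qed
  finally have "(1 - t * a) * P ?zp + (1 + t * a) * P ?zm <= 2 * P z + c * K^2 * t^2 * (m * norm z powr p)" .
  then have "eps * ((1 - t * a) * P ?zp + (1 + t * a) * P ?zm) <= eps * (2 * P z + c * K^2 * t^2 * (m * norm z powr p))"
   using e by (intro mult_left_mono) auto
  then have 2: "(1 - t * a) * (eps * P ?zp) + (1 + t * a) * (eps * P ?zm) <= 2 * (eps * P z) + c * m * K^2 * t^2 * (eps * norm z powr p)"
   by (simp add: algebra_simps)
  have 3: "C1 * K^2 * t^2 * X <= (C1 + c * m) * K^2 * t^2 * X" using C1(1) c m X by (intro mult_right_mono) auto
  have 4: "c * m * K^2 * t^2 * (eps * norm z powr p) <= (C1 + c * m) * K^2 * t^2 * (eps * norm z powr p)" using C1(1) c m e by (intro mult_right_mono) auto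
  have "(1 - t * a) * dens G p eps u ?zp + (1 + t * a) * dens G p eps u ?zm =
    ((1 - t * a) * (eps * P ?zp) + (1 + t * a) * (eps * P ?zm)) + ((1 - t * a) * g ?zp + (1 + t * a) * g ?zm)"
   unfolding dP by (simp only: distrib_left add_ac)
  also have "... <= 2 * (eps * P z) + 2 * g z + ((C1 + c * m) * K^2 * t^2 * (eps * norm z powr p) + (C1 + c * m) * K^2 * t^2 * X)"
   using 1 2 3 4 by linarith
  also have "... = 2 * dens G p eps u z + (C1 + c * m) * K^2 * t^2 * (eps * norm z powr p + norm u powr q + norm z powr q + 1)"
   unfolding dP X_def by (simp add: distrib_left)
  finally show "(1 - t * a) * dens G p eps u ?zp + (1 + t * a) * dens G p eps u ?zm
   <= 2 * dens G p eps u z + (C1 + c * m) * K^2 * t^2 * (eps * norm z powr p + norm u powr q + norm z powr q + 1)" .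
 qed
qed

section \<open>Growth of the integrand\<close>

lemma AE_open_ex:
 fixes Om :: "'a::euclidean_space set"
 assumes "open Om" "Om \<noteq> {}" "AE x in lebesgue_on Om. P x"
 shows "\<exists>x\<in>Om. P x"
proof (rule ccontr)
 assume n: "\<not> (\<exists>x\<in>Om. P x)"
 have O: "Om \<in> sets lebesgue" using assms(1) by auto
 have "AE x in lebesgue. x \<in> Om \<longrightarrow> P x" using assms(3) O by (simp add: AE_restrict_space_iff)
 then have "AE x in lebesgue. x \<notin> Om" by (rule eventually_mono) (use n in blast)
 then have "negligible Om" using AE_iff_null_sets[OF O] by (simp add: negligible_iff_null_sets)
 then show False using open_not_negligible[OF assms(1,2)] by simp
qed

text \<open>The hypothesis bounds \<open>G (s, xi)\<close> by values \<open>a x\<close> at almost every \<open>x\<close>, where the exceptional set depends on \<open>(s, xi)\<close>.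
  If no constant could replace \<open>a\<close>, there would be countably many counterexamples, and one point \<open>x\<close> good for all of
  them.\<close>

lemma H1_growth:
 fixes G :: "(real^'m) \<times> (real^'m) => real" and Om :: "(real^'n) set"
 assumes H: "H1 q Om G" and O: "open Om" "Om \<noteq> {}"
 shows "\<exists>A>0. \<forall>s\<in>orthant. \<forall>xi\<in>orthant. 0 <= G (s, xi) \<and>
  G (s, xi) <= A * (1 + (\<Sum>al\<in>UNIV. (s $ al) powr q) + (\<Sum>al\<in>UNIV. (xi $ al) powr q))"
proof -
 obtain L0 a where L0: "L0 > 1" and a: "\<forall>x\<in>Om. 0 <= a x" and
  ae: "!!s xi. s \<in> orthant ==> xi \<in> orthant ==> AE x in lebesgue_on Om.
     (\<Sum>al\<in>UNIV. (xi $ al) powr q) + (\<Sum>al\<in>UNIV. (s $ al) powr q) <= G (s, xi) \<and>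
     G (s, xi) <= L0 * ((\<Sum>al\<in>UNIV. (xi $ al) powr q) + (\<Sum>al\<in>UNIV. (s $ al) powr q) + a x)"
  using H unfolding H1_def by blast
 define S where "S v = (\<Sum>al\<in>UNIV. (v $ al) powr q)" for v :: "real^'m"
 have S: "S v \<ge> 0" for v unfolding S_def by (intro sum_nonneg) auto
 have pos: "0 <= G (s, xi)" if so: "s \<in> orthant" "xi \<in> orthant" for s xi
 proof -
  obtain x where "S xi + S s <= G (s, xi)" using AE_open_ex[OF O ae[OF so]] unfolding S_def by blast
  then show ?thesis using S[of s] S[of xi] by linarith
 qed
 have "\<exists>n::nat. \<forall>s\<in>orthant. \<forall>xi\<in>orthant. G (s, xi) <= L0 * (S xi + S s + real n)"
 proof (rule ccontr)
  assume "\<not> ?thesis"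
  then have "\<forall>n::nat. \<exists>s xi. s \<in> orthant & xi \<in> orthant & \<not> G (s, xi) <= L0 * (S xi + S s + real n)" by blast
  then obtain s xi where sx: "!!n. s n \<in> orthant" "!!n. xi n \<in> orthant" "!!n::nat. \<not> G (s n, xi n) <= L0 * (S (xi n) + S (s n) + real n)" by metis
  have "AE x in lebesgue_on Om. \<forall>n. G (s n, xi n) <= L0 * (S (xi n) + S (s n) + a x)"
   unfolding AE_all_countable
  proof
   fix n show "AE x in lebesgue_on Om. G (s n, xi n) <= L0 * (S (xi n) + S (s n) + a x)"
    using ae[OF sx(1,2), of n n] unfolding S_def by (rule eventually_mono) blast
  qed
  then obtain x where x: "x \<in> Om" "!!n. G (s n, xi n) <= L0 * (S (xi n) + S (s n) + a x)" using AE_open_ex[OF O] by blast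
  obtain n where n: "a x <= real n" using real_arch_simple by blast
  have "L0 * (S (xi n) + S (s n) + a x) <= L0 * (S (xi n) + S (s n) + real n)" using L0 n by (intro mult_left_mono) auto
  then show False using x(2)[of n] sx(3)[of n] by linarith
 qed
 then obtain n where n: "!!s xi. s \<in> orthant ==> xi \<in> orthant ==> G (s, xi) <= L0 * (S xi + S s + real n)" by blast
 show ?thesis
 proof (intro exI[of _ "L0 * (1 + real n)"] conjI ballI)
  show "0 < L0 * (1 + real n)" using L0 by (simp add: add_pos_nonneg)
  fix s xi :: "real^'m" assume so: "s \<in> orthant" "xi \<in> orthant"
  show "0 <= G (s, xi)" by (rule pos[OF so])
  have "S xi + S s + real n <= (1 + real n) * (1 + S s + S xi)"
   using S[of s] S[of xi] by (simp add: algebra_simps)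
  then have "L0 * (S xi + S s + real n) <= L0 * ((1 + real n) * (1 + S s + S xi))" using L0 by (intro mult_left_mono) auto
  then show "G (s, xi) <= L0 * (1 + real n) * (1 + (\<Sum>al\<in>UNIV. (s $ al) powr q) + (\<Sum>al\<in>UNIV. (xi $ al) powr q))"
   using n[OF so] by (simp add: S_def mult.assoc)
 qed
qed

lemma sqrt_sq_add_powr_le:
 fixes x eps p q :: real
 assumes "0 < eps" "eps <= 1" "0 <= x" "x <= y" "1 <= q" "q <= p"
 shows "sqrt (x^2 + eps) powr q <= 2 powr q * (2 + y powr p)"
proof -
 have "x^2 + eps <= (x + 1)^2" using assms by (simp add: power2_eq_square algebra_simps)
 then have "sqrt (x^2 + eps) <= sqrt ((x + 1)^2)" by (rule real_sqrt_le_mono)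
 then have "sqrt (x^2 + eps) <= x + 1" using assms by simp
 then have "sqrt (x^2 + eps) powr q <= abs (x + 1) powr q" using assms by (intro powr_mono2) auto
 also have "... <= 2 powr q * (abs x powr q + abs 1 powr q)" using assms by (intro powr_add_le) auto
 also have "... <= 2 powr q * (2 + y powr p)"
 proof -
  have "x powr q <= 1 + y powr p"
  proof (cases "x <= 1")
   case True
   then have "x powr q <= 1 powr q" using assms by (intro powr_mono2) auto
   then show ?thesis by (simp add: add_increasing2)
  next
   case False
   then have "x powr q <= x powr p" using assms by (intro powr_mono) auto
   also have "... <= y powr p" using assms by (intro powr_mono2) auto
   finally show ?thesis by simp
  qed
  then show ?thesis using assms by (intro mult_left_mono) auto
 qed
 finally show ?thesis .
qed

lemma dens_growth:
 fixes G :: "(real^'m) \<times> (real^'m) => real" and Om :: "(real^'n) set"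
 assumes H: "H1 q Om G" and O: "open Om" "Om \<noteq> {}" and q: "1 <= q" "q <= p"
 shows "\<exists>A>0. \<forall>eps (u::real^'m) (z::real^'n^'m). 0 < eps & eps <= 1 \<longrightarrow> 0 <= dens G p eps u z \<and>
  dens G p eps u z <= A * (1 + norm u powr p + norm z powr p)"
proof -
 obtain A where A: "A > 0" "!!s xi. s \<in> orthant ==> xi \<in> orthant ==> 0 <= G (s, xi) \<and>
  G (s, xi) <= A * (1 + (\<Sum>al\<in>UNIV. (s $ al) powr q) + (\<Sum>al\<in>UNIV. (xi $ al) powr q))"
  using H1_growth[OF H O] by blast
 define m where "m = real CARD('m)"
 have m: "m \<ge> 1" by (simp add: m_def Suc_leI)
 define c where "c = 2 powr q"
 have c: "c > 0" by (simp add: c_def)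
 show ?thesis
 proof (intro exI[of _ "m + A * (1 + 4 * m * c)"] conjI allI impI)
  show "0 < m + A * (1 + 4 * m * c)" using A m c by (intro add_pos_nonneg) auto
  fix eps :: real and u :: "real^'m" and z :: "real^'n^'m" assume e: "0 < eps & eps <= 1"
  define s where "s = (\<chi> al. sqrt (abs (u $ al)^2 + eps))"
  define x where "x = (\<chi> al. sqrt ((norm (z $ al))^2 + eps))"
  have so: "s \<in> orthant" "x \<in> orthant" using e by (auto simp: s_def x_def orthant_def)
  have d: "dens G p eps u z = eps * (\<Sum>al\<in>UNIV. norm (z $ al) powr p) + G (s, x)" by (simp add: dens_def s_def x_def)
  have P0: "0 <= (\<Sum>al\<in>UNIV. norm (z $ al) powr p)" by (intro sum_nonneg) auto
  show "0 <= dens G p eps u z" unfolding d using A(2)[OF so] P0 e by (intro add_nonneg_nonneg mult_nonneg_nonneg) auto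
  have P: "(\<Sum>al\<in>UNIV. norm (z $ al) powr p) <= m * norm z powr p"
  proof -
   have "norm (z $ al) powr p <= norm z powr p" for al using q by (intro powr_mono2 norm_vec_nth_le) auto
   then have "(\<Sum>al\<in>UNIV. norm (z $ al) powr p) <= (\<Sum>al\<in>(UNIV::'m set). norm z powr p)" by (intro sum_mono)
   then show ?thesis by (simp add: m_def)
  qed
  have "eps * (\<Sum>al\<in>UNIV. norm (z $ al) powr p) <= 1 * (\<Sum>al\<in>UNIV. norm (z $ al) powr p)" using e P0 by (intro mult_right_mono) auto
  then have 1: "eps * (\<Sum>al\<in>UNIV. norm (z $ al) powr p) <= m * norm z powr p" using P by linarith
  have s1: "(\<Sum>al\<in>UNIV. (s $ al) powr q) <= m * (c * (2 + norm u powr p))"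
  proof -
   have "(s $ al) powr q <= c * (2 + norm u powr p)" for al
    using sqrt_sq_add_powr_le[of eps "abs (u $ al)" "norm u" q p] e q component_le_norm_cart[of u al] by (simp add: s_def c_def)
   then have "(\<Sum>al\<in>UNIV. (s $ al) powr q) <= (\<Sum>al\<in>(UNIV::'m set). c * (2 + norm u powr p))" by (intro sum_mono)
   then show ?thesis by (simp add: m_def)
  qed
  have x1: "(\<Sum>al\<in>UNIV. (x $ al) powr q) <= m * (c * (2 + norm z powr p))"
  proof -
   have "(x $ al) powr q <= c * (2 + norm z powr p)" for al
    using sqrt_sq_add_powr_le[of eps "norm (z $ al)" "norm z" q p] e q norm_vec_nth_le[of z al] by (simp add: x_def c_def)
   then have "(\<Sum>al\<in>UNIV. (x $ al) powr q) <= (\<Sum>al\<in>(UNIV::'m set). c * (2 + norm z powr p))" by (intro sum_mono)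
   then show ?thesis by (simp add: m_def)
  qed
  define Y where "Y = 1 + norm u powr p + norm z powr p"
  have Y: "Y \<ge> 1" "norm u powr p <= Y" "norm z powr p <= Y" by (auto simp: Y_def)
  have mc: "0 <= m * c" using m c by simp
  have "1 + (\<Sum>al\<in>UNIV. (s $ al) powr q) + (\<Sum>al\<in>UNIV. (x $ al) powr q) <= Y + m * c * (4 + norm u powr p + norm z powr p)"
   using s1 x1 Y(1) by (simp add: algebra_simps)
  also have "... <= Y + m * c * (4 * Y)" using mc by (intro add_left_mono mult_left_mono) (auto simp: Y_def)
  also have "... = (1 + 4 * m * c) * Y" by (simp add: algebra_simps)
  finally have "G (s, x) <= A * ((1 + 4 * m * c) * Y)" using A(2)[OF so] mult_left_mono[of _ "(1 + 4 * m * c) * Y" A] A(1) by (meson less_imp_le order_trans)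
  moreover have "m * norm z powr p <= m * Y" using m Y by (intro mult_left_mono) auto
  ultimately have "dens G p eps u z <= m * Y + A * ((1 + 4 * m * c) * Y)" unfolding d using 1 by linarith
  also have "... = (m + A * (1 + 4 * m * c)) * Y" by (simp add: algebra_simps)
  finally show "dens G p eps u z <= (m + A * (1 + 4 * m * c)) * (1 + norm u powr p + norm z powr p)" by (simp add: Y_def)
 qed
qed

lemma continuous_dens:
 fixes G :: "(real^'m) \<times> (real^'m) => real"
 assumes H: "H2 q G" and e: "eps > 0" and p: "p > 0"
 shows "continuous_on UNIV (%y :: (real^'m) \<times> (real^'n^'m). dens G p eps (fst y) (snd y))"
proof -
 have G: "continuous_on (orthant \<times> orthant) G" using H2_Ck(1)[OF H] by (rule Ck_on_continuous)
 have R: "continuous_on UNIV (%y :: (real^'m) \<times> (real^'n^'m). (\<chi> al. sqrt (abs (fst y $ al)^2 + eps), \<chi> al. sqrt ((norm (snd y $ al))^2 + eps)))"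
  by (intro continuous_intros)
 have "continuous_on UNIV (%y :: (real^'m) \<times> (real^'n^'m). G (\<chi> al. sqrt (abs (fst y $ al)^2 + eps), \<chi> al. sqrt ((norm (snd y $ al))^2 + eps)))"
  by (rule continuous_on_compose2[OF G R]) (use e in \<open>auto simp: orthant_def\<close>)
 moreover have "continuous_on UNIV (%y :: (real^'m) \<times> (real^'n^'m). eps * (\<Sum>al\<in>UNIV. norm (snd y $ al) powr p))"
  by (intro continuous_intros continuous_on_powr') (use p in auto)
 ultimately show ?thesis unfolding dens_def by (rule continuous_on_add[rotated])
qed

section \<open>Strong limits of convex combinations\<close>

text \<open>The parallelogram identity only needs midpoints, so the hull of the tail from \<open>l\<close> on is closed under midpoints rather
  than under all convex combinations.\<close>

inductive_set midpoint_hull :: "(nat => 'a => 'b::real_vector) => nat => ('a => 'b) set" for v l where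
 base: "l <= k ==> v k \<in> midpoint_hull v l"
| mid: "f \<in> midpoint_hull v l ==> g \<in> midpoint_hull v l ==> (%x. (1/2) *\<^sub>R (f x + g x)) \<in> midpoint_hull v l"

lemma midpoint_hull_antimono: "l <= l' ==> midpoint_hull v l' \<subseteq> midpoint_hull v l"
proof
 fix f assume "l <= l'" "f \<in> midpoint_hull v l'"
 from this(2,1) show "f \<in> midpoint_hull v l"
  by (induction rule: midpoint_hull.induct) (auto intro: midpoint_hull.intros)
qed

lemma midpoint_hull_measurable:
 fixes v :: "nat => 'a => 'b::euclidean_space"
 assumes "!!k. v k \<in> borel_measurable M" "f \<in> midpoint_hull v l" shows "f \<in> borel_measurable M"
 using assms(2) by (induction rule: midpoint_hull.induct) (auto intro: assms(1))

lemma norm_midpoint_sq: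
 fixes x y :: "'b::real_inner"
 shows "(norm ((1/2) *\<^sub>R (x + y)))^2 + (norm (x - y))^2 / 4 = ((norm x)^2 + (norm y)^2) / 2"
 unfolding power2_norm_eq_inner by (simp add: inner_add_left inner_add_right inner_diff_left inner_diff_right inner_commute field_simps)

lemma midpoint_hull_weighted:
 fixes v :: "nat => 'a => 'b::euclidean_space" and w :: "'a => ennreal"
 assumes v[measurable]: "!!k. v k \<in> borel_measurable M" and w[measurable]: "w \<in> borel_measurable M"
  and b: "!!k. l <= k ==> (\<integral>\<^sup>+x. w x * ennreal ((norm (v k x))^2) \<partial>M) <= B" and f: "f \<in> midpoint_hull v l"
 shows "(\<integral>\<^sup>+x. w x * ennreal ((norm (f x))^2) \<partial>M) <= B"
 using f
proof (induction rule: midpoint_hull.induct)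
 case (base k) then show ?case by (rule b)
next
 case (mid f g)
 have [measurable]: "f \<in> borel_measurable M" "g \<in> borel_measurable M" using mid midpoint_hull_measurable[where v=v, OF v] by auto
 have "(\<integral>\<^sup>+x. w x * ennreal ((norm ((1/2) *\<^sub>R (f x + g x)))^2) \<partial>M) \<le>
   (\<integral>\<^sup>+x. ennreal (1/2) * (w x * ennreal ((norm (f x))^2)) + ennreal (1/2) * (w x * ennreal ((norm (g x))^2)) \<partial>M)"
 proof (rule nn_integral_mono)
  fix x
  have "(norm ((1/2) *\<^sub>R (f x + g x)))^2 <= 1/2 * (norm (f x))^2 + 1/2 * (norm (g x))^2"
  proof -
   have "0 <= (norm (f x - g x))^2 / 4" by simp
   then show ?thesis using norm_midpoint_sq[of "f x" "g x"] unfolding add_divide_distrib by linarith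
  qed
  then have "ennreal ((norm ((1/2) *\<^sub>R (f x + g x)))^2) <= ennreal (1/2 * (norm (f x))^2 + 1/2 * (norm (g x))^2)"
   by (rule ennreal_leI)
  also have "... = ennreal (1/2) * ennreal ((norm (f x))^2) + ennreal (1/2) * ennreal ((norm (g x))^2)"
   by (subst ennreal_plus, simp, simp, subst ennreal_mult, simp, simp, subst ennreal_mult, simp_all)
  finally have "w x * ennreal ((norm ((1/2) *\<^sub>R (f x + g x)))^2) <= w x * (ennreal (1/2) * ennreal ((norm (f x))^2) + ennreal (1/2) * ennreal ((norm (g x))^2))"
   by (rule mult_left_mono) simp
  then show "w x * ennreal ((norm ((1/2) *\<^sub>R (f x + g x)))^2) <= ennreal (1/2) * (w x * ennreal ((norm (f x))^2)) + ennreal (1/2) * (w x * ennreal ((norm (g x))^2))"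
   by (simp add: distrib_left mult_ac)
 qed
 also have "... = ennreal (1/2) * (\<integral>\<^sup>+x. w x * ennreal ((norm (f x))^2) \<partial>M) + ennreal (1/2) * (\<integral>\<^sup>+x. w x * ennreal ((norm (g x))^2) \<partial>M)"
  by (simp add: nn_integral_add nn_integral_cmult)
 also have "... <= ennreal (1/2) * B + ennreal (1/2) * B" using mid by (intro add_mono mult_left_mono) auto
 also have "... = (ennreal (1/2) + ennreal (1/2)) * B" by (rule distrib_right[symmetric])
 also have "ennreal (1/2) + ennreal (1/2) = 1" by (subst ennreal_plus[symmetric]) auto
 also have "1 * B = B" by simp
 finally show ?case .
qed

text \<open>Near-minimizers of the norm in the decreasing hulls form a Cauchy sequence, by the parallelogram identity.\<close>

lemma midpoint_hull_Cauchy: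
 fixes v :: "nat => 'a => 'b::euclidean_space"
 assumes v[measurable]: "!!k. v k \<in> borel_measurable M"
  and b: "!!k. (\<integral>\<^sup>+x. ennreal ((norm (v k x))^2) \<partial>M) <= ennreal B"
 obtains W where "!!l. W l \<in> midpoint_hull v l"
  and "!!e. e > 0 ==> \<exists>L. \<forall>l\<ge>L. \<forall>j\<ge>l. (\<integral>\<^sup>+x. ennreal ((norm (W l x - W j x))^2) \<partial>M) <= ennreal e"
proof -
 define I where "I f = (\<integral>\<^sup>+x. ennreal ((norm (f x))^2) \<partial>M)" for f :: "'a => 'b"
 define N where "N f = enn2real (I f)" for f :: "'a => 'b"
 have meas: "f \<in> borel_measurable M" if "f \<in> midpoint_hull v l" for f l by (rule midpoint_hull_measurable[where v=v, OF v that])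
 have IB: "I f <= ennreal B" if "f \<in> midpoint_hull v l" for f l
  using midpoint_hull_weighted[where v=v and w="%x. 1" and M=M and l=l and B="ennreal B" and f=f] b that v by (simp add: I_def)
 have IN: "I f = ennreal (N f)" if "f \<in> midpoint_hull v l" for f l
  using IB[OF that] unfolding N_def by (metis ennreal_enn2real ennreal_less_top le_less_trans)
 have N0: "N f \<ge> 0" for f by (simp add: N_def)
 have NB: "N f <= max B 0" if "f \<in> midpoint_hull v l" for f l
  using IB[OF that] IN[OF that] N0[of f] by (cases "B \<ge> 0") (auto simp: ennreal_neg max_def)
 have para: "I (%x. f x - g x) <= ennreal (2 * N f + 2 * N g - 4 * c)"
  if f: "f \<in> midpoint_hull v l" and g: "g \<in> midpoint_hull v l" and c: "!!h. h \<in> midpoint_hull v l ==> c <= N h" for f g l c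
 proof -
  let ?h = "%x. (1/2) *\<^sub>R (f x + g x)"
  have h: "?h \<in> midpoint_hull v l" using f g by (rule midpoint_hull.mid)
  have [measurable]: "f \<in> borel_measurable M" "g \<in> borel_measurable M" using meas f g by auto
  have "ennreal (4 * N ?h) + I (%x. f x - g x) = (\<integral>\<^sup>+x. 4 * ennreal ((norm (?h x))^2) \<partial>M) + I (%x. f x - g x)"
   using IN[OF h] N0[of ?h] by (subst nn_integral_cmult) (auto simp: I_def ennreal_mult)
  also have "... = (\<integral>\<^sup>+x. 4 * ennreal ((norm (?h x))^2) + ennreal ((norm (f x - g x))^2) \<partial>M)"
   unfolding I_def by (rule nn_integral_add[symmetric]) auto
  also have "... = (\<integral>\<^sup>+x. 2 * ennreal ((norm (f x))^2) + 2 * ennreal ((norm (g x))^2) \<partial>M)"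
  proof (rule nn_integral_cong)
   fix x
   have "4 * (norm (?h x))^2 + (norm (f x - g x))^2 = 2 * (norm (f x))^2 + 2 * (norm (g x))^2"
    using norm_midpoint_sq[of "f x" "g x"] unfolding add_divide_distrib by linarith
   then have "ennreal (4 * (norm (?h x))^2 + (norm (f x - g x))^2) = ennreal (2 * (norm (f x))^2 + 2 * (norm (g x))^2)" by simp
   then show "4 * ennreal ((norm (?h x))^2) + ennreal ((norm (f x - g x))^2) = 2 * ennreal ((norm (f x))^2) + 2 * ennreal ((norm (g x))^2)"
    by (simp only: ennreal_plus zero_le_power2 zero_le_mult_iff zero_le_numeral ennreal_mult ennreal_numeral simp_thms)
  qed
  also have "... = 2 * I f + 2 * I g" unfolding I_def by (simp add: nn_integral_add nn_integral_cmult)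
  also have "... = ennreal (2 * N f + 2 * N g)"
   using IN[OF f] IN[OF g] N0[of f] N0[of g] by (simp add: ennreal_mult)
  finally have eq: "ennreal (4 * N ?h) + I (%x. f x - g x) = ennreal (2 * N f + 2 * N g)" .
  have "I (%x. f x - g x) = ennreal (2 * N f + 2 * N g) - ennreal (4 * N ?h)"
   unfolding eq[symmetric] by simp
  also have "... = ennreal (2 * N f + 2 * N g - 4 * N ?h)" using N0[of ?h] by (simp add: ennreal_minus)
  also have "... <= ennreal (2 * N f + 2 * N g - 4 * c)" using c[OF h] by (intro ennreal_leI) simp
  finally show ?thesis .
 qed
 \<comment> \<open>The infimum of the norms over the tail hulls increases to a finite limit.\<close>
 define d where "d l = Inf (N ` midpoint_hull v l)" for l
 have bdd: "bdd_below (N ` midpoint_hull v l)" for l using N0 by (intro bdd_belowI2[of _ 0]) auto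
 have ne: "midpoint_hull v l \<noteq> {}" for l using midpoint_hull.base[of l l v] by auto
 have dle: "d l <= N h" if "h \<in> midpoint_hull v l" for h l unfolding d_def using bdd that by (intro cInf_lower) auto
 have "\<exists>f\<in>midpoint_hull v l. N f < d l + inverse (real (Suc l))" for l
  using cInf_lessD[of "N ` midpoint_hull v l" "d l + inverse (real (Suc l))"] ne by (auto simp: d_def)
 then have "\<forall>l. \<exists>f. f \<in> midpoint_hull v l & N f < d l + inverse (real (Suc l))" by blast
 then obtain W where W': "\<forall>l. W l \<in> midpoint_hull v l & N (W l) < d l + inverse (real (Suc l))" by (rule choice[THEN exE])
 have W: "!!l. W l \<in> midpoint_hull v l" "!!l. N (W l) < d l + inverse (real (Suc l))" using W' by auto
 have "incseq d"
  unfolding d_def by (intro incseq_SucI cInf_superset_mono image_mono midpoint_hull_antimono bdd) (auto simp: ne)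
 moreover have "d l <= max B 0" for l using dle[OF W(1)] NB[OF W(1)] by (rule order_trans)
 ultimately obtain D where D: "d \<longlonglongrightarrow> D" "!!l. d l <= D" using incseq_convergent[of d "max B 0"] by blast
 have C: "\<exists>L. \<forall>l\<ge>L. \<forall>j\<ge>l. I (%x. W l x - W j x) <= ennreal e" if e: "e > 0" for e :: real
 proof -
  have "(%l. 2 * (D - d l) + 4 * inverse (real (Suc l))) \<longlonglongrightarrow> 2 * (D - D) + 4 * 0"
   by (intro tendsto_intros D LIMSEQ_inverse_real_of_nat)
  then have "eventually (%l. 2 * (D - d l) + 4 * inverse (real (Suc l)) < e) sequentially"
   using e by (intro order_tendstoD(2)) auto
  then obtain L where L: "!!l. l \<ge> L ==> 2 * (D - d l) + 4 * inverse (real (Suc l)) < e" by (auto simp: eventually_sequentially)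
  show ?thesis
  proof (intro exI[of _ L] allI impI)
   fix l j assume lj: "L <= l" "l <= j"
   have Wj: "W j \<in> midpoint_hull v l" using W(1)[of j] midpoint_hull_antimono[OF lj(2)] by blast
   have "I (%x. W l x - W j x) <= ennreal (2 * N (W l) + 2 * N (W j) - 4 * d l)" by (rule para[OF W(1) Wj dle])
   also have "... <= ennreal e"
   proof (rule ennreal_leI)
    have "inverse (real (Suc j)) <= inverse (real (Suc l))" using lj by (intro le_imp_inverse_le) auto
    then have "N (W l) + N (W j) <= d l + D + 2 * inverse (real (Suc l))" using W(2)[of l] W(2)[of j] D(2)[of j] by linarith
    then have "2 * (N (W l) + N (W j) - 2 * d l) <= 2 * (D - d l + 2 * inverse (real (Suc l)))" by (intro mult_left_mono) auto
    also have "... <= e" using L[OF lj(1)] by (simp only: distrib_left)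
    finally show "2 * N (W l) + 2 * N (W j) - 4 * d l <= e" by (simp add: algebra_simps)
   qed
   finally show "I (%x. W l x - W j x) <= ennreal e" .
  qed
 qed
 show ?thesis by (rule that[OF W(1)]) (use C in \<open>simp add: I_def\<close>)
qed

lemma geometric_increments_converge:
 fixes V :: "nat => 'b::euclidean_space"
 assumes "(\<Sum>n. ennreal (4 ^ n * (norm (V (Suc n) - V n))^2)) \<noteq> \<infinity>"
 shows "convergent V"
proof -
 obtain C where C: "(\<Sum>n. ennreal (4 ^ n * (norm (V (Suc n) - V n))^2)) = ennreal C" "C \<ge> 0"
  by (rule that[OF ennreal_enn2real[symmetric] enn2real_nonneg]) (use assms in \<open>simp only: infinity_ennreal_def less_top\<close>)
 have le: "norm (V (Suc n) - V n) <= sqrt C * (1/2) ^ n" for n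
 proof -
  have "ennreal (4 ^ n * (norm (V (Suc n) - V n))^2) <= ennreal C"
  proof -
   have "(\<Sum>k\<in>{n}. ennreal (4 ^ k * (norm (V (Suc k) - V k))^2)) <= (\<Sum>k. ennreal (4 ^ k * (norm (V (Suc k) - V k))^2))"
    by (rule sum_le_suminf) auto
   then show ?thesis unfolding C(1) by (simp only: sum.insert finite.emptyI sum.empty empty_iff not_False_eq_True add_0_right)
  qed
  then have "4 ^ n * (norm (V (Suc n) - V n))^2 <= C" by (simp only: ennreal_le_iff[OF C(2)])
  moreover have "(2 ^ n * norm (V (Suc n) - V n))^2 = 4 ^ n * (norm (V (Suc n) - V n))^2"
   using power_even_eq[of "2::real" n] power_mult[of "2::real" 2 n] by (simp add: power_mult_distrib)
  ultimately have "2 ^ n * norm (V (Suc n) - V n) <= sqrt C" by (intro real_le_rsqrt) simp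
  then have "norm (V (Suc n) - V n) <= sqrt C / 2 ^ n" by (simp add: pos_le_divide_eq mult.commute)
  then show ?thesis by (simp only: power_one_over times_divide_eq_right mult_1_right)
 qed
 have "summable (%n. (1/2 :: real) ^ n)" by (rule summable_geometric) simp
 then have "summable (%n. sqrt C * (1/2) ^ n)" by (rule summable_mult)
 then have "summable (%n. V (Suc n) - V n)" by (rule summable_comparison_test'[where N=0]) (rule le)
 then have "convergent (%n. \<Sum>k<n. V (Suc k) - V k)" by (simp only: summable_iff_convergent)
 then have "convergent (%n. V n - V 0)" by (simp only: sum_lessThan_telescope)
 then have "convergent (%n. (V n - V 0) + V 0)" by (rule convergent_add[OF _ convergent_const])
 then show ?thesis by simp
qed

text \<open>This replaces weak compactness of bounded sets in \<open>L\<^sup>2\<close>: combinations of later and later members converge strongly, and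
  fast enough to converge almost everywhere.\<close>

lemma midpoint_hull_limit:
 fixes v :: "nat => 'a => 'b::euclidean_space"
 assumes v[measurable]: "!!k. v k \<in> borel_measurable M"
  and b: "!!k. (\<integral>\<^sup>+x. ennreal ((norm (v k x))^2) \<partial>M) <= ennreal B"
 shows "\<exists>V F. (\<forall>l. V l \<in> midpoint_hull v l) & F \<in> borel_measurable M & (AE x in M. (%l. V l x) \<longlonglongrightarrow> F x) \<and>
  (%l. \<integral>\<^sup>+x. ennreal ((norm (V l x - F x))^2) \<partial>M) \<longlonglongrightarrow> 0"
proof -
 obtain W where W: "!!l. W l \<in> midpoint_hull v l"
  and C: "!!e. e > 0 ==> \<exists>L. \<forall>l\<ge>L. \<forall>j\<ge>l. (\<integral>\<^sup>+x. ennreal ((norm (W l x - W j x))^2) \<partial>M) <= ennreal e"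
  by (rule midpoint_hull_Cauchy[where v=v, OF v b]) (rule that)
 have Wm[measurable]: "W l \<in> borel_measurable M" for l by (rule midpoint_hull_measurable[where v=v, OF v W])
 have "\<forall>n. \<exists>L. \<forall>l\<ge>L. \<forall>j\<ge>l. (\<integral>\<^sup>+x. ennreal ((norm (W l x - W j x))^2) \<partial>M) <= ennreal ((1/16) ^ n)"
  using C by simp
 then obtain L where L': "\<forall>n. \<forall>l\<ge>L n. \<forall>j\<ge>l. (\<integral>\<^sup>+x. ennreal ((norm (W l x - W j x))^2) \<partial>M) <= ennreal ((1/16) ^ n)" by (rule choice[THEN exE])
 have L: "!!n l j. L n <= l ==> l <= j ==> (\<integral>\<^sup>+x. ennreal ((norm (W l x - W j x))^2) \<partial>M) <= ennreal ((1/16) ^ n)" using L' by simp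
 \<comment> \<open>The indices are chosen so late that the increments are summable.\<close>
 define r where "r n = n + (\<Sum>k\<le>n. L k)" for n
 have r: "n <= r n" "L n <= r n" "r n <= r (Suc n)" for n
  by (auto simp: r_def intro: trans_le_add2 member_le_sum)
 have rmono: "r n <= r k" if "n <= k" for n k using lift_Suc_mono_le[of r] r(3) that by blast
 define V where "V n = W (r n)" for n
 have [measurable]: "V n \<in> borel_measurable M" for n by (simp add: V_def)
 have VH: "V l \<in> midpoint_hull v l" for l using W[of "r l"] midpoint_hull_antimono[OF r(1)] by (auto simp: V_def)
 have VV: "(\<integral>\<^sup>+x. ennreal ((norm (V l x - V k x))^2) \<partial>M) <= ennreal ((1/16) ^ l)" if "l <= k" for l k
  unfolding V_def by (rule L[OF r(2) rmono[OF that]])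
 have "(\<integral>\<^sup>+x. (\<Sum>n. ennreal (4 ^ n * (norm (V (Suc n) x - V n x))^2)) \<partial>M) = (\<Sum>n. \<integral>\<^sup>+x. ennreal (4 ^ n * (norm (V (Suc n) x - V n x))^2) \<partial>M)"
  by (rule nn_integral_suminf) measurable
 also have "... <= (\<Sum>n. ennreal ((1/4) ^ n))"
 proof (rule suminf_le)
  fix n
  have "(\<integral>\<^sup>+x. ennreal (4 ^ n * (norm (V (Suc n) x - V n x))^2) \<partial>M) = ennreal (4 ^ n) * (\<integral>\<^sup>+x. ennreal ((norm (V n x - V (Suc n) x))^2) \<partial>M)"
   by (subst nn_integral_cmult[symmetric]) (auto simp: ennreal_mult[symmetric] norm_minus_commute)
  also have "... <= ennreal (4 ^ n) * ennreal ((1/16) ^ n)" by (intro mult_left_mono VV) auto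
  also have "... = ennreal (4 ^ n * (1/16) ^ n)" by (rule ennreal_mult[symmetric]) auto
  also have "4 ^ n * (1/16) ^ n = ((1/4) ^ n :: real)" by (simp flip: power_mult_distrib)
  finally show "(\<integral>\<^sup>+x. ennreal (4 ^ n * (norm (V (Suc n) x - V n x))^2) \<partial>M) <= ennreal ((1/4) ^ n)" .
 qed auto
 also have "... < \<infinity>" by (subst suminf_ennreal2) (auto intro: summable_geometric)
 finally have "(\<integral>\<^sup>+x. (\<Sum>n. ennreal (4 ^ n * (norm (V (Suc n) x - V n x))^2)) \<partial>M) \<noteq> \<infinity>" by simp
 then have "AE x in M. (\<Sum>n. ennreal (4 ^ n * (norm (V (Suc n) x - V n x))^2)) \<noteq> \<infinity>"
  by (intro nn_integral_PInf_AE) measurable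
 then have cv: "AE x in M. convergent (%n. V n x)" by (rule eventually_mono) (rule geometric_increments_converge)
 define F where "F x = lim (%n. V n x)" for x
 have [measurable]: "F \<in> borel_measurable M" unfolding F_def by (rule borel_measurable_lim_metric) measurable
 have ae: "AE x in M. (%n. V n x) \<longlonglongrightarrow> F x" using cv by (rule eventually_mono) (simp add: F_def convergent_LIMSEQ_iff)
 have ineq: "(\<integral>\<^sup>+x. ennreal ((norm (V l x - F x))^2) \<partial>M) <= ennreal ((1/16) ^ l)" for l
 proof -
  have "(\<integral>\<^sup>+x. ennreal ((norm (V l x - F x))^2) \<partial>M) = (\<integral>\<^sup>+x. liminf (%k. ennreal ((norm (V l x - V k x))^2)) \<partial>M)"
  proof (rule nn_integral_cong_AE, use ae in eventually_elim)
   case (elim x)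
   then have "(%k. ennreal ((norm (V l x - V k x))^2)) \<longlonglongrightarrow> ennreal ((norm (V l x - F x))^2)" by (intro tendsto_intros tendsto_ennrealI)
   then show ?case by (intro lim_imp_Liminf[symmetric]) auto
  qed
  also have "... <= liminf (%k. \<integral>\<^sup>+x. ennreal ((norm (V l x - V k x))^2) \<partial>M)" by (rule nn_integral_liminf) measurable
  also have "... <= liminf (%k. ennreal ((1/16) ^ l))"
   by (rule Liminf_mono) (use VV in \<open>auto simp: eventually_sequentially\<close>)
  finally show ?thesis by (simp add: Liminf_const)
 qed
 have "(%l. ennreal ((1/16) ^ l)) \<longlonglongrightarrow> ennreal 0"
  by (intro tendsto_ennrealI LIMSEQ_power_zero) simp
 then have lim: "(%l. ennreal ((1/16) ^ l)) \<longlonglongrightarrow> 0" by (simp only: ennreal_0)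
 have "(%l. \<integral>\<^sup>+x. ennreal ((norm (V l x - F x))^2) \<partial>M) \<longlonglongrightarrow> 0"
  by (rule tendsto_sandwich[OF _ _ tendsto_const lim]) (intro always_eventually allI ineq zero_le)+
 then show ?thesis using VH ae \<open>F \<in> borel_measurable M\<close> by blast
qed

text \<open>Lower semicontinuity with converging weights: replace the weights by their infima over the tails.\<close>

lemma midpoint_hull_weighted_limit:
 fixes v :: "nat => 'a => 'b::euclidean_space" and w :: "nat => 'a => real"
 assumes v[measurable]: "!!k. v k \<in> borel_measurable M" and w[measurable]: "!!k. w k \<in> borel_measurable M" "w' \<in> borel_measurable M"
  and b: "!!k. (\<integral>\<^sup>+x. ennreal (w k x) * ennreal ((norm (v k x))^2) \<partial>M) <= B"
  and V: "!!l. V l \<in> midpoint_hull v l" and F[measurable]: "F \<in> borel_measurable M"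
  and ae: "AE x in M. (%l. V l x) \<longlonglongrightarrow> F x" and wae: "AE x in M. (%k. w k x) \<longlonglongrightarrow> w' x"
 shows "(\<integral>\<^sup>+x. ennreal (w' x) * ennreal ((norm (F x))^2) \<partial>M) <= B"
proof -
 \<comment> \<open>The infimum over a tail is below every later weight, so it is admissible for the whole tail hull.\<close>
 define u where "u l x = (INF k\<in>{l..}. ennreal (w k x))" for l x
 have [measurable]: "u l \<in> borel_measurable M" for l unfolding u_def by measurable
 have [measurable]: "V l \<in> borel_measurable M" for l by (rule midpoint_hull_measurable[where v=v, OF v V])
 have uV: "(\<integral>\<^sup>+x. u l x * ennreal ((norm (V l x))^2) \<partial>M) <= B" for l
 proof (rule midpoint_hull_weighted[where v=v, OF v _ _ V])
  fix k assume "l <= k"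
  then have "u l x <= ennreal (w k x)" for x unfolding u_def by (intro INF_lower) auto
  then have "(\<integral>\<^sup>+x. u l x * ennreal ((norm (v k x))^2) \<partial>M) <= (\<integral>\<^sup>+x. ennreal (w k x) * ennreal ((norm (v k x))^2) \<partial>M)"
   by (intro nn_integral_mono mult_right_mono) auto
  then show "(\<integral>\<^sup>+x. u l x * ennreal ((norm (v k x))^2) \<partial>M) <= B" using b[of k] by (rule order_trans)
 qed measurable
 have "(\<integral>\<^sup>+x. ennreal (w' x) * ennreal ((norm (F x))^2) \<partial>M) = (\<integral>\<^sup>+x. liminf (%l. u l x * ennreal ((norm (V l x))^2)) \<partial>M)"
 proof (rule nn_integral_cong_AE, use ae wae in eventually_elim)
  case (elim x)
  have "liminf (%k. ennreal (w k x)) = ennreal (w' x)"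
   using tendsto_ennrealI[OF elim(2)] by (intro lim_imp_Liminf) auto
  then have "(SUP l. u l x) = ennreal (w' x)" unfolding u_def liminf_SUP_INF .
  moreover have "incseq (%l. u l x)" unfolding u_def by (intro incseq_SucI INF_superset_mono) auto
  ultimately have "(%l. u l x) \<longlonglongrightarrow> ennreal (w' x)" using LIMSEQ_SUP[of "%l. u l x"] by simp
  moreover have "(%l. ennreal ((norm (V l x))^2)) \<longlonglongrightarrow> ennreal ((norm (F x))^2)" by (intro tendsto_ennrealI tendsto_intros elim)
  ultimately have "(%l. u l x * ennreal ((norm (V l x))^2)) \<longlonglongrightarrow> ennreal (w' x) * ennreal ((norm (F x))^2)"
   by (intro tendsto_mult_ennreal) auto
  then show ?case by (intro lim_imp_Liminf[symmetric]) auto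
 qed
 also have "... <= liminf (%l. \<integral>\<^sup>+x. u l x * ennreal ((norm (V l x))^2) \<partial>M)" by (rule nn_integral_liminf) measurable
 also have "... <= liminf (%l::nat. B)" by (rule Liminf_mono) (use uV in auto)
 finally show ?thesis by (simp add: Liminf_const)
qed

section \<open>Minimality for Borel representatives\<close>

lemma Lp_borel_representative:
 fixes v :: "'a::euclidean_space => real"
 assumes S: "S \<in> sets borel" and v: "Lp_on p S v" and p: "p > 0"
 shows "\<exists>v'. v' \<in> borel_measurable borel & (\<forall>x. x \<notin> S \<longrightarrow> v' x = 0) & (AE x in lebesgue_on S. v x = v' x) \<and>
  (\<integral>\<^sup>+x. ennreal (abs (v' x) powr p) \<partial>lborel) < \<infinity>"
proof -
 have vm: "v \<in> borel_measurable (lebesgue_on S)" and vi: "integrable (lebesgue_on S) (%x. abs (v x) powr p)"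
  using v by (auto simp: Lp_on_def)
 obtain v' where v'[measurable]: "v' \<in> borel_measurable borel" and 0: "!!x. x \<notin> S ==> v' x = 0" and ae: "AE x in lebesgue_on S. v x = v' x"
  using borel_representative[OF S vm] by blast
 have SL: "S \<in> sets lebesgue" using S by auto
 have "integrable (lebesgue_on S) (%x. abs (v' x) powr p)"
  by (rule integrable_lebesgue_on_cong_AE[OF vi SL]) (use ae in eventually_elim, simp)
 then have "integrable lebesgue (%x. abs (v' x) powr p)"
  by (subst (asm) lebesgue_on_vanish(2)[OF SL]) (use 0 p in auto)
 then have "integrable lborel (%x. abs (v' x) powr p)" by (subst (asm) integrable_completion) auto
 then have "(\<integral>\<^sup>+x. ennreal (abs (v' x) powr p) \<partial>lborel) < \<infinity>" by (simp add: integrable_iff_bounded)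
 then show ?thesis using v' 0 ae by blast
qed

lemma finite_Lp_bound:
 fixes f :: "'i::finite => 'a => real"
 assumes "!!i. (\<integral>\<^sup>+x. ennreal (abs (f i x) powr p) \<partial>M) < \<infinity>"
 shows "\<exists>c\<ge>0. \<forall>i. (\<integral>\<^sup>+x. ennreal (abs (f i x) powr p) \<partial>M) <= ennreal c"
proof -
 have "\<forall>i. \<exists>c\<ge>0. (\<integral>\<^sup>+x. ennreal (abs (f i x) powr p) \<partial>M) = ennreal c"
  using assms by (metis ennreal_enn2real enn2real_nonneg infinity_ennreal_def)
 then obtain c where c: "!!i. c i \<ge> 0" "!!i. (\<integral>\<^sup>+x. ennreal (abs (f i x) powr p) \<partial>M) = ennreal (c i)" by metis
 have "(\<integral>\<^sup>+x. ennreal (abs (f i x) powr p) \<partial>M) <= ennreal (\<Sum>i\<in>UNIV. c i)" for i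
  unfolding c(2) by (intro ennreal_leI member_le_sum c) auto
 then show ?thesis using c(1) by (intro exI[of _ "\<Sum>i\<in>UNIV. c i"]) (auto intro: sum_nonneg)
qed

lemma norm_vec_Lp_finite:
 fixes f :: "'a::euclidean_space => real^'m"
 assumes p: "p > 0" and m: "!!al. (%x. f x $ al) \<in> borel_measurable borel"
  and b: "!!al. (\<integral>\<^sup>+x. ennreal (abs (f x $ al) powr p) \<partial>lborel) < \<infinity>"
 shows "(\<integral>\<^sup>+x. ennreal (norm (f x) powr p) \<partial>lborel) < \<infinity>"
proof -
 obtain c where "c \<ge> 0" "!!al. (\<integral>\<^sup>+x. ennreal (abs (f x $ al) powr p) \<partial>lborel) <= ennreal c"
  using finite_Lp_bound[where f="%al x. f x $ al" and p=p and M=lborel] b by blast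
 from nn_integral_norm_vec_le[OF p m this(2,1)] show ?thesis by (rule le_less_trans) simp
qed

lemma norm_mat_Lp_finite:
 fixes f :: "'a::euclidean_space => real^'n^'m"
 assumes p: "p > 0" and m: "!!al i. (%x. f x $ al $ i) \<in> borel_measurable borel"
  and b: "!!al i. (\<integral>\<^sup>+x. ennreal (abs (f x $ al $ i) powr p) \<partial>lborel) < \<infinity>"
 shows "(\<integral>\<^sup>+x. ennreal (norm (f x) powr p) \<partial>lborel) < \<infinity>"
proof -
 obtain c where c: "c \<ge> 0" "\<forall>ai. (\<integral>\<^sup>+x. ennreal (abs (f x $ fst ai $ snd ai) powr p) \<partial>lborel) <= ennreal c"
  using finite_Lp_bound[where f="%ai x. f x $ fst ai $ snd ai" and p=p and M=lborel] b by blast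
 have "(\<integral>\<^sup>+x. ennreal (abs (f x $ al $ i) powr p) \<partial>lborel) <= ennreal c" for al i using c(2)[rule_format, of "(al, i)"] by simp
 from nn_integral_norm_mat_le[OF p m this c(1)] show ?thesis by (rule le_less_trans) simp
qed

lemma borel_measurable_matI:
 fixes f :: "'a::euclidean_space => real^'n^'m"
 assumes "!!al i. (%x. f x $ al $ i) \<in> borel_measurable M" shows "f \<in> borel_measurable M"
 by (intro borel_measurable_vecI assms)

lemma measurable_dens:
 fixes V :: "'a::euclidean_space => real^'m" and Y :: "'a => real^'n^'m"
 assumes H: "H2 q G" "eps > 0" "p > 0" and [measurable]: "V \<in> borel_measurable M" "Y \<in> borel_measurable M"
 shows "(%x. dens G p eps (V x) (Y x)) \<in> borel_measurable M"
proof -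
 have [measurable]: "(%y :: (real^'m) \<times> (real^'n^'m). dens G p eps (fst y) (snd y)) \<in> borel_measurable borel"
  by (rule borel_measurable_continuous_onI[OF continuous_dens[OF H]])
 have "(%x. (V x, Y x)) \<in> M \<rightarrow>\<^sub>M borel" by measurable
 from measurable_compose[OF this, of "%y. dens G p eps (fst y) (snd y)" borel] show ?thesis by simp
qed

lemma dens_integral_finite:
 fixes V :: "real^'n => real^'m" and Y :: "real^'n => real^'n^'m" and Om :: "(real^'n) set"
 assumes H: "H1 q Om G" and O: "open Om" "Om \<noteq> {}" and q: "1 <= q" "q <= p" and e: "0 < eps" "eps <= 1" and D: "open D" "bounded D"
  and Vm: "!!al. (%x. V x $ al) \<in> borel_measurable borel" and Ym: "!!al i. (%x. Y x $ al $ i) \<in> borel_measurable borel"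
  and Vfin: "!!al. (\<integral>\<^sup>+x. ennreal (abs (V x $ al) powr p) \<partial>lborel) < \<infinity>"
  and Yfin: "!!al i. (\<integral>\<^sup>+x. ennreal (abs (Y x $ al $ i) powr p) \<partial>lborel) < \<infinity>"
 shows "(\<integral>\<^sup>+x. ennreal (dens G p eps (V x) (Y x)) * indicator D x \<partial>lborel) < \<infinity>"
proof -
 obtain A where A': "A > 0 & (\<forall>eps (u::real^'m) (z::real^'n^'m). 0 < eps & eps <= 1 \<longrightarrow> 0 <= dens G p eps u z \<and>
  dens G p eps u z <= A * (1 + norm u powr p + norm z powr p))"
  using dens_growth[OF H O q] by (rule exE)
 have A: "A > 0" "!!u z. dens G p eps u (z :: real^'n^'m) <= A * (1 + norm (u :: real^'m) powr p + norm z powr p)"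
  using A' e by auto
 have [measurable]: "V \<in> borel_measurable borel" "Y \<in> borel_measurable borel" "D \<in> sets borel"
  using borel_measurable_vecI[OF Vm] borel_measurable_matI[OF Ym] D by auto
 have p: "p > 0" using q by simp
 have "(\<integral>\<^sup>+x. ennreal (dens G p eps (V x) (Y x)) * indicator D x \<partial>lborel) \<le>
  (\<integral>\<^sup>+x. ennreal A * (indicator D x + ennreal (norm (V x) powr p) + ennreal (norm (Y x) powr p)) \<partial>lborel)"
 proof (rule nn_integral_mono)
  fix x
  have "ennreal (dens G p eps (V x) (Y x)) <= ennreal (A * (1 + norm (V x) powr p + norm (Y x) powr p))" by (rule ennreal_leI[OF A(2)])
  also have "... = ennreal A * (1 + ennreal (norm (V x) powr p) + ennreal (norm (Y x) powr p))"
   using A(1) by (subst ennreal_mult) (auto simp: ennreal_plus)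
  finally show "ennreal (dens G p eps (V x) (Y x)) * indicator D x <= ennreal A * (indicator D x + ennreal (norm (V x) powr p) + ennreal (norm (Y x) powr p))"
   by (auto simp: indicator_def)
 qed
 also have "... = ennreal A * (emeasure lborel D + (\<integral>\<^sup>+x. ennreal (norm (V x) powr p) \<partial>lborel) + (\<integral>\<^sup>+x. ennreal (norm (Y x) powr p) \<partial>lborel))"
  by (subst nn_integral_cmult, simp, subst nn_integral_add, simp, simp, subst nn_integral_add) auto
 also have "... < \<infinity>"
  using emeasure_bounded_finite[OF D(2)] norm_vec_Lp_finite[OF p Vm Vfin] norm_mat_Lp_finite[OF p Ym Yfin]
  by (simp add: ennreal_mult_less_top)
 finally show ?thesis .
qed

lemma energy_eq:
 fixes v V :: "real^'n => real^'m" and Y :: "real^'n => real^'n^'m"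
 assumes H: "H2 q G" and nonneg: "!!u z. 0 <= dens G p eps u (z :: real^'n^'m)" and e: "0 < eps" and p: "p > 0" and D: "open D"
  and Vm: "!!al. (%x. V x $ al) \<in> borel_measurable borel" and Ym: "!!al i. (%x. Y x $ al $ i) \<in> borel_measurable borel"
  and vV: "AE x in lebesgue_on D. v x = V x" and wp: "!!al i. has_weak_partial D i (%x. V x $ al) (%x. Y x $ al $ i)"
 shows "energy G p eps v D = enn2real (\<integral>\<^sup>+x. ennreal (dens G p eps (V x) (Y x)) * indicator D x \<partial>lborel)"
proof -
 have DL: "D \<in> sets lebesgue" "D \<in> sets borel" using D by auto
 have [measurable]: "V \<in> borel_measurable borel" "Y \<in> borel_measurable borel"
  using borel_measurable_vecI[OF Vm] borel_measurable_matI[OF Ym] by auto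
 have dm[measurable]: "(%x. dens G p eps (V x) (Y x)) \<in> borel_measurable borel" by (rule measurable_dens[OF H e p]) measurable
 have "has_weak_partial D i (%x. v x $ al) (%x. Y x $ al $ i)" for al i
  by (rule has_weak_partial_cong_AE[OF wp _ _ DL(1)]) (use vV in \<open>auto elim: eventually_mono\<close>)
 then have "AE x in lebesgue_on D. weak_partial D i (%y. v y $ al) x = Y x $ al $ i" for al i by (rule weak_partial_AE[OF D])
 then have "AE x in lebesgue_on D. \<forall>al i. weak_partial D i (%y. v y $ al) x = Y x $ al $ i" by (simp add: eventually_all_finite)
 then have gr: "AE x in lebesgue_on D. weak_grad D v x = Y x" by eventually_elim (simp add: weak_grad_def vec_eq_iff)
 have ae: "AE x in lebesgue_on D. dens G p eps (v x) (weak_grad D v x) = dens G p eps (V x) (Y x)"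
  using gr vV by eventually_elim simp
 have m1: "(%x. dens G p eps (V x) (Y x)) \<in> borel_measurable (lebesgue_on D)"
  using dm by (intro measurable_restrict_space1 measurable_completion) simp
 have m2: "(%x. dens G p eps (v x) (weak_grad D v x)) \<in> borel_measurable (lebesgue_on D)"
  by (rule measurable_lebesgue_on_cong_AE[OF m1 DL(1) ae])
 have "energy G p eps v D = (LINT x|lebesgue_on D. dens G p eps (v x) (weak_grad D v x))" by (simp add: energy_def dens_def)
 also have "... = (LINT x|lebesgue_on D. dens G p eps (V x) (Y x))" by (rule integral_cong_AE[OF m2 m1 ae])
 also have "... = enn2real (\<integral>\<^sup>+x. ennreal (dens G p eps (V x) (Y x)) \<partial>lebesgue_on D)"
  by (rule integral_eq_nn_integral[OF m1]) (simp add: nonneg)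
 also have "(\<integral>\<^sup>+x. ennreal (dens G p eps (V x) (Y x)) \<partial>lebesgue_on D) = (\<integral>\<^sup>+x. ennreal (dens G p eps (V x) (Y x)) * indicator D x \<partial>lebesgue)"
  using DL(1) by (subst nn_integral_restrict_space) auto
 also have "... = (\<integral>\<^sup>+x. ennreal (dens G p eps (V x) (Y x)) * indicator D x \<partial>lborel)"
  using DL(2) by (subst nn_integral_completion) auto
 finally show ?thesis .
qed

text \<open>A local minimizer through Borel representatives of its values and its gradient, extended by zero.  Minimality is stated
  for competitors that differ on a compact set, with extended nonnegative integrals, so that sums and changes of variables
  need no integrability.\<close>

locale borel_minimizer =
 fixes G :: "(real^'m) \<times> (real^'m) => real" and p q eps :: real and Om :: "(real^'n) set"
  and U :: "real^'n => real^'m" and Z :: "real^'n => real^'n^'m"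
 assumes H1: "H1 q Om G" and H2: "H2 q G" and q: "2 <= q" "q < p" and eps: "0 < eps" "eps <= 1"
  and open_dom: "open Om" and bounded_dom: "bounded Om" and ne: "Om \<noteq> {}"
  and Um: "!!al. (%x. U x $ al) \<in> borel_measurable borel" and Zm: "!!al i. (%x. Z x $ al $ i) \<in> borel_measurable borel"
  and U0: "!!x. x \<notin> Om ==> U x = 0" and Z0: "!!x. x \<notin> Om ==> Z x = 0"
  and Ufin: "!!al. (\<integral>\<^sup>+x. ennreal (abs (U x $ al) powr p) \<partial>lborel) < \<infinity>"
  and Zfin: "!!al i. (\<integral>\<^sup>+x. ennreal (abs (Z x $ al $ i) powr p) \<partial>lborel) < \<infinity>"
  and wp: "!!al i. has_weak_partial Om i (%x. U x $ al) (%x. Z x $ al $ i)"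
  and minimal: "!!D K V Y. open D ==> compactly_inside D Om ==> compact K ==> K \<subseteq> D ==>
   (!!al. (%x. V x $ al) \<in> borel_measurable borel) ==> (!!al i. (%x. Y x $ al $ i) \<in> borel_measurable borel) ==>
   (!!al. (\<integral>\<^sup>+x. ennreal (abs (V x $ al) powr p) \<partial>lborel) < \<infinity>) ==>
   (!!al i. (\<integral>\<^sup>+x. ennreal (abs (Y x $ al $ i) powr p) \<partial>lborel) < \<infinity>) ==>
   (!!x. x \<notin> K ==> V x = U x) ==> (!!x. x \<notin> K ==> Y x = Z x) ==>
   (!!al i. has_weak_partial D i (%x. V x $ al) (%x. Y x $ al $ i)) ==>
   (\<integral>\<^sup>+x. ennreal (dens G p eps (U x) (Z x)) * indicator D x \<partial>lborel) \<le>
   (\<integral>\<^sup>+x. ennreal (dens G p eps (V x) (Y x)) * indicator D x \<partial>lborel)"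

lemma Lp_diff_finite:
 fixes f g :: "'a::euclidean_space => real"
 assumes [measurable]: "f \<in> borel_measurable borel" "g \<in> borel_measurable borel" and p: "p > 0"
  and f: "(\<integral>\<^sup>+x. ennreal (abs (f x) powr p) \<partial>lborel) < \<infinity>" and g: "(\<integral>\<^sup>+x. ennreal (abs (g x) powr p) \<partial>lborel) < \<infinity>"
 shows "(\<integral>\<^sup>+x. ennreal (abs (f x - g x) powr p) \<partial>lborel) < \<infinity>"
proof -
 have "Lp_dist p f g <= ennreal (2 powr p) * (Lp_dist p f (%_. 0) + Lp_dist p (%_. 0) g)" by (rule Lp_dist_triangle) (use p in auto)
 also have "... < \<infinity>" using f g by (simp add: Lp_dist_def ennreal_mult_less_top)
 finally show ?thesis by (simp add: Lp_dist_def)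
qed

text \<open>A competitor that differs on a compact set differs by an element of the space \<open>W\<^sub>0\<close>.  Both energies are finite by
  the growth of the integrand, so the inequality between Bochner integrals carries over.\<close>

lemma local_minimizer_borel:
 fixes u :: "real^'n => real^'m"
 assumes H1: "H1 q Om G" and H2: "H2 q G" and q: "2 <= q" "q < p" and eps: "0 < eps" "eps <= 1"
  and O: "open Om" "bounded Om" "Om \<noteq> {}" and u: "local_minimizer G p eps Om u"
 shows "\<exists>U Z. borel_minimizer G p q eps Om U Z & (AE x in lebesgue_on Om. u x = U x) & (AE x in lebesgue_on Om. weak_grad Om u x = Z x)"
proof -
 have p: "p > 0" "p \<ge> 1" using q by auto
 have OL: "Om \<in> sets lebesgue" "Om \<in> sets borel" using O by auto
 have sob: "sobolev 1 p Om (%x. u x $ al)" for al using u by (simp add: local_minimizer_def sobolev_vec_def)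
 have uL: "Lp_on p Om (%x. u x $ al)" for al using sob[of al] by simp
 have "\<forall>al i. \<exists>w. has_weak_partial Om i (%x. u x $ al) w & Lp_on p Om w" using sob by simp
 then have "\<forall>ai. \<exists>w. has_weak_partial Om (snd ai) (%x. u x $ fst ai) w & Lp_on p Om w" by blast
 from choice[OF this] obtain w' where w': "\<forall>ai. has_weak_partial Om (snd ai) (%x. u x $ fst ai) (w' ai) & Lp_on p Om (w' ai)" by (rule exE)
 define w where "w al i = w' (al, i)" for al i
 have w: "has_weak_partial Om i (%x. u x $ al) (w al i)" "Lp_on p Om (w al i)" for al i
  using w'[rule_format, of "(al, i)"] by (auto simp: w_def)
 define rep where "rep v v' \<longleftrightarrow> v' \<in> borel_measurable borel & (\<forall>x. x \<notin> Om \<longrightarrow> v' x = 0) & (AE x in lebesgue_on Om. v x = v' x) \<and>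
  (\<integral>\<^sup>+x. ennreal (abs (v' x) powr p) \<partial>lborel) < \<infinity>" for v v' :: "real^'n => real"
 have rep: "\<exists>v'. rep v v'" if "Lp_on p Om v" for v
  unfolding rep_def by (rule Lp_borel_representative[OF OL(2) that p(1)])
 have "\<forall>al. \<exists>v'. rep (%x. u x $ al) v'" using rep uL by blast
 from choice[OF this] obtain U' where U'': "\<forall>al. rep (%x. u x $ al) (U' al)" by (rule exE)
 have U': "U' al \<in> borel_measurable borel" "x \<notin> Om ==> U' al x = 0" "AE x in lebesgue_on Om. u x $ al = U' al x"
   "(\<integral>\<^sup>+x. ennreal (abs (U' al x) powr p) \<partial>lborel) < \<infinity>" for al x
  using U''[rule_format, of al] by (simp_all add: rep_def)
 have "\<forall>ai. \<exists>v'. rep (w' ai) v'" using rep w' by blast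
 from choice[OF this] obtain Z'' where Z'': "\<forall>ai. rep (w' ai) (Z'' ai)" by (rule exE)
 define Z' where "Z' al i = Z'' (al, i)" for al i
 have Z': "Z' al i \<in> borel_measurable borel" "x \<notin> Om ==> Z' al i x = 0" "AE x in lebesgue_on Om. w al i x = Z' al i x"
   "(\<integral>\<^sup>+x. ennreal (abs (Z' al i x) powr p) \<partial>lborel) < \<infinity>" for al i x
  using Z''[rule_format, of "(al, i)"] by (simp_all add: rep_def Z'_def w_def)
 define U where "U x = (\<chi> al. U' al x)" for x
 define Z where "Z x = (\<chi> al i. Z' al i x)" for x
 have uU: "AE x in lebesgue_on Om. u x = U x"
 proof -
  have "AE x in lebesgue_on Om. \<forall>al. u x $ al = U' al x" using U'(3) by (simp add: eventually_all_finite)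
  then show ?thesis by eventually_elim (simp add: U_def vec_eq_iff)
 qed
 have wp: "has_weak_partial Om i (%x. U x $ al) (%x. Z x $ al $ i)" for al i
  by (rule has_weak_partial_cong_AE[OF w(1)[of i al] _ _ OL(1)]) (use U'(3)[of al] Z'(3)[of al i] in \<open>simp_all add: U_def Z_def eq_commute\<close>)
 have wpu: "has_weak_partial Om i (%x. u x $ al) (%x. Z x $ al $ i)" for al i
  by (rule has_weak_partial_cong_AE[OF wp _ _ OL(1)]) (use uU in \<open>auto elim: eventually_mono\<close>)
 have "AE x in lebesgue_on Om. \<forall>al i. weak_partial Om i (%y. u y $ al) x = Z x $ al $ i"
  using weak_partial_AE[OF O(1) wpu] by (simp add: eventually_all_finite)
 then have gr: "AE x in lebesgue_on Om. weak_grad Om u x = Z x" by eventually_elim (simp add: weak_grad_def vec_eq_iff)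
 have nonneg: "0 <= dens G p eps u (z :: real^'n^'m)" for u z
 proof -
  have "1 <= q" "q <= p" using q by auto
  from dens_growth[OF H1 O(1,3) this] eps show ?thesis by blast
 qed
 have "borel_minimizer G p q eps Om U Z"
 proof (unfold_locales, goal_cases)
  case (17 D K V Y)
  have DL: "D \<in> sets lebesgue" and Dsub: "D \<subseteq> Om" using 17(1,2) closure_subset by (auto simp: compactly_inside_def)
  have Db: "bounded D" using 17(2) by (meson bounded_subset closure_subset compact_imp_bounded compactly_inside_def)
  have Um: "(%x. U x $ al) \<in> borel_measurable borel" for al using U' by (simp add: U_def)
  have Zm: "(%x. Z x $ al $ i) \<in> borel_measurable borel" for al i using Z' by (simp add: Z_def)
  have Ufin: "(\<integral>\<^sup>+x. ennreal (abs (U x $ al) powr p) \<partial>lborel) < \<infinity>" for al using U' by (simp add: U_def)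
  have Zfin: "(\<integral>\<^sup>+x. ennreal (abs (Z x $ al $ i) powr p) \<partial>lborel) < \<infinity>" for al i using Z' by (simp add: Z_def)
  have wpD: "has_weak_partial D i (%x. U x $ al) (%x. Z x $ al $ i)" for al i by (rule has_weak_partial_mono[OF wp Dsub OL(1) DL])
  have uUD: "AE x in lebesgue_on D. u x = U x" by (rule AE_lebesgue_on_subset[OF uU Dsub DL OL(1)])
  define phi where "phi x = V x - U x" for x
  have "sobolev_vec_zero p D phi"
  proof (rule compactly_supported_sobolev_zero[where K=K and w="%x. Y x - Z x"])
   show "has_weak_partial D i (%x. phi x $ al) (%x. (Y x - Z x) $ al $ i)" for al i
    using has_weak_partial_lincomb[OF DL 17(11)[of i al] wpD[of i al], of 1 "-1"] by (simp add: phi_def)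
   show "(\<integral>\<^sup>+x. ennreal (abs (phi x $ al) powr p) \<partial>lborel) < \<infinity>" for al
    using Lp_diff_finite[OF 17(5) Um p(1) 17(7) Ufin, of al al] by (simp add: phi_def)
   show "(\<integral>\<^sup>+x. ennreal (abs ((Y x - Z x) $ al $ i) powr p) \<partial>lborel) < \<infinity>" for al i
    using Lp_diff_finite[OF 17(6) Zm p(1) 17(8) Zfin, of al i al i] by simp
  qed (use 17 Um Zm p in \<open>auto simp: phi_def\<close>)
  then have "energy G p eps u D <= energy G p eps (%x. u x + phi x) D" using u 17(1,2) by (auto simp: local_minimizer_def)
  moreover have "energy G p eps u D = enn2real (\<integral>\<^sup>+x. ennreal (dens G p eps (U x) (Z x)) * indicator D x \<partial>lborel)"
   by (rule energy_eq[OF H2 nonneg eps(1) p(1) 17(1) Um Zm uUD wpD])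
  moreover have "AE x in lebesgue_on D. u x + phi x = V x" using uUD by eventually_elim (simp add: phi_def)
  from energy_eq[OF H2 nonneg eps(1) p(1) 17(1) 17(5,6) this 17(11)]
  have "energy G p eps (%x. u x + phi x) D = enn2real (\<integral>\<^sup>+x. ennreal (dens G p eps (V x) (Y x)) * indicator D x \<partial>lborel)" .
  ultimately have le: "enn2real (\<integral>\<^sup>+x. ennreal (dens G p eps (U x) (Z x)) * indicator D x \<partial>lborel) <= enn2real (\<integral>\<^sup>+x. ennreal (dens G p eps (V x) (Y x)) * indicator D x \<partial>lborel)" by simp
  have "(\<integral>\<^sup>+x. ennreal (dens G p eps (U x) (Z x)) * indicator D x \<partial>lborel) < \<infinity>"
   by (rule dens_integral_finite[OF H1 O(1,3) _ _ eps 17(1) Db Um Zm Ufin Zfin]) (use q in auto)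
  moreover have "(\<integral>\<^sup>+x. ennreal (dens G p eps (V x) (Y x)) * indicator D x \<partial>lborel) < \<infinity>"
   by (rule dens_integral_finite[OF H1 O(1,3) _ _ eps 17(1) Db 17(5,6,7,8)]) (use q in auto)
  ultimately show ?case using ennreal_leI[OF le] by simp
 qed (use H1 H2 q eps O U' Z' wp in \<open>auto simp: U_def Z_def vec_eq_iff\<close>)
 then show ?thesis using uU gr by blast
qed

section \<open>The energy comparison\<close>

lemma borel_measurable_vec_nth[measurable (raw)]:
 fixes f :: "'a => 'b::euclidean_space ^ 'n"
 assumes "f \<in> borel_measurable M" shows "(%x. f x $ i) \<in> borel_measurable M"
 by (rule borel_measurable_continuous_on[OF _ assms]) (intro continuous_intros)

lemma Lp_lincomb_finite:
 fixes f g a b :: "'a::euclidean_space => real"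
 assumes [measurable]: "f \<in> borel_measurable borel" "g \<in> borel_measurable borel" and p: "p > 0"
  and ab: "!!x. abs (a x) <= 1" "!!x. abs (b x) <= 1"
  and f: "(\<integral>\<^sup>+x. ennreal (abs (f x) powr p) \<partial>lborel) < \<infinity>" and g: "(\<integral>\<^sup>+x. ennreal (abs (g x) powr p) \<partial>lborel) < \<infinity>"
 shows "(\<integral>\<^sup>+x. ennreal (abs (a x * f x + b x * g x) powr p) \<partial>lborel) < \<infinity>"
proof -
 have "(\<integral>\<^sup>+x. ennreal (abs (a x * f x + b x * g x) powr p) \<partial>lborel) \<le>
  (\<integral>\<^sup>+x. ennreal (2 powr p) * (ennreal (abs (f x) powr p) + ennreal (abs (g x) powr p)) \<partial>lborel)"
 proof (rule nn_integral_mono)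
  fix x
  have "abs (a x * f x) <= abs (f x)" "abs (b x * g x) <= abs (g x)" using ab[of x] by (auto simp: abs_mult intro: mult_left_le_one_le)
  then have "abs (a x * f x) powr p + abs (b x * g x) powr p <= abs (f x) powr p + abs (g x) powr p"
   using p by (intro add_mono powr_mono2) auto
  then have "abs (a x * f x + b x * g x) powr p <= 2 powr p * (abs (f x) powr p + abs (g x) powr p)"
   using powr_add_le[OF p, of "a x * f x" "b x * g x"] by (rule_tac order_trans) (auto intro: mult_left_mono)
  then have "ennreal (abs (a x * f x + b x * g x) powr p) <= ennreal (2 powr p * (abs (f x) powr p + abs (g x) powr p))" by (rule ennreal_leI)
  also have "... = ennreal (2 powr p) * (ennreal (abs (f x) powr p) + ennreal (abs (g x) powr p))" by (subst ennreal_mult) auto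
  finally show "ennreal (abs (a x * f x + b x * g x) powr p) <= ennreal (2 powr p) * (ennreal (abs (f x) powr p) + ennreal (abs (g x) powr p))" .
 qed
 also have "... = ennreal (2 powr p) * ((\<integral>\<^sup>+x. ennreal (abs (f x) powr p) \<partial>lborel) + (\<integral>\<^sup>+x. ennreal (abs (g x) powr p) \<partial>lborel))"
  by (subst nn_integral_cmult, simp, subst nn_integral_add) auto
 also have "... < \<infinity>" using f g by (simp add: ennreal_mult_less_top)
 finally show ?thesis .
qed

lemma partial_cmult:
 assumes "test_function D eta" "e \<in> Basis"
 shows "partial_within UNIV e (%x. t * eta x) x = t * partial_within UNIV e eta x"
proof (rule partialI(2))
 have "((%s. eta (x + s *\<^sub>R e)) has_real_derivative partial_within UNIV e eta x) (at 0)"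
  using test_function_line[OF assms, of x 0] by simp
 then show "((%s. t * eta (x + s *\<^sub>R e)) has_real_derivative t * partial_within UNIV e eta x) (at 0)" by (rule DERIV_cmult)
qed

text \<open>The constants of the gain and of the cost are parameters, because they must not depend on the minimizer.\<close>

locale comparison = borel_minimizer G p q eps Om U Z
 for G :: "(real^'m) \<times> (real^'m) => real" and p q eps :: real and Om :: "(real^'n) set"
  and U :: "real^'n => real^'m" and Z :: "real^'n => real^'n^'m" +
 fixes c C :: real
 assumes c: "c > 0" and C: "C > 0"
  and gain: "!!(u::real^'m) (z::real^'n^'m) u' z'.
   dens G p eps ((1/2) *\<^sub>R (u + u')) ((1/2) *\<^sub>R (z + z')) + c * (ell_weight q eps (norm z - norm (z' - z)) * (norm (z' - z))^2)
   <= (dens G p eps u z + dens G p eps u' z') / 2"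
  and cost: "!!(u::real^'m) (z::real^'n^'m) b K t a. (\<forall>al. norm (b $ al) <= K * norm (z $ al)) ==> abs t * K <= 1/4 ==> abs a <= K ==>
   (1 - t * a) * dens G p eps u (z + (t / (1 - t * a)) *\<^sub>R b) + (1 + t * a) * dens G p eps u (z + (- (t / (1 + t * a))) *\<^sub>R b)
   <= 2 * dens G p eps u z + C * K^2 * t^2 * (eps * norm z powr p + norm u powr q + norm z powr q + 1)"
begin

lemma p_pos: "p > 0" "p \<ge> 1" "p \<ge> 2" using q by auto

lemma U_measurable[measurable]: "U \<in> borel_measurable borel" by (rule borel_measurable_vecI[OF Um])
lemma Z_measurable[measurable]: "Z \<in> borel_measurable borel" by (rule borel_measurable_matI[OF Zm])

lemma dens_nonneg: "0 <= dens G p eps u (z :: real^'n^'m)"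
proof -
 have "1 <= q" "q <= p" using q by auto
 from dens_growth[OF H1 open_dom ne this] eps show ?thesis by blast
qed

lemma integrable_components: "integrable lborel (%x. U x $ al)" "integrable lborel (%x. Z x $ al $ i)"
proof -
 show "integrable lborel (%x. U x $ al)" by (rule integrable_of_Lp_compact[OF Um Ufin p_pos(2) bounded_dom]) (simp add: U0)
 show "integrable lborel (%x. Z x $ al $ i)" by (rule integrable_of_Lp_compact[OF Zm Zfin p_pos(2) bounded_dom]) (simp add: Z0)
qed

definition bulk :: "real^'n => real" where
 "bulk y = eps * norm (Z y) powr p + norm (U y) powr q + norm (Z y) powr q + 1"

lemma bulk_measurable[measurable]: "bulk \<in> borel_measurable borel" unfolding bulk_def[abs_def] by measurable

lemma bulk_nonneg: "0 <= bulk y" using eps by (simp add: bulk_def)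

text \<open>Composition with \<open>moved k eta t\<close> moves a function by \<open>t eta\<close> in the \<open>k\<close>-th direction; \<open>moved_grad k eta t\<close> is the gradient
  that results, as a function of the original point.\<close>

definition moved :: "'n => (real^'n => real) => real => real^'n => real^'n" where
 "moved k eta t = unshear (axis k 1) (%x. t * eta x)"

definition tilt :: "'n => (real^'n => real) => real^'n => real^'n^'m" where
 "tilt k eta y = (\<chi> al j. partial_within UNIV (axis j 1) eta y * Z y $ al $ k)"

definition moved_grad :: "'n => (real^'n => real) => real => real^'n => real^'n^'m" where
 "moved_grad k eta t y = Z y + (t / (1 - t * partial_within UNIV (axis k 1) eta y)) *\<^sub>R tilt k eta y"

lemma tilt_nth: "tilt k eta y $ al = Z y $ al $ k *\<^sub>R (\<chi> j. partial_within UNIV (axis j 1) eta y)"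
 by (simp add: tilt_def vec_eq_iff)

lemma norm_tilt:
 assumes L: "!!e x. e \<in> Basis ==> abs (partial_within UNIV e eta x) <= L"
 shows "norm (tilt k eta y $ al) <= real CARD('n) * L * norm (Z y $ al)"
proof -
 have "norm (\<chi> j. partial_within UNIV (axis j 1) eta y) <= (\<Sum>j\<in>UNIV. abs (partial_within UNIV (axis j 1) eta y))"
  using norm_le_l1_cart[of "\<chi> j. partial_within UNIV (axis j (1::real)) eta y"] by simp
 also have "... <= (\<Sum>j\<in>(UNIV::'n set). L)" by (intro sum_mono L) (auto simp: axis_in_Basis_iff)
 finally have 1: "norm (\<chi> j. partial_within UNIV (axis j 1) eta y) <= real CARD('n) * L" by simp
 have 2: "norm (Z y $ al $ k) <= norm (Z y $ al)" by (rule norm_vec_nth_le)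
 have "norm (tilt k eta y $ al) = norm (Z y $ al $ k) * norm (\<chi> j. partial_within UNIV (axis j 1) eta y)" by (simp add: tilt_nth)
 also have "... <= norm (Z y $ al) * (real CARD('n) * L)" using 1 2 by (intro mult_mono) auto
 finally show ?thesis by (simp add: mult_ac)
qed

end

locale cutoff_comparison = comparison G p q eps Om U Z c C
 for G :: "(real^'m) \<times> (real^'m) => real" and p q eps :: real and Om :: "(real^'n) set"
  and U :: "real^'n => real^'m" and Z :: "real^'n => real^'n^'m" and c C :: real +
 fixes D :: "(real^'n) set" and eta :: "real^'n => real" and L h :: real and k :: 'n
 assumes D: "open D" "compactly_inside D Om" and eta: "test_function D eta"
  and eta_bounds: "!!x. 0 <= eta x" "!!x. eta x <= 1" and L0: "L > 0"
  and L: "!!e x. e \<in> Basis ==> abs (partial_within UNIV e eta x) <= L" and lip: "!!x y. abs (eta x - eta y) <= L * norm (x - y)"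
  and h: "0 < h" "h * (real CARD('n) * L) <= 1 / 4"
begin

lemma D_sub: "D \<subseteq> Om" and D_bounded: "bounded D" and D_sets[measurable]: "D \<in> sets borel" and D_leb: "D \<in> sets lebesgue"
proof -
 show "D \<subseteq> Om" using D(2) closure_subset by (auto simp: compactly_inside_def)
 then show "bounded D" using bounded_dom bounded_subset by blast
 show "D \<in> sets borel" "D \<in> sets lebesgue" using D(1) by auto
qed

lemma hL: "abs t <= h ==> abs t * L <= 1 / 4"
proof -
 assume t: "abs t <= h"
 have n: "1 <= real CARD('n)" using zero_less_card_finite[where 'a='n] by linarith
 have "abs t * L <= h * (1 * L)" using t L0 by (simp add: mult_right_mono)
 also have "... <= h * (real CARD('n) * L)" using h(1) L0 n by (intro mult_left_mono mult_right_mono) auto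
 finally show ?thesis using h(2) by linarith
qed

lemma axis_Basis: "axis j (1::real) \<in> Basis" by (simp add: axis_in_Basis_iff)

lemma t_partial: assumes "abs t <= h" "e \<in> Basis" shows "abs (t * partial_within UNIV e eta x) <= 1 / 4"
proof -
 have "abs (t * partial_within UNIV e eta x) <= abs t * L" unfolding abs_mult using L[OF assms(2), of x] by (intro mult_left_mono) auto
 then show ?thesis using hL[OF assms(1)] by linarith
qed

lemma shear_map: assumes t: "abs t <= h" shows "shear_map (axis k 1) (%x. t * eta x)"
proof
 show "axis k (1::real) \<in> Basis" by (rule axis_Basis)
 show "abs (t * eta x - t * eta y) <= norm (x - y) / 2" for x y
 proof -
  have "abs (t * eta x - t * eta y) = abs t * abs (eta x - eta y)" by (simp add: abs_mult[symmetric] right_diff_distrib)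
  also have "... <= abs t * (L * norm (x - y))" by (intro mult_left_mono lip) simp
  also have "... <= 1 / 4 * norm (x - y)" using hL[OF t] by (simp only: mult.assoc[symmetric]) (intro mult_right_mono, simp_all)
  finally show ?thesis using norm_ge_zero[of "x - y"] by linarith
 qed
 show "\<exists>B. \<forall>x. abs (t * eta x) <= B"
  using eta_bounds by (intro exI[of _ "abs t"]) (auto simp: abs_mult intro: mult_right_le_one_le)
 show "Ck_on k UNIV (%x. t * eta x)" for k by (intro Ck_on_cmult test_function_Ck[OF eta])
 show "abs (partial_within UNIV (axis k 1) (%x. t * eta x) x) <= 1 / 2" for x
  unfolding partial_cmult[OF eta axis_Basis] using t_partial[OF t axis_Basis, of k x] by linarith
qed

lemma eta0: assumes "x \<notin> D" shows "eta x = 0"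
proof -
 obtain K where "compact K" "K \<subseteq> D" "!!x. x \<notin> K ==> eta x = 0" using test_function_support[OF eta] by blast
 then show ?thesis using assms by blast
qed

lemma partial_measurable[measurable]: "partial_within UNIV (axis j 1) eta \<in> borel_measurable borel"
 by (rule test_function_measurable[OF test_function_partial[OF eta axis_Basis]])

lemma tilt_measurable[measurable]: "tilt k eta \<in> borel_measurable borel"
proof (rule borel_measurable_matI)
 fix al j
 have [measurable]: "(%x. Z x $ al $ k) \<in> borel_measurable borel" by (rule Zm)
 show "(%x. tilt k eta x $ al $ j) \<in> borel_measurable borel" unfolding tilt_def by simp
qed

lemma moved_grad_measurable[measurable]: "moved_grad k eta t \<in> borel_measurable borel"
 unfolding moved_grad_def[abs_def] by measurable

lemma moved_measurable[measurable]: "abs t <= h ==> moved k eta t \<in> borel_measurable borel"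
 unfolding moved_def by (rule shear_map.measurable_shear(2)[OF shear_map])

lemma moved_fixed: "abs t <= h ==> eta x = 0 ==> moved k eta t x = x"
 unfolding moved_def by (rule shear_map.psi_fixed[OF shear_map]) auto

lemma moved_mem: "abs t <= h ==> moved k eta t x \<in> D \<longleftrightarrow> x \<in> D"
 unfolding moved_def by (rule shear_map.psi_mem[OF shear_map]) (auto simp: eta0)

lemma moved_grad_nth: "moved_grad k eta t y $ al $ j =
 1 * Z y $ al $ j + (t * partial_within UNIV (axis j 1) eta y / (1 - t * partial_within UNIV (axis k 1) eta y)) * Z y $ al $ k"
 by (simp add: moved_grad_def tilt_def)

lemma moved_Lp:
 assumes t: "abs t <= h" and [measurable]: "f \<in> borel_measurable borel" and f: "(\<integral>\<^sup>+x. ennreal (abs (f x) powr p) \<partial>lborel) < \<infinity>"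
 shows "(\<integral>\<^sup>+x. ennreal (abs (f (moved k eta t x)) powr p) \<partial>lborel) < \<infinity>"
proof -
 have "(\<integral>\<^sup>+x. ennreal (abs (f (moved k eta t x)) powr p) \<partial>lborel) <= 2 * (\<integral>\<^sup>+x. ennreal (abs (f x) powr p) \<partial>lborel)"
  unfolding moved_def by (rule shear_map.nn_integral_psi_le[OF shear_map[OF t], of "%x. ennreal (abs (f x) powr p)"]) simp
 also have "... < \<infinity>" using f by (simp add: ennreal_mult_less_top)
 finally show ?thesis .
qed

lemma moved_grad_Lp: assumes t: "abs t <= h" shows "(\<integral>\<^sup>+x. ennreal (abs (moved_grad k eta t x $ al $ j) powr p) \<partial>lborel) < \<infinity>"
 unfolding moved_grad_nth
proof (rule Lp_lincomb_finite[OF Zm Zm p_pos(1) _ _ Zfin Zfin])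
 fix x
 have 1: "abs (t * partial_within UNIV (axis j 1) eta x) <= 1 / 4" "abs (t * partial_within UNIV (axis k 1) eta x) <= 1 / 4"
  by (rule t_partial[OF t axis_Basis])+
 have "3 / 4 <= 1 - t * partial_within UNIV (axis k 1) eta x" using abs_le_D1[OF 1(2)] by simp
 then have 2: "3 / 4 <= abs (1 - t * partial_within UNIV (axis k 1) eta x)" by (rule order_trans[OF _ abs_ge_self])
 then have "abs (t * partial_within UNIV (axis j 1) eta x) <= 1 * abs (1 - t * partial_within UNIV (axis k 1) eta x)" using 1(1) by simp
 moreover have "0 < abs (1 - t * partial_within UNIV (axis k 1) eta x)" using 2 by (rule less_le_trans[rotated]) simp
 ultimately show "abs (t * partial_within UNIV (axis j 1) eta x / (1 - t * partial_within UNIV (axis k 1) eta x)) <= 1"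
  unfolding abs_divide by (subst pos_divide_le_eq)
qed simp

lemma moved_weak_partial:
 assumes t: "abs t <= h"
 shows "has_weak_partial D j (%x. U (moved k eta t x) $ al) (%x. moved_grad k eta t (moved k eta t x) $ al $ j)"
proof -
 have wpD: "has_weak_partial D j (%x. U x $ al) (%x. Z x $ al $ j)" for j by (rule has_weak_partial_mono[OF wp D_sub _ D_leb]) (use open_dom in auto)
 have "t * eta x = 0" if "x \<notin> D" for x using eta0[OF that] by simp
 from has_weak_partial_unshear[OF shear_map[OF t] D(1) this integrable_components(1) integrable_components(2) wpD]
 show ?thesis unfolding moved_grad_nth partial_cmult[OF eta axis_Basis] moved_def by simp
qed

text \<open>The Jacobian of the change of variables is the factor in the cost inequality.\<close>

lemma moved_energy:
 assumes t: "abs t <= h"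
 shows "(\<integral>\<^sup>+x. ennreal (dens G p eps (U (moved k eta t x)) (moved_grad k eta t (moved k eta t x))) * indicator D x \<partial>lborel) =
  (\<integral>\<^sup>+y. ennreal ((1 - t * partial_within UNIV (axis k 1) eta y) * dens G p eps (U y) (moved_grad k eta t y)) * indicator D y \<partial>lborel)"
proof -
 have [measurable]: "(%y. dens G p eps (U y) (moved_grad k eta t y)) \<in> borel_measurable borel"
  by (rule measurable_dens[OF H2 eps(1) p_pos(1)]) measurable
 have "(\<integral>\<^sup>+x. ennreal (dens G p eps (U (moved k eta t x)) (moved_grad k eta t (moved k eta t x))) * indicator D x \<partial>lborel) =
  (\<integral>\<^sup>+x. ennreal (dens G p eps (U (moved k eta t x)) (moved_grad k eta t (moved k eta t x))) * indicator D (moved k eta t x) \<partial>lborel)"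
  by (rule nn_integral_cong) (simp add: indicator_def moved_mem[OF t])
 also have "... = (\<integral>\<^sup>+y. ennreal (dens G p eps (U y) (moved_grad k eta t y)) * indicator D y * ennreal (1 - t * partial_within UNIV (axis k 1) eta y) \<partial>lborel)"
  using shear_map.nn_integral_psi[OF shear_map[OF t], of "%y. ennreal (dens G p eps (U y) (moved_grad k eta t y)) * indicator D y"]
  unfolding moved_def partial_cmult[OF eta axis_Basis] by simp
 also have "... = (\<integral>\<^sup>+y. ennreal ((1 - t * partial_within UNIV (axis k 1) eta y) * dens G p eps (U y) (moved_grad k eta t y)) * indicator D y \<partial>lborel)"
 proof (rule nn_integral_cong)
  fix y
  have "0 <= 1 - t * partial_within UNIV (axis k 1) eta y" using t_partial[OF t axis_Basis, of k y] by linarith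
  then show "ennreal (dens G p eps (U y) (moved_grad k eta t y)) * indicator D y * ennreal (1 - t * partial_within UNIV (axis k 1) eta y) =
    ennreal ((1 - t * partial_within UNIV (axis k 1) eta y) * dens G p eps (U y) (moved_grad k eta t y)) * indicator D y"
   by (simp add: ennreal_mult dens_nonneg mult_ac)
 qed
 finally show ?thesis .
qed

abbreviation "mgap x \<equiv> moved_grad k eta (- h) (moved k eta (- h) x) - moved_grad k eta h (moved k eta h x)"
abbreviation "gap x \<equiv> ell_weight q eps (norm (moved_grad k eta h (moved k eta h x)) - norm (mgap x)) * (norm (mgap x))^2"

text \<open>The average of the two moved functions is a competitor.  Its energy lies below the average of the two moved energies by the
  gap, while that average exceeds the minimal energy only by a term of second order in \<open>h\<close>.\<close>

lemma inner_variation_estimate: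
 "(\<integral>\<^sup>+x. ennreal (gap x) * indicator D x \<partial>lborel)
  <= ennreal (C / (2 * c) * (real CARD('n) * L)^2 * h^2) * (\<integral>\<^sup>+x. ennreal (bulk x) * indicator D x \<partial>lborel)"
proof -
 have hh: "abs h <= h" "abs (- h) <= h" using h by auto
 \<comment> \<open>A bound for the norm of the full gradient of \<open>eta\<close>.\<close>
 define K where "K = real CARD('n) * L"
 have K: "K > 0" using L0 by (simp add: K_def)
 note [measurable] = moved_measurable[OF hh(1)] moved_measurable[OF hh(2)]
 define V where "V x = (1/2) *\<^sub>R (U (moved k eta h x) + U (moved k eta (- h) x))" for x
 define Y where "Y x = (1/2) *\<^sub>R (moved_grad k eta h (moved k eta h x) + moved_grad k eta (- h) (moved k eta (- h) x))" for x
 define A where "A = (\<integral>\<^sup>+x. ennreal (dens G p eps (U x) (Z x)) * indicator D x \<partial>lborel)"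
 define B where "B = (\<integral>\<^sup>+x. ennreal (bulk x) * indicator D x \<partial>lborel)"
 define W where "W = (\<integral>\<^sup>+x. ennreal (gap x) * indicator D x \<partial>lborel)"
 define E where "E t = (\<integral>\<^sup>+x. ennreal (dens G p eps (U (moved k eta t x)) (moved_grad k eta t (moved k eta t x))) * indicator D x \<partial>lborel)" for t
 have UV: "(%x. U (moved k eta t x)) \<in> borel_measurable borel" "(%x. moved_grad k eta t (moved k eta t x)) \<in> borel_measurable borel" if "abs t <= h" for t
  using moved_measurable[OF that] by measurable
 note [measurable] = UV[OF hh(1)] UV[OF hh(2)]
 have dm[measurable]: "(%x. dens G p eps (U x) (Z x)) \<in> borel_measurable borel"
   "(%x. dens G p eps (V x) (Y x)) \<in> borel_measurable borel"
   "(%x. dens G p eps (U (moved k eta h x)) (moved_grad k eta h (moved k eta h x))) \<in> borel_measurable borel"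
   "(%x. dens G p eps (U (moved k eta (- h) x)) (moved_grad k eta (- h) (moved k eta (- h) x))) \<in> borel_measurable borel"
  unfolding V_def Y_def by (rule measurable_dens[OF H2 eps(1) p_pos(1)]; measurable)+
 have gm[measurable]: "gap \<in> borel_measurable borel" unfolding ell_weight_def by measurable
 have gap0: "0 <= gap x" for x by (simp add: ell_weight_def)
 obtain S where S: "compact S" "S \<subseteq> D" "!!x. x \<notin> S ==> eta x = 0" using test_function_support[OF eta] by blast
 have out: "moved k eta t x = x" "moved_grad k eta t x = Z x" if "x \<notin> S" "abs t <= h" for x t
 proof -
  show "moved k eta t x = x" using moved_fixed[OF that(2) S(3)[OF that(1)]] .
  have "partial_within UNIV (axis j 1) eta x = 0" for j by (rule partial_eq_0_outside[OF compact_imp_closed[OF S(1)] S(3) that(1)])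
  then show "moved_grad k eta t x = Z x" by (simp add: vec_eq_iff moved_grad_nth)
 qed
 have Ym: "(%x. moved_grad k eta t (moved k eta t x) $ al $ i) \<in> borel_measurable borel" if "abs t <= h" for t al i
  using UV(2)[OF that] by measurable
 have mUf: "(\<integral>\<^sup>+x. ennreal (abs (U (moved k eta t x) $ al) powr p) \<partial>lborel) < \<infinity>" if "abs t <= h" for t al
  by (rule moved_Lp[OF that Um Ufin])
 have mGf: "(\<integral>\<^sup>+x. ennreal (abs (moved_grad k eta t (moved k eta t x) $ al $ i) powr p) \<partial>lborel) < \<infinity>" if "abs t <= h" for t al i
  by (rule moved_Lp[OF that _ moved_grad_Lp[OF that]]) measurable
 have AV: "A <= (\<integral>\<^sup>+x. ennreal (dens G p eps (V x) (Y x)) * indicator D x \<partial>lborel)"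
  unfolding A_def
 proof (rule minimal[OF D S(1,2)])
  show "(%x. V x $ al) \<in> borel_measurable borel" for al unfolding V_def by measurable
  show "(%x. Y x $ al $ i) \<in> borel_measurable borel" for al i unfolding Y_def by measurable
  show "(\<integral>\<^sup>+x. ennreal (abs (V x $ al) powr p) \<partial>lborel) < \<infinity>" for al
  proof -
   have "(%x. U (moved k eta t x) $ al) \<in> borel_measurable borel" if "abs t <= h" for t using UV(1)[OF that] by measurable
   from Lp_lincomb_finite[where a="%_. 1/2" and b="%_. 1/2", OF this[OF hh(1)] this[OF hh(2)] p_pos(1) _ _ mUf[OF hh(1)] mUf[OF hh(2)]]
   show ?thesis by (simp add: V_def distrib_left)
  qed
  show "(\<integral>\<^sup>+x. ennreal (abs (Y x $ al $ i) powr p) \<partial>lborel) < \<infinity>" for al i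
   using Lp_lincomb_finite[where a="%_. 1/2" and b="%_. 1/2", OF Ym[OF hh(1)] Ym[OF hh(2)] p_pos(1) _ _ mGf[OF hh(1)] mGf[OF hh(2)]]
   by (simp add: Y_def distrib_left)
  show "V x = U x" if "x \<notin> S" for x using out(1)[OF that hh(1)] out(1)[OF that hh(2)] by (simp add: V_def scaleR_2[symmetric])
  show "Y x = Z x" if "x \<notin> S" for x
   using out[OF that hh(1)] out[OF that hh(2)] by (simp add: Y_def scaleR_2[symmetric])
  show "has_weak_partial D i (%x. V x $ al) (%x. Y x $ al $ i)" for al i
   using has_weak_partial_lincomb[OF D_leb moved_weak_partial[OF hh(1), of i al] moved_weak_partial[OF hh(2), of i al], of "1/2" "1/2"]
   by (simp add: V_def Y_def distrib_left)
 qed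
 have 2: "(\<integral>\<^sup>+x. ennreal (dens G p eps (V x) (Y x)) * indicator D x \<partial>lborel) + ennreal c * W <= ennreal (1/2) * (E h + E (- h))"
 proof -
  have "(\<integral>\<^sup>+x. ennreal (dens G p eps (V x) (Y x)) * indicator D x \<partial>lborel) + ennreal c * W =
   (\<integral>\<^sup>+x. ennreal (dens G p eps (V x) (Y x)) * indicator D x + ennreal c * (ennreal (gap x) * indicator D x) \<partial>lborel)"
  proof -
   have "ennreal c * W = (\<integral>\<^sup>+x. ennreal c * (ennreal (gap x) * indicator D x) \<partial>lborel)"
    unfolding W_def by (rule nn_integral_cmult[symmetric]) measurable
   then show ?thesis by (simp only:) (rule nn_integral_add[symmetric]; measurable)
  qed
  also have "... <= (\<integral>\<^sup>+x. ennreal (1/2) * (ennreal (dens G p eps (U (moved k eta h x)) (moved_grad k eta h (moved k eta h x))) * indicator D x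
    + ennreal (dens G p eps (U (moved k eta (- h) x)) (moved_grad k eta (- h) (moved k eta (- h) x))) * indicator D x) \<partial>lborel)"
  proof (rule nn_integral_mono)
   fix x
   let ?d1 = "dens G p eps (U (moved k eta h x)) (moved_grad k eta h (moved k eta h x))" and ?d2 = "dens G p eps (U (moved k eta (- h) x)) (moved_grad k eta (- h) (moved k eta (- h) x))"
   have "dens G p eps (V x) (Y x) + c * gap x <= 1/2 * (?d1 + ?d2)"
    using gain[of "U (moved k eta h x)" "U (moved k eta (- h) x)" "moved_grad k eta h (moved k eta h x)" "moved_grad k eta (- h) (moved k eta (- h) x)"]
    by (simp add: V_def Y_def)
   then have "ennreal (dens G p eps (V x) (Y x) + c * gap x) <= ennreal (1/2 * (?d1 + ?d2))" by (rule ennreal_leI)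
   moreover have "ennreal (dens G p eps (V x) (Y x) + c * gap x) = ennreal (dens G p eps (V x) (Y x)) + ennreal c * ennreal (gap x)"
    using c gap0[of x] dens_nonneg[of "V x" "Y x"] by (subst ennreal_plus) (auto simp: ennreal_mult)
   moreover have "ennreal (1/2 * (?d1 + ?d2)) = ennreal (1/2) * (ennreal ?d1 + ennreal ?d2)"
    using dens_nonneg by (subst ennreal_mult) auto
   ultimately show "ennreal (dens G p eps (V x) (Y x)) * indicator D x + ennreal c * (ennreal (gap x) * indicator D x) \<le>
    ennreal (1/2) * (ennreal ?d1 * indicator D x + ennreal ?d2 * indicator D x)"
    by (auto simp: indicator_def)
  qed
  also have "... = ennreal (1/2) * (E h + E (- h))"
   unfolding E_def by (subst nn_integral_cmult, measurable) (rule arg_cong[OF nn_integral_add]; measurable)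
  finally show ?thesis .
 qed
 have 3: "E h + E (- h) <= 2 * A + ennreal (C * K^2 * h^2) * B"
 proof -
  define a where "a y = partial_within UNIV (axis k 1) eta y" for y
  have [measurable]: "a \<in> borel_measurable borel" unfolding a_def[abs_def] by measurable
  have [measurable]: "(%y. dens G p eps (U y) (moved_grad k eta t y)) \<in> borel_measurable borel" for t
   by (rule measurable_dens[OF H2 eps(1) p_pos(1)]) measurable
  have "E h + E (- h) = (\<integral>\<^sup>+y. ennreal ((1 - h * a y) * dens G p eps (U y) (moved_grad k eta h y)) * indicator D y
   + ennreal ((1 - (- h) * a y) * dens G p eps (U y) (moved_grad k eta (- h) y)) * indicator D y \<partial>lborel)"
   unfolding E_def moved_energy[OF hh(1)] moved_energy[OF hh(2)] a_def[symmetric] by (rule nn_integral_add[symmetric]) measurable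
  also have "... <= (\<integral>\<^sup>+y. 2 * (ennreal (dens G p eps (U y) (Z y)) * indicator D y) + ennreal (C * K^2 * h^2) * (ennreal (bulk y) * indicator D y) \<partial>lborel)"
  proof (rule nn_integral_mono)
   fix y
   let ?d = "%t. dens G p eps (U y) (moved_grad k eta t y)"
   have "abs (h * a y) <= 1 / 4" unfolding a_def by (rule t_partial[OF hh(1) axis_Basis])
   then have pos: "0 <= 1 - h * a y" "0 <= 1 - (- h) * a y" by auto
   have n: "1 <= real CARD('n)" using zero_less_card_finite[where 'a='n] by linarith
   have "abs (a y) <= K" unfolding a_def K_def using L[OF axis_Basis, of k y] n L0 by (smt (verit) mult_le_cancel_right1)
   moreover have "abs h * K <= 1 / 4" using h by (simp add: K_def)
   moreover have "\<forall>al. norm (tilt k eta y $ al) <= K * norm (Z y $ al)" using norm_tilt[OF L] by (simp add: K_def)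
   ultimately have "(1 - h * a y) * dens G p eps (U y) (Z y + (h / (1 - h * a y)) *\<^sub>R tilt k eta y)
     + (1 + h * a y) * dens G p eps (U y) (Z y + (- (h / (1 + h * a y))) *\<^sub>R tilt k eta y)
     <= 2 * dens G p eps (U y) (Z y) + C * K^2 * h^2 * bulk y" unfolding bulk_def by (intro cost)
   then have le: "(1 - h * a y) * ?d h + (1 - (- h) * a y) * ?d (- h) <= 2 * dens G p eps (U y) (Z y) + C * K^2 * h^2 * bulk y"
    by (simp add: moved_grad_def a_def)
   have "ennreal ((1 - h * a y) * ?d h) + ennreal ((1 - (- h) * a y) * ?d (- h)) = ennreal ((1 - h * a y) * ?d h + (1 - (- h) * a y) * ?d (- h))"
    using pos dens_nonneg by (intro ennreal_plus[symmetric] mult_nonneg_nonneg) auto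
   also have "... <= ennreal (2 * dens G p eps (U y) (Z y) + C * K^2 * h^2 * bulk y)" by (rule ennreal_leI[OF le])
   also have "... = ennreal (2 * dens G p eps (U y) (Z y)) + ennreal (C * K^2 * h^2 * bulk y)"
    using C bulk_nonneg dens_nonneg by (intro ennreal_plus) auto
   also have "... = 2 * ennreal (dens G p eps (U y) (Z y)) + ennreal (C * K^2 * h^2) * ennreal (bulk y)"
    using C bulk_nonneg dens_nonneg by (simp add: ennreal_mult)
   finally show "ennreal ((1 - h * a y) * ?d h) * indicator D y + ennreal ((1 - (- h) * a y) * ?d (- h)) * indicator D y \<le>
    2 * (ennreal (dens G p eps (U y) (Z y)) * indicator D y) + ennreal (C * K^2 * h^2) * (ennreal (bulk y) * indicator D y)"
    by (auto simp: indicator_def)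
  qed
  also have "... = 2 * A + ennreal (C * K^2 * h^2) * B"
  proof -
   have "2 * A = (\<integral>\<^sup>+y. 2 * (ennreal (dens G p eps (U y) (Z y)) * indicator D y) \<partial>lborel)"
    unfolding A_def by (rule nn_integral_cmult[symmetric]) measurable
   moreover have "ennreal (C * K^2 * h^2) * B = (\<integral>\<^sup>+y. ennreal (C * K^2 * h^2) * (ennreal (bulk y) * indicator D y) \<partial>lborel)"
    unfolding B_def by (rule nn_integral_cmult[symmetric]) measurable
   ultimately show ?thesis by (simp only:) (rule nn_integral_add; measurable)
  qed
  finally show ?thesis .
 qed
 have Afin: "A < \<infinity>" unfolding A_def
  by (rule dens_integral_finite[OF H1 open_dom ne _ _ eps D(1) D_bounded Um Zm Ufin Zfin]) (use q in auto)
 have "A + ennreal c * W <= (\<integral>\<^sup>+x. ennreal (dens G p eps (V x) (Y x)) * indicator D x \<partial>lborel) + ennreal c * W" by (intro add_right_mono AV)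
 also note 2
 also have "ennreal (1/2) * (E h + E (- h)) <= ennreal (1/2) * (2 * A + ennreal (C * K^2 * h^2) * B)" by (intro mult_left_mono 3) simp
 also have "... = A + ennreal (C * K^2 * h^2 / 2) * B"
 proof -
  have "ennreal (1/2) * ennreal 2 = ennreal (1/2 * 2)" by (rule ennreal_mult[symmetric]) auto
  also have "1/2 * 2 = (1::real)" by simp
  finally have "ennreal (1/2) * 2 = 1" by (simp only: ennreal_numeral ennreal_1)
  moreover have "ennreal (1/2) * ennreal (C * K^2 * h^2) = ennreal (C * K^2 * h^2 / 2)" using C by (subst ennreal_mult[symmetric]) auto
  ultimately show ?thesis by (simp only: distrib_left mult.assoc[symmetric] mult_1_left)
 qed
 finally have "A + ennreal c * W <= A + ennreal (C * K^2 * h^2 / 2) * B" .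
 then have cW: "ennreal c * W <= ennreal (C * K^2 * h^2 / 2) * B" using Afin by (auto simp: ennreal_add_left_cancel_le)
 have "W = ennreal (1/c) * (ennreal c * W)" using c by (simp add: mult.assoc[symmetric] ennreal_mult[symmetric])
 also have "... <= ennreal (1/c) * (ennreal (C * K^2 * h^2 / 2) * B)" by (intro mult_left_mono cW) simp
 also have "... = ennreal (C / (2 * c) * K^2 * h^2) * B"
  using c C by (simp only: mult.assoc[symmetric], subst ennreal_mult[symmetric]) (auto simp: field_simps)
 finally show ?thesis unfolding W_def B_def K_def .
qed

end

context comparison begin

text \<open>Near \<open>S\<close> the cutoff is \<open>1\<close>, so there the inverse shears are translations by \<open>\<plusminus> h\<close>.\<close>

lemma difference_estimate:
 assumes D: "open D" "compactly_inside D Om" and S: "compact S" "S \<noteq> {}" and r: "r > 0" "{x. infdist x S <= 3 * r} \<subseteq> D"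
  and h: "0 < h" "h * (real CARD('n) / r) <= 1 / 4"
 shows "(\<integral>\<^sup>+x. ennreal (ell_weight q eps (norm (Z (x + h *\<^sub>R axis k 1)) - norm (Z (x - h *\<^sub>R axis k 1) - Z (x + h *\<^sub>R axis k 1)))
    * (norm (Z (x - h *\<^sub>R axis k 1) - Z (x + h *\<^sub>R axis k 1)))^2) * indicator S x \<partial>lborel)
  <= ennreal (C / (2 * c) * (real CARD('n) / r)^2 * h^2) * (\<integral>\<^sup>+x. ennreal (bulk x) * indicator D x \<partial>lborel)"
proof -
 obtain eta where eta: "test_function D eta" "!!x. 0 <= eta x" "!!x. eta x <= 1"
  and one: "!!x. infdist x S <= r / 2 ==> eta x = 1"
  and part: "!!e x. e \<in> Basis ==> abs (partial_within UNIV e eta x) <= 1 / r"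
  and lip: "!!x y. abs (eta x - eta y) <= norm (x - y) / r"
  using smooth_cutoff[OF S r] by blast
 interpret cutoff_comparison G p q eps Om U Z c C D eta "1 / r" h k
  by unfold_locales (use D eta part lip r h in auto)
 have n: "1 <= real CARD('n)" using zero_less_card_finite[where 'a='n] by linarith
 have "h * (1 / r) <= h * (real CARD('n) / r)" using h(1) r(1) n by (intro mult_left_mono divide_right_mono) auto
 also have "... <= 1 / 4" using h(2) by simp
 finally have "h * (1 / r) <= 1 / 4" .
 then have "h <= r / 4" using r(1) by (simp add: field_simps)
 then have hr: "h < r / 2" using r(1) by simp
 have val: "moved k eta t x = x + t *\<^sub>R axis k 1" "moved_grad k eta t (moved k eta t x) = Z (x + t *\<^sub>R axis k 1)"
  if x: "x \<in> S" and t: "abs t <= h" for x t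
 proof -
  have near: "infdist y S <= norm (y - x)" for y using infdist_le[OF x, of y] by (simp add: dist_norm)
  have n1: "norm (t *\<^sub>R axis k (1::real)) <= h" using t by simp
  have e1: "eta (x + t *\<^sub>R axis k 1) = 1" by (rule one) (use near[of "x + t *\<^sub>R axis k 1"] n1 hr in simp)
  have "shear (axis k 1) (%x. t * eta x) (x + t *\<^sub>R axis k 1) = x" by (simp add: shear_def e1)
  then show m: "moved k eta t x = x + t *\<^sub>R axis k 1" unfolding moved_def using shear_map.psi_chi[OF shear_map[OF t], of "x + t *\<^sub>R axis k 1"] by simp
  have "partial_within UNIV (axis j 1) eta (x + t *\<^sub>R axis k 1) = 0" for j
  proof (rule DERIV_local_const)
   show "((%s. eta (x + t *\<^sub>R axis k 1 + s *\<^sub>R axis j 1)) has_real_derivative partial_within UNIV (axis j 1) eta (x + t *\<^sub>R axis k 1)) (at 0)"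
    using test_function_line[OF eta(1) axis_Basis, where z="x + t *\<^sub>R axis k 1" and s=0] by simp
   show "0 < r / 2 - h" using hr by simp
   show "\<forall>s. abs (0 - s) < r / 2 - h \<longrightarrow> eta (x + t *\<^sub>R axis k 1 + 0 *\<^sub>R axis j 1) = eta (x + t *\<^sub>R axis k 1 + s *\<^sub>R axis j 1)"
   proof (intro allI impI)
    fix s :: real assume s: "abs (0 - s) < r / 2 - h"
    have "norm (t *\<^sub>R axis k 1 + s *\<^sub>R axis j (1::real) :: real^'n) <= h + abs s"
     using norm_triangle_ineq[of "t *\<^sub>R axis k (1::real) :: real^'n" "s *\<^sub>R axis j (1::real)"] n1 by simp
    moreover have "infdist (x + t *\<^sub>R axis k 1 + s *\<^sub>R axis j 1) S <= norm (t *\<^sub>R axis k 1 + s *\<^sub>R axis j (1::real) :: real^'n)"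
     using near[of "x + t *\<^sub>R axis k 1 + s *\<^sub>R axis j 1"] by (simp add: add.assoc)
    ultimately have "infdist (x + t *\<^sub>R axis k 1 + s *\<^sub>R axis j 1) S <= r / 2" using s by simp
    then show "eta (x + t *\<^sub>R axis k 1 + 0 *\<^sub>R axis j 1) = eta (x + t *\<^sub>R axis k 1 + s *\<^sub>R axis j 1)" using one e1 by simp
   qed
  qed
  then show "moved_grad k eta t (moved k eta t x) = Z (x + t *\<^sub>R axis k 1)" by (simp add: m vec_eq_iff moved_grad_nth)
 qed
 have SD: "S \<subseteq> D" using r by auto
 have "(\<integral>\<^sup>+x. ennreal (ell_weight q eps (norm (Z (x + h *\<^sub>R axis k 1)) - norm (Z (x - h *\<^sub>R axis k 1) - Z (x + h *\<^sub>R axis k 1)))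
    * (norm (Z (x - h *\<^sub>R axis k 1) - Z (x + h *\<^sub>R axis k 1)))^2) * indicator S x \<partial>lborel)
  <= (\<integral>\<^sup>+x. ennreal (gap x) * indicator D x \<partial>lborel)"
 proof (rule nn_integral_mono)
  fix x
  show "ennreal (ell_weight q eps (norm (Z (x + h *\<^sub>R axis k 1)) - norm (Z (x - h *\<^sub>R axis k 1) - Z (x + h *\<^sub>R axis k 1)))
    * (norm (Z (x - h *\<^sub>R axis k 1) - Z (x + h *\<^sub>R axis k 1)))^2) * indicator S x <= ennreal (gap x) * indicator D x"
  proof (cases "x \<in> S")
   case True
   then have "moved_grad k eta h (moved k eta h x) = Z (x + h *\<^sub>R axis k 1)" "moved_grad k eta (- h) (moved k eta (- h) x) = Z (x - h *\<^sub>R axis k 1)"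
    using val(2)[of x h] val(2)[of x "- h"] h by auto
   then show ?thesis using True SD by auto
  qed simp
 qed
 also have "... <= ennreal (C / (2 * c) * (real CARD('n) * (1 / r))^2 * h^2) * (\<integral>\<^sup>+x. ennreal (bulk x) * indicator D x \<partial>lborel)"
  by (rule inner_variation_estimate)
 finally show ?thesis by simp
qed

end

section \<open>Second weak derivatives from difference quotients\<close>

lemma Lp_dist_translate_tendsto:
 fixes f :: "'a::euclidean_space => real"
 assumes f: "f \<in> borel_measurable borel" and p: "p > 0"
  and fin: "(\<integral>\<^sup>+x. ennreal (abs (f x) powr p) \<partial>lborel) < \<infinity>" and v: "v \<longlonglongrightarrow> 0"
 shows "(%n. Lp_dist p (%x. f (x + v n)) f) \<longlonglongrightarrow> 0"
proof (rule order_tendstoI)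
 fix a :: ennreal assume "0 < a"
 then obtain b where b: "0 < b" "b < a" using dense by blast
 then have bt: "b < top" by (auto intro: less_le_trans)
 define e where "e = enn2real b"
 have e: "e > 0" "ennreal e = b" using b bt by (auto simp: e_def enn2real_positive_iff)
 obtain d where d: "d > 0" "!!h. norm h < d ==> Lp_dist p (%x. f (x + h)) f <= ennreal e"
  using Lp_translation_continuous[OF f p fin e(1)] by blast
 have "eventually (%n. norm (v n) < d) sequentially"
  using order_tendstoD(2)[OF tendsto_norm_zero[OF v] d(1)] by simp
 then show "eventually (%n. Lp_dist p (%x. f (x + v n)) f < a) sequentially"
 proof (rule eventually_mono)
  fix n assume "norm (v n) < d"
  from d(2)[OF this] show "Lp_dist p (%x. f (x + v n)) f < a" unfolding e(2) using b(2) by (rule le_less_trans)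
 qed
qed simp

text \<open>Translations converge in the mean; one subsequence works almost everywhere for finitely many functions and both signs.\<close>

lemma translation_AE_sequence:
 fixes f :: "'i::finite => 'a::euclidean_space => real"
 assumes m: "!!i. f i \<in> borel_measurable borel" and p: "p > 0"
  and fin: "!!i. (\<integral>\<^sup>+x. ennreal (abs (f i x) powr p) \<partial>lborel) < \<infinity>" and \<delta>: "\<delta> > (0::real)"
 shows "\<exists>s::nat => real. (\<forall>n. 0 < s n & s n <= \<delta>) & s \<longlonglongrightarrow> 0 \<and>
  (AE x in lborel. \<forall>i. (%n. f i (x + s n *\<^sub>R e)) \<longlonglongrightarrow> f i x & (%n. f i (x + (- s n) *\<^sub>R e)) \<longlonglongrightarrow> f i x)"
proof -
 note [measurable] = m
 define s where "s n = \<delta> * inverse (real (Suc n))" for n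
 have s0: "s \<longlonglongrightarrow> 0" unfolding s_def using tendsto_mult[OF tendsto_const LIMSEQ_inverse_real_of_nat, of \<delta>] by simp
 have spos: "0 < s n" "s n <= \<delta>" for n
  using \<delta> by (auto simp: s_def intro: mult_left_le inverse_le_1_iff[THEN iffD2])
 define D where "D t i x = abs (f i (x + t *\<^sub>R e) - f i x) powr p" for t i x
 have [measurable]: "D t i \<in> borel_measurable borel" for t i unfolding D_def[abs_def] by measurable
 have D0: "0 <= D t i x" for t i x by (simp add: D_def)
 have lim: "(%n. \<integral>\<^sup>+x. ennreal (D (t n) i x) \<partial>lborel) \<longlonglongrightarrow> 0" if "t \<longlonglongrightarrow> 0" for t i
 proof -
  have "(%n. t n *\<^sub>R e) \<longlonglongrightarrow> 0 *\<^sub>R e" by (intro tendsto_intros that)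
  then have "(%n. t n *\<^sub>R e) \<longlonglongrightarrow> 0" by simp
  from Lp_dist_translate_tendsto[OF m p fin this] show ?thesis by (simp add: Lp_dist_def D_def)
 qed
 have Dfin: "(\<integral>\<^sup>+x. ennreal (D t i x) \<partial>lborel) < \<infinity>" for t i
 proof -
  have "(\<integral>\<^sup>+x. ennreal (abs (f i (x + t *\<^sub>R e)) powr p) \<partial>lborel) < \<infinity>"
   using nn_integral_translate[of "%x. ennreal (abs (f i x) powr p)" "t *\<^sub>R e"] fin[of i] by simp
  from Lp_diff_finite[OF _ m p this fin[of i]] show ?thesis by (simp add: D_def)
 qed
 \<comment> \<open>One integrable function dominates all deviations at once.\<close>
 define u where "u n x = (\<Sum>i\<in>UNIV. D (s n) i x + D (- s n) i x)" for n x
 have u0: "0 <= u n x" for n x unfolding u_def by (intro sum_nonneg add_nonneg_nonneg D0)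
 have um[measurable]: "u n \<in> borel_measurable borel" for n unfolding u_def[abs_def] by measurable
 have uI: "(\<integral>\<^sup>+x. ennreal (u n x) \<partial>lborel) = (\<Sum>i\<in>UNIV. (\<integral>\<^sup>+x. ennreal (D (s n) i x) \<partial>lborel) + (\<integral>\<^sup>+x. ennreal (D (- s n) i x) \<partial>lborel))" for n
 proof -
  have "(\<integral>\<^sup>+x. ennreal (u n x) \<partial>lborel) = (\<integral>\<^sup>+x. (\<Sum>i\<in>UNIV. ennreal (D (s n) i x) + ennreal (D (- s n) i x)) \<partial>lborel)"
   unfolding u_def by (intro nn_integral_cong) (simp add: D0 sum_ennreal[symmetric] ennreal_plus add_nonneg_nonneg del: sum_ennreal)
  then show ?thesis by (simp add: nn_integral_sum nn_integral_add)
 qed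
 have "(%n. - s n) \<longlonglongrightarrow> 0" using tendsto_minus[OF s0] by simp
 then have "(%n. \<Sum>i\<in>UNIV. (\<integral>\<^sup>+x. ennreal (D (s n) i x) \<partial>lborel) + (\<integral>\<^sup>+x. ennreal (D (- s n) i x) \<partial>lborel)) \<longlonglongrightarrow> (\<Sum>i\<in>(UNIV::'i set). 0 + 0)"
  by (intro tendsto_sum tendsto_add lim s0)
 then have ul: "(%n. \<integral>\<^sup>+x. ennreal (u n x) \<partial>lborel) \<longlonglongrightarrow> 0" by (simp add: uI)
 have ufin: "(\<integral>\<^sup>+x. ennreal (u n x) \<partial>lborel) < \<infinity>" for n using Dfin by (simp add: uI)
 have ui: "integrable lborel (u n)" for n
  using ufin[of n] by (intro integrableI_bounded) (auto simp: u0)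
 have "(%n. enn2real (\<integral>\<^sup>+x. ennreal (u n x) \<partial>lborel)) \<longlonglongrightarrow> 0" by (rule tendsto_enn2real) (use ul in auto)
 moreover have "enn2real (\<integral>\<^sup>+x. ennreal (u n x) \<partial>lborel) = (LINT x|lborel. norm (u n x))" for n
  using u0 by (subst integral_eq_nn_integral) auto
 ultimately have "(%n. LINT x|lborel. norm (u n x)) \<longlonglongrightarrow> 0" by simp
 from tendsto_L1_AE_subseq[OF ui this] obtain r where r: "strict_mono r" "AE x in lborel. (%n. u (r n) x) \<longlonglongrightarrow> 0" by blast
 have conv: "(%n. f i (x + t n *\<^sub>R e)) \<longlonglongrightarrow> f i x" if lim: "(%n. u (r n) x) \<longlonglongrightarrow> 0" and t: "!!n. D (t n) i x <= u (r n) x" for x i t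
 proof -
  have "(%n. D (t n) i x) \<longlonglongrightarrow> 0"
   by (rule tendsto_sandwich[OF _ _ tendsto_const lim]) (intro always_eventually allI D0 t)+
  then have "(%n. D (t n) i x powr (1/p)) \<longlonglongrightarrow> 0 powr (1/p)" using p by (intro tendsto_powr2[where b="1/p"] tendsto_const) (auto simp: D0)
  moreover have "D (t n) i x powr (1/p) = abs (f i (x + t n *\<^sub>R e) - f i x)" for n using p by (simp add: D_def powr_powr)
  ultimately have "(%n. abs (f i (x + t n *\<^sub>R e) - f i x)) \<longlonglongrightarrow> 0" using p by simp
  then show ?thesis by (simp add: tendsto_rabs_zero_iff LIM_zero_iff)
 qed
 have le: "D (s n) i x <= u n x" "D (- s n) i x <= u n x" for n i x
 proof -
  have "D (s n) i x + D (- s n) i x <= u n x"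
   unfolding u_def by (rule member_le_sum[where f="%i. D (s n) i x + D (- s n) i x"]) (auto intro: add_nonneg_nonneg D0)
  then show "D (s n) i x <= u n x" "D (- s n) i x <= u n x" using D0[of "s n" i x] D0[of "- s n" i x] by linarith+
 qed
 have "AE x in lborel. \<forall>i. (%n. f i (x + s (r n) *\<^sub>R e)) \<longlonglongrightarrow> f i x & (%n. f i (x + (- s (r n)) *\<^sub>R e)) \<longlonglongrightarrow> f i x"
  using r(2) by (rule eventually_mono) (intro allI conjI conv; simp add: le)
 moreover have "(%n. s (r n)) \<longlonglongrightarrow> 0" using LIMSEQ_subseq_LIMSEQ[OF s0 r(1)] by (simp add: o_def)
 ultimately show ?thesis using spos by (intro exI[of _ "%n. s (r n)"]) auto
qed

lemma difference_quotient_pairing: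
 fixes f :: "'a::euclidean_space => real"
 assumes f: "integrable lborel f" and phi: "test_function S phi" and e: "e \<in> Basis"
  and s: "!!n. 0 < s n" "s \<longlonglongrightarrow> 0"
 shows "(%n. LINT x|lborel. (1 / (2 * s n)) * (f (x + s n *\<^sub>R e) - f (x + (- s n) *\<^sub>R e)) * phi x) \<longlonglongrightarrow> - (LINT x|lborel. f x * partial_within UNIV e phi x)"
proof -
 have [measurable]: "f \<in> borel_measurable borel" using f by auto
 have [measurable]: "phi \<in> borel_measurable borel" "partial_within UNIV e phi \<in> borel_measurable borel"
  using test_function_measurable[OF phi] test_function_measurable[OF test_function_partial[OF phi e]] by auto
 obtain B1 where B1: "B1 > 0" "!!x. abs (phi x) <= B1" using test_function_bounded[OF phi] by blast
 obtain B where B: "B > 0" "!!x. abs (partial_within UNIV e phi x) <= B" using test_function_bounded[OF test_function_partial[OF phi e]] by blast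
 have tr: "(LINT x|lborel. f (x + t *\<^sub>R e) * phi x) = (LINT x|lborel. f x * phi (x + (- t) *\<^sub>R e))" for t
  using integral_translate[of "%x. f x * phi (x + (- t) *\<^sub>R e)" "t *\<^sub>R e"] by (simp add: add.assoc)
 have int1: "integrable lborel (%x. f (x + t *\<^sub>R e) * phi x)" for t
 proof (rule integrable_bounded_finite[OF _ _ B1(2)])
  have "(\<integral>\<^sup>+x. ennreal (norm (f (x + t *\<^sub>R e))) \<partial>lborel) < \<infinity>"
   using nn_integral_translate[of "%x. ennreal (norm (f x))" "t *\<^sub>R e"] f by (simp add: integrable_iff_bounded)
  then show "integrable lborel (%x. f (x + t *\<^sub>R e))" by (intro integrableI_bounded) auto
 qed simp
 have int2: "integrable lborel (%x. f x * phi (x + t *\<^sub>R e))" for t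
  by (rule integrable_bounded_finite[OF f _ B1(2)]) simp
 have eq: "(LINT x|lborel. (1 / (2 * s n)) * (f (x + s n *\<^sub>R e) - f (x + (- s n) *\<^sub>R e)) * phi x) =
  (LINT x|lborel. f x * ((phi (x + (- s n) *\<^sub>R e) - phi (x + s n *\<^sub>R e)) / (2 * s n)))" for n
 proof -
  have "(LINT x|lborel. (1 / (2 * s n)) * (f (x + s n *\<^sub>R e) - f (x + (- s n) *\<^sub>R e)) * phi x) =
   (LINT x|lborel. (1 / (2 * s n)) * (f (x + s n *\<^sub>R e) * phi x - f (x + (- s n) *\<^sub>R e) * phi x))"
   by (intro Bochner_Integration.integral_cong refl) (simp add: algebra_simps)
  also have "... = (1 / (2 * s n)) * ((LINT x|lborel. f (x + s n *\<^sub>R e) * phi x) - (LINT x|lborel. f (x + (- s n) *\<^sub>R e) * phi x))"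
   by (simp only: integral_mult_right_zero Bochner_Integration.integral_diff[OF int1 int1])
  also have "... = (1 / (2 * s n)) * ((LINT x|lborel. f x * phi (x + (- s n) *\<^sub>R e)) - (LINT x|lborel. f x * phi (x + s n *\<^sub>R e)))"
   unfolding tr by simp
  also have "... = (LINT x|lborel. (1 / (2 * s n)) * (f x * phi (x + (- s n) *\<^sub>R e) - f x * phi (x + s n *\<^sub>R e)))"
   by (simp only: integral_mult_right_zero Bochner_Integration.integral_diff[OF int2 int2])
  also have "... = (LINT x|lborel. f x * ((phi (x + (- s n) *\<^sub>R e) - phi (x + s n *\<^sub>R e)) / (2 * s n)))"
   by (intro Bochner_Integration.integral_cong refl) (simp add: right_diff_distrib diff_divide_distrib)
  finally show ?thesis .
 qed
 have bound: "abs (phi (x + (- t) *\<^sub>R e) - phi (x + t *\<^sub>R e)) <= B * (2 * t)" if "t > 0" for x t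
 proof -
  have d: "((%s. phi (x + s *\<^sub>R e)) has_real_derivative partial_within UNIV e phi (x + s *\<^sub>R e)) (at s)" for s by (rule test_function_line[OF phi e])
  have "- t < t" using that by simp
  from MVT2[OF this, of "%s. phi (x + s *\<^sub>R e)" "%s. partial_within UNIV e phi (x + s *\<^sub>R e)"] d
  obtain z where z: "phi (x + t *\<^sub>R e) - phi (x + (- t) *\<^sub>R e) = (t - (- t)) * partial_within UNIV e phi (x + z *\<^sub>R e)" by blast
  have "abs (phi (x + (- t) *\<^sub>R e) - phi (x + t *\<^sub>R e)) = (2 * t) * abs (partial_within UNIV e phi (x + z *\<^sub>R e))"
   using z that by (subst abs_minus_commute) (simp add: abs_mult)
  also have "... <= (2 * t) * B" using that by (intro mult_left_mono B) auto
  finally show ?thesis by (simp add: mult.commute)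
 qed
 have ptw: "(%n. (phi (x + (- s n) *\<^sub>R e) - phi (x + s n *\<^sub>R e)) / (2 * s n)) \<longlonglongrightarrow> - partial_within UNIV e phi x" for x
 proof -
  let ?g = "%t. phi (x + t *\<^sub>R e)"
  have "(?g has_real_derivative partial_within UNIV e phi (x + 0 *\<^sub>R e)) (at 0)" by (rule test_function_line[OF phi e])
  then have d: "((%t. (?g t - ?g 0) / t) \<longlongrightarrow> partial_within UNIV e phi x) (at 0)" by (simp add: has_field_derivative_iff)
  have "filterlim s (at 0) sequentially" using s by (intro filterlim_atI) (auto simp: less_imp_neq[symmetric])
  from filterlim_compose[OF d this] have 1: "(%n. (?g (s n) - ?g 0) / s n) \<longlonglongrightarrow> partial_within UNIV e phi x" .
  have "(%n. - s n) \<longlonglongrightarrow> 0" using tendsto_minus[OF s(2)] by simp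
  then have "filterlim (%n. - s n) (at 0) sequentially" using s(1) by (intro filterlim_atI) (auto simp: less_imp_neq[symmetric])
  from filterlim_compose[OF d this] have 2: "(%n. (?g (- s n) - ?g 0) / (- s n)) \<longlonglongrightarrow> partial_within UNIV e phi x" .
  have "(%n. - (1/2) * ((?g (s n) - ?g 0) / s n + (?g (- s n) - ?g 0) / (- s n))) \<longlonglongrightarrow> - (1/2) * (partial_within UNIV e phi x + partial_within UNIV e phi x)"
   by (intro tendsto_intros 1 2)
  moreover have "- (1/2) * ((?g (s n) - ?g 0) / s n + (?g (- s n) - ?g 0) / (- s n)) = (?g (- s n) - ?g (s n)) / (2 * s n)" for n
   using s(1)[of n] by (simp add: field_simps)
  ultimately show ?thesis by simp
 qed
 have "(%n. LINT x|lborel. f x * ((phi (x + (- s n) *\<^sub>R e) - phi (x + s n *\<^sub>R e)) / (2 * s n))) \<longlonglongrightarrow> (LINT x|lborel. f x * - partial_within UNIV e phi x)"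
 proof (rule integral_dominated_convergence[where w="%x. norm (f x) * B"])
  show "integrable lborel (%x. norm (f x) * B)" using f by (intro integrable_mult_left integrable_norm)
  show "AE x in lborel. (%n. f x * ((phi (x + (- s n) *\<^sub>R e) - phi (x + s n *\<^sub>R e)) / (2 * s n))) \<longlonglongrightarrow> f x * - partial_within UNIV e phi x"
   by (rule AE_I2) (intro tendsto_mult tendsto_const ptw)
  show "AE x in lborel. norm (f x * ((phi (x + (- s n) *\<^sub>R e) - phi (x + s n *\<^sub>R e)) / (2 * s n))) <= norm (f x) * B" for n
  proof (rule AE_I2)
   fix x
   have "abs ((phi (x + (- s n) *\<^sub>R e) - phi (x + s n *\<^sub>R e)) / (2 * s n)) <= B"
    using bound[OF s(1)[of n], of x] s(1)[of n] by (simp add: abs_divide pos_divide_le_eq)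
   then show "norm (f x * ((phi (x + (- s n) *\<^sub>R e) - phi (x + s n *\<^sub>R e)) / (2 * s n))) <= norm (f x) * B"
    unfolding norm_mult by (intro mult_left_mono) auto
  qed
 qed measurable
 then show ?thesis unfolding eq by simp
qed

lemma midpoint_hull_pairing:
 fixes v :: "nat => 'a => 'b::euclidean_space" and g :: "'b => real"
 assumes g: "linear g" and int: "!!k. integrable M (%x. g (v k x) * phi x)"
  and b: "!!k. l <= k ==> abs ((LINT x|M. g (v k x) * phi x) - a) <= \<delta>" and f: "f \<in> midpoint_hull v l"
 shows "integrable M (%x. g (f x) * phi x) & abs ((LINT x|M. g (f x) * phi x) - a) <= \<delta>"
 using f
proof (induction rule: midpoint_hull.induct)
 case (base k) then show ?case using int b by simp
next
 case (mid f h)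
 have eq: "g ((1/2) *\<^sub>R (f x + h x)) * phi x = (1/2) * (g (f x) * phi x + g (h x) * phi x)" for x
  by (simp add: linear_add[OF g] linear_scale[OF g] distrib_right)
 have i: "integrable M (%x. g (f x) * phi x)" "integrable M (%x. g (h x) * phi x)" using mid by auto
 have I: "(LINT x|M. g ((1/2) *\<^sub>R (f x + h x)) * phi x) = (1/2) * ((LINT x|M. g (f x) * phi x) + (LINT x|M. g (h x) * phi x))"
  unfolding eq by (simp only: integral_mult_right_zero Bochner_Integration.integral_add[OF i])
 have "abs ((1/2) * (A + B) - a) <= \<delta>" if "abs (A - a) <= \<delta>" "abs (B - a) <= \<delta>" for A B :: real
  using that unfolding abs_le_iff by (auto simp: field_simps)
 then have "abs ((LINT x|M. g ((1/2) *\<^sub>R (f x + h x)) * phi x) - a) <= \<delta>" unfolding I using mid by blast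
 moreover have "integrable M (%x. g ((1/2) *\<^sub>R (f x + h x)) * phi x)" unfolding eq by (intro integrable_mult_right Bochner_Integration.integrable_add i)
 ultimately show ?case by blast
qed

lemma L2_pairing_tendsto:
 fixes V :: "nat => 'a => real" and F phi :: "'a => real"
 assumes i: "!!l. integrable M (%x. V l x * phi x)" "integrable M (%x. F x * phi x)" and phi: "integrable M (%x. (phi x)^2)"
  and m[measurable]: "!!l. V l \<in> borel_measurable M" "F \<in> borel_measurable M" "phi \<in> borel_measurable M"
  and lim: "(%l. \<integral>\<^sup>+x. ennreal ((V l x - F x)^2) \<partial>M) \<longlonglongrightarrow> 0"
 shows "(%l. LINT x|M. V l x * phi x) \<longlonglongrightarrow> (LINT x|M. F x * phi x)"
proof (rule LIMSEQ_I)
 fix e :: real assume e: "e > 0"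
 define P where "P = (LINT x|M. (phi x)^2)"
 have P: "P \<ge> 0" unfolding P_def by (rule integral_nonneg_AE) simp
 \<comment> \<open>The parameter of Young's inequality, which balances its two terms.\<close>
 define s where "s = e / (P + 1)"
 have s: "s > 0" using e P by (simp add: s_def)
 have "eventually (%l. (\<integral>\<^sup>+x. ennreal ((V l x - F x)^2) \<partial>M) < ennreal (s^2)) sequentially"
  using s by (intro order_tendstoD(2)[OF lim]) simp
 then obtain L where L: "!!l. l \<ge> L ==> (\<integral>\<^sup>+x. ennreal ((V l x - F x)^2) \<partial>M) < ennreal (s^2)" by (auto simp: eventually_sequentially)
 show "\<exists>no. \<forall>n\<ge>no. norm ((LINT x|M. V n x * phi x) - (LINT x|M. F x * phi x)) < e"
 proof (intro exI[of _ L] allI impI)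
  fix l assume l: "L <= l"
  have di: "integrable M (%x. V l x * phi x - F x * phi x)" using i by simp
  have "ennreal (norm ((LINT x|M. V l x * phi x) - (LINT x|M. F x * phi x))) = ennreal (norm (LINT x|M. V l x * phi x - F x * phi x))"
   by (simp only: Bochner_Integration.integral_diff[OF i])
  also have "... <= (\<integral>\<^sup>+x. ennreal (norm (V l x * phi x - F x * phi x)) \<partial>M)" by (rule integral_norm_bound_ennreal[OF di])
  also have "... <= (\<integral>\<^sup>+x. ennreal (s / 2) * ennreal ((phi x)^2) + ennreal (1 / (2 * s)) * ennreal ((V l x - F x)^2) \<partial>M)"
  proof (rule nn_integral_mono)
   fix x
   have "norm (V l x * phi x - F x * phi x) = abs (V l x - F x) * abs (phi x)" by (simp add: abs_mult[symmetric] left_diff_distrib)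
   also have "... <= s / 2 * (phi x)^2 + 1 / (2 * s) * (V l x - F x)^2"
   proof -
    have "0 <= (s * abs (phi x) - abs (V l x - F x))^2" by simp
    then have "2 * s * (abs (V l x - F x) * abs (phi x)) <= s^2 * (phi x)^2 + (V l x - F x)^2" by (simp add: power2_diff power_mult_distrib mult_ac)
    then show ?thesis using s by (simp add: field_simps power2_eq_square)
   qed
   finally have "ennreal (norm (V l x * phi x - F x * phi x)) <= ennreal (s / 2 * (phi x)^2 + 1 / (2 * s) * (V l x - F x)^2)" by (rule ennreal_leI)
   also have "... = ennreal (s / 2) * ennreal ((phi x)^2) + ennreal (1 / (2 * s)) * ennreal ((V l x - F x)^2)"
    using s by (subst ennreal_plus) (auto simp: ennreal_mult[symmetric])
   finally show "ennreal (norm (V l x * phi x - F x * phi x)) <= ennreal (s / 2) * ennreal ((phi x)^2) + ennreal (1 / (2 * s)) * ennreal ((V l x - F x)^2)" .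
  qed
  also have "... = ennreal (s / 2) * (\<integral>\<^sup>+x. ennreal ((phi x)^2) \<partial>M) + ennreal (1 / (2 * s)) * (\<integral>\<^sup>+x. ennreal ((V l x - F x)^2) \<partial>M)"
   by (simp add: nn_integral_add nn_integral_cmult)
  also have "... <= ennreal (s / 2) * ennreal P + ennreal (1 / (2 * s)) * ennreal (s^2)"
   using L[OF l] nn_integral_eq_integral[OF phi] by (intro add_mono mult_left_mono) (auto simp: P_def)
  also have "... = ennreal (s / 2 * P + 1 / (2 * s) * s^2)"
   using s P by (subst ennreal_plus) (auto simp: ennreal_mult[symmetric])
  also have "s / 2 * P + 1 / (2 * s) * s^2 = s / 2 * (P + 1)" using s by (simp add: field_simps power2_eq_square)
  also have "... = (s * (P + 1)) / 2" by simp
  also have "s * (P + 1) = e" using P by (simp add: s_def)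
  finally have "norm ((LINT x|M. V l x * phi x) - (LINT x|M. F x * phi x)) <= e / 2" using e by (subst (asm) ennreal_le_iff) auto
  then show "norm ((LINT x|M. V l x * phi x) - (LINT x|M. F x * phi x)) < e" using e by linarith
 qed
qed

lemma ell_weight_at_norm: "ell_weight q eps (norm z) = ((norm z)^2 + eps) powr ((q - 2) / 2)"
 by (simp add: ell_weight_def max_def)

lemma ell_weight_lower: "0 < eps ==> 2 <= q ==> eps powr ((q - 2) / 2) <= ell_weight q eps r"
 unfolding ell_weight_def by (rule powr_mono2) auto

lemma tendsto_ell_weight:
 assumes "0 < eps" "(f \<longlongrightarrow> r) F" shows "((%x. ell_weight q eps (f x)) \<longlongrightarrow> ell_weight q eps r) F"
proof -
 have "(max 0 r)^2 + eps > 0" using assms(1) by (simp add: add_nonneg_pos)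
 then show ?thesis unfolding ell_weight_def by (intro tendsto_powr tendsto_intros tendsto_max assms(2)) auto
qed

context comparison begin

lemma bulk_finite:
 assumes D: "D \<in> sets borel" "bounded D"
 shows "(\<integral>\<^sup>+x. ennreal (bulk x) * indicator D x \<partial>lborel) < \<infinity>"
proof -
 note [measurable] = D(1)
 have "(\<integral>\<^sup>+x. ennreal (bulk x) * indicator D x \<partial>lborel) \<le>
  (\<integral>\<^sup>+x. 3 * indicator D x + 2 * ennreal (norm (Z x) powr p) + ennreal (norm (U x) powr p) \<partial>lborel)"
 proof (rule nn_integral_mono)
  fix x
  have pq: "a powr q <= 1 + a powr p" if "a \<ge> 0" for a :: real
  proof (cases "a <= 1")
   case True
   then have "a powr q <= 1" using that q by (simp add: powr_le1)
   then show ?thesis using powr_ge_zero[of a p] by linarith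
  next
   case False then have "a powr q <= a powr p" using q by (intro powr_mono) auto
   then show ?thesis by simp
  qed
  have "eps * norm (Z x) powr p <= 1 * norm (Z x) powr p" using eps by (intro mult_right_mono) auto
  then have "bulk x <= 3 + 2 * norm (Z x) powr p + norm (U x) powr p"
   unfolding bulk_def using pq[of "norm (Z x)"] pq[of "norm (U x)"] by simp
  then have "ennreal (bulk x) <= ennreal (3 + 2 * norm (Z x) powr p + norm (U x) powr p)" by (rule ennreal_leI)
  also have "... = 3 + 2 * ennreal (norm (Z x) powr p) + ennreal (norm (U x) powr p)" by (simp add: ennreal_plus ennreal_mult)
  finally show "ennreal (bulk x) * indicator D x <= 3 * indicator D x + 2 * ennreal (norm (Z x) powr p) + ennreal (norm (U x) powr p)"
   by (auto simp: indicator_def)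
 qed
 also have "... = 3 * emeasure lborel D + 2 * (\<integral>\<^sup>+x. ennreal (norm (Z x) powr p) \<partial>lborel) + (\<integral>\<^sup>+x. ennreal (norm (U x) powr p) \<partial>lborel)"
  by (simp add: nn_integral_add nn_integral_cmult nn_integral_cmult_indicator)
 also have "... < \<infinity>"
  using emeasure_bounded_finite[OF D(2)] norm_vec_Lp_finite[OF p_pos(1) Um Ufin] norm_mat_Lp_finite[OF p_pos(1) Zm Zfin]
  by (simp add: ennreal_mult_less_top)
 finally show ?thesis .
qed

text \<open>The weights are bounded below by a positive power of \<open>eps\<close>.  Thus the difference quotients are bounded in \<open>L\<^sup>2\<close>; this
  bound degenerates with \<open>eps\<close>, but it only serves to extract the limit.  Pairings with test functions are stable under
  midpoints, so the limit is the weak derivative, and its weighted norm obeys the bound of the quotients, uniformly in \<open>eps\<close>.\<close>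

lemma weak_derivative_estimate:
 assumes D: "open D" "compactly_inside D Om" and S: "compact S" "S \<noteq> {}" and r: "r > 0" "{x. infdist x S <= 3 * r} \<subseteq> D"
 shows "\<exists>F. F \<in> borel_measurable borel & (\<forall>x. x \<notin> S \<longrightarrow> F x = 0) & (\<integral>\<^sup>+x. ennreal ((norm (F x))^2) \<partial>lborel) < \<infinity> \<and>
  (\<forall>al j. has_weak_partial (interior S) k (%x. Z x $ al $ j) (%x. F x $ al $ j)) \<and>
  (\<integral>\<^sup>+x. ennreal (((norm (Z x))^2 + eps) powr ((q - 2) / 2)) * ennreal ((norm (F x))^2) \<partial>lborel)
   <= ennreal (C / (8 * c) * (real CARD('n) / r)^2) * (\<integral>\<^sup>+x. ennreal (bulk x) * indicator D x \<partial>lborel)"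
proof -
 define e :: "real^'n" where "e = axis k 1"
 have e: "e \<in> Basis" by (simp add: e_def axis_in_Basis_iff)
 have Sb[measurable]: "S \<in> sets borel" using S by (simp add: compact_imp_closed borel_closed)
 define n where "n = real CARD('n)"
 have n: "1 <= n" unfolding n_def using zero_less_card_finite[where 'a='n] by linarith
 \<comment> \<open>The largest step that the difference estimate admits.\<close>
 define \<delta> where "\<delta> = r / (4 * n)"
 have \<delta>: "\<delta> > 0" using r n by (simp add: \<delta>_def)
 obtain s where s: "!!n. 0 < s n" "!!n. s n <= \<delta>" "s \<longlonglongrightarrow> 0"
  and sae: "AE x in lborel. \<forall>i. (%n. Z (x + s n *\<^sub>R e) $ fst i $ snd i) \<longlonglongrightarrow> Z x $ fst i $ snd i \<and>
    (%n. Z (x + (- s n) *\<^sub>R e) $ fst i $ snd i) \<longlonglongrightarrow> Z x $ fst i $ snd i"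
  using translation_AE_sequence[of "%i x. Z x $ fst i $ snd i" p \<delta> e, OF Zm p_pos(1) Zfin \<delta>] by blast
 have Zae: "AE x in lborel. (%n. Z (x + s n *\<^sub>R e)) \<longlonglongrightarrow> Z x & (%n. Z (x + (- s n) *\<^sub>R e)) \<longlonglongrightarrow> Z x"
  using sae by (rule eventually_mono) (auto intro!: vec_tendstoI)
 have sh: "s i * (n / r) <= 1 / 4" for i
 proof -
  have "s i * (n / r) <= \<delta> * (n / r)" using s(2) n r by (intro mult_right_mono) auto
  also have "... = 1 / 4" using r n by (simp add: \<delta>_def)
  finally show ?thesis .
 qed
 define Q where "Q i x = Z (x + (- s i) *\<^sub>R e) - Z (x + s i *\<^sub>R e)" for i x
 define v where "v i x = indicator S x *\<^sub>R ((- (1 / (2 * s i))) *\<^sub>R Q i x)" for i x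
 define w where "w i x = ell_weight q eps (norm (Z (x + s i *\<^sub>R e)) - norm (Q i x))" for i x
 define B where "B = (\<integral>\<^sup>+x. ennreal (bulk x) * indicator D x \<partial>lborel)"
 define Cst where "Cst = C / (8 * c) * (n / r)^2"
 have Cst: "Cst \<ge> 0" using C c by (simp add: Cst_def)
 have [measurable]: "Q i \<in> borel_measurable borel" for i unfolding Q_def[abs_def] by measurable
 have vm[measurable]: "v i \<in> borel_measurable borel" for i unfolding v_def[abs_def] by measurable
 have wm[measurable]: "w i \<in> borel_measurable borel" for i unfolding w_def[abs_def] ell_weight_def by measurable
 have w0: "0 <= w i x" for i x by (simp add: w_def ell_weight_def)
 have wb: "(\<integral>\<^sup>+x. ennreal (w i x) * ennreal ((norm (v i x))^2) \<partial>lborel) <= ennreal Cst * B" for i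
 proof -
  have "(\<integral>\<^sup>+x. ennreal (w i x) * ennreal ((norm (v i x))^2) \<partial>lborel) =
   (\<integral>\<^sup>+x. ennreal (1 / (4 * (s i)^2)) * (ennreal (w i x * (norm (Q i x))^2) * indicator S x) \<partial>lborel)"
  proof (rule nn_integral_cong)
   fix x
   have "(norm (v i x))^2 = 1 / (4 * (s i)^2) * (norm (Q i x))^2" if "x \<in> S"
    using that by (simp add: v_def power_mult_distrib power_divide)
   then show "ennreal (w i x) * ennreal ((norm (v i x))^2) = ennreal (1 / (4 * (s i)^2)) * (ennreal (w i x * (norm (Q i x))^2) * indicator S x)"
   proof (cases "x \<in> S")
    case True
    have "ennreal W * ennreal (\<kappa> * N) = ennreal \<kappa> * ennreal (W * N)" if "0 <= W" "0 <= \<kappa>" "0 <= N" for W \<kappa> N :: real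
     using that by (simp add: ennreal_mult[symmetric] mult.left_commute)
    from this[OF w0, of "1 / (4 * (s i)^2)" "(norm (Q i x))^2" i x] show ?thesis
     unfolding \<open>x \<in> S ==> (norm (v i x))^2 = 1 / (4 * (s i)^2) * (norm (Q i x))^2\<close>[OF True] using True by simp
   qed (simp add: v_def)
  qed
  also have "... = ennreal (1 / (4 * (s i)^2)) * (\<integral>\<^sup>+x. ennreal (w i x * (norm (Q i x))^2) * indicator S x \<partial>lborel)"
   by (rule nn_integral_cmult) measurable
  also have "... <= ennreal (1 / (4 * (s i)^2)) * (ennreal (C / (2 * c) * (n / r)^2 * (s i)^2) * B)"
   using difference_estimate[OF D S r s(1)[of i], of k] sh[of i]
   by (intro mult_left_mono) (simp_all add: w_def Q_def e_def[symmetric] n_def B_def)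
  also have "... = ennreal Cst * B"
   using s(1)[of i] C c by (simp only: mult.assoc[symmetric], subst ennreal_mult[symmetric]) (auto simp: Cst_def field_simps)
  finally show ?thesis .
 qed
 \<comment> \<open>Only here does a bound depend on \<open>eps\<close>.\<close>
 define w1 where "w1 = eps powr ((q - 2) / 2)"
 have w1: "w1 > 0" using eps by (simp add: w1_def)
 have Bfin: "B < \<infinity>" unfolding B_def
  by (rule bulk_finite) (use D bounded_dom in \<open>auto intro: bounded_subset closure_subset[THEN subset_trans] simp: compactly_inside_def\<close>)
 define B2 where "B2 = enn2real (ennreal (1 / w1) * (ennreal Cst * B))"
 have B2: "ennreal (1 / w1) * (ennreal Cst * B) = ennreal B2"
  unfolding B2_def using Bfin by (subst ennreal_enn2real) (auto simp: ennreal_mult_less_top)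
 have vb: "(\<integral>\<^sup>+x. ennreal ((norm (v i x))^2) \<partial>lborel) <= ennreal B2" for i
 proof -
  have "(\<integral>\<^sup>+x. ennreal ((norm (v i x))^2) \<partial>lborel) <= (\<integral>\<^sup>+x. ennreal (1 / w1) * (ennreal (w i x) * ennreal ((norm (v i x))^2)) \<partial>lborel)"
  proof (rule nn_integral_mono)
   fix x
   have "w1 <= w i x" unfolding w_def w1_def by (rule ell_weight_lower) (use eps q in auto)
   then have "1 <= 1 / w1 * w i x" using w1 by (simp add: pos_le_divide_eq)
   then have "1 * (norm (v i x))^2 <= 1 / w1 * w i x * (norm (v i x))^2" by (rule mult_right_mono) simp
   then have "ennreal ((norm (v i x))^2) <= ennreal (1 / w1 * w i x * (norm (v i x))^2)" by (intro ennreal_leI) simp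
   also have "... = ennreal (1 / w1) * (ennreal (w i x) * ennreal ((norm (v i x))^2))"
    using w1 w0[of i x] by (simp add: ennreal_mult[symmetric] mult_ac)
   finally show "ennreal ((norm (v i x))^2) <= ennreal (1 / w1) * (ennreal (w i x) * ennreal ((norm (v i x))^2))" .
  qed
  also have "... = ennreal (1 / w1) * (\<integral>\<^sup>+x. ennreal (w i x) * ennreal ((norm (v i x))^2) \<partial>lborel)" by (rule nn_integral_cmult) measurable
  also have "... <= ennreal (1 / w1) * (ennreal Cst * B)" by (intro mult_left_mono wb) simp
  finally show ?thesis unfolding B2 .
 qed
 have vml: "!!i. v i \<in> borel_measurable lborel" by simp
 obtain V F0 where V: "!!l. V l \<in> midpoint_hull v l" and F0[measurable]: "F0 \<in> borel_measurable lborel"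
  and ae: "AE x in lborel. (%l. V l x) \<longlonglongrightarrow> F0 x" and L2: "(%l. \<integral>\<^sup>+x. ennreal ((norm (V l x - F0 x))^2) \<partial>lborel) \<longlonglongrightarrow> 0"
  using midpoint_hull_limit[where v=v and M=lborel and B=B2, OF vml vb] by blast
 have Vm[measurable]: "V l \<in> borel_measurable borel" for l using midpoint_hull_measurable[where v=v and M=lborel, OF vml V] by simp
 have hull0: "f x = 0" if "f \<in> midpoint_hull v l" "x \<notin> S" for f l x
  using that by (induction rule: midpoint_hull.induct) (auto simp: v_def)
 \<comment> \<open>Members of the hull vanish off \<open>S\<close>; cutting off makes this true everywhere for the limit.\<close>
 define F where "F x = indicator S x *\<^sub>R F0 x" for x
 have Fm[measurable]: "F \<in> borel_measurable borel" unfolding F_def[abs_def] using F0 by measurable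
 have FF: "AE x in lborel. F0 x = F x" using ae
 proof (rule eventually_mono)
  fix x assume lim: "(%l. V l x) \<longlonglongrightarrow> F0 x"
  show "F0 x = F x"
  proof (cases "x \<in> S")
   case False
   then have "V l x = 0" for l using hull0[OF V] by blast
   then have "(%l. 0) \<longlonglongrightarrow> F0 x" using lim by simp
   from LIMSEQ_unique[OF this tendsto_const] have "F0 x = 0" .
   then show ?thesis by (simp add: F_def)
  qed (simp add: F_def)
 qed
 have aeF: "AE x in lborel. (%l. V l x) \<longlonglongrightarrow> F x" using ae FF by eventually_elim simp
 have L2F: "(%l. \<integral>\<^sup>+x. ennreal ((norm (V l x - F x))^2) \<partial>lborel) \<longlonglongrightarrow> 0"
 proof -
  have "(\<integral>\<^sup>+x. ennreal ((norm (V l x - F x))^2) \<partial>lborel) = (\<integral>\<^sup>+x. ennreal ((norm (V l x - F0 x))^2) \<partial>lborel)" for l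
   by (rule nn_integral_cong_AE) (use FF in eventually_elim, simp)
  then show ?thesis using L2 by simp
 qed
 have Fl: "F \<in> borel_measurable lborel" by simp
 have fin: "(\<integral>\<^sup>+x. ennreal 1 * ennreal ((norm (F x))^2) \<partial>lborel) <= ennreal B2"
  by (rule midpoint_hull_weighted_limit[where v=v and w="%_ _. 1" and w'="%_. 1" and M=lborel and V=V, OF vml _ _ _ V Fl aeF])
   (use vb in auto)
 from le_less_trans[OF fin ennreal_less_top] have fin': "(\<integral>\<^sup>+x. ennreal ((norm (F x))^2) \<partial>lborel) < \<infinity>"
  by (simp only: ennreal_1 mult_1_left infinity_ennreal_def)
 have wae: "AE x in lborel. (%i. w i x) \<longlonglongrightarrow> ((norm (Z x))^2 + eps) powr ((q - 2) / 2)"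
  using Zae
 proof (rule eventually_mono)
  fix x assume "(%n. Z (x + s n *\<^sub>R e)) \<longlonglongrightarrow> Z x & (%n. Z (x + (- s n) *\<^sub>R e)) \<longlonglongrightarrow> Z x"
  then have "(%i. norm (Z (x + s i *\<^sub>R e)) - norm (Q i x)) \<longlonglongrightarrow> norm (Z x) - norm (Z x - Z x)"
   unfolding Q_def by (intro tendsto_intros) auto
  then have "(%i. w i x) \<longlonglongrightarrow> ell_weight q eps (norm (Z x) - norm (Z x - Z x))" unfolding w_def by (rule tendsto_ell_weight[OF eps(1)])
  then show "(%i. w i x) \<longlonglongrightarrow> ((norm (Z x))^2 + eps) powr ((q - 2) / 2)" by (simp add: ell_weight_at_norm)
 qed
 have est: "(\<integral>\<^sup>+x. ennreal (((norm (Z x))^2 + eps) powr ((q - 2) / 2)) * ennreal ((norm (F x))^2) \<partial>lborel) <= ennreal Cst * B"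
  by (rule midpoint_hull_weighted_limit[where v=v and w=w and M=lborel and V=V, OF vml _ _ wb V Fl aeF wae]) auto
 have F0S: "F x = 0" if "x \<notin> S" for x using that by (simp add: F_def)
 have Fint: "integrable lborel (%x. F x $ al $ j)" for al j
 proof (rule integrable_of_Lp_compact[where p=2, OF _ _ _ compact_imp_bounded[OF S(1)]])
  have "(\<integral>\<^sup>+x. ennreal (abs (F x $ al $ j) powr 2) \<partial>lborel) <= (\<integral>\<^sup>+x. ennreal ((norm (F x))^2) \<partial>lborel)"
  proof (rule nn_integral_mono, rule ennreal_leI)
   fix x
   have "abs (F x $ al $ j) <= norm (F x)" using norm_vec_nth_le[of "F x $ al" j] norm_vec_nth_le[of "F x" al] by simp
   then have "abs (F x $ al $ j)^2 <= (norm (F x))^2" by (intro power_mono) auto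
   then show "abs (F x $ al $ j) powr 2 <= (norm (F x))^2" by (simp add: powr_numeral)
  qed
  then show "(\<integral>\<^sup>+x. ennreal (abs (F x $ al $ j) powr 2) \<partial>lborel) < \<infinity>" using fin' by (rule le_less_trans)
 qed (auto simp: F0S)
 have wp: "has_weak_partial (interior S) k (%x. Z x $ al $ j) (%x. F x $ al $ j)" for al j
 proof (subst has_weak_partial_borel[OF open_interior Zm], measurable, intro conjI allI impI loc_integrable_borel_integrable integrable_components(2) Fint)
  fix phi assume phi: "test_function (interior S) phi"
  define a where "a = - (LINT x|lborel. Z x $ al $ j * partial_within UNIV e phi x)"
  have phim[measurable]: "phi \<in> borel_measurable borel" by (rule test_function_measurable[OF phi])
  obtain B3 where B3: "B3 > 0" "!!x. abs (phi x) <= B3" using test_function_bounded[OF phi] by blast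
  obtain K where K: "compact K" "K \<subseteq> interior S" "!!x. x \<notin> K ==> phi x = 0" using test_function_support[OF phi] by blast
  have phi0: "phi x = 0" if "x \<notin> S" for x using K that interior_subset by blast
  have veq: "v i x $ al $ j * phi x = (1 / (2 * s i)) * (Z (x + s i *\<^sub>R e) $ al $ j - Z (x + (- s i) *\<^sub>R e) $ al $ j) * phi x" for i x
   using phi0[of x] by (cases "x \<in> S") (auto simp: v_def Q_def algebra_simps)
  have vlim: "(%i. LINT x|lborel. v i x $ al $ j * phi x) \<longlonglongrightarrow> a"
   unfolding veq a_def by (rule difference_quotient_pairing[OF integrable_components(2) phi e s(1,3)])
  have tint: "integrable lborel (%x. Z (x + t *\<^sub>R e) $ al $ j)" for t
  proof -
   have "(\<integral>\<^sup>+x. ennreal (norm (Z (x + t *\<^sub>R e) $ al $ j)) \<partial>lborel) < \<infinity>"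
    using nn_integral_translate[of "%x. ennreal (norm (Z x $ al $ j))" "t *\<^sub>R e"] integrable_components(2)[of al j]
    by (simp add: integrable_iff_bounded)
   then show ?thesis by (intro integrableI_bounded) auto
  qed
  have vint: "integrable lborel (%x. v i x $ al $ j * phi x)" for i
  proof -
   have "integrable lborel (%x. (1 / (2 * s i)) * (Z (x + s i *\<^sub>R e) $ al $ j - Z (x + (- s i) *\<^sub>R e) $ al $ j))"
    by (intro integrable_mult_right Bochner_Integration.integrable_diff tint)
   then show ?thesis unfolding veq by (rule integrable_bounded_finite[OF _ _ B3(2)]) simp
  qed
  have lin: "linear (%z :: real^'n^'m. z $ al $ j)" by (rule linearI) auto
  have Vint: "integrable lborel (%x. V l x $ al $ j * phi x)" for l
  proof -
   have "\<exists>b. \<forall>i. abs ((LINT x|lborel. v i x $ al $ j * phi x) - a) <= b"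
   proof -
    have "Bseq (%i. (LINT x|lborel. v i x $ al $ j * phi x) - a)"
     by (rule convergent_imp_Bseq[OF convergentI[OF tendsto_diff[OF vlim tendsto_const]]])
    then show ?thesis unfolding Bseq_def real_norm_def by blast
   qed
   then obtain b where b: "!!i. abs ((LINT x|lborel. v i x $ al $ j * phi x) - a) <= b" by blast
   show ?thesis using midpoint_hull_pairing[where v=v and g="%z. z $ al $ j" and M=lborel and phi=phi and a=a and \<delta>=b, OF lin vint b V] by blast
  qed
  have Vlim: "(%l. LINT x|lborel. V l x $ al $ j * phi x) \<longlonglongrightarrow> a"
  proof (rule LIMSEQ_I)
   fix \<rho> :: real assume \<rho>: "\<rho> > 0"
   then obtain L where L: "!!i. i \<ge> L ==> norm ((LINT x|lborel. v i x $ al $ j * phi x) - a) < \<rho> / 2" using LIMSEQ_D[OF vlim, of "\<rho> / 2"] by auto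
   show "\<exists>no. \<forall>l\<ge>no. norm ((LINT x|lborel. V l x $ al $ j * phi x) - a) < \<rho>"
   proof (intro exI[of _ L] allI impI)
    fix l assume l: "L <= l"
    have b: "abs ((LINT x|lborel. v i x $ al $ j * phi x) - a) <= \<rho> / 2" if "l <= i" for i using L[of i] l that by simp
    from midpoint_hull_pairing[where v=v and g="%z. z $ al $ j" and M=lborel and phi=phi and a=a and \<delta>="\<rho> / 2", OF lin vint b V]
    have "abs ((LINT x|lborel. V l x $ al $ j * phi x) - a) <= \<rho> / 2" by blast
    then show "norm ((LINT x|lborel. V l x $ al $ j * phi x) - a) < \<rho>" using \<rho> by simp
   qed
  qed
  have "(%l. LINT x|lborel. V l x $ al $ j * phi x) \<longlonglongrightarrow> (LINT x|lborel. F x $ al $ j * phi x)"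
  proof (rule L2_pairing_tendsto[OF Vint])
   show "integrable lborel (%x. F x $ al $ j * phi x)" by (rule integrable_bounded_finite[OF Fint _ B3(2)]) simp
   show "integrable lborel (%x. (phi x)^2)" unfolding power2_eq_square
    by (rule integrable_bounded_finite[OF test_function_integrable[OF phi] _ B3(2)]) simp
   show "(%l. \<integral>\<^sup>+x. ennreal ((V l x $ al $ j - F x $ al $ j)^2) \<partial>lborel) \<longlonglongrightarrow> 0"
   proof (rule tendsto_sandwich[OF _ _ tendsto_const L2F]; intro always_eventually allI)
    fix l
    show "(\<integral>\<^sup>+x. ennreal ((V l x $ al $ j - F x $ al $ j)^2) \<partial>lborel) <= (\<integral>\<^sup>+x. ennreal ((norm (V l x - F x))^2) \<partial>lborel)"
    proof (rule nn_integral_mono, rule ennreal_leI)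
     fix x
     have "abs ((V l x - F x) $ al $ j) <= norm (V l x - F x)"
      using norm_vec_nth_le[of "(V l x - F x) $ al" j] norm_vec_nth_le[of "V l x - F x" al] by simp
     then have "abs ((V l x - F x) $ al $ j)^2 <= (norm (V l x - F x))^2" by (intro power_mono) auto
     then show "(V l x $ al $ j - F x $ al $ j)^2 <= (norm (V l x - F x))^2" by simp
    qed
   qed simp
  qed measurable
  from LIMSEQ_unique[OF this Vlim]
  show "(LINT x|lborel. Z x $ al $ j * partial_within UNIV (axis k 1) phi x) = - (LINT x|lborel. F x $ al $ j * phi x)"
   by (simp add: a_def e_def)
 qed
 show ?thesis
  by (rule exI[of _ F]) (use Fm F0S fin' wp est in \<open>auto simp: Cst_def n_def B_def\<close>)
qed

end

section \<open>Global second derivatives and the estimate\<close>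

lemma has_weak_partial_exhaust:
 fixes Om :: "(real^'n) set"
 assumes O: "open Om" and I: "!!n::nat. open (I n)" "!!n. I n \<subseteq> Om"
  and ex: "!!L. compact L ==> L \<subseteq> Om ==> \<exists>n. L \<subseteq> I n" and wp: "!!n. has_weak_partial (I n) i v w"
 shows "has_weak_partial Om i v w"
proof -
 have OL: "Om \<in> sets lebesgue" "!!n. I n \<in> sets lebesgue" using O I(1) by auto
 have loc: "loc_integrable Om v" "loc_integrable Om w"
  using wp ex unfolding loc_integrable_def has_weak_partial_def by metis+
 moreover have "(LINT x|lebesgue. v x * partial_within UNIV (axis i 1) phi x) = - (LINT x|lebesgue. w x * phi x)" if phi: "test_function Om phi" for phi
 proof -
  have "compact (closure {x. phi x \<noteq> 0})" "closure {x. phi x \<noteq> 0} \<subseteq> Om" using phi by (auto simp: test_function_def)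
  from ex[OF this] obtain n where n: "closure {x. phi x \<noteq> 0} \<subseteq> I n" by blast
  then have "test_function (I n) phi" using phi by (auto simp: test_function_def)
  with wp[of n] show ?thesis unfolding has_weak_partial_alt[OF OL(2)] by blast
 qed
 ultimately show ?thesis unfolding has_weak_partial_alt[OF OL(1)] by blast
qed

text \<open>Weak derivatives on the members of an increasing exhaustion agree almost everywhere where both are defined, so each
  point may take its value from the first member that contains it.\<close>

lemma has_weak_partial_glue:
 fixes Om :: "(real^'n) set"
 assumes O: "open Om" "Om \<noteq> {}"
  and loc: "!!K. compact K ==> K \<noteq> {} ==> K \<subseteq> Om ==> \<exists>w. has_weak_partial (interior K) i v w"
 shows "\<exists>w. has_weak_partial Om i v w"
proof -
 obtain C :: "nat => (real^'n) set" where CC: "(\<forall>n. compact (C n)) & (\<forall>n. C n \<subseteq> Om) & (\<forall>n. C n \<subseteq> interior (C (Suc n))) & \<Union> (range C) = Om \<and>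
  (\<forall>K. compact K & K \<subseteq> Om \<longrightarrow> (\<exists>N. \<forall>n\<ge>N. K \<subseteq> C n))"
  using compact_exhaustion[OF O(1)] by (rule exE)
 have C: "compact (C n)" "C n \<subseteq> Om" "C n \<subseteq> interior (C (Suc n))" for n using CC by auto
 have ex: "\<exists>N. \<forall>n\<ge>N. K \<subseteq> C n" if "compact K" "K \<subseteq> Om" for K using CC that by blast
 obtain a where a: "a \<in> Om" using O by blast
 define I where "I n = interior (C n)" for n
 have Io: "open (I n)" for n by (simp add: I_def)
 have IL: "I n \<in> sets lebesgue" for n using Io by auto
 have Isub: "I n \<subseteq> Om" for n using C(2) interior_subset unfolding I_def by blast
 have Imono: "I m \<subseteq> I n" if "m <= n" for m n
 proof -
  have "I n \<subseteq> I (Suc n)" for n using C(3)[of n] interior_subset unfolding I_def by blast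
  then show ?thesis using lift_Suc_mono_le[of I] that by blast
 qed
 \<comment> \<open>The additional point only serves to make the compact set nonempty.\<close>
 have "\<exists>w. has_weak_partial (I n) i v w" for n
 proof -
  have "compact (insert a (C n))" "insert a (C n) \<noteq> {}" "insert a (C n) \<subseteq> Om" using C(1,2) a by (auto intro: compact_insert)
  from loc[OF this] obtain w where w: "has_weak_partial (interior (insert a (C n))) i v w" by blast
  have "I n \<subseteq> interior (insert a (C n))" unfolding I_def by (intro interior_mono) auto
  moreover have "interior (insert a (C n)) \<in> sets lebesgue" using open_interior by auto
  ultimately show ?thesis using has_weak_partial_mono[OF w _ _ IL] by blast
 qed
 then have "\<forall>n. \<exists>w. has_weak_partial (I n) i v w" by blast
 from choice[OF this] obtain w where w: "\<forall>n. has_weak_partial (I n) i v (w n)" by (rule exE)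
 define F where "F y = w (LEAST n. y \<in> I n) y" for y
 have agree: "AE y in lebesgue. y \<in> I m \<longrightarrow> w m y = w n y" if "m <= n" for m n
 proof -
  have "has_weak_partial (I m) i v (w n)" using has_weak_partial_mono[OF _ Imono[OF that] IL IL] w by blast
  then have "AE y in lebesgue_on (I m). w m y = w n y" using w by (intro has_weak_partial_unique[OF Io]) auto
  then show ?thesis by (subst (asm) AE_restrict_space_iff) (use IL in auto)
 qed
 have FI: "AE y in lebesgue_on (I n). F y = w n y" for n
 proof -
  have "AE y in lebesgue. \<forall>m\<in>{..n}. y \<in> I m \<longrightarrow> w m y = w n y" by (rule AE_finite_allI) (use agree in auto)
  then have "AE y in lebesgue. y \<in> I n \<longrightarrow> F y = w n y"
  proof (rule eventually_mono, intro impI)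
   fix y assume all: "\<forall>m\<in>{..n}. y \<in> I m \<longrightarrow> w m y = w n y" and y: "y \<in> I n"
   have "(LEAST n. y \<in> I n) <= n" "y \<in> I (LEAST n. y \<in> I n)" using y by (auto intro: Least_le LeastI)
   then show "F y = w n y" using all by (simp add: F_def)
  qed
  then show ?thesis by (subst AE_restrict_space_iff) (use IL in auto)
 qed
 have FW: "has_weak_partial (I n) i v F" for n by (rule has_weak_partial_cong_AE[OF w[rule_format] _ FI IL]) simp
 have cover: "\<exists>n. L \<subseteq> I n" if L: "compact L" "L \<subseteq> Om" for L
 proof -
  obtain N where "L \<subseteq> C N" using ex[OF L] by blast
  then show ?thesis using C(3)[of N] unfolding I_def by blast
 qed
 show ?thesis by (rule exI[of _ F], rule has_weak_partial_exhaust[OF O(1) Io Isub cover FW])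
qed

lemma Lp_on_cong_AE:
 fixes f g :: "'a::euclidean_space => real"
 assumes g: "Lp_on p S g" and S: "S \<in> sets lebesgue" and ae: "AE x in lebesgue_on S. f x = g x"
 shows "Lp_on p S f"
 unfolding Lp_on_def
proof
 show "f \<in> borel_measurable (lebesgue_on S)" using g measurable_lebesgue_on_cong_AE[OF _ S ae] by (auto simp: Lp_on_def)
 have "AE x in lebesgue_on S. abs (f x) powr p = abs (g x) powr p" using ae by eventually_elim simp
 then show "integrable (lebesgue_on S) (%x. abs (f x) powr p)"
  by (rule integrable_lebesgue_on_cong_AE[OF _ S, rotated]) (use g in \<open>simp add: Lp_on_def\<close>)
qed

lemma L2_of_Lp_bounded:
 fixes f :: "'a::euclidean_space => real"
 assumes [measurable]: "f \<in> borel_measurable borel" and p: "2 <= p" and f: "(\<integral>\<^sup>+x. ennreal (abs (f x) powr p) \<partial>lborel) < \<infinity>"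
  and S: "open S" "bounded S" "!!x. x \<notin> S ==> f x = 0"
 shows "(\<integral>\<^sup>+x. ennreal (abs (f x) powr 2) \<partial>lborel) < \<infinity>"
proof -
 have [measurable]: "S \<in> sets borel" using S by auto
 have "(\<integral>\<^sup>+x. ennreal (abs (f x) powr 2) \<partial>lborel) <= (\<integral>\<^sup>+x. indicator S x + ennreal (abs (f x) powr p) \<partial>lborel)"
 proof (rule nn_integral_mono)
  fix x
  have "abs (f x) powr 2 <= 1 + abs (f x) powr p"
  proof (cases "abs (f x) <= 1")
   case True
   then have "abs (f x) powr 2 <= 1 powr 2" by (intro powr_mono2) auto
   then have "abs (f x) powr 2 <= 1" by (simp only: powr_one_eq_one)
   then show ?thesis using powr_ge_zero[of "abs (f x)" p] by linarith
  next
   case False then have "abs (f x) powr 2 <= abs (f x) powr p" using p by (intro powr_mono) auto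
   then show ?thesis by simp
  qed
  then have "ennreal (abs (f x) powr 2) <= 1 + ennreal (abs (f x) powr p)" using ennreal_leI by fastforce
  then show "ennreal (abs (f x) powr 2) <= indicator S x + ennreal (abs (f x) powr p)" using S(3)[of x] by (cases "x \<in> S") auto
 qed
 also have "... = emeasure lborel S + (\<integral>\<^sup>+x. ennreal (abs (f x) powr p) \<partial>lborel)" by (simp add: nn_integral_add)
 also have "... < \<infinity>" using emeasure_bounded_finite[OF S(2)] f by simp
 finally show ?thesis .
qed

lemma norm_vec_sq: "(norm (x :: 'a::real_normed_vector ^ 'n))^2 = (\<Sum>i\<in>UNIV. (norm (x $ i))^2)"
 by (simp add: norm_vec_def L2_set_def sum_nonneg)

context comparison begin

lemma second_derivative_exists:
 assumes K: "compact K" "K \<noteq> {}" "K \<subseteq> Om"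
 shows "\<exists>F. F \<in> borel_measurable borel & (\<integral>\<^sup>+x. ennreal ((norm (F x))^2) \<partial>lborel) < \<infinity> \<and>
  (\<forall>al j. has_weak_partial (interior K) k (%x. Z x $ al $ j) (%x. F x $ al $ j))"
proof -
 obtain r where r: "r > 0" "{x. infdist x K <= 3 * r} \<subseteq> Om" using compact_infdist_nbhd[OF K(1,2) open_dom K(3)] by blast
 \<comment> \<open>A neighbourhood of \<open>K\<close> that is still compactly inside \<open>Om\<close>.\<close>
 define D where "D = {x. infdist x K < 3 * r}"
 have D: "open D" unfolding D_def by (intro open_Collect_less continuous_intros)
 have cl: "closed {x. infdist x K <= 3 * r}" by (intro closed_Collect_le continuous_intros)
 have "closure D \<subseteq> {x. infdist x K <= 3 * r}" by (rule closure_minimal[OF _ cl]) (auto simp: D_def)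
 then have clD: "closure D \<subseteq> Om" using r(2) by blast
 then have "compactly_inside D Om" using bounded_subset[OF bounded_dom clD] by (simp add: compactly_inside_def compact_eq_bounded_closed)
 moreover have "{x. infdist x K <= 3 * (r / 2)} \<subseteq> D" using r(1) by (auto simp: D_def)
 moreover have "r / 2 > 0" using r by simp
 ultimately show ?thesis using weak_derivative_estimate[OF D _ K(1,2), of "r / 2" k] by blast
qed

lemma second_derivative_global: "\<exists>w. has_weak_partial Om k (%x. Z x $ al $ j) w"
proof (rule has_weak_partial_glue[OF open_dom ne])
 fix K assume K: "compact K" "K \<noteq> {}" "K \<subseteq> Om"
 obtain F :: "real^'n => real^'n^'m" where F: "F \<in> borel_measurable borel & (\<integral>\<^sup>+x. ennreal ((norm (F x))^2) \<partial>lborel) < \<infinity> \<and>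
  (\<forall>al j. has_weak_partial (interior K) k (%x. Z x $ al $ j) (%x. F x $ al $ j))"
  using second_derivative_exists[OF K] by (rule exE)
 show "\<exists>w. has_weak_partial (interior K) k (%x. Z x $ al $ j) w"
  by (rule exI[of _ "%x. F x $ al $ j"]) (use F in simp)
qed

end

lemma sobolev_empty: "sobolev k p {} v"
proof (induction k arbitrary: v)
 have m: "(v :: real^'n => real) \<in> borel_measurable (lebesgue_on {})" for v by (simp add: measurable_def space_restrict_space)
 have L: "Lp_on p {} v" for v :: "real^'n => real"
  unfolding Lp_on_def using m by (auto simp: integrable_iff_bounded nn_integral_empty space_restrict_space)
 case 0 show ?case using L by simp
 case (Suc k)
 have "loc_integrable {} v" for v :: "real^'n => real"
  using m by (auto simp: loc_integrable_def integrable_iff_bounded nn_integral_empty space_restrict_space)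
 then have "has_weak_partial {} i v (%_. 0)" for i v
  unfolding has_weak_partial_def by (auto intro!: Bochner_Integration.integral_cong simp: Bochner_Integration.integral_empty space_restrict_space)
 then show ?case using Suc L by auto
qed

context comparison begin

lemma sobolev_loc:
 assumes uU: "AE x in lebesgue_on Om. u x = U x"
 shows "sobolev_vec_loc 2 2 Om u"
 unfolding sobolev_vec_loc_def sobolev_vec_def
proof (intro allI impI)
 fix D :: "(real^'n) set" and al assume D: "open D & compactly_inside D Om"
 have DL: "D \<in> sets lebesgue" "Om \<in> sets lebesgue" and Dsub: "D \<subseteq> Om" using D open_dom closure_subset by (auto simp: compactly_inside_def)
 obtain a where a: "a \<in> Om" using ne by blast
 \<comment> \<open>The additional point only serves to make the compact set nonempty.\<close>
 define K where "K = insert a (closure D)"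
 have K: "compact K" "K \<noteq> {}" "K \<subseteq> Om" using D a by (auto simp: K_def compactly_inside_def intro: compact_insert)
 have DK: "D \<subseteq> interior K" using D closure_subset by (intro interior_maximal) (auto simp: K_def)
 have uUD: "AE x in lebesgue_on D. u x $ al = U x $ al" using AE_lebesgue_on_subset[OF uU Dsub DL] by eventually_elim simp
 have "Lp_on 2 D (%x. U x $ al)"
  by (rule Lp_on_borel[OF Um L2_of_Lp_bounded[OF Um p_pos(3) Ufin open_dom bounded_dom] DL(1)]) (simp add: U0)
 then have Lu: "Lp_on 2 D (%x. u x $ al)" by (rule Lp_on_cong_AE[OF _ DL(1) uUD])
 have LZ: "Lp_on 2 D (%x. Z x $ al $ j)" for j
  by (rule Lp_on_borel[OF Zm L2_of_Lp_bounded[OF Zm p_pos(3) Zfin open_dom bounded_dom] DL(1)]) (simp add: Z0)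
 have wu: "has_weak_partial D j (%x. u x $ al) (%x. Z x $ al $ j)" for j
  by (rule has_weak_partial_cong_AE[OF has_weak_partial_mono[OF wp Dsub DL(2,1)] uUD _ DL(1)]) simp
 have wZ: "\<exists>w. has_weak_partial D k (%x. Z x $ al $ j) w & Lp_on 2 D w" for j k
 proof -
  obtain F where F: "F \<in> borel_measurable borel" "(\<integral>\<^sup>+x. ennreal ((norm (F x))^2) \<partial>lborel) < \<infinity>"
   "\<forall>al j. has_weak_partial (interior K) k (%x. Z x $ al $ j) (%x. F x $ al $ j)"
   using second_derivative_exists[OF K, of k] by blast
  note [measurable] = F(1)
  have "(\<integral>\<^sup>+x. ennreal (abs (F x $ al $ j) powr 2) \<partial>lborel) <= (\<integral>\<^sup>+x. ennreal ((norm (F x))^2) \<partial>lborel)"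
  proof (rule nn_integral_mono, rule ennreal_leI)
   fix x
   have "abs (F x $ al $ j) <= norm (F x)" using norm_vec_nth_le[of "F x $ al" j] norm_vec_nth_le[of "F x" al] by simp
   then have "abs (F x $ al $ j)^2 <= (norm (F x))^2" by (intro power_mono) auto
   then show "abs (F x $ al $ j) powr 2 <= (norm (F x))^2" by (simp add: powr_numeral)
  qed
  then have "Lp_on 2 D (%x. F x $ al $ j)" using F(2) DL(1) by (intro Lp_on_borel) auto
  moreover have "has_weak_partial D k (%x. Z x $ al $ j) (%x. F x $ al $ j)"
   by (rule has_weak_partial_mono[OF F(3)[rule_format] DK _ DL(1)]) auto
  ultimately show ?thesis by blast
 qed
 show "sobolev 2 2 D (%x. u x $ al)" unfolding numeral_2_eq_2 sobolev.simps unfolding numeral_2_eq_2[symmetric]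
  using Lu LZ wu wZ by blast
qed

text \<open>With \<open>r = (t - s) / 4\<close> the estimate in one direction has the factor \<open>C / (8 c) (4 n / (t - s))\<^sup>2\<close>; the sum over \<open>n\<close> directions
  gives the constant.\<close>

lemma hessian_estimate:
 assumes uU: "AE x in lebesgue_on Om. u x = U x" and gr: "AE x in lebesgue_on Om. weak_grad Om u x = Z x"
  and st: "0 < s" "s < t" and B: "cball x0 t \<subseteq> Om"
 shows "(\<integral>\<^sup>+x\<in>ball x0 s. ennreal (((norm (weak_grad Om u x))^2 + eps) powr ((q - 2) / 2) * (norm (weak_hess Om u x))^2) \<partial>lebesgue)
  <= ennreal (2 * real CARD('n) ^ 3 * C / c / (t - s)^2) *
   (\<integral>\<^sup>+x\<in>ball x0 t. ennreal (eps * norm (weak_grad Om u x) powr p + norm (u x) powr q + norm (weak_grad Om u x) powr q + 1) \<partial>lebesgue)"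
proof -
 define n where "n = real CARD('n)"
 define r where "r = (t - s) / 4"
 have r: "r > 0" using st by (simp add: r_def)
 have OL: "Om \<in> sets lebesgue" using open_dom by auto
 have cs: "cball x0 s \<subseteq> Om" and bt: "ball x0 t \<subseteq> Om" using B st by auto
 have bs: "ball x0 s \<subseteq> Om" using cs by auto
 have ins: "compactly_inside (ball x0 t) Om" using B st by (simp add: compactly_inside_def)
 have nb: "{x. infdist x (cball x0 s) <= 3 * r} \<subseteq> ball x0 t"
 proof
  fix x assume "x \<in> {x. infdist x (cball x0 s) <= 3 * r}"
  moreover obtain y where y: "y \<in> cball x0 s" "infdist x (cball x0 s) = dist x y"
   using infdist_attains_inf[of "cball x0 s" x] st by auto
  ultimately have "dist x0 x <= s + 3 * r" using dist_triangle[of x0 x y] by (simp add: dist_commute)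
  moreover have "s + 3 * r < t" using st unfolding r_def by (simp add: field_simps)
  ultimately show "x \<in> ball x0 t" by simp
 qed
 define P where "P k F \<longleftrightarrow> F \<in> borel_measurable borel \<and>
  (\<forall>al j. has_weak_partial (ball x0 s) k (%x. Z x $ al $ j) (%x. F x $ al $ j)) \<and>
  (\<integral>\<^sup>+x. ennreal (((norm (Z x))^2 + eps) powr ((q - 2) / 2)) * ennreal ((norm (F x))^2) \<partial>lborel)
   <= ennreal (C / (8 * c) * (n / r)^2) * (\<integral>\<^sup>+x. ennreal (bulk x) * indicator (ball x0 t) x \<partial>lborel)" for k and F :: "real^'n => real^'n^'m"
 have "\<exists>F. P k F" for k
  using weak_derivative_estimate[OF open_ball ins compact_cball _ r nb, of k] st unfolding interior_cball n_def P_def by force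
 then have "\<forall>k. \<exists>F. P k F" by blast
 from choice[OF this] obtain F where "\<forall>k. P k (F k)" by (rule exE)
 note F = this[unfolded P_def]
 have Fm[measurable]: "F k \<in> borel_measurable borel" for k using F by blast
 have bsL: "ball x0 s \<in> sets lebesgue" "ball x0 t \<in> sets lebesgue" by auto
 define H where "H al j k = weak_partial Om k (weak_partial Om j (%y. u y $ al))" for al j k
 have wj: "AE x in lebesgue_on Om. weak_partial Om j (%y. u y $ al) x = Z x $ al $ j" for al j
  using gr by (rule eventually_mono) (simp add: weak_grad_def vec_eq_iff)
 have hw: "AE x in lebesgue_on (ball x0 s). H al j k x = F k x $ al $ j" for al j k
 proof -
  obtain w where "has_weak_partial Om k (%x. Z x $ al $ j) w" using second_derivative_global by blast
  then have "has_weak_partial Om k (weak_partial Om j (%y. u y $ al)) w"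
   by (rule has_weak_partial_cong_AE[OF _ wj _ OL]) simp
  then have "has_weak_partial Om k (weak_partial Om j (%y. u y $ al)) (H al j k)" unfolding H_def by (rule weak_partial_works)
  then have "has_weak_partial Om k (%x. Z x $ al $ j) (H al j k)"
   by (rule has_weak_partial_cong_AE[OF _ _ _ OL]) (use wj[of j al] in \<open>auto elim: eventually_mono\<close>)
  then have "has_weak_partial (ball x0 s) k (%x. Z x $ al $ j) (H al j k)" by (rule has_weak_partial_mono[OF _ bs OL bsL(1)])
  then show ?thesis using F by (intro has_weak_partial_unique[OF open_ball]) auto
 qed
 have aeH: "AE x in lebesgue_on (ball x0 s). \<forall>al j k. H al j k x = F k x $ al $ j" using hw by (simp add: eventually_all_finite)
 have aeG: "AE x in lebesgue_on (ball x0 s). weak_grad Om u x = Z x" by (rule AE_lebesgue_on_subset[OF gr bs bsL(1) OL])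
 define W where "W x = ((norm (Z x))^2 + eps) powr ((q - 2) / 2)" for x
 have [measurable]: "W \<in> borel_measurable borel" unfolding W_def[abs_def] by measurable
 have W0: "0 <= W x" for x by (simp add: W_def)
 have hsq: "(norm (weak_hess Om u x))^2 = (\<Sum>k\<in>UNIV. (norm (F k x))^2)" if "\<forall>al j k. H al j k x = F k x $ al $ j" for x
 proof -
  have "(norm (weak_hess Om u x))^2 = (\<Sum>al\<in>UNIV. \<Sum>j\<in>UNIV. \<Sum>k\<in>UNIV. (F k x $ al $ j)^2)"
   using that unfolding weak_hess_def H_def by (simp add: norm_vec_sq)
  also have "... = (\<Sum>al\<in>UNIV. \<Sum>k\<in>UNIV. \<Sum>j\<in>UNIV. (F k x $ al $ j)^2)"
   by (rule sum.cong[OF refl]) (rule sum.swap)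
  also have "... = (\<Sum>k\<in>UNIV. \<Sum>al\<in>UNIV. \<Sum>j\<in>UNIV. (F k x $ al $ j)^2)" by (rule sum.swap)
  also have "... = (\<Sum>k\<in>UNIV. (norm (F k x))^2)" by (simp add: norm_vec_sq)
  finally show ?thesis .
 qed
 have ae1: "AE x in lebesgue. x \<in> ball x0 s \<longrightarrow> weak_grad Om u x = Z x & (\<forall>al j k. H al j k x = F k x $ al $ j)"
 proof -
  have "AE x in lebesgue_on (ball x0 s). weak_grad Om u x = Z x & (\<forall>al j k. H al j k x = F k x $ al $ j)" using aeH aeG by eventually_elim blast
  then show ?thesis by (subst (asm) AE_restrict_space_iff) (use bsL in auto)
 qed
 have "(\<integral>\<^sup>+x\<in>ball x0 s. ennreal (((norm (weak_grad Om u x))^2 + eps) powr ((q - 2) / 2) * (norm (weak_hess Om u x))^2) \<partial>lebesgue)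
  <= (\<integral>\<^sup>+x. (\<Sum>k\<in>UNIV. ennreal (W x) * ennreal ((norm (F k x))^2)) \<partial>lebesgue)"
 proof (rule nn_integral_mono_AE, use ae1 in \<open>rule eventually_mono\<close>)
  fix x assume ae: "x \<in> ball x0 s \<longrightarrow> weak_grad Om u x = Z x & (\<forall>al j k. H al j k x = F k x $ al $ j)"
  show "ennreal (((norm (weak_grad Om u x))^2 + eps) powr ((q - 2) / 2) * (norm (weak_hess Om u x))^2) * indicator (ball x0 s) x
   <= (\<Sum>k\<in>UNIV. ennreal (W x) * ennreal ((norm (F k x))^2))"
  proof (cases "x \<in> ball x0 s")
   case True
   then have g: "weak_grad Om u x = Z x" and h: "\<forall>al j k. H al j k x = F k x $ al $ j" using ae by auto
   have "ennreal (W x * (\<Sum>k\<in>UNIV. (norm (F k x))^2)) = (\<Sum>k\<in>UNIV. ennreal (W x) * ennreal ((norm (F k x))^2))"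
    by (simp add: sum_distrib_left[symmetric] ennreal_mult W0 sum_nonneg)
   then show ?thesis using True unfolding g hsq[OF h] W_def[symmetric] by simp
  qed simp
 qed
 also have "... = (\<integral>\<^sup>+x. (\<Sum>k\<in>UNIV. ennreal (W x) * ennreal ((norm (F k x))^2)) \<partial>lborel)" by (rule nn_integral_completion) measurable
 also have "... = (\<Sum>k\<in>UNIV. \<integral>\<^sup>+x. ennreal (W x) * ennreal ((norm (F k x))^2) \<partial>lborel)" by (rule nn_integral_sum) measurable
 also have "... <= (\<Sum>k\<in>(UNIV::'n set). ennreal (C / (8 * c) * (n / r)^2) * (\<integral>\<^sup>+x. ennreal (bulk x) * indicator (ball x0 t) x \<partial>lborel))"
  unfolding W_def by (rule sum_mono) (use F in blast)
 also have "... = ennreal n * (ennreal (C / (8 * c) * (n / r)^2) * (\<integral>\<^sup>+x. ennreal (bulk x) * indicator (ball x0 t) x \<partial>lborel))"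
  by (simp add: n_def ennreal_of_nat_eq_real_of_nat)
 also have "... = ennreal (2 * n ^ 3 * C / c / (t - s)^2) * (\<integral>\<^sup>+x. ennreal (bulk x) * indicator (ball x0 t) x \<partial>lborel)"
 proof -
  have "n * (C / (8 * c) * (n / r)^2) = 2 * n ^ 3 * C / c / (t - s)^2"
   using c st by (simp add: r_def power2_eq_square power3_eq_cube)
  moreover have "ennreal n * ennreal (C / (8 * c) * (n / r)^2) = ennreal (n * (C / (8 * c) * (n / r)^2))"
   using c C by (intro ennreal_mult[symmetric]) (auto simp: n_def)
  ultimately show ?thesis by (simp only: mult.assoc[symmetric])
 qed
 also have "(\<integral>\<^sup>+x. ennreal (bulk x) * indicator (ball x0 t) x \<partial>lborel) = (\<integral>\<^sup>+x. ennreal (bulk x) * indicator (ball x0 t) x \<partial>lebesgue)"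
  by (rule nn_integral_completion[symmetric]) measurable
 also have "... = (\<integral>\<^sup>+x\<in>ball x0 t. ennreal (eps * norm (weak_grad Om u x) powr p + norm (u x) powr q + norm (weak_grad Om u x) powr q + 1) \<partial>lebesgue)"
 proof (rule nn_integral_cong_AE)
  have "AE x in lebesgue_on Om. weak_grad Om u x = Z x & u x = U x" using gr uU by eventually_elim blast
  then have "AE x in lebesgue. x \<in> Om \<longrightarrow> weak_grad Om u x = Z x & u x = U x" by (subst (asm) AE_restrict_space_iff) (use OL in auto)
  then show "AE x in lebesgue. ennreal (bulk x) * indicator (ball x0 t) x =
   ennreal (eps * norm (weak_grad Om u x) powr p + norm (u x) powr q + norm (weak_grad Om u x) powr q + 1) * indicator (ball x0 t) x"
  proof (rule eventually_mono)
   fix x assume "x \<in> Om \<longrightarrow> weak_grad Om u x = Z x & u x = U x"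
   then show "ennreal (bulk x) * indicator (ball x0 t) x =
   ennreal (eps * norm (weak_grad Om u x) powr p + norm (u x) powr q + norm (weak_grad Om u x) powr q + 1) * indicator (ball x0 t) x"
    using bt by (cases "x \<in> ball x0 t") (auto simp: bulk_def)
  qed
 qed
 finally show ?thesis by (simp add: n_def)
qed

end

text \<open>A connected set that meets a set and its complement meets the frontier.\<close>

lemma cball_subset_of_frontier:
 fixes Om :: "'a::euclidean_space set"
 assumes x: "x0 \<in> Om" and t: "0 < t" "t < infdist x0 (frontier Om)"
 shows "cball x0 t \<subseteq> Om"
proof (rule ccontr)
 assume "\<not> cball x0 t \<subseteq> Om"
 then have "cball x0 t - Om \<noteq> {}" by blast
 moreover have "x0 \<in> cball x0 t \<inter> Om" using x t by simp
 then have "cball x0 t \<inter> Om \<noteq> {}" by blast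
 moreover have "connected (cball x0 t)" by (simp add: convex_connected)
 ultimately obtain y where "y \<in> cball x0 t" "y \<in> frontier Om" using connected_Int_frontier by blast
 then have "infdist x0 (frontier Om) <= t" using infdist_le[of y "frontier Om" x0] by simp
 then show False using t by simp
qed

theorem theorem4:
  fixes \<Omega> :: "(real^'n) set"
    and G :: "(real^'m) \<times> (real^'m) \<Rightarrow> real"
    and p q :: real
  assumes "CARD('n) \<ge> 2"
    and "2 \<le> q" and "q < p" and "p < real CARD('n)"
    and "open \<Omega>" and "bounded \<Omega>"
    and "H1 q \<Omega> G" and "H2 q G"
  shows "\<exists>C>0. \<forall>\<epsilon> u. 0 < \<epsilon> \<and> \<epsilon> \<le> 1 \<and> local_minimizer G p \<epsilon> \<Omega> u \<longrightarrow>
     sobolev_vec_loc 2 2 \<Omega> u \<and>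
     (\<forall>x0\<in>\<Omega>. \<forall>s t R0. 0 < s \<and> s < t \<and> t < R0 \<and> R0 < min 1 (infdist x0 (frontier \<Omega>)) \<longrightarrow>
       (\<integral>\<^sup>+x\<in>ball x0 s. ennreal (((norm (weak_grad \<Omega> u x))\<^sup>2 + \<epsilon>) powr ((q - 2) / 2)
            * (norm (weak_hess \<Omega> u x))\<^sup>2) \<partial>lebesgue)
       \<le> ennreal (C / (t - s)\<^sup>2) *
         (\<integral>\<^sup>+x\<in>ball x0 t. ennreal (\<epsilon> * norm (weak_grad \<Omega> u x) powr p + norm (u x) powr q
            + norm (weak_grad \<Omega> u x) powr q + 1) \<partial>lebesgue))"
proof -
  note q = assms(2,3) and O = assms(5,6) and H = assms(7,8)
  have p: "1 \<le> p" "2 \<le> p" using q by auto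
  obtain c where c: "c > 0" "\<forall>\<epsilon> (u::real^'m) (z::real^'n^'m) u' z'. 0 < \<epsilon> \<longrightarrow>
    dens G p \<epsilon> ((1/2) *\<^sub>R (u + u')) ((1/2) *\<^sub>R (z + z')) + c * (ell_weight q \<epsilon> (norm z - norm (z' - z)) * (norm (z' - z))\<^sup>2)
      \<le> (dens G p \<epsilon> u z + dens G p \<epsilon> u' z') / 2"
    using dens_midpoint[OF H(2) q(1) p(1)] by blast
  obtain C where C: "C > 0" "\<forall>\<epsilon> (u::real^'m) (z::real^'n^'m) b K t a. 0 < \<epsilon> \<and> \<epsilon> \<le> 1 \<and> (\<forall>\<alpha>. norm (b $ \<alpha>) \<le> K * norm (z $ \<alpha>)) \<and> \<bar>t\<bar> * K \<le> 1/4 \<and> \<bar>a\<bar> \<le> K \<longrightarrow>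
    (1 - t * a) * dens G p \<epsilon> u (z + (t / (1 - t * a)) *\<^sub>R b) + (1 + t * a) * dens G p \<epsilon> u (z + (- (t / (1 + t * a))) *\<^sub>R b)
    \<le> 2 * dens G p \<epsilon> u z + C * K\<^sup>2 * t\<^sup>2 * (\<epsilon> * norm z powr p + norm u powr q + norm z powr q + 1)"
    using dens_inner_variation[OF H(2) q(1) p(2)] by blast
  let ?E = "\<lambda>\<epsilon> (u :: real^'n \<Rightarrow> real^'m) x0 s t.
     (\<integral>\<^sup>+x\<in>ball x0 s. ennreal (((norm (weak_grad \<Omega> u x))\<^sup>2 + \<epsilon>) powr ((q - 2) / 2) * (norm (weak_hess \<Omega> u x))\<^sup>2) \<partial>lebesgue)
     \<le> ennreal (2 * real CARD('n) ^ 3 * C / c / (t - s)\<^sup>2) *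
       (\<integral>\<^sup>+x\<in>ball x0 t. ennreal (\<epsilon> * norm (weak_grad \<Omega> u x) powr p + norm (u x) powr q + norm (weak_grad \<Omega> u x) powr q + 1) \<partial>lebesgue)"
  have main: "sobolev_vec_loc 2 2 \<Omega> u \<and> (\<forall>x0 s t. 0 < s \<and> s < t \<and> cball x0 t \<subseteq> \<Omega> \<longrightarrow> ?E \<epsilon> u x0 s t)"
    if u: "0 < \<epsilon> \<and> \<epsilon> \<le> 1 \<and> local_minimizer G p \<epsilon> \<Omega> u" and ne: "\<Omega> \<noteq> {}" for \<epsilon> u
  proof -
    have eps: "0 < \<epsilon>" "\<epsilon> \<le> 1" and min: "local_minimizer G p \<epsilon> \<Omega> u" using u by auto
    obtain U Z where bm: "borel_minimizer G p q \<epsilon> \<Omega> U Z" and uU: "AE x in lebesgue_on \<Omega>. u x = U x" and gr: "AE x in lebesgue_on \<Omega>. weak_grad \<Omega> u x = Z x"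
      using local_minimizer_borel[OF H q eps O ne min] by blast
    interpret comparison G p q \<epsilon> \<Omega> U Z c C
      by (rule comparison.intro[OF bm], unfold_locales) (use c C eps in blast)+
    show ?thesis using sobolev_loc[OF uU] hessian_estimate[OF uU gr] by blast
  qed
  show ?thesis
  proof (intro exI[of _ "2 * real CARD('n) ^ 3 * C / c"] conjI allI impI ballI)
    show "0 < 2 * real CARD('n) ^ 3 * C / c" using c(1) C(1) by simp
    fix \<epsilon> and u :: "real^'n \<Rightarrow> real^'m" assume u: "0 < \<epsilon> \<and> \<epsilon> \<le> 1 \<and> local_minimizer G p \<epsilon> \<Omega> u"
    show "sobolev_vec_loc 2 2 \<Omega> u"
    proof (cases "\<Omega> = {}")
      case True
      have "D = {}" if "compactly_inside D \<Omega>" for D :: "(real^'n) set" using that closure_subset[of D] True by (auto simp: compactly_inside_def)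
      then show ?thesis using sobolev_empty by (auto simp: sobolev_vec_loc_def sobolev_vec_def)
    qed (use main[OF u] in blast)
    fix x0 s t R0 assume x0: "x0 \<in> \<Omega>" and st: "0 < s \<and> s < t \<and> t < R0 \<and> R0 < min 1 (infdist x0 (frontier \<Omega>))"
    have "0 < t" "t < infdist x0 (frontier \<Omega>)" using st by auto
    then have "cball x0 t \<subseteq> \<Omega>" by (rule cball_subset_of_frontier[OF x0])
    then show "?E \<epsilon> u x0 s t" using main[OF u] x0 st by blast
  qed
qed

end
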